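(* Suppose that the standing assumptions on $b,f,g$ stated in the context hold, and let $\beta\in[2,\infty]$. (i) There exists a constant $C_3>0$, depending only on $T,L,x_0$, such that for all $u(\cdot),\bar u(\cdot)\in L^\infty$, $$\|J''(u(\cdot))-J''(\bar u(\cdot))\|_{\mathbb{L}(L^\beta,L^\beta)}\le C_3(1+\|u\|_1)\|u-\bar u\|_\infty .$$ More precisely, $C_3$ is given by $$C_3=TC_2\,[L(C_1T+2)+C_1(T+2)]+C_1(T+1).$$ (ii) If $b_{uu}$ and $f_{uu}$ are independent of $u$, then there exists a constant $C_4>0$, depending only on $T,L,x_0,\beta$, such that for all $u(\cdot),\bar u(\cdot)\in L^\beta$, $$\|J''(u(\cdot))-J''(\bar u(\cdot))\|_{\mathbb{L}(L^\beta,L^\beta)}\le C_4(1+\|u\|_1)\|u-\bar u\|_\beta .$$ More precisely, $C_4$ is given by $$C_4=T^{1-\frac1\beta}\bigl\{C_2[L(C_1T+2)+C_1(T+2)]+C_1\bigr\}.$$ Here $1/\beta=0$ when $\beta=\infty$, and $C_1,C_2$ are the explicit constants given in the context.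
   Context: Setting. Fix $T>0$, $n,m\in\mathbb{N}$, $x_0\in\mathbb{R}^n$ and maps $b:[0,T]\times\mathbb{R}^n\times\mathbb{R}^m\to\mathbb{R}^n$, $f:[0,T]\times\mathbb{R}^n\times\mathbb{R}^m\to\mathbb{R}$, $g:\mathbb{R}^n\to\mathbb{R}$. $|\cdot|$ is the Euclidean norm (for matrices and higher-order arrays, that of the entries). For $\beta\in[1,\infty]$, $L^\beta=L^\beta(0,T;\mathbb{R}^m)$ with norm $\|\cdot\|_\beta$. $\mathbb{L}(X,Y)$ is the space of bounded linear operators with the operator norm. Derivatives. $b_x,b_u$ are Jacobians ($n\times n$, $n\times m$); gradients $f_x,f_u,g_x,H_x,H_u$ are column vectors; $H_{xu}$ is the derivative of $H_x$ with respect to $u$ (an $n\times m$ matrix), $H_{ux}=H_{xu}^\top$; $\varphi_{(x,u)^2}$ is the full second derivative of $\varphi$ in $(x,u)$. Standing assumptions. $b,f,g$ are measurable; for every $t$, $b(t,\cdot,\cdot)$ and $f(t,\cdot,\cdot)$ are twice differentiable, and $g$ is twice differentiable; there is a constant $L>0$, independent of $t$, such that for all $t\in[0,T]$, $x,\bar x\in\mathbb{R}^n$, $u,\bar u\in\mathbb{R}^m$: $|b(t,x,u)|\le L(|x|+|u|+1)$, $|b_x(t,x,u)|+|b_u(t,x,u)|\le L$, $|b_{(x,u)^2}(t,x,u)|\le L$, $|b_{(x,u)^2}(t,x,u)-b_{(x,u)^2}(t,\bar x,\bar u)|\le L(|x-\bar x|+|u-\bar u|)$; $|f(t,x,u)|\le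 L(|x|^2+|u|^2+1)$, $|f_x(t,x,u)|+|f_u(t,x,u)|\le L(|x|+|u|+1)$, $|f_{(x,u)^2}(t,x,u)|\le L$, $|f_{(x,u)^2}(t,x,u)-f_{(x,u)^2}(t,\bar x,\bar u)|\le L(|x-\bar x|+|u-\bar u|)$; $|g(x)|\le L(|x|^2+1)$, $|g_x(x)|\le L(|x|+1)$, $|g_{xx}(x)|\le L$, $|g_{xx}(x)-g_{xx}(\bar x)|\le L|x-\bar x|$. State, cost, adjoint. For $u(\cdot)\in L^2$, the state $x(\cdot)$ is the unique solution of $\dot x(t)=b(t,x(t),u(t))$, $x(0)=x_0$; the cost is $J(u(\cdot))=\int_0^Tf(t,x(t),u(t))\,dt+g(x(T))$; the adjoint $p(\cdot)$ is the unique solution of $\dot p(t)=-b_x(t,x(t),u(t))^\top p(t)-f_x(t,x(t),u(t))$, $p(T)=g_x(x(T))$. The Hamiltonian is $H(t,x,u,p)=b(t,x,u)^\top p+f(t,x,u)$. Write $b_i[t]=b_i(t,x(t),u(t))$ and $H_i[t]=H_i(t,x(t),u(t),p(t))$. Second derivative. Under these assumptions $J:L^2\to\mathbb{R}$ is twice G\^ateaux differentiable and, for $u(\cdot),v(\cdot)\in L^2$, $(J''(u(\cdot))v(\cdot))(t)=H_{ux}[t]y(t)+H_{uu}[t]v(t)+b_u[t]^\top\psi(t)$ for a.e. $t$, where $\dot y=b_x[t]y+b_u[t]v$, $y(0)=0$, and $\dot\psi=-b_x[t]^\top\psi-H_{xx}[t]y-H_{xu}[t]v$, $\psi(T)=g_{xx}(x(T))y(T)$.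 For $u(\cdot)\in L^\beta$, $\beta\in[2,\infty]$, $J''(u(\cdot))$ maps $L^\beta$ boundedly into $L^\beta$. Constants. $C_x=\max\{e^{LT}(|x_0|+LT),\,Le^{LT}\}$, $K_p=Le^{LT}(1+C_x)(T+1)$, $C_p=\max\{K_p,\,Le^{LT}[C_x+(C_xT+1)(1+K_p)]\}$, $C_H=\max\{L(C_p+C_x+C_pC_x),\,L(1+C_p)\}$, $C_1=\max\{C_x,C_p,C_H\}$; $C_y=Le^{LT}[(C_1+Le^{LT}+C_1LTe^{LT})T+1]$, $K_\psi=e^{LT}[LC_y+C_1(C_yT+1)]$, $C_\psi=\max\{K_\psi,\,e^{LT}[LC_y(C_1T+1)+LK_\psi T(C_1T+1)+C_1(C_yT^2+2C_yT+T+1)]\}$, $C_2=\max\{C_y,C_\psi\}$. *)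

theory Defs
  imports "HOL-Analysis.Analysis" "HOL-Probability.Essential_Supremum"
begin

section \<open>The spaces \<open>L\<^sup>\<beta>(0,T; E)\<close>\<close>

text \<open>
  Elements of \<open>L\<^sup>\<beta>\<close> are represented by functions on the real line, whose values outside \<open>[0,T]\<close>
  and on null sets are irrelevant. The norm takes the value \<open>\<infinity>\<close> on functions that are not Lebesgue
  measurable on \<open>[0,T]\<close>, so that membership in \<open>L\<^sup>\<beta>\<close> is just finiteness of the norm.
  It is meant for \<open>1 \<le> \<beta> \<le> \<infinity>\<close>.
\<close>

definition lp_norm :: "real \<Rightarrow> ennreal \<Rightarrow> (real \<Rightarrow> 'e::euclidean_space) \<Rightarrow> ennreal" where
  "lp_norm T \<beta> v =
     (if v \<notin> borel_measurable (lebesgue_on {0..T}) then \<infinity>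
      else if \<beta> = \<infinity> then esssup (lebesgue_on {0..T}) (\<lambda>t. ennreal (norm (v t)))
      else
        (let I = (\<integral>\<^sup>+t. ennreal (norm (v t) powr enn2real \<beta>) \<partial>lebesgue_on {0..T})
         in if I < \<infinity> then ennreal (enn2real I powr (1 / enn2real \<beta>)) else \<infinity>))"

definition lp_space :: "real \<Rightarrow> ennreal \<Rightarrow> (real \<Rightarrow> 'e::euclidean_space) set" where
  "lp_space T \<beta> = {v. lp_norm T \<beta> v < \<infinity>}"

definition lp_bounded_linear ::
    "real \<Rightarrow> ennreal \<Rightarrow> ((real \<Rightarrow> 'e::euclidean_space) \<Rightarrow> (real \<Rightarrow> 'e)) \<Rightarrow> bool" where
  "lp_bounded_linear T \<beta> A \<longleftrightarrow>
     (\<forall>v\<in>lp_space T \<beta>. A v \<in> lp_space T \<beta>) \<and>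
     (\<forall>v\<in>lp_space T \<beta>. \<forall>w\<in>lp_space T \<beta>.
        AE t in lebesgue_on {0..T}. A (\<lambda>s. v s + w s) t = A v t + A w t) \<and>
     (\<forall>c. \<forall>v\<in>lp_space T \<beta>. AE t in lebesgue_on {0..T}. A (\<lambda>s. c *\<^sub>R v s) t = c *\<^sub>R A v t) \<and>
     (\<exists>K::real. \<forall>v\<in>lp_space T \<beta>. lp_norm T \<beta> (A v) \<le> ennreal K * lp_norm T \<beta> v)"

text \<open>The operator norm on \<open>L(L\<^sup>\<beta>,L\<^sup>\<beta>)\<close>; it is \<open>\<infinity>\<close> if some \<open>A v\<close> leaves \<open>L\<^sup>\<beta>\<close> or \<open>A\<close> is unbounded.\<close>

definition lp_op_norm ::
    "real \<Rightarrow> ennreal \<Rightarrow> ((real \<Rightarrow> 'e::euclidean_space) \<Rightarrow> (real \<Rightarrow> 'e)) \<Rightarrow> ennreal" where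
  "lp_op_norm T \<beta> A = (SUP v\<in>{v \<in> lp_space T \<beta>. lp_norm T \<beta> v \<le> 1}. lp_norm T \<beta> (A v))"


section \<open>Derivatives of the data\<close>

definition grad :: "(real^'k \<Rightarrow> real) \<Rightarrow> real^'k \<Rightarrow> real^'k" where
  "grad \<phi> z = (\<chi> i. frechet_derivative \<phi> (at z) (axis i 1))"

definition twice_differentiable :: "('a::real_normed_vector \<Rightarrow> 'b::real_normed_vector) \<Rightarrow> bool" where
  "twice_differentiable \<phi> \<longleftrightarrow>
     (\<forall>z. \<phi> differentiable (at z)) \<and>
     (\<forall>z. (\<lambda>w. Blinfun (frechet_derivative \<phi> (at w))) differentiable (at z))"

definition joint_axis :: "'n + 'm \<Rightarrow> (real^'n) \<times> (real^'m)" where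
  "joint_axis k = (case k of Inl i \<Rightarrow> (axis i 1, 0) | Inr j \<Rightarrow> (0, axis j 1))"

text \<open>
  The full second derivative \<open>\<phi>\<^bsub>(x,u)\<^sup>2\<^esub>\<close> as the array of all second-order partial derivatives in the
  \<open>n + m\<close> joint coordinates. Its library norm is the Euclidean norm of the entries, also when
  \<open>\<phi>\<close> is vector-valued.
\<close>

definition second_deriv ::
    "(real^'n \<Rightarrow> real^'m \<Rightarrow> 'b::real_normed_vector) \<Rightarrow> real^'n \<Rightarrow> real^'m \<Rightarrow> 'b^('n+'m)^('n+'m)" where
  "second_deriv \<phi> x u =
     (\<chi> j k. frechet_derivative
               (\<lambda>z. frechet_derivative (\<lambda>(x, u). \<phi> x u) (at z) (joint_axis k))
               (at (x, u)) (joint_axis j))"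

definition standing_assumptions ::
    "real \<Rightarrow> real \<Rightarrow> (real \<Rightarrow> real^'n \<Rightarrow> real^'m \<Rightarrow> real^'n) \<Rightarrow> (real \<Rightarrow> real^'n \<Rightarrow> real^'m \<Rightarrow> real)
       \<Rightarrow> (real^'n \<Rightarrow> real) \<Rightarrow> bool" where
  "standing_assumptions T L b f g \<longleftrightarrow>
     0 < L \<and>
     (\<lambda>(t, x, u). b t x u) \<in> borel_measurable (lebesgue_on ({0..T} \<times> UNIV)) \<and>
     (\<lambda>(t, x, u). f t x u) \<in> borel_measurable (lebesgue_on ({0..T} \<times> UNIV)) \<and>
     g \<in> borel_measurable lebesgue \<and>
     (\<forall>t\<in>{0..T}. twice_differentiable (\<lambda>(x, u). b t x u)) \<and>
     (\<forall>t\<in>{0..T}. twice_differentiable (\<lambda>(x, u). f t x u)) \<and>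
     twice_differentiable g \<and>
     (\<forall>t\<in>{0..T}. \<forall>x x' u u'.
        norm (b t x u) \<le> L * (norm x + norm u + 1) \<and>
        norm (jacobian (\<lambda>x. b t x u) (at x)) + norm (jacobian (\<lambda>u. b t x u) (at u)) \<le> L \<and>
        norm (second_deriv (b t) x u) \<le> L \<and>
        norm (second_deriv (b t) x u - second_deriv (b t) x' u') \<le> L * (norm (x - x') + norm (u - u')) \<and>
        \<bar>f t x u\<bar> \<le> L * ((norm x)\<^sup>2 + (norm u)\<^sup>2 + 1) \<and>
        norm (grad (\<lambda>x. f t x u) x) + norm (grad (\<lambda>u. f t x u) u) \<le> L * (norm x + norm u + 1) \<and>
        norm (second_deriv (f t) x u) \<le> L \<and>
        norm (second_deriv (f t) x u - second_deriv (f t) x' u') \<le> L * (norm (x - x') + norm (u - u'))) \<and>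
     (\<forall>x x'.
        \<bar>g x\<bar> \<le> L * ((norm x)\<^sup>2 + 1) \<and>
        norm (grad g x) \<le> L * (norm x + 1) \<and>
        norm (jacobian (grad g) (at x)) \<le> L \<and>
        norm (jacobian (grad g) (at x) - jacobian (grad g) (at x')) \<le> L * norm (x - x'))"

definition vec_uu :: "(real \<Rightarrow> real^'n \<Rightarrow> real^'m \<Rightarrow> real^'n) \<Rightarrow> real \<Rightarrow> real^'n \<Rightarrow> real^'m \<Rightarrow> real^'m^'m^'n" where
  "vec_uu b t x u = (\<chi> i. jacobian (grad (\<lambda>u. b t x u $ i)) (at u))"

definition scal_uu :: "(real \<Rightarrow> real^'n \<Rightarrow> real^'m \<Rightarrow> real) \<Rightarrow> real \<Rightarrow> real^'n \<Rightarrow> real^'m \<Rightarrow> real^'m^'m" where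
  "scal_uu f t x u = jacobian (grad (\<lambda>u. f t x u)) (at u)"


section \<open>State, cost and the second Gateaux derivative of the cost\<close>

text \<open>
  Solutions are in the sense of Caratheodory: absolutely continuous functions satisfying the
  equation almost everywhere, i.e. solutions of the integral equation. They are unique only
  on \<open>[0,T]\<close>, whence \<open>SOME\<close> and not \<open>THE\<close>.
\<close>

definition is_state ::
    "real \<Rightarrow> (real \<Rightarrow> real^'n \<Rightarrow> real^'m \<Rightarrow> real^'n) \<Rightarrow> real^'n \<Rightarrow> (real \<Rightarrow> real^'m) \<Rightarrow> (real \<Rightarrow> real^'n) \<Rightarrow> bool" where
  "is_state T b x0 u x \<longleftrightarrow>
     integrable (lebesgue_on {0..T}) (\<lambda>t. b t (x t) (u t)) \<and>
     (\<forall>t\<in>{0..T}. x t = x0 + (\<integral>s. b s (x s) (u s) \<partial>lebesgue_on {0..t}))"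

definition state ::
    "real \<Rightarrow> (real \<Rightarrow> real^'n \<Rightarrow> real^'m \<Rightarrow> real^'n) \<Rightarrow> real^'n \<Rightarrow> (real \<Rightarrow> real^'m) \<Rightarrow> real \<Rightarrow> real^'n" where
  "state T b x0 u = (SOME x. is_state T b x0 u x)"

definition cost ::
    "real \<Rightarrow> (real \<Rightarrow> real^'n \<Rightarrow> real^'m \<Rightarrow> real^'n) \<Rightarrow> (real \<Rightarrow> real^'n \<Rightarrow> real^'m \<Rightarrow> real)
       \<Rightarrow> (real^'n \<Rightarrow> real) \<Rightarrow> real^'n \<Rightarrow> (real \<Rightarrow> real^'m) \<Rightarrow> real" where
  "cost T b f g x0 u =
     (\<integral>t. f t (state T b x0 u t) (u t) \<partial>lebesgue_on {0..T}) + g (state T b x0 u T)"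

text \<open>
  The Gateaux derivative of \<open>J\<close> at \<open>u\<close> is a bounded linear functional on \<open>L\<^sup>2\<close>; it is identified with
  its Riesz representative \<open>G \<in> L\<^sup>2\<close>, as is implicit in regarding \<open>J''(u) v\<close> as a function of \<open>t\<close>.
\<close>

definition has_gateaux_gradient ::
    "real \<Rightarrow> ((real \<Rightarrow> 'e::euclidean_space) \<Rightarrow> real) \<Rightarrow> (real \<Rightarrow> 'e) \<Rightarrow> (real \<Rightarrow> 'e) \<Rightarrow> bool" where
  "has_gateaux_gradient T J u G \<longleftrightarrow>
     G \<in> lp_space T 2 \<and>
     (\<forall>v\<in>lp_space T 2.
        ((\<lambda>\<epsilon>. (J (\<lambda>t. u t + \<epsilon> *\<^sub>R v t) - J u) / \<epsilon>)
           \<longlongrightarrow> (\<integral>t. G t \<bullet> v t \<partial>lebesgue_on {0..T})) (at 0))"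

definition gateaux_gradient ::
    "real \<Rightarrow> ((real \<Rightarrow> 'e::euclidean_space) \<Rightarrow> real) \<Rightarrow> (real \<Rightarrow> 'e) \<Rightarrow> real \<Rightarrow> 'e" where
  "gateaux_gradient T J u = (SOME G. has_gateaux_gradient T J u G)"

definition has_second_gateaux ::
    "real \<Rightarrow> ((real \<Rightarrow> 'e::euclidean_space) \<Rightarrow> real) \<Rightarrow> (real \<Rightarrow> 'e)
       \<Rightarrow> ((real \<Rightarrow> 'e) \<Rightarrow> (real \<Rightarrow> 'e)) \<Rightarrow> bool" where
  "has_second_gateaux T J u A \<longleftrightarrow>
     (\<forall>w\<in>lp_space T 2. \<exists>G. has_gateaux_gradient T J w G) \<and>
     lp_bounded_linear T 2 A \<and>
     (\<forall>v\<in>lp_space T 2.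
        ((\<lambda>\<epsilon>. lp_norm T 2 (\<lambda>t. (1 / \<epsilon>) *\<^sub>R (gateaux_gradient T J (\<lambda>s. u s + \<epsilon> *\<^sub>R v s) t
                                          - gateaux_gradient T J u t) - A v t))
           \<longlongrightarrow> 0) (at 0))"

text \<open>Up to equality almost everywhere of \<open>A v\<close> for \<open>v \<in> L\<^sup>2\<close>, there is only one such \<open>A\<close>.\<close>

definition second_gateaux ::
    "real \<Rightarrow> ((real \<Rightarrow> 'e::euclidean_space) \<Rightarrow> real) \<Rightarrow> (real \<Rightarrow> 'e) \<Rightarrow> (real \<Rightarrow> 'e) \<Rightarrow> real \<Rightarrow> 'e" where
  "second_gateaux T J u = (SOME A. has_second_gateaux T J u A)"


section \<open>The explicit constants\<close>

definition C_x :: "real \<Rightarrow> real \<Rightarrow> real^'n \<Rightarrow> real" where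
  "C_x T L x0 = max (exp (L*T) * (norm x0 + L*T)) (L * exp (L*T))"

definition K_p :: "real \<Rightarrow> real \<Rightarrow> real^'n \<Rightarrow> real" where
  "K_p T L x0 = L * exp (L*T) * (1 + C_x T L x0) * (T + 1)"

definition C_p :: "real \<Rightarrow> real \<Rightarrow> real^'n \<Rightarrow> real" where
  "C_p T L x0 = max (K_p T L x0)
     (L * exp (L*T) * (C_x T L x0 + (C_x T L x0 * T + 1) * (1 + K_p T L x0)))"

definition C_H :: "real \<Rightarrow> real \<Rightarrow> real^'n \<Rightarrow> real" where
  "C_H T L x0 = max (L * (C_p T L x0 + C_x T L x0 + C_p T L x0 * C_x T L x0))
     (L * (1 + C_p T L x0))"

definition C_1 :: "real \<Rightarrow> real \<Rightarrow> real^'n \<Rightarrow> real" where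
  "C_1 T L x0 = max (C_x T L x0) (max (C_p T L x0) (C_H T L x0))"

definition C_y :: "real \<Rightarrow> real \<Rightarrow> real^'n \<Rightarrow> real" where
  "C_y T L x0 = L * exp (L*T) *
     ((C_1 T L x0 + L * exp (L*T) + C_1 T L x0 * L * T * exp (L*T)) * T + 1)"

definition K_psi :: "real \<Rightarrow> real \<Rightarrow> real^'n \<Rightarrow> real" where
  "K_psi T L x0 = exp (L*T) * (L * C_y T L x0 + C_1 T L x0 * (C_y T L x0 * T + 1))"

definition C_psi :: "real \<Rightarrow> real \<Rightarrow> real^'n \<Rightarrow> real" where
  "C_psi T L x0 = max (K_psi T L x0)
     (exp (L*T) *
       (L * C_y T L x0 * (C_1 T L x0 * T + 1)
        + L * K_psi T L x0 * T * (C_1 T L x0 * T + 1)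
        + C_1 T L x0 * (C_y T L x0 * T\<^sup>2 + 2 * C_y T L x0 * T + T + 1)))"

definition C_2 :: "real \<Rightarrow> real \<Rightarrow> real^'n \<Rightarrow> real" where
  "C_2 T L x0 = max (C_y T L x0) (C_psi T L x0)"

definition C_3 :: "real \<Rightarrow> real \<Rightarrow> real^'n \<Rightarrow> real" where
  "C_3 T L x0 =
     T * C_2 T L x0 * (L * (C_1 T L x0 * T + 2) + C_1 T L x0 * (T + 2)) + C_1 T L x0 * (T + 1)"

text \<open>In \<open>ennreal\<close>, \<open>1 / \<infinity> = 0\<close>.\<close>

definition C_4 :: "real \<Rightarrow> real \<Rightarrow> real^'n \<Rightarrow> ennreal \<Rightarrow> real" where
  "C_4 T L x0 \<beta> = T powr (1 - enn2real (1 / \<beta>)) *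
     (C_2 T L x0 * (L * (C_1 T L x0 * T + 2) + C_1 T L x0 * (T + 2)) + C_1 T L x0)"

end

theory Submission
  imports Defs
begin

text \<open>
Everything rests on Gronwall's inequality. Testing the equation of the difference of two states
  with the adjoint \<open>p\<close> shows that \<open>J(u + v) - J(u)\<close> equals \<open>\<integral> H\<^sub>u \<bullet> v\<close> up to a multiple of
  \<open>\<parallel>v\<parallel>\<^sub>2\<^sup>2\<close>, so the gradient is \<open>H\<^sub>u\<close>. State and adjoint at \<open>u + \<epsilon> v\<close> agree with their
  linearisations \<open>y, \<psi>\<close> up to \<open>O(\<epsilon>\<^sup>2)\<close> uniformly in \<open>t\<close>, because the Taylor remainders are
  integrable; the remainder of \<open>H\<^sub>u\<close> itself is quadratic in \<open>v(t)\<close>, hence only in \<open>L\<^sup>1\<close>, and is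
  controlled in \<open>L\<^sup>2\<close> by dominated convergence, which identifies \<open>J''(u)v\<close>.
  In the Lipschitz estimates the two parts differ only in the bound \<open>M\<close> for
  \<open>\<integral> |u - u'| |v|\<close>: it is \<open>\<parallel>u - u'\<parallel>\<^sub>\<infinity> \<parallel>v\<parallel>\<^sub>1\<close> in (i) and comes from Hoelder's inequality in (ii). In
  both cases \<open>\<parallel>u - u'\<parallel>\<^sub>1 \<parallel>v\<parallel>\<^sub>1 \<le> T M\<close>, which gives \<open>|y - y'| \<le> C\<^sub>y M\<close> and
  \<open>|\<psi> - \<psi>'| \<le> C\<^sub>\<psi> (1 + \<parallel>u\<parallel>\<^sub>1) M\<close>. The independence assumption in (ii) is needed for the single
  term \<open>H\<^sub>u\<^sub>u v\<close>, a product of two functions that are merely in \<open>L\<^sup>\<beta>\<close>.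
\<close>

section \<open>Integral equations and Gronwall bounds\<close>

text \<open>The claim concerns the operator selected by \<open>second_gateaux\<close>, not the
  formula for J''. Existence of both Gateaux derivatives and their uniqueness up to null sets
  therefore come before any estimate, and representatives can only be compared almost everywhere. A
  second obstacle is measurability: joint Lebesgue measurability of the data says nothing about a
  single section in t, so superpositions are handled through continuity in (x,u). The factor 1 +
  \<parallel>u\<parallel>_1 comes from the adjoint. The first derivatives of b are bounded, so y has
  a bound independent of u, whereas p grows like f_x and g_x, that is, with the state. To keep this
  factor to the first power and free of u', every difference of products is split so that the size
  of p and \<psi> is only ever taken at u; y may be taken at either control. In C_p and C_psi one
  entry of the maximum bounds the quantity itself and the other its difference for two
  controls.\<close>

lemma has_integral_reflect_shift:
  fixes h :: "real \<Rightarrow> 'a::euclidean_space"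
  assumes "(h has_integral I) {a..b}"
  shows "((\<lambda>s. h (c - s)) has_integral I) {c - b..c - a}"
proof -
  have "((\<lambda>x. h (-1 *\<^sub>R x + c)) has_integral (1 / \<bar>-1\<bar> ^ DIM(real)) *\<^sub>R I)
      ((\<lambda>x. (1 / -1) *\<^sub>R x + - ((1 / -1) *\<^sub>R c)) ` cbox a b)"
    by (rule has_integral_affinity) (use assms in auto)
  moreover have "(\<lambda>x. (1 / -1) *\<^sub>R x + - ((1 / -1) *\<^sub>R c)) ` cbox a b = {c - b..c - a}"
  proof -
    have "(\<lambda>x. c - x) ` {a..b} = {c - b..c - a}"
      by (simp add: image_diff_atLeastAtMost)
    then show ?thesis by simp
  qed
  ultimately show ?thesis by simp
qed

lemma integral_reflect_shift:
  fixes h :: "real \<Rightarrow> 'a::euclidean_space"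
  assumes "h integrable_on {a..b}"
  shows "integral {c - b..c - a} (\<lambda>s. h (c - s)) = integral {a..b} h"
  using has_integral_reflect_shift[OF integrable_integral[OF assms]] by (rule integral_unique)

lemma absolutely_integrable_reflect_shift:
  fixes h :: "real \<Rightarrow> 'a::euclidean_space"
  assumes "h absolutely_integrable_on {a..b}"
  shows "(\<lambda>s. h (c - s)) absolutely_integrable_on {c - b..c - a}"
  using assms unfolding absolutely_integrable_on_def integrable_on_def
  by (auto dest: has_integral_reflect_shift[of h _ _ _ c] has_integral_reflect_shift[of "\<lambda>s. norm (h s)" _ _ _ c])

lemma gronwall_integral:
  fixes w :: "real \<Rightarrow> real"
  assumes cont: "continuous_on {0..T} w" and L: "0 \<le> L"
    and le: "\<And>t. t \<in> {0..T} \<Longrightarrow> w t \<le> A + L * integral {0..t} w"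
    and t: "t \<in> {0..T}"
  shows "w t \<le> A * exp (L * t)"
proof -
  \<comment> \<open>Integrating factor: the derivative of \<phi> is L e^{-Ls} times the slack in the
    hypothesis, hence nonpositive, and \<phi> starts at A.\<close>
  define \<phi> where "\<phi> s = exp (- L * s) * (A + L * integral {0..s} w)" for s
  have int: "w integrable_on {0..T}" using cont by (rule integrable_continuous_real)
  have sub: "{0..t} \<subseteq> {0..T}" using t by auto
  have "\<phi> t \<le> \<phi> 0"
  proof (rule DERIV_nonpos_imp_decreasing_open[of 0 t \<phi>])
    show "0 \<le> t" using t by simp
    have "continuous_on {0..t} (\<lambda>s. integral {0..s} w)"
      using indefinite_integral_continuous_1[OF int] sub by (rule continuous_on_subset)
    then show "continuous_on {0..t} \<phi>"
      unfolding \<phi>_def by (intro continuous_intros)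
    fix s assume s: "0 < s" "s < t"
    then have sT: "s \<in> {0..T}" using t by auto
    have "((\<lambda>x. integral {0..x} w) has_real_derivative w s) (at s within {0..T})"
      using integral_has_real_derivative[OF cont sT] .
    then have D: "((\<lambda>x. integral {0..x} w) has_real_derivative w s) (at s)"
      using s t by (simp add: at_within_Icc_at)
    have "(\<phi> has_real_derivative
       exp (- L * s) * (L * w s) + (- L * exp (- L * s)) * (A + L * integral {0..s} w)) (at s)"
      unfolding \<phi>_def by (auto intro!: derivative_eq_intros D)
    also have "exp (- L * s) * (L * w s) + (- L * exp (- L * s)) * (A + L * integral {0..s} w)
       = exp (- L * s) * (L * (w s - (A + L * integral {0..s} w)))"
      by (simp add: algebra_simps)
    finally have "(\<phi> has_real_derivative exp (- L * s) * (L * (w s - (A + L * integral {0..s} w)))) (at s)" .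
    moreover have "exp (- L * s) * (L * (w s - (A + L * integral {0..s} w))) \<le> 0"
      using le[OF sT] L by (simp add: mult_le_0_iff)
    ultimately show "\<exists>y. (\<phi> has_real_derivative y) (at s) \<and> y \<le> 0" by blast
  qed
  then have "exp (- L * t) * (A + L * integral {0..t} w) \<le> A" by (simp add: \<phi>_def)
  then have "A + L * integral {0..t} w \<le> A * exp (L * t)"
    by (simp add: exp_minus field_simps)
  then show ?thesis using le[OF t] by simp
qed

lemma continuous_on_integral_equation:
  fixes x :: "real \<Rightarrow> 'a::euclidean_space"
  assumes "\<And>t. t \<in> {0..T} \<Longrightarrow> x t = a + integral {0..t} h" "h absolutely_integrable_on {0..T}"
  shows "continuous_on {0..T} x"
proof -
  have "continuous_on {0..T} (\<lambda>t. a + integral {0..t} h)"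
    using assms(2) by (intro continuous_intros indefinite_integral_continuous_1)
      (simp add: absolutely_integrable_on_def)
  then show ?thesis by (rule continuous_on_eq) (use assms(1) in auto)
qed

text \<open>The forcing term k enters only through its integral over the whole interval, so the
  bound is uniform in t. The expressions e^{LT} (datum + integral) behind the explicit constants
  come from this lemma and its time reversal.\<close>

lemma gronwall_forward:
  fixes x :: "real \<Rightarrow> 'a::euclidean_space"
  assumes x: "\<And>t. t \<in> {0..T} \<Longrightarrow> x t = a + integral {0..t} h"
    and h: "h absolutely_integrable_on {0..T}"
    and L: "0 \<le> L" and k: "k integrable_on {0..T}"
    and le: "\<And>s. s \<in> {0..T} \<Longrightarrow> norm (h s) \<le> L * norm (x s) + k s"
    and k0: "\<And>s. s \<in> {0..T} \<Longrightarrow> 0 \<le> k s"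
    and a: "norm a \<le> A"
    and t: "t \<in> {0..T}"
  shows "norm (x t) \<le> exp (L * T) * (A + integral {0..T} k)"
proof -
  have cont: "continuous_on {0..T} (\<lambda>s. norm (x s))"
    by (rule continuous_on_norm[OF continuous_on_integral_equation[OF x h]])
  have "norm (x t) \<le> (A + integral {0..T} k) + L * integral {0..t} (\<lambda>s. norm (x s))"
    if t: "t \<in> {0..T}" for t
  proof -
    have sub: "{0..t} \<subseteq> {0..T}" using t by auto
    have i1: "h integrable_on {0..t}"
      by (rule integrable_on_subinterval[of h "{0..T}"]) (use assms sub in \<open>auto simp: absolutely_integrable_on_def\<close>)
    have i2: "(\<lambda>s. L * norm (x s)) integrable_on {0..t}"
      by (intro integrable_continuous_real continuous_on_mult_left continuous_on_subset[OF cont sub])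
    have i3: "k integrable_on {0..t}" using k sub by (rule integrable_on_subinterval)
    have "norm (integral {0..t} h) \<le> integral {0..t} (\<lambda>s. L * norm (x s) + k s)"
      by (rule integral_norm_bound_integral[OF i1 integrable_add[OF i2 i3]]) (use le sub in auto)
    also have "\<dots> = L * integral {0..t} (\<lambda>s. norm (x s)) + integral {0..t} k"
      by (simp add: integral_add[OF i2 i3])
    \<comment> \<open>Gronwall's inequality is applied with a fixed number, so the running integral
      of k is enlarged to the full one.\<close>
    also have "integral {0..t} k \<le> integral {0..T} k"
      using k0 by (intro integral_subset_le sub i3 k) auto
    finally have "norm (integral {0..t} h) \<le> L * integral {0..t} (\<lambda>s. norm (x s)) + integral {0..T} k"
      by simp
    then show ?thesis
      using x[OF t] norm_triangle_ineq[of a "integral {0..t} h"] a by simp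
  qed
  from gronwall_integral[OF cont L this t]
  have *: "norm (x t) \<le> (A + integral {0..T} k) * exp (L * t)" .
  have "0 \<le> A + integral {0..T} k"
    using order_trans[OF norm_ge_zero a] integral_nonneg[OF k k0] by linarith
  moreover have "exp (L * t) \<le> exp (L * T)"
    using t L by (simp add: mult_left_mono)
  ultimately have "(A + integral {0..T} k) * exp (L * t) \<le> (A + integral {0..T} k) * exp (L * T)"
    by (intro mult_left_mono)
  with * show ?thesis by (simp add: mult.commute)
qed

lemma integral_equation_reflect:
  fixes h :: "real \<Rightarrow> 'a::euclidean_space"
  assumes h: "h absolutely_integrable_on {0..T}" and t: "t \<in> {0..T}"
  shows "integral {T - t..T} h = integral {0..t} (\<lambda>s. h (T - s))"
proof -
  have "h integrable_on {T - t..T}"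
    by (rule integrable_on_subinterval[of h "{0..T}"]) (use assms in \<open>auto simp: absolutely_integrable_on_def\<close>)
  from integral_reflect_shift[OF this, of T] show ?thesis by simp
qed

text \<open>The reflection s to T - s turns a terminal value problem into an initial value problem
  and preserves L, the integral of k and the length of the interval.\<close>

lemma gronwall_backward:
  fixes x :: "real \<Rightarrow> 'a::euclidean_space"
  assumes x: "\<And>t. t \<in> {0..T} \<Longrightarrow> x t = a + integral {t..T} h"
    and h: "h absolutely_integrable_on {0..T}"
    and L: "0 \<le> L" and k: "k integrable_on {0..T}"
    and le: "\<And>s. s \<in> {0..T} \<Longrightarrow> norm (h s) \<le> L * norm (x s) + k s"
    and k0: "\<And>s. s \<in> {0..T} \<Longrightarrow> 0 \<le> k s"
    and a: "norm a \<le> A"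
    and t: "t \<in> {0..T}"
  shows "norm (x t) \<le> exp (L * T) * (A + integral {0..T} k)"
proof -
  have "norm ((\<lambda>s. x (T - s)) (T - t)) \<le> exp (L * T) * (A + integral {0..T} (\<lambda>s. k (T - s)))"
  proof (rule gronwall_forward[where x = "\<lambda>s. x (T - s)" and a = a and h = "\<lambda>s. h (T - s)"])
    show "x (T - s) = a + integral {0..s} (\<lambda>s. h (T - s))" if "s \<in> {0..T}" for s
      using x[of "T - s"] integral_equation_reflect[OF h that] that by simp
    show "(\<lambda>s. h (T - s)) absolutely_integrable_on {0..T}"
      using absolutely_integrable_reflect_shift[OF h, of T] by simp
    show "(\<lambda>s. k (T - s)) integrable_on {0..T}"
      using has_integral_reflect_shift[OF integrable_integral[OF k], of T] by auto
  qed (use assms in auto)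
  then show ?thesis using integral_reflect_shift[OF k, of T] by simp
qed

text \<open>Contraction in the norm \<open>sup e\<^bsup>-2Lt\<^esup>|x(t)|\<close>; the bounded continuous function \<open>z\<close> below stands for
  the path \<open>t \<mapsto> e\<^bsup>2Lt\<^esup> z(t)\<close>.\<close>

lemma picard_forward:
  fixes F :: "real \<Rightarrow> 'a::euclidean_space \<Rightarrow> 'a"
  assumes T: "0 \<le> T" and L: "0 < L"
    and lip: "\<And>t x y. t \<in> {0..T} \<Longrightarrow> norm (F t x - F t y) \<le> L * norm (x - y)"
    and int: "\<And>x. continuous_on {0..T} x \<Longrightarrow> (\<lambda>t. F t (x t)) absolutely_integrable_on {0..T}"
  obtains x where "continuous_on {0..T} x"
    "\<And>t. t \<in> {0..T} \<Longrightarrow> x t = a + integral {0..t} (\<lambda>s. F s (x s))"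
proof -
  define E where "E z t = exp (2 * L * t) *\<^sub>R apply_bcontfun z t" for z :: "real \<Rightarrow>\<^sub>C 'a" and t
  define \<Phi>0 where "\<Phi>0 z t = exp (- 2 * L * t) *\<^sub>R (a + integral {0..t} (\<lambda>s. F s (E z s)))" for z t
  have contE: "continuous_on S (E z)" for S z
    unfolding E_def by (rule continuous_on_scaleR) (intro continuous_on_exp continuous_on_mult continuous_on_const continuous_on_id, rule continuous_on_apply_bcontfun)
  have intE: "(\<lambda>s. F s (E z s)) integrable_on {0..T}" for z
    using int[OF contE] by (simp add: absolutely_integrable_on_def)
  have cont: "continuous_on {0..T} (\<Phi>0 z)" for z
    unfolding \<Phi>0_def by (intro continuous_intros indefinite_integral_continuous_1 intE)
  \<comment> \<open>\<open>\<Phi>0 z\<close> is continuous on [0,T] only; composing it with the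
    projection onto [0,T] gives a bounded continuous function on the whole line, to which the
    complete space of such functions applies.\<close>
  define c where "c = clamp 0 T"
  have c: "c t \<in> {0..T}" for t using clamp_in_interval[of 0 T t] T by (auto simp: c_def)
  have c_id: "c t = t" if "t \<in> {0..T}" for t using that by (simp add: c_def)
  have "\<forall>z. \<exists>y. \<forall>t. apply_bcontfun y t = \<Phi>0 z (c t)"
  proof
    fix z
    have "continuous_on UNIV (\<lambda>t. \<Phi>0 z (c t))"
      unfolding c_def by (rule clamp_continuous_on) (use cont in auto)
    moreover have "bounded (range (\<lambda>t. \<Phi>0 z (c t)))"
    proof (rule bounded_subset)
      show "bounded (\<Phi>0 z ` {0..T})"
        by (intro compact_imp_bounded compact_continuous_image cont) auto
      show "range (\<lambda>t. \<Phi>0 z (c t)) \<subseteq> \<Phi>0 z ` {0..T}" using c by auto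
    qed
    ultimately have "(\<lambda>t. \<Phi>0 z (c t)) \<in> bcontfun" by (simp add: bcontfun_def)
    then obtain y where "(\<lambda>t. \<Phi>0 z (c t)) = apply_bcontfun y" by (rule bcontfunE)
    then show "\<exists>y. \<forall>t. apply_bcontfun y t = \<Phi>0 z (c t)" by (intro exI[of _ y]) (auto simp: fun_eq_iff)
  qed
  from choice[OF this] obtain \<Phi> where "\<forall>z t. apply_bcontfun (\<Phi> z) t = \<Phi>0 z (c t)" ..
  then have \<Phi>: "apply_bcontfun (\<Phi> z) t = \<Phi>0 z (c t)" for z t by blast
  \<comment> \<open>The integral of L e^{2Ls} over [0,t] is at most e^{2Lt}/2, so the weight yields
    the contraction factor 1/2 whatever T is and no subdivision of the interval is required.\<close>
  have "dist (\<Phi> y) (\<Phi> z) \<le> 1/2 * dist y z" for y z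
  proof (rule dist_bound)
    fix t0
    define t where "t = c t0"
    have t: "t \<in> {0..T}" using c by (simp add: t_def)
    define d where "d = dist y z"
    have d0: "0 \<le> d" by (simp add: d_def)
    have sub: "{0..t} \<subseteq> {0..T}" using t by auto
    have i: "(\<lambda>s. F s (E z s)) integrable_on {0..t}" for z
      using intE sub by (rule integrable_on_subinterval)
    have D: "((\<lambda>s. exp (2 * L * s) * (d / 2)) has_vector_derivative L * (exp (2 * L * s) * d)) (at s within {0..t})" for s
    proof -
      have "((\<lambda>s. exp (2 * L * s) * (d / 2)) has_real_derivative exp (2 * L * s) * (2 * L) * (d / 2)) (at s within {0..t})"
        by (auto intro!: derivative_eq_intros)
      then show ?thesis by (simp add: has_real_derivative_iff_has_vector_derivative ac_simps)
    qed
    have I: "((\<lambda>s. L * (exp (2 * L * s) * d)) has_integral (exp (2 * L * t) * (d / 2) - exp (2 * L * 0) * (d / 2))) {0..t}"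
      by (rule fundamental_theorem_of_calculus) (use t D in auto)
    have "norm (integral {0..t} (\<lambda>s. F s (E y s)) - integral {0..t} (\<lambda>s. F s (E z s)))
        = norm (integral {0..t} (\<lambda>s. F s (E y s) - F s (E z s)))"
      using i by (simp add: integral_diff)
    also have "\<dots> \<le> integral {0..t} (\<lambda>s. L * (exp (2 * L * s) * d))"
    proof (rule integral_norm_bound_integral)
      fix s assume s: "s \<in> {0..t}"
      have "norm (F s (E y s) - F s (E z s)) \<le> L * norm (E y s - E z s)"
        using s sub by (intro lip) auto
      also have "norm (E y s - E z s) = exp (2 * L * s) * dist (apply_bcontfun y s) (apply_bcontfun z s)"
        by (simp add: E_def dist_norm flip: scaleR_diff_right)
      also have "\<dots> \<le> exp (2 * L * s) * d"
        by (simp add: d_def dist_bounded)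
      finally show "norm (F s (E y s) - F s (E z s)) \<le> L * (exp (2 * L * s) * d)"
        using L by (simp add: mult_left_mono)
    qed (use i I in \<open>auto intro: integrable_diff\<close>)
    also have "\<dots> \<le> exp (2 * L * t) * (d / 2)"
      using integral_unique[OF I] d0 by simp
    finally have *: "norm (integral {0..t} (\<lambda>s. F s (E y s)) - integral {0..t} (\<lambda>s. F s (E z s)))
      \<le> exp (2 * L * t) * (d / 2)" .
    have "dist (\<Phi>0 y t) (\<Phi>0 z t) = exp (- 2 * L * t) *
       norm (integral {0..t} (\<lambda>s. F s (E y s)) - integral {0..t} (\<lambda>s. F s (E z s)))"
      by (simp add: \<Phi>0_def dist_norm flip: scaleR_diff_right)
    also have "\<dots> \<le> exp (- 2 * L * t) * (exp (2 * L * t) * (d / 2))"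
      by (intro mult_left_mono *) auto
    also have "\<dots> = 1/2 * d" by (simp add: exp_minus)
    finally show "dist (apply_bcontfun (\<Phi> y) t0) (apply_bcontfun (\<Phi> z) t0) \<le> 1/2 * dist y z"
      by (simp add: \<Phi> t_def d_def)
  qed
  then obtain z where z: "\<Phi> z = z"
    using banach_fix_type[of "1/2" \<Phi>] by auto
  show thesis
  proof
    show "continuous_on {0..T} (E z)" by (rule contE)
    fix t assume t: "t \<in> {0..T}"
    have "apply_bcontfun z t = \<Phi>0 z t" using \<Phi>[of z t] c_id[OF t] by (simp add: z)
    then show "E z t = a + integral {0..t} (\<lambda>s. F s (E z s))"
      by (simp add: E_def[of z t] \<Phi>0_def exp_minus)
  qed
qed

lemma picard_backward:
  fixes F :: "real \<Rightarrow> 'a::euclidean_space \<Rightarrow> 'a"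
  assumes T: "0 \<le> T" and L: "0 < L"
    and lip: "\<And>t x y. t \<in> {0..T} \<Longrightarrow> norm (F t x - F t y) \<le> L * norm (x - y)"
    and int: "\<And>x. continuous_on {0..T} x \<Longrightarrow> (\<lambda>t. F t (x t)) absolutely_integrable_on {0..T}"
  obtains x where "continuous_on {0..T} x"
    "\<And>t. t \<in> {0..T} \<Longrightarrow> x t = a + integral {t..T} (\<lambda>s. F s (x s))"
proof -
  have reflect: "continuous_on {0..T} (\<lambda>t. x (T - t))" if "continuous_on {0..T} x" for x :: "real \<Rightarrow> 'a"
    by (rule continuous_on_compose2[OF that]) (auto intro: continuous_intros)
  obtain y where y: "continuous_on {0..T} y"
    "\<And>t. t \<in> {0..T} \<Longrightarrow> y t = a + integral {0..t} (\<lambda>s. F (T - s) (y s))"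
  proof (rule picard_forward[OF T L, of "\<lambda>s. F (T - s)" a])
    fix x :: "real \<Rightarrow> 'a" assume "continuous_on {0..T} x"
    from absolutely_integrable_reflect_shift[OF int[OF reflect[OF this]], of T]
    show "(\<lambda>s. F (T - s) (x s)) absolutely_integrable_on {0..T}" by simp
  qed (use lip in auto)
  show thesis
  proof
    show c: "continuous_on {0..T} (\<lambda>t. y (T - t))" by (rule reflect[OF y(1)])
    fix t assume t: "t \<in> {0..T}"
    have "integral {T - (T - t)..T} (\<lambda>s. F s (y (T - s))) = integral {0..T - t} (\<lambda>s. F (T - s) (y (T - (T - s))))"
      by (rule integral_equation_reflect[OF int[OF c]]) (use t in auto)
    then show "y (T - t) = a + integral {t..T} (\<lambda>s. F s (y (T - s)))"
      using y(2)[of "T - t"] t by simp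
  qed
qed

section \<open>Integration by parts for absolutely continuous functions\<close>

lemma inner_integral_left:
  fixes h :: "real \<Rightarrow> 'a::euclidean_space"
  assumes "h integrable_on S"
  shows "integral S (\<lambda>s. c \<bullet> h s) = c \<bullet> integral S h"
  using integral_linear[OF assms bounded_linear_inner_right] by (simp add: o_def)

lemma integral_diff_interval:
  fixes h :: "real \<Rightarrow> 'a::banach"
  assumes "h integrable_on {0..T}" "0 \<le> s" "s \<le> t" "t \<le> T"
  shows "integral {0..t} h - integral {0..s} h = integral {s..t} h"
proof -
  have "h integrable_on {0..t}"
    by (rule integrable_on_subinterval[OF assms(1)]) (use assms in auto)
  from Henstock_Kurzweil_Integration.integral_combine[OF assms(2,3) this] show ?thesis by (simp add: algebra_simps)
qed

lemma absolutely_integrable_inner_continuous: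
  fixes x h :: "real \<Rightarrow> 'a::euclidean_space"
  assumes x: "continuous_on {0..T} x" and h: "h absolutely_integrable_on {0..T}"
  shows "(\<lambda>s. x s \<bullet> h s) absolutely_integrable_on {0..T}"
proof -
  have "bounded (x ` {0..T})"
    by (intro compact_imp_bounded compact_continuous_image x) auto
  then obtain B where B: "\<And>s. s \<in> {0..T} \<Longrightarrow> norm (x s) \<le> B"
    unfolding bounded_iff by blast
  have n: "(\<lambda>s. norm (h s)) integrable_on {0..T}"
    using h by (simp add: absolutely_integrable_on_def)
  show ?thesis
  proof (rule measurable_bounded_by_integrable_imp_absolutely_integrable)
    have "x \<in> borel_measurable (lebesgue_on {0..T})"
      using x by (intro continuous_imp_measurable_on_sets_lebesgue) auto
    moreover have "h \<in> borel_measurable (lebesgue_on {0..T})"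
      using h by (intro absolutely_integrable_imp_borel_measurable) auto
    ultimately show "(\<lambda>s. x s \<bullet> h s) \<in> borel_measurable (lebesgue_on {0..T})"
      by (rule borel_measurable_inner)
    show "(\<lambda>s. B * norm (h s)) integrable_on {0..T}"
      by (rule integrable_on_mult_right[OF n])
    fix s assume "s \<in> {0..T}"
    then show "norm (x s \<bullet> h s) \<le> B * norm (h s)"
      using Cauchy_Schwarz_ineq2[of "x s" "h s"] B[of s]
      by (smt (verit) mult_right_mono norm_ge_zero real_norm_def)
  qed auto
qed

text \<open>Both factors are absolutely continuous but need not be differentiable everywhere; on a fine
  partition the increments of the two sides differ by the oscillation of the factors times the
  mass of \<open>|h| + |k|\<close>.\<close>

lemma integral_by_parts_absolutely_continuous:
  fixes x y h k :: "real \<Rightarrow> 'a::euclidean_space"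
  assumes T: "0 \<le> T"
    and h: "h absolutely_integrable_on {0..T}" and k: "k absolutely_integrable_on {0..T}"
    and x: "\<And>t. t \<in> {0..T} \<Longrightarrow> x t = a + integral {0..t} h"
    and y: "\<And>t. t \<in> {0..T} \<Longrightarrow> y t = b + integral {0..t} k"
  shows "x T \<bullet> y T - x 0 \<bullet> y 0 = integral {0..T} (\<lambda>t. x t \<bullet> k t + h t \<bullet> y t)"
proof -
  have cx: "continuous_on {0..T} x" using continuous_on_integral_equation[OF x h] .
  have cy: "continuous_on {0..T} y" using continuous_on_integral_equation[OF y k] .
  have hi: "h integrable_on {0..T}" and ki: "k integrable_on {0..T}"
    and hn: "(\<lambda>s. norm (h s)) integrable_on {0..T}" and kn: "(\<lambda>s. norm (k s)) integrable_on {0..T}"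
    using h k by (auto simp: absolutely_integrable_on_def)
  define F where "F t = x t \<bullet> k t + h t \<bullet> y t" for t
  define m where "m t = norm (h t) + norm (k t)" for t
  have Fi: "F integrable_on {0..T}"
    unfolding F_def
    using absolutely_integrable_inner_continuous[OF cx k] absolutely_integrable_inner_continuous[OF cy h]
    by (auto simp: absolutely_integrable_on_def inner_commute intro!: integrable_add)
  have mi: "m integrable_on {0..T}" unfolding m_def by (intro integrable_add hn kn)
  define \<phi> where "\<phi> t = x t \<bullet> y t - integral {0..t} F" for t
  define M where "M = integral {0..T} m"
  have M0: "0 \<le> M" unfolding M_def by (rule integral_nonneg[OF mi]) (simp add: m_def)
  have "\<bar>\<phi> T - \<phi> 0\<bar> \<le> e * M" if e: "0 < e" for e
  proof -
    have ux: "uniformly_continuous_on {0..T} x" and uy: "uniformly_continuous_on {0..T} y"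
      using cx cy by (auto intro: compact_uniformly_continuous)
    obtain d1 where d1: "0 < d1" "\<And>s t. s \<in> {0..T} \<Longrightarrow> t \<in> {0..T} \<Longrightarrow> dist s t < d1 \<Longrightarrow> dist (x s) (x t) < e"
      using ux e unfolding uniformly_continuous_on_def by blast
    obtain d2 where d2: "0 < d2" "\<And>s t. s \<in> {0..T} \<Longrightarrow> t \<in> {0..T} \<Longrightarrow> dist s t < d2 \<Longrightarrow> dist (y s) (y t) < e"
      using uy e unfolding uniformly_continuous_on_def by blast
    have step: "\<bar>\<phi> t - \<phi> s\<bar> \<le> e * integral {s..t} m"
      if st: "0 \<le> s" "s \<le> t" "t \<le> T" "t - s < min d1 d2" for s t
    proof -
      have sub: "{s..t} \<subseteq> {0..T}" using st by auto
      have i: "h integrable_on {s..t}" "k integrable_on {s..t}" "F integrable_on {s..t}" "m integrable_on {s..t}"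
        using hi ki Fi mi sub by (auto intro: integrable_on_subinterval)
      have dx: "x t - x s = integral {s..t} h" and dy: "y t - y s = integral {s..t} k"
        using x[of t] x[of s] y[of t] y[of s] st integral_diff_interval[OF hi] integral_diff_interval[OF ki] by auto
      have i2: "(\<lambda>r. x t \<bullet> k r + y s \<bullet> h r) integrable_on {s..t}"
        using integrable_linear[OF i(1) bounded_linear_inner_right[of "y s"]]
          integrable_linear[OF i(2) bounded_linear_inner_right[of "x t"]]
        by (auto simp: o_def intro: integrable_add)
      \<comment> \<open>Freezing one factor at the right endpoint and the other at the left
        reproduces the increment of \<open>x \<bullet> y\<close> exactly, without a second order
        term.\<close>
      have i3: "integral {s..t} (\<lambda>r. x t \<bullet> k r + y s \<bullet> h r) = x t \<bullet> (y t - y s) + y s \<bullet> (x t - x s)"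
        using integrable_linear[OF i(1) bounded_linear_inner_right[of "y s"]]
          integrable_linear[OF i(2) bounded_linear_inner_right[of "x t"]]
        by (simp add: o_def integral_add inner_integral_left i dx dy)
      have "\<phi> t - \<phi> s = x t \<bullet> y t - x s \<bullet> y s - integral {s..t} F"
        unfolding \<phi>_def using integral_diff_interval[OF Fi st(1-3)] by simp
      also have "x t \<bullet> y t - x s \<bullet> y s = integral {s..t} (\<lambda>r. x t \<bullet> k r + y s \<bullet> h r)"
        unfolding i3 by (simp add: inner_diff_right inner_diff_left inner_commute)
      also have "\<dots> - integral {s..t} F = integral {s..t} (\<lambda>r. (x t \<bullet> k r + y s \<bullet> h r) - F r)"
        by (rule integral_diff[OF i2 i(3), symmetric])
      also have "norm \<dots> \<le> integral {s..t} (\<lambda>r. e * m r)"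
      proof (rule integral_norm_bound_integral)
        fix r assume r: "r \<in> {s..t}"
        have rT: "r \<in> {0..T}" "s \<in> {0..T}" "t \<in> {0..T}" using r sub st by auto
        have dd: "dist t r < d1" "dist s r < d2" using r st by (auto simp: dist_real_def)
        have a1: "norm (x t - x r) \<le> e" using d1(2)[OF rT(3,1) dd(1)] by (simp add: dist_norm)
        have a2: "norm (y s - y r) \<le> e" using d2(2)[OF rT(2,1) dd(2)] by (simp add: dist_norm)
        have "(x t \<bullet> k r + y s \<bullet> h r) - F r = (x t - x r) \<bullet> k r + (y s - y r) \<bullet> h r"
          by (simp add: F_def inner_diff_left inner_diff_right inner_commute)
        also have "norm \<dots> \<le> norm (x t - x r) * norm (k r) + norm (y s - y r) * norm (h r)"
          unfolding real_norm_def by (intro order_trans[OF abs_triangle_ineq] add_mono Cauchy_Schwarz_ineq2)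
        also have "\<dots> \<le> e * norm (k r) + e * norm (h r)"
          by (intro add_mono mult_right_mono a1 a2) auto
        finally show "norm ((x t \<bullet> k r + y s \<bullet> h r) - F r) \<le> e * m r"
          by (simp add: m_def algebra_simps)
      qed (use i i2 in \<open>auto intro: integrable_diff integrable_on_mult_right\<close>)
      finally show ?thesis by simp
    qed
    obtain n :: nat where n: "T / min d1 d2 < real n" "0 < n"
      using reals_Archimedean2[of "max 1 (T / min d1 d2)"] by (metis max_less_iff_conj of_nat_0_less_iff less_trans zero_less_one)
    define p where "p i = T * real i / real n" for i
    have p: "p 0 = 0" "p n = T" using n by (auto simp: p_def)
    have dpos: "0 < min d1 d2" using d1 d2 by simp
    have pS: "p (Suc i) - p i = T / n" for i by (simp add: p_def diff_divide_distrib[symmetric] algebra_simps)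
    have pd: "T / n < min d1 d2" using n dpos by (simp add: pos_divide_less_eq mult.commute del: min_less_iff_conj)
    have p_le: "p (Suc i) \<le> T" if "i < n" for i
    proof -
      have "T * real (Suc i) \<le> T * real n" using that T by (intro mult_left_mono) auto
      then show ?thesis using n by (simp add: p_def pos_divide_le_eq)
    qed
    have "\<bar>\<phi> (p i) - \<phi> 0\<bar> \<le> e * integral {0..p i} m" if "i \<le> n" for i
      using that
    proof (induction i)
      case 0 then show ?case by (simp add: p)
    next
      case (Suc i)
      have pi: "0 \<le> p i" using T by (simp add: p_def)
      have ps: "p i \<le> p (Suc i)" using pS[of i] T by (smt (verit) divide_nonneg_nonneg of_nat_0_le_iff)
      have "\<bar>\<phi> (p (Suc i)) - \<phi> (p i)\<bar> \<le> e * integral {p i..p (Suc i)} m"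
        by (rule step[OF pi ps]) (use Suc p_le pS pd in auto)
      moreover have "integral {0..p (Suc i)} m - integral {0..p i} m = integral {p i..p (Suc i)} m"
        by (rule integral_diff_interval[OF mi pi ps]) (use Suc p_le in auto)
      moreover have "\<bar>\<phi> (p i) - \<phi> 0\<bar> \<le> e * integral {0..p i} m" using Suc by simp
      ultimately show ?case by (simp add: right_diff_distrib algebra_simps)
    qed
    from this[of n] show ?thesis by (simp add: p M_def)
  qed
  \<comment> \<open>The bound e * M is arbitrarily small, but the argument divides by M, so M = 0 is
    treated on its own.\<close>
  then have "\<bar>\<phi> T - \<phi> 0\<bar> \<le> 0"
  proof (cases "M = 0")
    case False
    then have Mp: "0 < M" using M0 by simp
    show ?thesis
    proof (rule field_le_epsilon)
      fix e :: real assume "0 < e"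
      then show "\<bar>\<phi> T - \<phi> 0\<bar> \<le> 0 + e"
        using \<open>\<And>e. 0 < e \<Longrightarrow> \<bar>\<phi> T - \<phi> 0\<bar> \<le> e * M\<close>[of "e / M"] Mp by simp
    qed
  qed (use \<open>\<And>e. 0 < e \<Longrightarrow> \<bar>\<phi> T - \<phi> 0\<bar> \<le> e * M\<close>[of 1] in simp)
  then show ?thesis by (simp add: \<phi>_def F_def[abs_def])
qed

section \<open>Measurability of superpositions and of sections\<close>

text \<open>Simple functions approximate z; on each of their finitely many level sets the second
  argument is constant, and continuity in it carries measurability to the limit.\<close>

lemma borel_measurable_caratheodory:
  fixes \<phi> :: "real \<Rightarrow> 'z::euclidean_space \<Rightarrow> 'b::euclidean_space"
  assumes meas: "\<And>z. (\<lambda>t. \<phi> t z) \<in> borel_measurable (lebesgue_on S)"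
    and cont: "\<And>t. t \<in> S \<Longrightarrow> continuous_on UNIV (\<phi> t)"
    and z: "z \<in> borel_measurable (lebesgue_on S)"
  shows "(\<lambda>t. \<phi> t (z t)) \<in> borel_measurable (lebesgue_on S)"
proof -
  obtain F where F: "\<And>i. simple_function (lebesgue_on S) (F i)"
    "\<And>t. t \<in> space (lebesgue_on S) \<Longrightarrow> (\<lambda>i. F i t) \<longlonglongrightarrow> z t"
    using borel_measurable_implies_sequence_metric[OF z, of 0] by blast
  have "(\<lambda>t. \<phi> t (F i t)) \<in> borel_measurable (lebesgue_on S)" for i
  proof (rule measurable_piecewise_restrict[where C = "(\<lambda>c. F i -` {c} \<inter> space (lebesgue_on S)) ` F i ` space (lebesgue_on S)"])
    show "countable ((\<lambda>c. F i -` {c} \<inter> space (lebesgue_on S)) ` F i ` space (lebesgue_on S))"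
      using simple_functionD(1)[OF F(1)] by (simp add: countable_finite)
    show "\<Omega> \<inter> space (lebesgue_on S) \<in> sets (lebesgue_on S)"
      if "\<Omega> \<in> (\<lambda>c. F i -` {c} \<inter> space (lebesgue_on S)) ` F i ` space (lebesgue_on S)" for \<Omega>
      using that simple_functionD(2)[OF F(1)] by (auto simp: Int_absorb2)
    show "space (lebesgue_on S) \<subseteq> \<Union> ((\<lambda>c. F i -` {c} \<inter> space (lebesgue_on S)) ` F i ` space (lebesgue_on S))"
      by auto
    fix \<Omega> assume "\<Omega> \<in> (\<lambda>c. F i -` {c} \<inter> space (lebesgue_on S)) ` F i ` space (lebesgue_on S)"
    then obtain c where c: "\<Omega> = F i -` {c} \<inter> space (lebesgue_on S)" by auto
    have "(\<lambda>t. \<phi> t c) \<in> borel_measurable (restrict_space (lebesgue_on S) \<Omega>)"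
      by (rule measurable_restrict_space1[OF meas])
    moreover have "(\<lambda>t. \<phi> t (F i t)) \<in> borel_measurable (restrict_space (lebesgue_on S) \<Omega>) \<longleftrightarrow>
        (\<lambda>t. \<phi> t c) \<in> borel_measurable (restrict_space (lebesgue_on S) \<Omega>)"
      by (rule measurable_cong) (auto simp: c space_restrict_space)
    ultimately show "(\<lambda>t. \<phi> t (F i t)) \<in> borel_measurable (restrict_space (lebesgue_on S) \<Omega>)" by simp
  qed
  then show ?thesis
  proof (rule borel_measurable_LIMSEQ_metric)
    fix t assume t: "t \<in> space (lebesgue_on S)"
    then have "isCont (\<phi> t) (z t)"
      using cont[of t] by (auto simp: continuous_on_eq_continuous_at space_restrict_space)
    from isCont_tendsto_compose[OF this F(2)[OF t]]
    show "(\<lambda>i. \<phi> t (F i t)) \<longlonglongrightarrow> \<phi> t (z t)" .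
  qed
qed

text \<open>A Lebesgue measurable function agrees with a Borel function off a null set. By Fubini
  almost every section of that set is null, and every section of the Borel function is
  measurable.\<close>

lemma AE_section_borel_measurable:
  fixes h :: "real \<times> 'z::euclidean_space \<Rightarrow> real"
  assumes "h \<in> borel_measurable lebesgue"
  shows "AE z in lborel. (\<lambda>t. h (t, z)) \<in> borel_measurable lebesgue"
proof -
  obtain g where g: "g \<in> borel_measurable lborel" "AE p in lborel. h p = g p"
    using completion_ex_borel_measurable_real[OF assms] by blast
  obtain N where N: "N \<in> null_sets lborel" "{p \<in> space lborel. h p \<noteq> g p} \<subseteq> N"
    using g(2) unfolding eventually_ae_filter by blast
  have "AE p in (lborel \<Otimes>\<^sub>M lborel :: (real \<times> 'z) measure). p \<notin> N"
    unfolding lborel_prod using AE_not_in[OF N(1)] .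
  then have "AE t in lborel. AE z in lborel. (t, z) \<notin> N" by (rule lborel_pair.AE_pair)
  moreover have "{p \<in> space (lborel \<Otimes>\<^sub>M lborel). (fst p, snd p) \<notin> N} \<in> sets (lborel \<Otimes>\<^sub>M lborel :: (real \<times> 'z) measure)"
  proof -
    have "{p \<in> space (lborel \<Otimes>\<^sub>M lborel). (fst p, snd p) \<notin> N} = space lborel - N"
      by (auto simp: space_pair_measure)
    then show ?thesis unfolding lborel_prod using N(1) by auto
  qed
  ultimately have "AE z in lborel. AE t in lborel. (t, z) \<notin> N"
    using lborel_pair.AE_commute[of "\<lambda>t z. (t, z) \<notin> N"] by blast
  then show ?thesis
  proof (rule AE_mp, intro AE_I2 impI)
    fix z :: 'z assume "AE t in lborel. (t, z) \<notin> N"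
    then have "AE t in lborel. g (t, z) = h (t, z)"
      by (rule AE_mp) (use N(2) in \<open>force intro!: AE_I2\<close>)
    then have ae: "AE t in lebesgue. g (t, z) = h (t, z)" by (rule AE_completion)
    have "(\<lambda>t. g (t, z)) \<in> borel_measurable lborel"
    proof -
      have "(\<lambda>t. (t, z)) \<in> measurable lborel (borel :: (real \<times> 'z) measure)" by simp
      moreover have "g \<in> borel_measurable borel" using g(1) by simp
      ultimately show ?thesis by (rule measurable_compose)
    qed
    then have "(\<lambda>t. g (t, z)) \<in> borel_measurable lebesgue" by (rule measurable_completion)
    from borel_measurable_AE[OF this ae]
    show "(\<lambda>t. h (t, z)) \<in> borel_measurable lebesgue" .
  qed
qed

text \<open>Only almost every section is measurable a priori; continuity in \<open>z\<close> extends this to every \<open>z\<close>.\<close>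

lemma borel_measurable_section:
  fixes h :: "real \<Rightarrow> 'z::euclidean_space \<Rightarrow> 'b::euclidean_space"
  assumes meas: "(\<lambda>(t, z). h t z) \<in> borel_measurable (lebesgue_on (S \<times> UNIV))"
    and S: "S \<in> sets borel"
    and cont: "\<And>t. t \<in> S \<Longrightarrow> continuous_on UNIV (h t)"
  shows "(\<lambda>t. h t z) \<in> borel_measurable (lebesgue_on S)"
proof (subst borel_measurable_euclidean_space, intro ballI)
  fix i :: 'b assume i: "i \<in> Basis"
  \<comment> \<open>Extension by zero passes from the restricted measure to Lebesgue measure on the
    whole product.\<close>
  define H where "H p = (if p \<in> S \<times> UNIV then h (fst p) (snd p) \<bullet> i else 0)" for p
  have SU: "S \<times> (UNIV :: 'z set) \<in> sets lebesgue"
    by (rule sets_completionI_sets) (simp add: borel_Times S)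
  have "(\<lambda>p. h (fst p) (snd p) \<bullet> i) \<in> borel_measurable (lebesgue_on (S \<times> UNIV))"
    using borel_measurable_inner[OF meas borel_measurable_const[of i]] by (simp add: case_prod_unfold)
  then have "H \<in> borel_measurable lebesgue"
    unfolding H_def by (simp only: borel_measurable_if[OF SU])
  from AE_section_borel_measurable[OF this]
  have ae: "AE z in lborel. (\<lambda>t. H (t, z)) \<in> borel_measurable lebesgue" .
  \<comment> \<open>A ball has positive measure and cannot lie inside the exceptional null set; this
    yields points with measurable sections that converge to z.\<close>
  have "\<exists>w. dist w z < inverse (real (Suc n)) \<and> (\<lambda>t. H (t, w)) \<in> borel_measurable lebesgue" for n
  proof (rule ccontr)
    assume no: "\<not> ?thesis"
    have "AE w in lborel. w \<notin> ball z (inverse (real (Suc n)))"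
    proof (rule AE_mp[OF ae], intro AE_I2 impI)
      fix w assume "(\<lambda>t. H (t, w)) \<in> borel_measurable lebesgue"
      with no show "w \<notin> ball z (inverse (real (Suc n)))" by (auto simp: dist_commute)
    qed
    then have "ball z (inverse (real (Suc n))) \<in> null_sets lborel"
      using AE_iff_null_sets[of "ball z (inverse (real (Suc n)))" lborel] by simp
    then have "negligible (ball z (inverse (real (Suc n))))"
      by (auto simp: negligible_iff_null_sets intro: null_sets_completionI)
    then show False
      using open_not_negligible[of "ball z (inverse (real (Suc n)))"] by simp
  qed
  then have "\<forall>n. \<exists>w. dist w z < inverse (real (Suc n)) \<and> (\<lambda>t. H (t, w)) \<in> borel_measurable lebesgue" by blast
  from choice[OF this] obtain w where w: "\<And>n. dist (w n) z < inverse (real (Suc n))"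
    "\<And>n. (\<lambda>t. H (t, w n)) \<in> borel_measurable lebesgue" by blast
  have "(\<lambda>n. dist (w n) z) \<longlonglongrightarrow> 0"
    by (rule tendsto_sandwich[OF _ _ tendsto_const LIMSEQ_inverse_real_of_nat])
       (use w(1) in \<open>auto intro!: always_eventually less_imp_le\<close>)
  then have wz: "w \<longlonglongrightarrow> z" by (rule tendsto_dist_iff[THEN iffD2])
  have "(\<lambda>t. h t (w n) \<bullet> i) \<in> borel_measurable (lebesgue_on S)" for n
  proof -
    have "(\<lambda>t. H (t, w n)) \<in> borel_measurable (lebesgue_on S)"
      using w(2) by (rule measurable_restrict_space1)
    moreover have "(\<lambda>t. H (t, w n)) \<in> borel_measurable (lebesgue_on S) \<longleftrightarrow>
        (\<lambda>t. h t (w n) \<bullet> i) \<in> borel_measurable (lebesgue_on S)"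
      by (rule measurable_cong) (simp add: H_def space_restrict_space)
    ultimately show ?thesis by simp
  qed
  then show "(\<lambda>t. h t z \<bullet> i) \<in> borel_measurable (lebesgue_on S)"
  proof (rule borel_measurable_LIMSEQ_metric)
    fix t assume "t \<in> space (lebesgue_on S)"
    then have "isCont (h t) z"
      using cont[of t] by (auto simp: continuous_on_eq_continuous_at space_restrict_space)
    from isCont_tendsto_compose[OF this wz]
    show "(\<lambda>n. h t (w n) \<bullet> i) \<longlonglongrightarrow> h t z \<bullet> i" by (intro tendsto_intros)
  qed
qed

section \<open>The spaces \<open>L\<^sup>\<beta>\<close>\<close>

text \<open>The norm inequalities are first shown for strictly positive bounds, by which one can
  divide. Letting the bound decrease extends them to the bound itself, including 0.\<close>

lemma le_mult_of_greater:
  fixes X a K :: real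
  assumes "0 \<le> K" "\<And>a'. a < a' \<Longrightarrow> X \<le> a' * K"
  shows "X \<le> a * K"
proof (cases "K = 0")
  case True then show ?thesis using assms(2)[of "a + 1"] by simp
next
  case False
  then have K: "0 < K" using assms(1) by simp
  have "X / K \<le> a"
    by (rule dense_ge) (use assms(2) K in \<open>simp add: pos_divide_le_eq\<close>)
  then show ?thesis using K by (simp add: pos_divide_le_eq)
qed

lemma powr_convex_nonneg:
  fixes x y l r :: real
  assumes "0 \<le> x" "0 \<le> y" "0 \<le> l" "l \<le> 1" "1 \<le> r"
  shows "(l * x + (1 - l) * y) powr r \<le> l * x powr r + (1 - l) * y powr r"
proof -
  \<comment> \<open>If x or y is 0 the claim reduces to this bound for the weight of the other one;
    convexity is invoked only for positive arguments.\<close>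
  have le: "c powr r \<le> c" if "0 \<le> c" "c \<le> 1" for c :: real
  proof (cases "c = 0")
    case False
    then have "c powr r \<le> c powr 1" using that assms by (intro powr_mono') auto
    then show ?thesis using that by simp
  qed simp
  show ?thesis
  proof (cases "x = 0 \<or> y = 0")
    case True
    then show ?thesis
      using assms le[of l] le[of "1 - l"] by (auto simp: powr_mult mult_right_mono)
  next
    case False
    with powr_convex[OF assms(5)] show ?thesis
      using assms unfolding convex_on_def by (auto dest!: bspec[of _ _ x] bspec[of _ _ y] spec[of _ l] spec[of _ "1 - l"])
  qed
qed

text \<open>Young's inequality with one factor equal to 1. Integrated after a suitable normalisation
  it gives Hoelder's inequality against constants.\<close>

lemma le_powr_mean:
  fixes s r :: real
  assumes "0 \<le> s" "1 \<le> r"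
  shows "s \<le> (1 - 1 / r) + s powr r / r"
proof (cases "s = 0")
  case False
  then have "(s powr r) powr (1 / r) * 1 powr (1 - 1 / r) \<le> (1 / r) * s powr r + (1 - 1 / r) * 1"
    using assms by (intro Youngs_inequality_0) auto
  then show ?thesis using assms False by (simp add: powr_powr)
qed (use assms in simp)

text \<open>Bridge between the nonnegative integral in \<open>lp_norm\<close> and the gauge integral
  of the integral equations; finiteness on the left encodes integrability on the right.\<close>

lemma nn_integral_lebesgue_on_le_iff:
  fixes f :: "real \<Rightarrow> real"
  assumes f: "f \<in> borel_measurable (lebesgue_on {a..b})" and f0: "\<And>t. 0 \<le> f t" and c: "0 \<le> c"
  shows "(\<integral>\<^sup>+t. ennreal (f t) \<partial>lebesgue_on {a..b}) \<le> ennreal c \<longleftrightarrow>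
    f integrable_on {a..b} \<and> integral {a..b} f \<le> c"
proof
  assume le: "(\<integral>\<^sup>+t. ennreal (f t) \<partial>lebesgue_on {a..b}) \<le> ennreal c"
  have i: "integrable (lebesgue_on {a..b}) f"
    using f f0 le order_le_less_trans[OF le ennreal_less_top] by (intro integrableI_nonneg) auto
  have "ennreal (integral {a..b} f) \<le> ennreal c"
    using le nn_integral_eq_integral[OF i] f0 lebesgue_integral_eq_integral[OF i] by simp
  then show "f integrable_on {a..b} \<and> integral {a..b} f \<le> c"
    using i c by (simp add: integrable_on_lebesgue_on ennreal_le_iff)
next
  assume r: "f integrable_on {a..b} \<and> integral {a..b} f \<le> c"
  then have "f absolutely_integrable_on {a..b}"
    using f0 by (intro nonnegative_absolutely_integrable_1) auto
  then have i: "integrable (lebesgue_on {a..b}) f" by (rule absolutely_integrable_imp_integrable) simp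
  show "(\<integral>\<^sup>+t. ennreal (f t) \<partial>lebesgue_on {a..b}) \<le> ennreal c"
    using nn_integral_eq_integral[OF i] f0 lebesgue_integral_eq_integral[OF i] r by (simp add: ennreal_leI)
qed

text \<open>Norms are always compared with a real c: this resolves the case distinctions of
  \<open>lp_norm\<close> and replaces the root of an integral by a power of c.\<close>

lemma lp_norm_le_iff:
  fixes v :: "real \<Rightarrow> 'e::euclidean_space"
  assumes \<beta>: "\<beta> \<noteq> \<infinity>" "1 \<le> \<beta>" and c: "0 \<le> c"
  shows "lp_norm T \<beta> v \<le> ennreal c \<longleftrightarrow> v \<in> borel_measurable (lebesgue_on {0..T}) \<and>
    (\<lambda>t. norm (v t) powr enn2real \<beta>) integrable_on {0..T} \<and>
    integral {0..T} (\<lambda>t. norm (v t) powr enn2real \<beta>) \<le> c powr enn2real \<beta>"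
proof (cases "v \<in> borel_measurable (lebesgue_on {0..T})")
  case True
  define r where "r = enn2real \<beta>"
  have "ennreal 1 \<le> ennreal r" using \<beta> by (simp add: r_def top.not_eq_extremum)
  then have r: "1 \<le> r" by (metis ennreal_le_iff2 not_one_le_zero)
  define I where "I = (\<integral>\<^sup>+t. ennreal (norm (v t) powr r) \<partial>lebesgue_on {0..T})"
  have "lp_norm T \<beta> v = (if I < \<infinity> then ennreal (enn2real I powr (1 / r)) else \<infinity>)"
    using True \<beta> by (simp add: lp_norm_def I_def r_def Let_def)
  moreover have "(if I < \<infinity> then ennreal (enn2real I powr (1 / r)) else \<infinity>) \<le> ennreal c \<longleftrightarrow> I \<le> ennreal (c powr r)"
  proof (cases I)
    case (real i)
    have "i powr (1 / r) \<le> c \<longleftrightarrow> i \<le> c powr r"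
    proof
      assume "i powr (1 / r) \<le> c"
      then have "(i powr (1 / r)) powr r \<le> c powr r" using r by (intro powr_mono2) auto
      then show "i \<le> c powr r" using r real by (simp add: powr_powr)
    next
      assume "i \<le> c powr r"
      then have "i powr (1 / r) \<le> (c powr r) powr (1 / r)" using r real by (intro powr_mono2) auto
      then show "i powr (1 / r) \<le> c" using r c by (simp add: powr_powr)
    qed
    then show ?thesis using real c by (simp add: ennreal_le_iff)
  next
    case top
    then show ?thesis by (simp add: top_unique)
  qed
  moreover have "I \<le> ennreal (c powr r) \<longleftrightarrow> (\<lambda>t. norm (v t) powr r) integrable_on {0..T} \<and>
    integral {0..T} (\<lambda>t. norm (v t) powr r) \<le> c powr r"
    unfolding I_def using True by (intro nn_integral_lebesgue_on_le_iff) auto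
  ultimately show ?thesis using True by (simp add: r_def)
qed (simp add: lp_norm_def top_unique)

lemma lp_norm_infinity_le_iff:
  fixes v :: "real \<Rightarrow> 'e::euclidean_space"
  assumes c: "0 \<le> c"
  shows "lp_norm T top v \<le> ennreal c \<longleftrightarrow> v \<in> borel_measurable (lebesgue_on {0..T}) \<and>
    (AE t in lebesgue_on {0..T}. norm (v t) \<le> c)"
proof (cases "v \<in> borel_measurable (lebesgue_on {0..T})")
  case True
  have "esssup (lebesgue_on {0..T}) (\<lambda>t. ennreal (norm (v t))) \<le> ennreal c \<longleftrightarrow>
    (AE t in lebesgue_on {0..T}. norm (v t) \<le> c)"
  proof
    assume le: "esssup (lebesgue_on {0..T}) (\<lambda>t. ennreal (norm (v t))) \<le> ennreal c"
    show "AE t in lebesgue_on {0..T}. norm (v t) \<le> c"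
      using esssup_AE[of "\<lambda>t. ennreal (norm (v t))" "lebesgue_on {0..T}"]
    proof (rule AE_mp, intro AE_I2 impI)
      fix t assume "ennreal (norm (v t)) \<le> esssup (lebesgue_on {0..T}) (\<lambda>t. ennreal (norm (v t)))"
      then show "norm (v t) \<le> c" using le c by (meson ennreal_le_iff order_trans)
    qed
  next
    assume ae: "AE t in lebesgue_on {0..T}. norm (v t) \<le> c"
    show "esssup (lebesgue_on {0..T}) (\<lambda>t. ennreal (norm (v t))) \<le> ennreal c"
    proof (rule esssup_I)
      show "(\<lambda>t. ennreal (norm (v t))) \<in> borel_measurable (lebesgue_on {0..T})" using True by measurable
      show "AE t in lebesgue_on {0..T}. ennreal (norm (v t)) \<le> ennreal c"
        using ae by eventually_elim (rule ennreal_leI)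
    qed
  qed
  then show ?thesis using True by (simp add: lp_norm_def)
qed (simp add: lp_norm_def top_unique)

lemma lp_norm_le_measurable:
  "lp_norm T \<beta> v \<le> ennreal c \<Longrightarrow> v \<in> borel_measurable (lebesgue_on {0..T})"
  by (auto simp: lp_norm_def top_unique split: if_splits)

lemma lp_space_iff: "v \<in> lp_space T \<beta> \<longleftrightarrow> (\<exists>c\<ge>0. lp_norm T \<beta> v = ennreal c)"
  unfolding lp_space_def by (cases "lp_norm T \<beta> v") auto

lemma one_le_enn2real: "1 \<le> enn2real \<beta>" if "\<beta> \<noteq> \<infinity>" "1 \<le> \<beta>"
proof -
  have "ennreal 1 \<le> ennreal (enn2real \<beta>)" using that by (simp add: top.not_eq_extremum)
  then show ?thesis by (metis ennreal_le_iff2 not_one_le_zero)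
qed

section \<open>Minkowski's inequality and affine domination\<close>

text \<open>Minkowski's inequality, phrased as pointwise domination so that the three functions may
  take values in different spaces. The argument is convexity of the r-th power for normalised
  functions, hence the positive a and b.\<close>

lemma lp_norm_triangle_dominated_pos:
  fixes v :: "real \<Rightarrow> 'e::euclidean_space" and h :: "real \<Rightarrow> 'f::euclidean_space" and k :: "real \<Rightarrow> 'g::euclidean_space"
  assumes \<beta>: "1 \<le> \<beta>" and v: "v \<in> borel_measurable (lebesgue_on {0..T})"
    and h: "lp_norm T \<beta> h \<le> ennreal a" and k: "lp_norm T \<beta> k \<le> ennreal b"
    and ab: "0 < a" "0 < b"
    and le: "\<And>t. t \<in> {0..T} \<Longrightarrow> norm (v t) \<le> norm (h t) + norm (k t)"
  shows "lp_norm T \<beta> v \<le> ennreal (a + b)"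
proof (cases "\<beta> = \<infinity>")
  case True
  have "AE t in lebesgue_on {0..T}. norm (h t) \<le> a" "AE t in lebesgue_on {0..T}. norm (k t) \<le> b"
    using h k ab by (auto simp: True lp_norm_infinity_le_iff)
  with AE_space[of "lebesgue_on {0..T}"] have "AE t in lebesgue_on {0..T}. norm (v t) \<le> a + b"
  proof eventually_elim
    case (elim t) then show ?case using le[of t] by (simp add: space_restrict_space)
  qed
  then show ?thesis unfolding True infinity_ennreal_def using ab v by (subst lp_norm_infinity_le_iff) auto
next
  case False
  define r where "r = enn2real \<beta>"
  have r: "1 \<le> r" unfolding r_def using False \<beta> by (rule one_le_enn2real)
  have hk: "(\<lambda>t. norm (h t) powr r) integrable_on {0..T}" "integral {0..T} (\<lambda>t. norm (h t) powr r) \<le> a powr r"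
    "(\<lambda>t. norm (k t) powr r) integrable_on {0..T}" "integral {0..T} (\<lambda>t. norm (k t) powr r) \<le> b powr r"
    using h k ab False \<beta> by (auto simp: lp_norm_le_iff r_def)
  \<comment> \<open>With this weight |h| + |k| is a + b times a convex combination of |h|/a and
    |k|/b, whose r-th powers have integral at most 1.\<close>
  define l where "l = a / (a + b)"
  have l: "0 \<le> l" "l \<le> 1" "1 - l = b / (a + b)" using ab by (auto simp: l_def field_simps)
  define R where "R t = (a + b) powr r * (l / a powr r * norm (h t) powr r + (1 - l) / b powr r * norm (k t) powr r)" for t
  have Ri: "R integrable_on {0..T}"
    unfolding R_def by (intro integrable_on_mult_right integrable_add hk)
  have vR: "norm (v t) powr r \<le> R t" if t: "t \<in> {0..T}" for t
  proof -
    have "norm (v t) powr r \<le> (norm (h t) + norm (k t)) powr r"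
      using le[OF t] r by (intro powr_mono2) auto
    also have "norm (h t) + norm (k t) = (a + b) * (l * (norm (h t) / a) + (1 - l) * (norm (k t) / b))"
    proof -
      have "l * (norm (h t) / a) = norm (h t) / (a + b)" "(1 - l) * (norm (k t) / b) = norm (k t) / (a + b)"
        using ab unfolding l(3) by (auto simp: l_def)
      then show ?thesis using ab by (simp add: add_divide_distrib[symmetric])
    qed
    also have "\<dots> powr r = (a + b) powr r * (l * (norm (h t) / a) + (1 - l) * (norm (k t) / b)) powr r"
      by (rule powr_mult)
    also have "\<dots> \<le> (a + b) powr r * (l * (norm (h t) / a) powr r + (1 - l) * (norm (k t) / b) powr r)"
      using ab l r by (intro mult_left_mono powr_convex_nonneg) auto
    also have "\<dots> = R t" using ab by (simp add: R_def powr_divide)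
    finally show ?thesis .
  qed
  have vm: "(\<lambda>t. norm (v t) powr r) \<in> borel_measurable (lebesgue_on {0..T})"
    using v by measurable
  have vi: "(\<lambda>t. norm (v t) powr r) integrable_on {0..T}"
    by (rule measurable_bounded_by_integrable_imp_integrable[OF vm Ri]) (use vR in auto)
  have "integral {0..T} (\<lambda>t. norm (v t) powr r) \<le> integral {0..T} R"
    by (rule integral_le[OF vi Ri vR])
  also have "\<dots> = (a + b) powr r * (l / a powr r * integral {0..T} (\<lambda>t. norm (h t) powr r) + (1 - l) / b powr r * integral {0..T} (\<lambda>t. norm (k t) powr r))"
    unfolding R_def by (simp only: integral_mult_right integral_add[OF integrable_on_mult_right[OF hk(1)] integrable_on_mult_right[OF hk(3)]])
  also have "\<dots> \<le> (a + b) powr r * (l / a powr r * a powr r + (1 - l) / b powr r * b powr r)"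
    using hk l ab by (intro mult_left_mono add_mono) auto
  also have "\<dots> = (a + b) powr r" using ab by simp
  finally show ?thesis using v vi ab False \<beta> by (subst lp_norm_le_iff) (auto simp: r_def)
qed

lemma ennreal_le_of_greater:
  assumes "\<And>c'. c < c' \<Longrightarrow> X \<le> ennreal c'"
  shows "X \<le> ennreal c"
proof (cases "0 \<le> c")
  case True
  show ?thesis
  proof (rule ennreal_le_epsilon)
    fix e :: real assume "0 < e"
    then show "X \<le> ennreal c + ennreal e"
      using assms[of "c + e"] True by (simp add: ennreal_plus)
  qed
next
  case False
  then show ?thesis using assms[of 0] by (simp add: ennreal_neg)
qed

lemma lp_norm_triangle_dominated:
  fixes v :: "real \<Rightarrow> 'e::euclidean_space" and h :: "real \<Rightarrow> 'f::euclidean_space" and k :: "real \<Rightarrow> 'g::euclidean_space"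
  assumes "1 \<le> \<beta>" "v \<in> borel_measurable (lebesgue_on {0..T})"
    and h: "lp_norm T \<beta> h \<le> ennreal a" and k: "lp_norm T \<beta> k \<le> ennreal b"
    and ab: "0 \<le> a" "0 \<le> b"
    and "\<And>t. t \<in> {0..T} \<Longrightarrow> norm (v t) \<le> norm (h t) + norm (k t)"
  shows "lp_norm T \<beta> v \<le> ennreal (a + b)"
proof (rule ennreal_le_of_greater)
  fix c assume c: "a + b < c"
  define e where "e = (c - (a + b)) / 2"
  have e: "0 < e" "c = (a + e) + (b + e)" using c by (auto simp: e_def field_simps)
  have "ennreal a \<le> ennreal (a + e)" "ennreal b \<le> ennreal (b + e)" using e ab by (auto intro: ennreal_leI)
  then show "lp_norm T \<beta> v \<le> ennreal c"
    unfolding e(2) using assms e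
    by (intro lp_norm_triangle_dominated_pos[of \<beta> v T h _ k]) (auto intro: order_trans)
qed

lemma lp_norm_scaled:
  fixes h :: "real \<Rightarrow> 'f::euclidean_space"
  assumes \<beta>: "1 \<le> \<beta>" and h: "lp_norm T \<beta> h \<le> ennreal a" and ac: "0 \<le> a" "0 \<le> c"
  shows "lp_norm T \<beta> (\<lambda>t. c * norm (h t)) \<le> ennreal (c * a)"
proof (cases "\<beta> = \<infinity>")
  case True
  have "AE t in lebesgue_on {0..T}. norm (h t) \<le> a" and m[measurable]: "h \<in> borel_measurable (lebesgue_on {0..T})"
    using h ac by (auto simp: True lp_norm_infinity_le_iff)
  then have "AE t in lebesgue_on {0..T}. norm (c * norm (h t)) \<le> c * a"
    by (elim AE_mp) (use ac in \<open>auto intro!: AE_I2 simp: abs_mult mult_left_mono\<close>)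
  then show ?thesis using ac by (simp add: True lp_norm_infinity_le_iff)
next
  case False
  define r where "r = enn2real \<beta>"
  have r: "1 \<le> r" unfolding r_def using False \<beta> by (rule one_le_enn2real)
  have hk: "(\<lambda>t. norm (h t) powr r) integrable_on {0..T}" "integral {0..T} (\<lambda>t. norm (h t) powr r) \<le> a powr r"
    and m[measurable]: "h \<in> borel_measurable (lebesgue_on {0..T})"
    using h ac False \<beta> by (auto simp: lp_norm_le_iff r_def)
  have eq: "(\<lambda>t. norm (c * norm (h t)) powr r) = (\<lambda>t. c powr r * norm (h t) powr r)"
    using ac by (simp add: abs_mult powr_mult)
  have "(\<lambda>t. c powr r * norm (h t) powr r) integrable_on {0..T}"
    by (rule integrable_on_mult_right[OF hk(1)])
  then show ?thesis using False \<beta> ac hk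
    by (simp add: lp_norm_le_iff r_def[symmetric] eq)
      (simp add: powr_mult mult_left_mono)
qed

lemma enn2real_inverse:
  assumes "\<beta> \<noteq> \<infinity>" "1 \<le> \<beta>"
  shows "enn2real (1 / \<beta>) = 1 / enn2real \<beta>"
proof -
  have "\<beta> = ennreal (enn2real \<beta>)" using assms by (simp add: top.not_eq_extremum)
  moreover have "1 \<le> enn2real \<beta>" using assms by (rule one_le_enn2real)
  ultimately have "1 / \<beta> = ennreal (1 / enn2real \<beta>)"
    by (metis divide_ennreal ennreal_1 less_le_trans zero_le_one zero_less_one)
  then show ?thesis by simp
qed

lemma lp_norm_const:
  assumes \<beta>: "1 \<le> \<beta>" and c: "0 \<le> c" and T: "0 < T"
  shows "lp_norm T \<beta> (\<lambda>t. c) \<le> ennreal (c * T powr enn2real (1 / \<beta>))"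
proof (cases "\<beta> = \<infinity>")
  case True
  then show ?thesis using c T by (simp add: lp_norm_infinity_le_iff)
next
  case False
  have r: "1 \<le> enn2real \<beta>" using False \<beta> by (rule one_le_enn2real)
  show ?thesis using False \<beta> c r T
    by (simp add: lp_norm_le_iff enn2real_inverse powr_mult powr_powr integrable_on_const)
qed

text \<open>Every L^\<beta> estimate ends here: a pointwise affine bound is turned into a norm
  bound, in which a constant contributes its value times T^{1/\<beta>}. This power enters C_3 and
  C_4.\<close>

lemma lp_norm_affine_bound:
  fixes v :: "real \<Rightarrow> 'e::euclidean_space" and h :: "real \<Rightarrow> 'f::euclidean_space" and k :: "real \<Rightarrow> 'g::euclidean_space"
  assumes \<beta>: "1 \<le> \<beta>" and T: "0 < T" and v: "v \<in> borel_measurable (lebesgue_on {0..T})"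
    and h: "lp_norm T \<beta> h \<le> ennreal a" and k: "lp_norm T \<beta> k \<le> ennreal b"
    and ab: "0 \<le> a" "0 \<le> b" "0 \<le> c0" "0 \<le> c1" "0 \<le> c2"
    and le: "\<And>t. t \<in> {0..T} \<Longrightarrow> norm (v t) \<le> c0 + c1 * norm (h t) + c2 * norm (k t)"
  shows "lp_norm T \<beta> v \<le> ennreal (c0 * T powr enn2real (1 / \<beta>) + c1 * a + c2 * b)"
proof -
  have [measurable]: "h \<in> borel_measurable (lebesgue_on {0..T})" "k \<in> borel_measurable (lebesgue_on {0..T})"
    using h k by (auto intro: lp_norm_le_measurable)
  have "lp_norm T \<beta> (\<lambda>t. c0 + c1 * norm (h t)) \<le> ennreal (c0 * T powr enn2real (1 / \<beta>) + c1 * a)"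
    by (rule lp_norm_triangle_dominated[OF \<beta> _ lp_norm_const[OF \<beta>] lp_norm_scaled[OF \<beta> h]]) (use ab T in auto)
  from lp_norm_triangle_dominated[OF \<beta> v this lp_norm_scaled[OF \<beta> k]]
  show ?thesis using ab le by (simp add: abs_mult)
qed

section \<open>Hoelder's inequality and embeddings on a bounded interval\<close>

text \<open>Hoelder's inequality against the constant 1, obtained by integrating Young's inequality
  pointwise; the same majorant gives integrability.\<close>

lemma integrable_of_powr_mean_pos:
  fixes v :: "real \<Rightarrow> 'e::euclidean_space"
  assumes \<beta>: "\<beta> \<noteq> \<infinity>" "1 \<le> \<beta>" and T: "0 < T" and v: "lp_norm T \<beta> v \<le> ennreal a" and a: "0 < a"
  shows "v absolutely_integrable_on {0..T} \<and> integral {0..T} (\<lambda>t. norm (v t)) \<le> a * T powr (1 - enn2real (1 / \<beta>))"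
proof -
  define r where "r = enn2real \<beta>"
  have r: "1 \<le> r" unfolding r_def using \<beta> by (rule one_le_enn2real)
  have vi: "(\<lambda>t. norm (v t) powr r) integrable_on {0..T}" "integral {0..T} (\<lambda>t. norm (v t) powr r) \<le> a powr r"
    and m: "v \<in> borel_measurable (lebesgue_on {0..T})"
    using v a \<beta> by (auto simp: lp_norm_le_iff r_def)
  \<comment> \<open>The constant function \<sigma> has L^\<beta> norm a on [0,T] and is thus the
    extremal case of Hoelder's inequality; with this scale the two Young terms add up to \<sigma>
    T.\<close>
  define \<sigma> where "\<sigma> = a * T powr (- (1 / r))"
  have \<sigma>: "0 < \<sigma>" using a T by (simp add: \<sigma>_def)
  define R where "R t = \<sigma> * ((1 - 1 / r) + 1 / (r * \<sigma> powr r) * norm (v t) powr r)" for t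
  have vR: "norm (v t) \<le> R t" for t
  proof -
    have "norm (v t) / \<sigma> \<le> (1 - 1 / r) + (norm (v t) / \<sigma>) powr r / r"
      using \<sigma> r by (intro le_powr_mean) auto
    then have "norm (v t) \<le> \<sigma> * ((1 - 1 / r) + (norm (v t) / \<sigma>) powr r / r)"
      using \<sigma> by (simp add: pos_divide_le_eq mult.commute)
    also have "\<dots> = R t" using \<sigma> by (simp add: R_def powr_divide)
    finally show ?thesis .
  qed
  have Ri: "R integrable_on {0..T}"
    unfolding R_def by (intro integrable_on_mult_right integrable_add vi integrable_on_const) auto
  have abs: "v absolutely_integrable_on {0..T}"
    by (rule measurable_bounded_by_integrable_imp_absolutely_integrable[OF m _ Ri]) (use vR in auto)
  have "integral {0..T} (\<lambda>t. norm (v t)) \<le> integral {0..T} R"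
    using abs Ri vR by (intro integral_le) (auto simp: absolutely_integrable_on_def)
  also have "\<dots> = \<sigma> * ((1 - 1 / r) * T + 1 / (r * \<sigma> powr r) * integral {0..T} (\<lambda>t. norm (v t) powr r))"
    unfolding R_def using T
    by (simp only: integral_mult_right integral_add[OF integrable_on_const integrable_on_mult_right[OF vi(1)]] lmeasurable_interval) simp
  also have "\<dots> \<le> \<sigma> * ((1 - 1 / r) * T + 1 / (r * \<sigma> powr r) * a powr r)"
    using \<sigma> r vi by (intro mult_left_mono add_mono) auto
  also have "1 / (r * \<sigma> powr r) * a powr r = T / r"
  proof -
    have "\<sigma> powr r = a powr r * T powr (- 1)" using r by (simp add: \<sigma>_def powr_mult powr_powr)
    then have "a powr r = T * \<sigma> powr r" using T by (simp add: powr_minus)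
    then show ?thesis using \<sigma> by simp
  qed
  also have "\<sigma> * ((1 - 1 / r) * T + T / r) = \<sigma> * T" by (simp add: algebra_simps)
  also have "\<dots> = a * T powr (1 - enn2real (1 / \<beta>))"
    using T \<beta> by (simp add: \<sigma>_def enn2real_inverse r_def powr_diff powr_minus field_simps)
  finally show ?thesis using abs by blast
qed

text \<open>The preceding argument for the square, with Young's exponent r/2, which is admissible
  because \<beta> is at least 2.\<close>

lemma square_integrable_of_powr_mean_pos:
  fixes v :: "real \<Rightarrow> 'e::euclidean_space"
  assumes \<beta>: "\<beta> \<noteq> \<infinity>" "2 \<le> \<beta>" and T: "0 < T" and v: "lp_norm T \<beta> v \<le> ennreal a" and a: "0 < a"
  shows "(\<lambda>t. (norm (v t))\<^sup>2) integrable_on {0..T} \<and>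
    integral {0..T} (\<lambda>t. (norm (v t))\<^sup>2) \<le> a\<^sup>2 * T powr (1 - 2 * enn2real (1 / \<beta>))"
proof -
  define r where "r = enn2real \<beta>"
  have \<beta>1: "1 \<le> \<beta>" using \<beta>(2) by (rule order_trans[rotated]) simp
  have r: "2 \<le> r"
  proof -
    have "ennreal 2 \<le> ennreal r" using \<beta> by (simp add: r_def top.not_eq_extremum)
    then show ?thesis by (metis ennreal_le_iff2 not_numeral_le_zero)
  qed
  have vi: "(\<lambda>t. norm (v t) powr r) integrable_on {0..T}" "integral {0..T} (\<lambda>t. norm (v t) powr r) \<le> a powr r"
    and m[measurable]: "v \<in> borel_measurable (lebesgue_on {0..T})"
    using v a \<beta>(1) \<beta>1 by (auto simp: lp_norm_le_iff r_def)
  define \<sigma> where "\<sigma> = a * T powr (- (1 / r))"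
  have \<sigma>: "0 < \<sigma>" using a T by (simp add: \<sigma>_def)
  define R where "R t = \<sigma>\<^sup>2 * ((1 - 2 / r) + 2 / (r * \<sigma> powr r) * norm (v t) powr r)" for t
  have vR: "(norm (v t))\<^sup>2 \<le> R t" for t
  proof -
    have "(norm (v t) / \<sigma>)\<^sup>2 \<le> (1 - 1 / (r / 2)) + ((norm (v t) / \<sigma>)\<^sup>2) powr (r / 2) / (r / 2)"
      using r by (intro le_powr_mean) auto
    also have "((norm (v t) / \<sigma>)\<^sup>2) powr (r / 2) = norm (v t) powr r / \<sigma> powr r"
      using \<sigma> by (cases "norm (v t) = 0") (auto simp: powr_powr powr_divide simp flip: powr_numeral)
    finally have "(norm (v t))\<^sup>2 \<le> \<sigma>\<^sup>2 * ((1 - 1 / (r / 2)) + norm (v t) powr r / \<sigma> powr r / (r / 2))"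
      using \<sigma> by (simp add: power_divide pos_divide_le_eq mult.commute)
    then show ?thesis by (simp add: R_def mult.commute)
  qed
  have Ri: "R integrable_on {0..T}"
    unfolding R_def by (intro integrable_on_mult_right integrable_add vi integrable_on_const) auto
  have m2: "(\<lambda>t. (norm (v t))\<^sup>2) \<in> borel_measurable (lebesgue_on {0..T})" by measurable
  have i: "(\<lambda>t. (norm (v t))\<^sup>2) integrable_on {0..T}"
    by (rule measurable_bounded_by_integrable_imp_integrable[OF m2 Ri]) (use vR in auto)
  have "integral {0..T} (\<lambda>t. (norm (v t))\<^sup>2) \<le> integral {0..T} R"
    by (rule integral_le[OF i Ri]) (rule vR)
  also have "\<dots> = \<sigma>\<^sup>2 * ((1 - 2 / r) * T + 2 / (r * \<sigma> powr r) * integral {0..T} (\<lambda>t. norm (v t) powr r))"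
    unfolding R_def using T
    by (simp only: integral_mult_right integral_add[OF integrable_on_const integrable_on_mult_right[OF vi(1)]] lmeasurable_interval) simp
  also have "\<dots> \<le> \<sigma>\<^sup>2 * ((1 - 2 / r) * T + 2 / (r * \<sigma> powr r) * a powr r)"
    using \<sigma> r vi by (intro mult_left_mono add_mono) auto
  also have "2 / (r * \<sigma> powr r) * a powr r = 2 * T / r"
  proof -
    have "\<sigma> powr r = a powr r * T powr (- 1)" using r by (simp add: \<sigma>_def powr_mult powr_powr)
    then have "a powr r = T * \<sigma> powr r" using T by (simp add: powr_minus)
    then show ?thesis using \<sigma> by simp
  qed
  also have "\<sigma>\<^sup>2 * ((1 - 2 / r) * T + 2 * T / r) = \<sigma>\<^sup>2 * T" by (simp add: algebra_simps)
  also have "\<dots> = a\<^sup>2 * (T powr (- (1 / r)) * T powr (- (1 / r)) * T powr 1)"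
    using T by (simp add: \<sigma>_def power2_eq_square)
  also have "T powr (- (1 / r)) * T powr (- (1 / r)) * T powr 1 = T powr (1 - 2 * enn2real (1 / \<beta>))"
    unfolding powr_add[symmetric] using \<beta>(1) \<beta>1 by (simp add: enn2real_inverse r_def)
  finally show ?thesis using i by blast
qed

lemma lp_norm_two_le_iff:
  fixes v :: "real \<Rightarrow> 'e::euclidean_space"
  assumes "0 \<le> c"
  shows "lp_norm T 2 v \<le> ennreal c \<longleftrightarrow> v \<in> borel_measurable (lebesgue_on {0..T}) \<and>
    (\<lambda>t. (norm (v t))\<^sup>2) integrable_on {0..T} \<and> integral {0..T} (\<lambda>t. (norm (v t))\<^sup>2) \<le> c\<^sup>2"
proof -
  have e: "enn2real 2 = 2" using enn2real_numeral[of "num.Bit0 num.One"] by simp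
  have p: "x powr 2 = x\<^sup>2" if "0 \<le> x" for x :: real using that by (cases "x = 0") (auto simp: powr_numeral)
  show ?thesis using lp_norm_le_iff[of 2 c T v] assms by (simp add: e p)
qed

lemma lp_norm_two_of_infinity:
  fixes v :: "real \<Rightarrow> 'e::euclidean_space"
  assumes T: "0 < T" and v: "lp_norm T top v \<le> ennreal a" and a: "0 \<le> a"
  shows "lp_norm T 2 v \<le> ennreal (a * sqrt T)"
proof -
  have m[measurable]: "v \<in> borel_measurable (lebesgue_on {0..T})" and ae: "AE t in lebesgue_on {0..T}. norm (v t) \<le> a"
    using v a by (auto simp: lp_norm_infinity_le_iff)
  have "(\<integral>\<^sup>+t. ennreal ((norm (v t))\<^sup>2) \<partial>lebesgue_on {0..T}) \<le> (\<integral>\<^sup>+t. ennreal (a\<^sup>2) \<partial>lebesgue_on {0..T})"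
    by (rule nn_integral_mono_AE, use ae in eventually_elim) (auto intro!: ennreal_leI power_mono)
  also have "\<dots> = ennreal (a\<^sup>2 * T)"
    using T by (simp add: emeasure_restrict_space ennreal_mult)
  finally have "(\<lambda>t. (norm (v t))\<^sup>2) integrable_on {0..T} \<and> integral {0..T} (\<lambda>t. (norm (v t))\<^sup>2) \<le> a\<^sup>2 * T"
    using T by (subst (asm) nn_integral_lebesgue_on_le_iff) auto
  then show ?thesis using a T by (subst lp_norm_two_le_iff) (auto simp: power_mult_distrib)
qed

lemma square_integral_of_lp_norm:
  fixes v :: "real \<Rightarrow> 'e::euclidean_space"
  assumes \<beta>: "2 \<le> \<beta>" and T: "0 < T" and v: "lp_norm T \<beta> v \<le> ennreal a" and a: "0 < a"
  shows "(\<lambda>t. (norm (v t))\<^sup>2) integrable_on {0..T} \<and>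
    integral {0..T} (\<lambda>t. (norm (v t))\<^sup>2) \<le> a\<^sup>2 * T powr (1 - 2 * enn2real (1 / \<beta>))"
proof (cases "\<beta> = \<infinity>")
  case True
  then show ?thesis
    using lp_norm_two_of_infinity[OF T, of v a] v a T by (simp add: lp_norm_two_le_iff power_mult_distrib)
next
  case False
  then show ?thesis using square_integrable_of_powr_mean_pos assms by blast
qed

lemma lp_norm_one_le:
  fixes v :: "real \<Rightarrow> 'e::euclidean_space"
  assumes \<beta>: "2 \<le> \<beta>" and T: "0 < T" and v: "lp_norm T \<beta> v \<le> ennreal a" and a: "0 \<le> a"
  shows "v absolutely_integrable_on {0..T}" (is ?A)
    and "integral {0..T} (\<lambda>t. norm (v t)) \<le> a * T powr (1 - enn2real (1 / \<beta>))" (is "?I \<le> _")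
proof -
  have \<beta>1: "1 \<le> \<beta>" using \<beta> by (rule order_trans[rotated]) simp
  have *: "?A \<and> ?I \<le> a' * T powr (1 - enn2real (1 / \<beta>))" if "a < a'" for a'
  proof -
    have v': "lp_norm T \<beta> v \<le> ennreal a'" "0 < a'"
      using v a that by (auto intro: order_trans ennreal_leI)
    show ?thesis
    proof (cases "\<beta> = \<infinity>")
      \<comment> \<open>The bounded case goes through L^2: one factor sqrt T arises on the way into
        L^2 and another on the way into L^1, which gives a' T in accordance with 1/\<beta> =
        0.\<close>
      case True
      have v2: "lp_norm T 2 v \<le> ennreal (a' * sqrt T)"
        using lp_norm_two_of_infinity[OF T, of v a'] v' by (simp add: True)
      have e: "enn2real (1 / 2) = 1 / 2"
        using enn2real_inverse[of 2] enn2real_numeral[of "num.Bit0 num.One"] by simp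
      have "?A \<and> ?I \<le> (a' * sqrt T) * T powr (1 - enn2real (1 / 2))"
        using v2 v'(2) T by (intro integrable_of_powr_mean_pos) auto
      also have "(a' * sqrt T) * T powr (1 - enn2real (1 / 2)) = a' * T"
        using T by (simp add: e powr_half_sqrt)
      finally show ?thesis using T by (simp add: True)
    next
      case False
      then show ?thesis using integrable_of_powr_mean_pos[OF False \<beta>1 T v'] by simp
    qed
  qed
  show ?A using *[of "a + 1"] by simp
  show "?I \<le> a * T powr (1 - enn2real (1 / \<beta>))"
    by (rule le_mult_of_greater) (use * in auto)
qed

text \<open>Cauchy-Schwarz after embedding both factors in L^2, each embedding costing T to the
  power 1/2 - 1/\<beta>.\<close>

lemma holder_product_bound:
  fixes v :: "real \<Rightarrow> 'e::euclidean_space" and h :: "real \<Rightarrow> 'f::euclidean_space"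
  assumes \<beta>: "2 \<le> \<beta>" and T: "0 < T" and v: "lp_norm T \<beta> v \<le> ennreal a" and h: "lp_norm T \<beta> h \<le> ennreal b"
    and ab: "0 \<le> a" "0 \<le> b"
  shows "(\<lambda>t. norm (h t) * norm (v t)) integrable_on {0..T}" (is ?A)
    and "integral {0..T} (\<lambda>t. norm (h t) * norm (v t)) \<le> b * a * T powr (1 - 2 * enn2real (1 / \<beta>))" (is "?I \<le> _")
proof -
  define K where "K = T powr (1 - 2 * enn2real (1 / \<beta>))"
  have *: "?A \<and> ?I \<le> b' * (a' * K)" if ab': "a < a'" "b < b'" for a' b'
  proof -
    have v': "lp_norm T \<beta> v \<le> ennreal a'" "0 < a'" and h': "lp_norm T \<beta> h \<le> ennreal b'" "0 < b'"
      using v h ab ab' by (auto intro: order_trans ennreal_leI)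
    note sv = square_integral_of_lp_norm[OF \<beta> T v'] and sh = square_integral_of_lp_norm[OF \<beta> T h']
    have m[measurable]: "v \<in> borel_measurable (lebesgue_on {0..T})" "h \<in> borel_measurable (lebesgue_on {0..T})"
      using v h by (auto intro: lp_norm_le_measurable)
    define R where "R t = b' / (2 * a') * (norm (v t))\<^sup>2 + a' / (2 * b') * (norm (h t))\<^sup>2" for t
    have Ri: "R integrable_on {0..T}"
      unfolding R_def using sv sh by (intro integrable_add integrable_on_mult_right) auto
    have le: "norm (h t) * norm (v t) \<le> R t" for t
    proof -
      \<comment> \<open>After division by the bounds the elementary inequality 2 p q \<le> p^2 + q^2
        is balanced, so that its integral reproduces the product of the bounds.\<close>
      define p q where "p = norm (v t) / a'" and "q = norm (h t) / b'"
      have e: "norm (v t) = a' * p" "norm (h t) = b' * q" using v' h' by (auto simp: p_def q_def)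
      have "b' * q * (a' * p) = a' * b' * (q * p)" by simp
      also have "q * p \<le> (q\<^sup>2 + p\<^sup>2) / 2" using sum_squares_bound[of q p] by simp
      then have "a' * b' * (q * p) \<le> a' * b' * ((q\<^sup>2 + p\<^sup>2) / 2)" using v' h' by (intro mult_left_mono) auto
      also have "\<dots> = R t" unfolding R_def e using v' h' by (simp add: power2_eq_square field_simps)
      finally show ?thesis by (simp add: e)
    qed
    have m2: "(\<lambda>t. norm (h t) * norm (v t)) \<in> borel_measurable (lebesgue_on {0..T})" by measurable
    have i: ?A
      by (rule measurable_bounded_by_integrable_imp_integrable[OF m2 Ri]) (use le in auto)
    have "?I \<le> integral {0..T} R" by (rule integral_le[OF i Ri]) (rule le)
    also have "\<dots> = b' / (2 * a') * integral {0..T} (\<lambda>t. (norm (v t))\<^sup>2) + a' / (2 * b') * integral {0..T} (\<lambda>t. (norm (h t))\<^sup>2)"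
      unfolding R_def using sv sh
      by (simp only: integral_mult_right integral_add[OF integrable_on_mult_right integrable_on_mult_right])
    also have "\<dots> \<le> b' / (2 * a') * (a'\<^sup>2 * K) + a' / (2 * b') * (b'\<^sup>2 * K)"
      using sv sh v' h' by (intro add_mono mult_left_mono) (auto simp: K_def)
    also have "\<dots> = b' * (a' * K)" using v' h' by (simp add: power2_eq_square field_simps)
    finally show ?thesis using i by blast
  qed
  show ?A using *[of "a + 1" "b + 1"] by simp
  have K0: "0 \<le> K" by (simp add: K_def)
  have "?I \<le> b * (a' * K)" if a': "a < a'" for a'
    by (rule le_mult_of_greater) (use * a' ab K0 in auto)
  then have "?I \<le> a' * (b * K)" if "a < a'" for a'
    unfolding mult.left_commute[of a' b K] using that by blast
  then have "?I \<le> a * (b * K)" by (rule le_mult_of_greater[rotated]) (use ab K0 in auto)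
  then show "?I \<le> b * a * T powr (1 - 2 * enn2real (1 / \<beta>))" by (simp add: K_def ac_simps)
qed

lemma lp_space_subset_two:
  fixes v :: "real \<Rightarrow> 'e::euclidean_space"
  assumes \<beta>: "2 \<le> \<beta>" and T: "0 < T" and v: "v \<in> lp_space T \<beta>"
  shows "v \<in> lp_space T 2"
proof -
  obtain c where c: "0 \<le> c" "lp_norm T \<beta> v = ennreal c" using v by (auto simp: lp_space_iff)
  then have v': "lp_norm T \<beta> v \<le> ennreal (c + 1)" "0 < c + 1" by (auto intro: ennreal_leI)
  from square_integral_of_lp_norm[OF \<beta> T this] lp_norm_le_measurable[OF v'(1)]
  have "lp_norm T 2 v \<le> ennreal (sqrt ((c + 1)\<^sup>2 * T powr (1 - 2 * enn2real (1 / \<beta>))))"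
    by (subst lp_norm_two_le_iff) auto
  then show ?thesis by (auto simp: lp_space_def intro: le_less_trans)
qed

lemma lp_space_two_iff:
  fixes v :: "real \<Rightarrow> 'e::euclidean_space"
  shows "v \<in> lp_space T 2 \<longleftrightarrow> v \<in> borel_measurable (lebesgue_on {0..T}) \<and> (\<lambda>t. (norm (v t))\<^sup>2) integrable_on {0..T}"
proof
  assume "v \<in> lp_space T 2"
  then obtain c where "0 \<le> c" "lp_norm T 2 v = ennreal c" by (auto simp: lp_space_iff)
  then show "v \<in> borel_measurable (lebesgue_on {0..T}) \<and> (\<lambda>t. (norm (v t))\<^sup>2) integrable_on {0..T}"
    using lp_norm_two_le_iff[of c T v] by simp
next
  assume a: "v \<in> borel_measurable (lebesgue_on {0..T}) \<and> (\<lambda>t. (norm (v t))\<^sup>2) integrable_on {0..T}"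
  then have "0 \<le> integral {0..T} (\<lambda>t. (norm (v t))\<^sup>2)" by (intro integral_nonneg) auto
  then have "lp_norm T 2 v \<le> ennreal (sqrt (integral {0..T} (\<lambda>t. (norm (v t))\<^sup>2)))"
    using a by (subst lp_norm_two_le_iff) auto
  then show "v \<in> lp_space T 2" by (auto simp: lp_space_def intro: le_less_trans)
qed

text \<open>Turns the extended real \<parallel>u\<parallel>_1 of the theorem into the real integral
  used in all estimates.\<close>

lemma lp_norm_one_eq:
  fixes v :: "real \<Rightarrow> 'e::euclidean_space"
  assumes "v absolutely_integrable_on {0..T}"
  shows "lp_norm T 1 v = ennreal (integral {0..T} (\<lambda>t. norm (v t)))"
proof -
  have m: "v \<in> borel_measurable (lebesgue_on {0..T})" and i: "(\<lambda>t. norm (v t)) integrable_on {0..T}"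
    using assms by (auto intro: absolutely_integrable_imp_borel_measurable simp: absolutely_integrable_on_def)
  define J where "J = integral {0..T} (\<lambda>t. norm (v t))"
  have J0: "0 \<le> J" unfolding J_def by (rule integral_nonneg[OF i]) simp
  have le: "lp_norm T 1 v \<le> ennreal c \<longleftrightarrow> J \<le> c" if "0 \<le> c" for c
    using lp_norm_le_iff[of 1 c T v] that m i by (simp add: J_def)
  have "lp_norm T 1 v \<le> ennreal J" using le[OF J0] by simp
  moreover obtain c where c: "lp_norm T 1 v = ennreal c" "0 \<le> c"
    using calculation by (cases "lp_norm T 1 v") (auto simp: top_unique)
  then have "J \<le> c" using le[of c] by simp
  ultimately show ?thesis using c J0 by (simp add: J_def ennreal_le_iff)
qed

section \<open>Functions with a Lipschitz second derivative\<close>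

text \<open>The explicit finite sum makes measurability of gradients in t immediate, and since the
  basis may be that of a product space, gradients in (x,u) are obtained without coordinates.\<close>

definition riesz :: "('z::euclidean_space \<Rightarrow> real) \<Rightarrow> 'z" where
  "riesz l = (\<Sum>k\<in>Basis. l k *\<^sub>R k)"

lemma riesz_inner: "linear l \<Longrightarrow> riesz l \<bullet> k = l k"
proof -
  assume l: "linear l"
  have "l k = l (\<Sum>i\<in>Basis. (k \<bullet> i) *\<^sub>R i)" by (simp add: euclidean_representation)
  also have "\<dots> = (\<Sum>i\<in>Basis. (k \<bullet> i) * l i)" using l by (simp add: linear_sum linear_scale)
  finally show ?thesis
    by (simp add: riesz_def inner_sum_left mult.commute inner_commute[of k])
qed

text \<open>Gradients are introduced by duality, and so are their bounds: testing with w itself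
  recovers the norm.\<close>

lemma norm_le_of_inner:
  fixes w :: "'z::euclidean_space"
  assumes "\<And>k. \<bar>w \<bullet> k\<bar> \<le> K * norm k"
  shows "norm w \<le> K"
proof (cases "w = 0")
  case True
  obtain k :: 'z where "k \<in> Basis" by (metis SOME_Basis)
  then show ?thesis using assms[of k] True by simp
next
  case False
  have "norm w * norm w \<le> K * norm w" using assms[of w] by (simp add: dot_square_norm power2_eq_square)
  then show ?thesis using False by simp
qed

lemma eq_of_inner:
  fixes v w :: "'z::euclidean_space"
  assumes "\<And>k. v \<bullet> k = w \<bullet> k" shows "v = w"
  using assms by (rule vector_eq_rdot[THEN iffD1, rule_format])

lemma abs_inner_le:
  fixes v q :: "'z::real_inner"
  assumes "norm v \<le> K * norm k"
  shows "\<bar>v \<bullet> q\<bar> \<le> K * norm q * norm k"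
proof -
  have "\<bar>v \<bullet> q\<bar> \<le> norm v * norm q" by (rule Cauchy_Schwarz_ineq2)
  also have "\<dots> \<le> K * norm k * norm q" by (intro mult_right_mono assms) auto
  finally show ?thesis by (simp add: ac_simps)
qed

lemma norm_diff_le_fst_snd:
  fixes z z' :: "'a::real_normed_vector \<times> 'b::real_normed_vector"
  shows "norm (z - z') \<le> norm (fst z - fst z') + norm (snd z - snd z')"
proof -
  have "z - z' = (fst z - fst z', snd z - snd z')" by (simp add: prod_eq_iff)
  then show ?thesis by (simp add: norm_Pair_le)
qed

lemma norm_fst_le_norm:
  fixes w :: "'a::real_normed_vector \<times> 'b::real_normed_vector"
  shows "norm (fst w) \<le> norm w"
  using norm_fst_le[of "fst w" "snd w"] by simp

lemma norm_snd_le_norm: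
  fixes w :: "'a::real_normed_vector \<times> 'b::real_normed_vector"
  shows "norm (snd w) \<le> norm w"
  using norm_snd_le[of "snd w" "fst w"] by simp

lemma norm_pair_zero [simp]:
  fixes a :: "'a::real_normed_vector" and c :: "'b::real_normed_vector"
  shows "norm (a, 0 :: 'b) = norm a" "norm (0 :: 'a, c) = norm c"
  by (simp_all add: norm_Pair)

text \<open>Expanding \<open>h t\<close> in the basis turns a measurable family of linear maps into
  a finite sum of measurable products.\<close>

lemma measurable_linear_argument:
  fixes l :: "real \<Rightarrow> 'z::euclidean_space \<Rightarrow> 'b::euclidean_space"
  assumes "\<And>i. i \<in> Basis \<Longrightarrow> (\<lambda>t. l t i) \<in> borel_measurable (lebesgue_on S)"
    and "\<And>t. t \<in> S \<Longrightarrow> linear (l t)" and "h \<in> borel_measurable (lebesgue_on S)"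
  shows "(\<lambda>t. l t (h t)) \<in> borel_measurable (lebesgue_on S)"
proof -
  have "(\<lambda>t. \<Sum>i\<in>Basis. (h t \<bullet> i) *\<^sub>R l t i) \<in> borel_measurable (lebesgue_on S)"
    using assms(1,3) by (intro borel_measurable_sum borel_measurable_scaleR borel_measurable_inner) auto
  moreover have "(\<Sum>i\<in>Basis. (h t \<bullet> i) *\<^sub>R l t i) = l t (h t)" if "t \<in> S" for t
  proof -
    have "l t (h t) = l t (\<Sum>i\<in>Basis. (h t \<bullet> i) *\<^sub>R i)" by (simp add: euclidean_representation)
    then show ?thesis using assms(2)[OF that] by (simp add: linear_sum linear_scale)
  qed
  ultimately show ?thesis
    by (subst measurable_cong[where g = "\<lambda>t. \<Sum>i\<in>Basis. (h t \<bullet> i) *\<^sub>R l t i"]) (auto simp: space_restrict_space)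
qed

text \<open>Mean value inequality along a segment. Only the derivative in the direction d is
  bounded, which matches estimates of \<open>D2\<close> in one fixed pair of directions.\<close>

lemma norm_increment_le:
  fixes \<phi> :: "'z::real_normed_vector \<Rightarrow> 'b::real_normed_vector"
  assumes der: "\<And>s. s \<in> {0..1} \<Longrightarrow> (\<phi> has_derivative D (z + s *\<^sub>R d)) (at (z + s *\<^sub>R d))"
    and bd: "\<And>s. s \<in> {0..1} \<Longrightarrow> norm (D (z + s *\<^sub>R d) d) \<le> M"
  shows "norm (\<phi> (z + d) - \<phi> z) \<le> M"
proof -
  have "norm ((\<lambda>s. \<phi> (z + s *\<^sub>R d)) 1 - (\<lambda>s. \<phi> (z + s *\<^sub>R d)) 0) \<le> M * norm (1 - 0 :: real)"
  proof (rule differentiable_bound[where S = "{0..1}" and f' = "\<lambda>s h. h *\<^sub>R D (z + s *\<^sub>R d) d"])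
    fix s :: real assume s: "s \<in> {0..1}"
    have "((\<lambda>s. z + s *\<^sub>R d) has_derivative (\<lambda>h. h *\<^sub>R d)) (at s within {0..1})"
      by (auto intro!: derivative_eq_intros)
    from has_derivative_compose[OF this der[OF s]]
    have "((\<lambda>s. \<phi> (z + s *\<^sub>R d)) has_derivative (\<lambda>h. D (z + s *\<^sub>R d) (h *\<^sub>R d))) (at s within {0..1})" .
    moreover have "D (z + s *\<^sub>R d) (h *\<^sub>R d) = h *\<^sub>R D (z + s *\<^sub>R d) d" for h
      using has_derivative_linear[OF der[OF s]] by (simp add: linear_scale)
    ultimately show "((\<lambda>s. \<phi> (z + s *\<^sub>R d)) has_derivative (\<lambda>h. h *\<^sub>R D (z + s *\<^sub>R d) d)) (at s within {0..1})"
      by simp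
    show "onorm (\<lambda>h. h *\<^sub>R D (z + s *\<^sub>R d) d) \<le> M"
      using bd[OF s] by (simp add: onorm_scaleR_left onorm_id)
  qed auto
  then show ?thesis by simp
qed

text \<open>In \<open>D2 z h k\<close> the vector \<open>h\<close> is the direction in which \<open>D1 \<cdot> k\<close> is differentiated.\<close>

locale second_derivative =
  fixes \<phi> :: "'z::euclidean_space \<Rightarrow> 'b::euclidean_space" and D1 :: "'z \<Rightarrow> 'z \<Rightarrow> 'b"
    and D2 :: "'z \<Rightarrow> 'z \<Rightarrow> 'z \<Rightarrow> 'b"
  assumes der: "\<And>z. (\<phi> has_derivative D1 z) (at z)"
    and der2: "\<And>z k. ((\<lambda>z. D1 z k) has_derivative (\<lambda>h. D2 z h k)) (at z)"
begin

lemma linear_D1: "linear (D1 z)"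
  using has_derivative_linear[OF der] .

lemma linear_D2_left: "linear (\<lambda>h. D2 z h k)"
  using has_derivative_linear[OF der2] .

text \<open>Linearity in k is inherited from \<open>D1\<close>, which is linear in k at every point:
  both sides are derivatives of the same map, and derivatives are unique.\<close>

lemma linear_D2_right: "linear (D2 z h)"
proof (rule linearI)
  fix k k' :: 'z and c :: real
  have "((\<lambda>z. D1 z (k + k')) has_derivative (\<lambda>h. D2 z h k + D2 z h k')) (at z)"
    using has_derivative_add[OF der2[of k z] der2[of k' z]] by (simp add: linear_add[OF linear_D1])
  from has_derivative_unique[OF this der2] show "D2 z h (k + k') = D2 z h k + D2 z h k'"
    by (rule fun_cong[symmetric])
  have "((\<lambda>z. D1 z (c *\<^sub>R k)) has_derivative (\<lambda>h. c *\<^sub>R D2 z h k)) (at z)"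
    using has_derivative_scaleR_right[OF der2[of k z], of c] by (simp add: linear_scale[OF linear_D1])
  from has_derivative_unique[OF this der2] show "D2 z h (c *\<^sub>R k) = c *\<^sub>R D2 z h k"
    by (rule fun_cong[symmetric])
qed

end

text \<open>K is kept apart from L because a Lipschitz bound in the sum of the component norms
  becomes 2 L in the product norm, as for b and f, while g keeps L.\<close>

locale second_order = second_derivative \<phi> D1 D2
  for \<phi> :: "'z::euclidean_space \<Rightarrow> 'b::euclidean_space" and D1 :: "'z \<Rightarrow> 'z \<Rightarrow> 'b"
    and D2 :: "'z \<Rightarrow> 'z \<Rightarrow> 'z \<Rightarrow> 'b" +
  fixes L K :: real
  assumes D2_bound: "\<And>z h k. norm (D2 z h k) \<le> L * norm h * norm k"
    and D2_lip: "\<And>z z' h k. norm (D2 z h k - D2 z' h k) \<le> K * norm (z - z') * norm h * norm k"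
    and K0: "0 \<le> K"
begin

lemma L_nonneg: "0 \<le> L"
proof -
  obtain k :: 'z where "k \<in> Basis" by (metis SOME_Basis)
  then show ?thesis using order_trans[OF norm_ge_zero D2_bound[of 0 k k]] by simp
qed

lemma D1_lip: "norm (D1 z' k - D1 z k) \<le> L * norm (z' - z) * norm k"
  using norm_increment_le[of "\<lambda>z. D1 z k" "\<lambda>z h. D2 z h k" z "z' - z", OF der2 D2_bound] by simp

text \<open>Mean value inequality for the difference of \<phi> and its linear part, whose derivative
  is small by the Lipschitz bound for \<open>D1\<close>. The factor 1/2 is given away: Taylor
  remainders serve differentiability only and enter none of the explicit constants.\<close>

lemma taylor1: "norm (\<phi> z' - \<phi> z - D1 z (z' - z)) \<le> L * (norm (z' - z))\<^sup>2"
proof -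
  have "norm ((\<lambda>w. \<phi> w - D1 z w) (z + (z' - z)) - (\<lambda>w. \<phi> w - D1 z w) z) \<le> L * (norm (z' - z))\<^sup>2"
  proof (rule norm_increment_le)
    fix s :: real assume s: "s \<in> {0..1}"
    have "bounded_linear (D1 z)" using der by (rule has_derivative_bounded_linear)
    then show "((\<lambda>w. \<phi> w - D1 z w) has_derivative (\<lambda>w h. D1 w h - D1 z h) (z + s *\<^sub>R (z' - z))) (at (z + s *\<^sub>R (z' - z)))"
      by (intro has_derivative_diff der bounded_linear_imp_has_derivative)
    have "norm (D1 (z + s *\<^sub>R (z' - z)) (z' - z) - D1 z (z' - z)) \<le> L * (\<bar>s\<bar> * norm (z' - z)) * norm (z' - z)"
      using D1_lip[of "z + s *\<^sub>R (z' - z)" "z' - z" z] by simp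
    also have "\<dots> \<le> L * (1 * norm (z' - z)) * norm (z' - z)"
      using s L_nonneg by (intro mult_right_mono mult_left_mono) auto
    finally show "norm (D1 (z + s *\<^sub>R (z' - z)) (z' - z) - D1 z (z' - z)) \<le> L * (norm (z' - z))\<^sup>2"
      by (simp add: power2_eq_square)
  qed
  then show ?thesis by (simp add: linear_diff[OF linear_D1] algebra_simps)
qed

lemma taylor2: "norm (D1 z' k - D1 z k - D2 z (z' - z) k) \<le> K * (norm (z' - z))\<^sup>2 * norm k"
proof -
  have "norm ((\<lambda>w. D1 w k - D2 z w k) (z + (z' - z)) - (\<lambda>w. D1 w k - D2 z w k) z) \<le> K * (norm (z' - z))\<^sup>2 * norm k"
  proof (rule norm_increment_le)
    fix s :: real assume s: "s \<in> {0..1}"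
    have "bounded_linear (\<lambda>h. D2 z h k)" using der2 by (rule has_derivative_bounded_linear)
    then show "((\<lambda>w. D1 w k - D2 z w k) has_derivative (\<lambda>w h. D2 w h k - D2 z h k) (z + s *\<^sub>R (z' - z))) (at (z + s *\<^sub>R (z' - z)))"
      by (intro has_derivative_diff der2 bounded_linear_imp_has_derivative)
    have "norm (D2 (z + s *\<^sub>R (z' - z)) (z' - z) k - D2 z (z' - z) k) \<le> K * (\<bar>s\<bar> * norm (z' - z)) * norm (z' - z) * norm k"
      using D2_lip[of "z + s *\<^sub>R (z' - z)" "z' - z" k z] by simp
    also have "\<dots> \<le> K * (1 * norm (z' - z)) * norm (z' - z) * norm k"
      using s K0 by (intro mult_right_mono mult_left_mono) auto
    finally show "norm (D2 (z + s *\<^sub>R (z' - z)) (z' - z) k - D2 z (z' - z) k) \<le> K * (norm (z' - z))\<^sup>2 * norm k"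
      by (simp add: power2_eq_square)
  qed
  then show ?thesis by (simp add: linear_diff[OF linear_D2_left] algebra_simps)
qed

lemma isCont_D1: "isCont (\<lambda>z. D1 z k) z"
  using der2 by (rule has_derivative_continuous)

lemma isCont_D2: "isCont (\<lambda>z. D2 z h k) z"
proof -
  have "((\<lambda>z'. D2 z' h k) \<longlongrightarrow> D2 z h k) (at z)"
  proof (rule Lim_null[THEN iffD2], rule Lim_null_comparison)
    show "\<forall>\<^sub>F z' in at z. norm (D2 z' h k - D2 z h k) \<le> K * norm (z' - z) * norm h * norm k"
      by (intro always_eventually allI D2_lip)
    have "((\<lambda>z'. K * norm (z' - z) * norm h * norm k) \<longlongrightarrow> K * norm (z - z) * norm h * norm k) (at z)"
      by (intro tendsto_intros)
    then show "((\<lambda>z'. K * norm (z' - z) * norm h * norm k) \<longlongrightarrow> 0) (at z)" by simp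
  qed
  then show ?thesis by (simp add: isCont_def)
qed

end

text \<open>A directional derivative is the limit of the difference quotients with steps 1/(n+1),
  each of which is measurable in t.\<close>

lemma borel_measurable_derivative:
  fixes \<phi> :: "real \<Rightarrow> 'z::real_normed_vector \<Rightarrow> 'b::euclidean_space"
  assumes meas: "\<And>z. (\<lambda>t. \<phi> t z) \<in> borel_measurable (lebesgue_on S)"
    and der: "\<And>t. t \<in> S \<Longrightarrow> (\<phi> t has_derivative D t) (at z)"
  shows "(\<lambda>t. D t k) \<in> borel_measurable (lebesgue_on S)"
proof (rule borel_measurable_LIMSEQ_metric)
  show "(\<lambda>t. real (Suc n) *\<^sub>R (\<phi> t (z + inverse (real (Suc n)) *\<^sub>R k) - \<phi> t z)) \<in> borel_measurable (lebesgue_on S)" for n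
    by (intro borel_measurable_scaleR borel_measurable_diff meas) auto
  fix t assume "t \<in> space (lebesgue_on S)"
  then have t: "t \<in> S" by (simp add: space_restrict_space)
  have "((\<lambda>s. z + s *\<^sub>R k) has_derivative (\<lambda>h. h *\<^sub>R k)) (at 0)"
    by (auto intro!: derivative_eq_intros)
  moreover have "(\<phi> t has_derivative D t) (at (z + 0 *\<^sub>R k))" using der[OF t] by simp
  ultimately have "((\<lambda>s. \<phi> t (z + s *\<^sub>R k)) has_derivative (\<lambda>h. D t (h *\<^sub>R k))) (at 0)"
    by (rule has_derivative_compose)
  then have d: "((\<lambda>s. \<phi> t (z + s *\<^sub>R k)) has_derivative (\<lambda>h. h *\<^sub>R D t k)) (at 0)"
    by (simp add: linear_scale[OF has_derivative_linear[OF der[OF t]]])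
  have lim: "((\<lambda>s. (1 / s) *\<^sub>R (\<phi> t (z + s *\<^sub>R k) - \<phi> t z)) \<longlongrightarrow> D t k) (at 0)"
  proof (rule Lim_null[THEN iffD2], rule tendsto_norm_zero_cancel)
    have "((\<lambda>s. norm (\<phi> t (z + s *\<^sub>R k) - \<phi> t z - s *\<^sub>R D t k) / norm s) \<longlongrightarrow> 0) (at 0)"
      using d by (simp add: has_derivative_at)
    moreover have "\<forall>\<^sub>F s in at 0. norm (\<phi> t (z + s *\<^sub>R k) - \<phi> t z - s *\<^sub>R D t k) / norm s
        = norm ((1 / s) *\<^sub>R (\<phi> t (z + s *\<^sub>R k) - \<phi> t z) - D t k)"
    proof (rule eventually_at_filter[THEN iffD2], rule always_eventually, intro allI impI)
      fix s :: real assume s: "s \<noteq> 0"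
      have "(1 / s) *\<^sub>R (\<phi> t (z + s *\<^sub>R k) - \<phi> t z) - D t k = (1 / s) *\<^sub>R (\<phi> t (z + s *\<^sub>R k) - \<phi> t z - s *\<^sub>R D t k)"
        using s by (simp add: scaleR_diff_right)
      then show "norm (\<phi> t (z + s *\<^sub>R k) - \<phi> t z - s *\<^sub>R D t k) / norm s
        = norm ((1 / s) *\<^sub>R (\<phi> t (z + s *\<^sub>R k) - \<phi> t z) - D t k)" by simp
    qed
    ultimately show "((\<lambda>s. norm ((1 / s) *\<^sub>R (\<phi> t (z + s *\<^sub>R k) - \<phi> t z) - D t k)) \<longlongrightarrow> 0) (at 0)"
      by (rule Lim_transform_eventually)
  qed
  have "filterlim (\<lambda>n. inverse (real (Suc n))) (at 0) sequentially"
    using LIMSEQ_inverse_real_of_nat by (auto simp: filterlim_at)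
  from filterlim_compose[OF lim this]
  show "(\<lambda>n. real (Suc n) *\<^sub>R (\<phi> t (z + inverse (real (Suc n)) *\<^sub>R k) - \<phi> t z)) \<longlonglongrightarrow> D t k"
    by (simp add: inverse_eq_divide)
qed

section \<open>The control problem\<close>

text \<open>The analysis uses derivatives as linear and bilinear maps; the coordinate arrays of the
  assumptions are confined to the instantiation at the end. \<open>B2_lip\<close> and
  \<open>F2_lip\<close> retain the constant L for the sum of the two component norms, beside the
  cruder 2 L in the product norm, because the explicit constants do not tolerate a factor 2.\<close>

locale control_data =
  fixes T L :: real and x0 :: "real^'n"
    and b :: "real \<Rightarrow> real^'n \<Rightarrow> real^'m \<Rightarrow> real^'n"
    and f :: "real \<Rightarrow> real^'n \<Rightarrow> real^'m \<Rightarrow> real"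
    and g :: "real^'n \<Rightarrow> real"
    and B1 :: "real \<Rightarrow> (real^'n) \<times> (real^'m) \<Rightarrow> (real^'n) \<times> (real^'m) \<Rightarrow> real^'n"
    and B2 :: "real \<Rightarrow> (real^'n) \<times> (real^'m) \<Rightarrow> (real^'n) \<times> (real^'m) \<Rightarrow> (real^'n) \<times> (real^'m) \<Rightarrow> real^'n"
    and F1 :: "real \<Rightarrow> (real^'n) \<times> (real^'m) \<Rightarrow> (real^'n) \<times> (real^'m) \<Rightarrow> real"
    and F2 :: "real \<Rightarrow> (real^'n) \<times> (real^'m) \<Rightarrow> (real^'n) \<times> (real^'m) \<Rightarrow> (real^'n) \<times> (real^'m) \<Rightarrow> real"
    and g1 :: "real^'n \<Rightarrow> real^'n \<Rightarrow> real" and g2 :: "real^'n \<Rightarrow> real^'n \<Rightarrow> real^'n \<Rightarrow> real"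
  assumes T: "0 < T" and L: "0 < L"
    and so_b: "\<And>t. t \<in> {0..T} \<Longrightarrow> second_order (\<lambda>z. b t (fst z) (snd z)) (B1 t) (B2 t) L (2 * L)"
    and so_f: "\<And>t. t \<in> {0..T} \<Longrightarrow> second_order (\<lambda>z. f t (fst z) (snd z)) (F1 t) (F2 t) L (2 * L)"
    and so_g: "second_order g g1 g2 L L"
    and b_growth: "\<And>t x u. t \<in> {0..T} \<Longrightarrow> norm (b t x u) \<le> L * (norm x + norm u + 1)"
    and f_growth: "\<And>t x u. t \<in> {0..T} \<Longrightarrow> \<bar>f t x u\<bar> \<le> L * ((norm x)\<^sup>2 + (norm u)\<^sup>2 + 1)"
    and B1_bound: "\<And>t z k. t \<in> {0..T} \<Longrightarrow> norm (B1 t z k) \<le> L * norm k"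
    and F1_bound: "\<And>t z k. t \<in> {0..T} \<Longrightarrow> \<bar>F1 t z k\<bar> \<le> L * (norm (fst z) + norm (snd z) + 1) * norm k"
    and B2_lip: "\<And>t z z' h k. t \<in> {0..T} \<Longrightarrow>
        norm (B2 t z h k - B2 t z' h k) \<le> L * (norm (fst z - fst z') + norm (snd z - snd z')) * norm h * norm k"
    and F2_lip: "\<And>t z z' h k. t \<in> {0..T} \<Longrightarrow>
        \<bar>F2 t z h k - F2 t z' h k\<bar> \<le> L * (norm (fst z - fst z') + norm (snd z - snd z')) * norm h * norm k"
    and g1_bound: "\<And>x k. \<bar>g1 x k\<bar> \<le> L * (norm x + 1) * norm k"
    and b_meas: "\<And>z. (\<lambda>t. b t (fst z) (snd z)) \<in> borel_measurable (lebesgue_on {0..T})"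
    and f_meas: "\<And>z. (\<lambda>t. f t (fst z) (snd z)) \<in> borel_measurable (lebesgue_on {0..T})"
begin

text \<open>The transpose of the full derivative of b, with components b_x^T q and b_u^T q. One
  object thus serves the adjoint equation through \<open>fst\<close> and the gradient of the cost
  through \<open>snd\<close>.\<close>

definition DB :: "real \<Rightarrow> (real^'n) \<times> (real^'m) \<Rightarrow> real^'n \<Rightarrow> (real^'n) \<times> (real^'m)" where
  "DB t z q = riesz (\<lambda>k. B1 t z k \<bullet> q)"

definition DF :: "real \<Rightarrow> (real^'n) \<times> (real^'m) \<Rightarrow> (real^'n) \<times> (real^'m)" where
  "DF t z = riesz (F1 t z)"

text \<open>\<open>DH\<close> is the gradient of the Hamiltonian in the joint variable \<open>(x,u)\<close>, and \<open>DDH\<close> its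
  derivative in the direction \<open>h\<close>.\<close>

definition DH :: "real \<Rightarrow> (real^'n) \<times> (real^'m) \<Rightarrow> real^'n \<Rightarrow> (real^'n) \<times> (real^'m)" where
  "DH t z p = DB t z p + DF t z"

definition DDH :: "real \<Rightarrow> (real^'n) \<times> (real^'m) \<Rightarrow> real^'n \<Rightarrow> (real^'n) \<times> (real^'m) \<Rightarrow> (real^'n) \<times> (real^'m)" where
  "DDH t z p h = riesz (\<lambda>k. B2 t z h k \<bullet> p + F2 t z h k)"

definition Dg :: "real^'n \<Rightarrow> real^'n" where "Dg x = riesz (g1 x)"

definition DDg :: "real^'n \<Rightarrow> real^'n \<Rightarrow> real^'n" where "DDg x h = riesz (g2 x h)"

section \<open>Linearity, bounds and measurability for the derivatives of the Hamiltonian\<close>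

lemma linear_inner_B1: "t \<in> {0..T} \<Longrightarrow> linear (\<lambda>k. B1 t z k \<bullet> q)"
  using second_derivative.linear_D1[OF second_order.axioms(1)[OF so_b], of t z]
  by (auto simp: linear_iff inner_add_left inner_scaleR_left)

lemma linear_inner_B2: "t \<in> {0..T} \<Longrightarrow> linear (\<lambda>k. B2 t z h k \<bullet> q)"
  using second_derivative.linear_D2_right[OF second_order.axioms(1)[OF so_b], of t z h]
  by (auto simp: linear_iff inner_add_left inner_scaleR_left)

lemma DB_inner: "t \<in> {0..T} \<Longrightarrow> DB t z q \<bullet> k = B1 t z k \<bullet> q"
  unfolding DB_def by (rule riesz_inner[OF linear_inner_B1])

lemma DF_inner: "t \<in> {0..T} \<Longrightarrow> DF t z \<bullet> k = F1 t z k"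
  unfolding DF_def by (rule riesz_inner[OF second_derivative.linear_D1[OF second_order.axioms(1)[OF so_f]]])

lemma DDH_inner: "t \<in> {0..T} \<Longrightarrow> DDH t z p h \<bullet> k = B2 t z h k \<bullet> p + F2 t z h k"
  unfolding DDH_def
  by (rule riesz_inner) (intro linear_compose_add linear_inner_B2 second_derivative.linear_D2_right[OF second_order.axioms(1)[OF so_f]])

lemma Dg_inner: "Dg x \<bullet> k = g1 x k"
  unfolding Dg_def by (rule riesz_inner[OF second_derivative.linear_D1[OF second_order.axioms(1)[OF so_g]]])

lemma DDg_inner: "DDg x h \<bullet> k = g2 x h k"
  unfolding DDg_def by (rule riesz_inner[OF second_derivative.linear_D2_right[OF second_order.axioms(1)[OF so_g]]])

lemma DB_add: "t \<in> {0..T} \<Longrightarrow> DB t z (p + q) = DB t z p + DB t z q"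
  by (rule eq_of_inner) (simp add: DB_inner inner_add_left inner_add_right)

lemma DB_diff: "t \<in> {0..T} \<Longrightarrow> DB t z (p - q) = DB t z p - DB t z q"
  by (rule eq_of_inner) (simp add: DB_inner inner_diff_left inner_diff_right)

lemma DB_scaleR: "t \<in> {0..T} \<Longrightarrow> DB t z (c *\<^sub>R p) = c *\<^sub>R DB t z p"
  by (rule eq_of_inner) (simp add: DB_inner)

lemma DDH_add: "t \<in> {0..T} \<Longrightarrow> DDH t z p (h + k) = DDH t z p h + DDH t z p k"
  by (rule eq_of_inner) (simp add: DDH_inner inner_add_left linear_add[OF second_derivative.linear_D2_left[OF second_order.axioms(1)[OF so_b]]]
    linear_add[OF second_derivative.linear_D2_left[OF second_order.axioms(1)[OF so_f]]])

lemma DDH_diff: "t \<in> {0..T} \<Longrightarrow> DDH t z p (h - k) = DDH t z p h - DDH t z p k"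
  by (rule eq_of_inner) (simp add: DDH_inner inner_diff_left linear_diff[OF second_derivative.linear_D2_left[OF second_order.axioms(1)[OF so_b]]]
    linear_diff[OF second_derivative.linear_D2_left[OF second_order.axioms(1)[OF so_f]]])

lemma DDH_scaleR: "t \<in> {0..T} \<Longrightarrow> DDH t z p (c *\<^sub>R h) = c *\<^sub>R DDH t z p h"
  by (rule eq_of_inner) (simp add: DDH_inner linear_scale[OF second_derivative.linear_D2_left[OF second_order.axioms(1)[OF so_b]]]
    linear_scale[OF second_derivative.linear_D2_left[OF second_order.axioms(1)[OF so_f]]] algebra_simps)

lemma DDg_add: "DDg x (h + k) = DDg x h + DDg x k"
  by (rule eq_of_inner) (simp add: DDg_inner inner_add_left linear_add[OF second_derivative.linear_D2_left[OF second_order.axioms(1)[OF so_g]]])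

lemma DDg_diff: "DDg x (h - k) = DDg x h - DDg x k"
  by (rule eq_of_inner) (simp add: DDg_inner inner_diff_left linear_diff[OF second_derivative.linear_D2_left[OF second_order.axioms(1)[OF so_g]]])

lemma DDg_scaleR: "DDg x (c *\<^sub>R h) = c *\<^sub>R DDg x h"
  by (rule eq_of_inner) (simp add: DDg_inner linear_scale[OF second_derivative.linear_D2_left[OF second_order.axioms(1)[OF so_g]]])

lemma norm_DB_le: "t \<in> {0..T} \<Longrightarrow> norm (DB t z q) \<le> L * norm q"
  by (rule norm_le_of_inner) (simp add: DB_inner abs_inner_le B1_bound)

lemma norm_DF_le: "t \<in> {0..T} \<Longrightarrow> norm (DF t z) \<le> L * (norm (fst z) + norm (snd z) + 1)"
  by (rule norm_le_of_inner) (simp add: DF_inner F1_bound)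

lemma norm_DB_diff_le:
  assumes t: "t \<in> {0..T}"
  shows "norm (DB t z q - DB t z' q) \<le> L * (norm (fst z - fst z') + norm (snd z - snd z')) * norm q"
proof (rule norm_le_of_inner)
  fix k
  have "norm (B1 t z k - B1 t z' k) \<le> L * norm (z - z') * norm k"
    by (rule second_order.D1_lip[OF so_b[OF t]])
  also have "\<dots> \<le> L * (norm (fst z - fst z') + norm (snd z - snd z')) * norm k"
    using L by (intro mult_right_mono mult_left_mono norm_diff_le_fst_snd) auto
  finally have "\<bar>(B1 t z k - B1 t z' k) \<bullet> q\<bar> \<le> L * (norm (fst z - fst z') + norm (snd z - snd z')) * norm q * norm k"
    by (rule abs_inner_le)
  then show "\<bar>(DB t z q - DB t z' q) \<bullet> k\<bar> \<le> L * (norm (fst z - fst z') + norm (snd z - snd z')) * norm q * norm k"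
    by (simp add: inner_diff_left DB_inner[OF t])
qed

lemma norm_DF_diff_le:
  assumes t: "t \<in> {0..T}"
  shows "norm (DF t z - DF t z') \<le> L * (norm (fst z - fst z') + norm (snd z - snd z'))"
proof (rule norm_le_of_inner)
  fix k
  have "norm (F1 t z k - F1 t z' k) \<le> L * norm (z - z') * norm k"
    by (rule second_order.D1_lip[OF so_f[OF t]])
  also have "\<dots> \<le> L * (norm (fst z - fst z') + norm (snd z - snd z')) * norm k"
    using L by (intro mult_right_mono mult_left_mono norm_diff_le_fst_snd) auto
  finally show "\<bar>(DF t z - DF t z') \<bullet> k\<bar> \<le> L * (norm (fst z - fst z') + norm (snd z - snd z')) * norm k"
    by (simp add: inner_diff_left DF_inner[OF t])
qed

lemma norm_DH_diff_le:
  assumes t: "t \<in> {0..T}"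
  shows "norm (DH t z p - DH t z' p) \<le> L * (norm (fst z - fst z') + norm (snd z - snd z')) * (1 + norm p)"
proof -
  have "DH t z p - DH t z' p = (DB t z p - DB t z' p) + (DF t z - DF t z')" by (simp add: DH_def)
  then have "norm (DH t z p - DH t z' p) \<le> norm (DB t z p - DB t z' p) + norm (DF t z - DF t z')"
    by (simp only: norm_triangle_ineq)
  also have "\<dots> \<le> L * (norm (fst z - fst z') + norm (snd z - snd z')) * norm p + L * (norm (fst z - fst z') + norm (snd z - snd z'))"
    by (intro add_mono norm_DB_diff_le norm_DF_diff_le t)
  finally show ?thesis by (simp add: algebra_simps)
qed

lemma norm_DDH_le:
  assumes t: "t \<in> {0..T}"
  shows "norm (DDH t z p h) \<le> L * (1 + norm p) * norm h"
proof (rule norm_le_of_inner)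
  fix k
  have "\<bar>B2 t z h k \<bullet> p\<bar> \<le> L * norm h * norm p * norm k"
    by (rule abs_inner_le) (rule second_order.D2_bound[OF so_b[OF t]])
  moreover have "\<bar>F2 t z h k\<bar> \<le> L * norm h * norm k"
    using second_order.D2_bound[OF so_f[OF t], of z h k] by simp
  ultimately show "\<bar>DDH t z p h \<bullet> k\<bar> \<le> L * (1 + norm p) * norm h * norm k"
    unfolding DDH_inner[OF t] by (simp add: algebra_simps)
qed

text \<open>The intermediate term has the old p at the new point, so the change of point is
  multiplied by the size of p and never of p'. This asymmetry is why only the norm of u appears in
  the theorem.\<close>

lemma norm_DDH_diff_le:
  assumes t: "t \<in> {0..T}"
  shows "norm (DDH t z p h - DDH t z' p' h) \<le>
    (L * (norm (fst z - fst z') + norm (snd z - snd z')) * (1 + norm p) + L * norm (p - p')) * norm h"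
proof (rule norm_le_of_inner)
  fix k
  define \<delta> where "\<delta> = norm (fst z - fst z') + norm (snd z - snd z')"
  have "\<bar>(B2 t z h k - B2 t z' h k) \<bullet> p\<bar> \<le> L * \<delta> * norm h * norm p * norm k"
    by (rule abs_inner_le) (use B2_lip[OF t] in \<open>simp add: \<delta>_def\<close>)
  moreover have "\<bar>F2 t z h k - F2 t z' h k\<bar> \<le> L * \<delta> * norm h * norm k"
    using F2_lip[OF t] by (simp add: \<delta>_def)
  moreover have "\<bar>B2 t z' h k \<bullet> (p - p')\<bar> \<le> L * norm h * norm (p - p') * norm k"
    by (rule abs_inner_le) (rule second_order.D2_bound[OF so_b[OF t]])
  moreover have "(DDH t z p h - DDH t z' p' h) \<bullet> k =
     (B2 t z h k - B2 t z' h k) \<bullet> p + (F2 t z h k - F2 t z' h k) + B2 t z' h k \<bullet> (p - p')"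
    by (simp add: DDH_inner[OF t] inner_diff_left inner_diff_right)
  ultimately have "\<bar>(DDH t z p h - DDH t z' p' h) \<bullet> k\<bar> \<le>
     L * \<delta> * norm h * norm p * norm k + L * \<delta> * norm h * norm k + L * norm h * norm (p - p') * norm k"
    by linarith
  then show "\<bar>(DDH t z p h - DDH t z' p' h) \<bullet> k\<bar> \<le>
    (L * (norm (fst z - fst z') + norm (snd z - snd z')) * (1 + norm p) + L * norm (p - p')) * norm h * norm k"
    unfolding \<delta>_def[symmetric] by (simp add: algebra_simps)
qed

lemma norm_DH_taylor_le:
  assumes t: "t \<in> {0..T}"
  shows "norm (DH t z' p - DH t z p - DDH t z p (z' - z)) \<le> 2 * L * (1 + norm p) * (norm (z' - z))\<^sup>2"
proof (rule norm_le_of_inner)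
  fix k
  have "\<bar>(B1 t z' k - B1 t z k - B2 t z (z' - z) k) \<bullet> p\<bar> \<le> 2 * L * (norm (z' - z))\<^sup>2 * norm p * norm k"
    by (rule abs_inner_le) (rule second_order.taylor2[OF so_b[OF t]])
  moreover have "\<bar>F1 t z' k - F1 t z k - F2 t z (z' - z) k\<bar> \<le> 2 * L * (norm (z' - z))\<^sup>2 * norm k"
    using second_order.taylor2[OF so_f[OF t], of z' k z] by simp
  moreover have "(DH t z' p - DH t z p - DDH t z p (z' - z)) \<bullet> k =
     (B1 t z' k - B1 t z k - B2 t z (z' - z) k) \<bullet> p + (F1 t z' k - F1 t z k - F2 t z (z' - z) k)"
    by (simp add: DH_def DDH_inner[OF t] DB_inner[OF t] DF_inner[OF t] inner_diff_left inner_add_left)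
  ultimately show "\<bar>(DH t z' p - DH t z p - DDH t z p (z' - z)) \<bullet> k\<bar> \<le> 2 * L * (1 + norm p) * (norm (z' - z))\<^sup>2 * norm k"
    by (simp add: algebra_simps)
qed

lemma b_lip:
  assumes t: "t \<in> {0..T}"
  shows "norm (b t x u - b t x' u') \<le> L * (norm (x - x') + norm (u - u'))"
proof -
  have "norm (b t x u - b t x' u') \<le> L * norm ((x, u) - (x', u'))"
    using norm_increment_le[of "\<lambda>z. b t (fst z) (snd z)" "B1 t" "(x', u')" "(x, u) - (x', u')",
        OF second_derivative.der[OF second_order.axioms(1)[OF so_b[OF t]]] B1_bound[OF t]] by simp
  also have "\<dots> \<le> L * (norm (x - x') + norm (u - u'))"
    using norm_diff_le_fst_snd[of "(x, u)" "(x', u')"] L by (intro mult_left_mono) auto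
  finally show ?thesis .
qed

lemma b_taylor: "t \<in> {0..T} \<Longrightarrow>
    norm (b t (fst z') (snd z') - b t (fst z) (snd z) - B1 t z (z' - z)) \<le> L * (norm (z' - z))\<^sup>2"
  using second_order.taylor1[OF so_b] .

lemma f_taylor: "t \<in> {0..T} \<Longrightarrow>
    \<bar>f t (fst z') (snd z') - f t (fst z) (snd z) - F1 t z (z' - z)\<bar> \<le> L * (norm (z' - z))\<^sup>2"
  using second_order.taylor1[OF so_f, of t z' z] by simp

lemma norm_Dg_le: "norm (Dg x) \<le> L * (norm x + 1)"
  by (rule norm_le_of_inner) (simp add: Dg_inner g1_bound)

lemma norm_Dg_diff_le: "norm (Dg x - Dg x') \<le> L * norm (x - x')"
  by (rule norm_le_of_inner)
    (use second_order.D1_lip[OF so_g, of x _ x'] in \<open>simp add: Dg_inner inner_diff_left\<close>)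

lemma norm_DDg_le: "norm (DDg x h) \<le> L * norm h"
  by (rule norm_le_of_inner) (use second_order.D2_bound[OF so_g, of x h] in \<open>simp add: DDg_inner\<close>)

lemma norm_DDg_diff_le: "norm (DDg x h - DDg x' h) \<le> L * norm (x - x') * norm h"
  by (rule norm_le_of_inner)
    (use second_order.D2_lip[OF so_g, of x h _ x'] in \<open>simp add: DDg_inner inner_diff_left\<close>)

lemma norm_Dg_taylor_le: "norm (Dg x' - Dg x - DDg x (x' - x)) \<le> L * (norm (x' - x))\<^sup>2"
  by (rule norm_le_of_inner)
    (use second_order.taylor2[OF so_g, of x' _ x] in \<open>simp add: DDg_inner Dg_inner inner_diff_left\<close>)

lemma g_taylor: "\<bar>g x' - g x - Dg x \<bullet> (x' - x)\<bar> \<le> L * (norm (x' - x))\<^sup>2"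
  using second_order.taylor1[OF so_g, of x' x] by (simp add: Dg_inner)

lemma b_measurable:
  assumes z: "z \<in> borel_measurable (lebesgue_on {0..T})"
  shows "(\<lambda>t. b t (fst (z t)) (snd (z t))) \<in> borel_measurable (lebesgue_on {0..T})"
proof (rule borel_measurable_caratheodory[OF b_meas _ z])
  fix t assume "t \<in> {0..T}"
  from second_derivative.der[OF second_order.axioms(1)[OF so_b[OF this]]]
  show "continuous_on UNIV (\<lambda>z. b t (fst z) (snd z))"
    by (auto simp: continuous_on_eq_continuous_at intro: has_derivative_continuous)
qed

lemma f_measurable:
  assumes z: "z \<in> borel_measurable (lebesgue_on {0..T})"
  shows "(\<lambda>t. f t (fst (z t)) (snd (z t))) \<in> borel_measurable (lebesgue_on {0..T})"
proof (rule borel_measurable_caratheodory[OF f_meas _ z])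
  fix t assume "t \<in> {0..T}"
  from second_derivative.der[OF second_order.axioms(1)[OF so_f[OF this]]]
  show "continuous_on UNIV (\<lambda>z. f t (fst z) (snd z))"
    by (auto simp: continuous_on_eq_continuous_at intro: has_derivative_continuous)
qed

lemma B1_meas: "(\<lambda>t. B1 t z k) \<in> borel_measurable (lebesgue_on {0..T})"
  using b_meas by (rule borel_measurable_derivative) (rule second_derivative.der[OF second_order.axioms(1)[OF so_b]])

lemma F1_meas: "(\<lambda>t. F1 t z k) \<in> borel_measurable (lebesgue_on {0..T})"
  using f_meas by (rule borel_measurable_derivative) (rule second_derivative.der[OF second_order.axioms(1)[OF so_f]])

lemma B2_meas: "(\<lambda>t. B2 t z h k) \<in> borel_measurable (lebesgue_on {0..T})"
  using B1_meas by (rule borel_measurable_derivative) (rule second_derivative.der2[OF second_order.axioms(1)[OF so_b]])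

lemma F2_meas: "(\<lambda>t. F2 t z h k) \<in> borel_measurable (lebesgue_on {0..T})"
  using F1_meas by (rule borel_measurable_derivative) (rule second_derivative.der2[OF second_order.axioms(1)[OF so_f]])

lemma B1_measurable:
  assumes z: "z \<in> borel_measurable (lebesgue_on {0..T})"
  shows "(\<lambda>t. B1 t (z t) k) \<in> borel_measurable (lebesgue_on {0..T})"
  by (rule borel_measurable_caratheodory[OF B1_meas _ z])
    (auto simp: continuous_on_eq_continuous_at intro: second_order.isCont_D1[OF so_b])

lemma F1_measurable:
  assumes z: "z \<in> borel_measurable (lebesgue_on {0..T})"
  shows "(\<lambda>t. F1 t (z t) k) \<in> borel_measurable (lebesgue_on {0..T})"
  by (rule borel_measurable_caratheodory[OF F1_meas _ z])
    (auto simp: continuous_on_eq_continuous_at intro: second_order.isCont_D1[OF so_f])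

lemma B2_measurable:
  assumes z: "z \<in> borel_measurable (lebesgue_on {0..T})"
  shows "(\<lambda>t. B2 t (z t) h k) \<in> borel_measurable (lebesgue_on {0..T})"
  by (rule borel_measurable_caratheodory[OF B2_meas _ z])
    (auto simp: continuous_on_eq_continuous_at intro: second_order.isCont_D2[OF so_b])

lemma F2_measurable:
  assumes z: "z \<in> borel_measurable (lebesgue_on {0..T})"
  shows "(\<lambda>t. F2 t (z t) h k) \<in> borel_measurable (lebesgue_on {0..T})"
  by (rule borel_measurable_caratheodory[OF F2_meas _ z])
    (auto simp: continuous_on_eq_continuous_at intro: second_order.isCont_D2[OF so_f])

lemma DB_measurable:
  assumes "z \<in> borel_measurable (lebesgue_on {0..T})" "q \<in> borel_measurable (lebesgue_on {0..T})"
  shows "(\<lambda>t. DB t (z t) (q t)) \<in> borel_measurable (lebesgue_on {0..T})"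
  unfolding DB_def riesz_def
  by (intro borel_measurable_sum borel_measurable_scaleR borel_measurable_inner B1_measurable assms borel_measurable_const)

lemma DF_measurable:
  assumes "z \<in> borel_measurable (lebesgue_on {0..T})"
  shows "(\<lambda>t. DF t (z t)) \<in> borel_measurable (lebesgue_on {0..T})"
  unfolding DF_def riesz_def
  by (intro borel_measurable_sum borel_measurable_scaleR F1_measurable assms borel_measurable_const)

lemma DH_measurable:
  assumes "z \<in> borel_measurable (lebesgue_on {0..T})" "p \<in> borel_measurable (lebesgue_on {0..T})"
  shows "(\<lambda>t. DH t (z t) (p t)) \<in> borel_measurable (lebesgue_on {0..T})"
  unfolding DH_def by (intro borel_measurable_add DB_measurable DF_measurable assms)

lemma B1_measurable2:
  assumes "z \<in> borel_measurable (lebesgue_on {0..T})" "h \<in> borel_measurable (lebesgue_on {0..T})"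
  shows "(\<lambda>t. B1 t (z t) (h t)) \<in> borel_measurable (lebesgue_on {0..T})"
  by (rule measurable_linear_argument[OF B1_measurable[OF assms(1)] second_derivative.linear_D1[OF second_order.axioms(1)[OF so_b]] assms(2)])

lemma DDH_measurable:
  assumes "z \<in> borel_measurable (lebesgue_on {0..T})" "p \<in> borel_measurable (lebesgue_on {0..T})"
    "h \<in> borel_measurable (lebesgue_on {0..T})"
  shows "(\<lambda>t. DDH t (z t) (p t) (h t)) \<in> borel_measurable (lebesgue_on {0..T})"
  unfolding DDH_def riesz_def
  by (intro borel_measurable_sum borel_measurable_scaleR borel_measurable_add borel_measurable_inner assms borel_measurable_const
     measurable_linear_argument[OF B2_measurable[OF assms(1)] second_derivative.linear_D2_left[OF second_order.axioms(1)[OF so_b]] assms(3)]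
     measurable_linear_argument[OF F2_measurable[OF assms(1)] second_derivative.linear_D2_left[OF second_order.axioms(1)[OF so_f]] assms(3)])

end

section \<open>Integrability on subintervals and by domination\<close>

lemma norm_integrable:
  fixes h :: "real \<Rightarrow> 'a::euclidean_space"
  shows "h absolutely_integrable_on S \<Longrightarrow> (\<lambda>t. norm (h t)) integrable_on S"
  by (simp add: absolutely_integrable_on_def)

lemma absolutely_integrable_difference:
  fixes u u' :: "real \<Rightarrow> 'a::euclidean_space"
  assumes "u absolutely_integrable_on S" "u' absolutely_integrable_on S"
  shows "(\<lambda>t. u t - u' t) absolutely_integrable_on S"
  using set_integral_diff(1)[OF assms] .

lemma absolutely_integrable_linear_combination:
  fixes u v :: "real \<Rightarrow> 'a::euclidean_space"
  assumes "u absolutely_integrable_on S" "v absolutely_integrable_on S"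
  shows "(\<lambda>t. c *\<^sub>R u t + d *\<^sub>R v t) absolutely_integrable_on S"
  by (rule set_integral_add(1)[OF absolutely_integrable_scaleR_left[OF assms(1)] absolutely_integrable_scaleR_left[OF assms(2)]])

lemma integral_linear_combination:
  fixes h k :: "real \<Rightarrow> 'a::euclidean_space"
  assumes "h integrable_on S" "k integrable_on S"
  shows "integral S (\<lambda>t. c *\<^sub>R h t + d *\<^sub>R k t) = c *\<^sub>R integral S h + d *\<^sub>R integral S k"
  using assms by (simp add: integral_add integrable_cmul)

lemma integrable_restrict:
  fixes h :: "real \<Rightarrow> 'a::euclidean_space"
  assumes "h absolutely_integrable_on S" "{r..s} \<subseteq> S"
  shows "h integrable_on {r..s}"
  by (rule integrable_on_subinterval[OF _ assms(2)]) (use assms in \<open>auto simp: absolutely_integrable_on_def\<close>)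

lemma integral_increment_diff:
  fixes h k :: "real \<Rightarrow> 'a::euclidean_space"
  assumes "h absolutely_integrable_on {0..T}" "k absolutely_integrable_on {0..T}" "t \<in> {0..T}"
  shows "integral {0..t} h - integral {0..t} k = integral {0..t} (\<lambda>s. h s - k s)"
    and "integral {t..T} h - integral {t..T} k = integral {t..T} (\<lambda>s. h s - k s)"
proof -
  have "h integrable_on {0..t}" "k integrable_on {0..t}" "h integrable_on {t..T}" "k integrable_on {t..T}"
    using assms by (auto intro!: integrable_on_subinterval[of _ "{0..T}"] simp: absolutely_integrable_on_def)
  then show "integral {0..t} h - integral {0..t} k = integral {0..t} (\<lambda>s. h s - k s)"
    "integral {t..T} h - integral {t..T} k = integral {t..T} (\<lambda>s. h s - k s)"
    by (simp_all add: integral_diff)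
qed

lemma absolutely_integrable_fst:
  fixes h :: "real \<Rightarrow> 'a::euclidean_space \<times> 'b::euclidean_space"
  shows "h absolutely_integrable_on S \<Longrightarrow> (\<lambda>s. fst (h s)) absolutely_integrable_on S"
  using absolutely_integrable_linear[OF _ bounded_linear_fst] unfolding o_def by blast

lemma absolutely_integrable_affine_bound:
  fixes h :: "real \<Rightarrow> 'a::euclidean_space" and u :: "real \<Rightarrow> 'b::euclidean_space" and v :: "real \<Rightarrow> 'c::euclidean_space"
  assumes "h \<in> borel_measurable (lebesgue_on {0..T})"
    and u: "u absolutely_integrable_on {0..T}" and v: "v absolutely_integrable_on {0..T}"
    and "\<And>t. t \<in> {0..T} \<Longrightarrow> norm (h t) \<le> c + d * norm (u t) + e * norm (v t)"
  shows "h absolutely_integrable_on {0..T}"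
proof (rule measurable_bounded_by_integrable_imp_absolutely_integrable[OF assms(1)])
  show "(\<lambda>t. c + d * norm (u t) + e * norm (v t)) integrable_on {0..T}"
    using u v by (intro integrable_add integrable_on_const integrable_on_mult_right)
      (auto simp: absolutely_integrable_on_def)
qed (use assms in auto)

lemma continuous_on_Icc_bounded:
  fixes x :: "real \<Rightarrow> 'a::euclidean_space"
  assumes "continuous_on {0..T} x"
  obtains C where "0 \<le> C" "\<And>t. t \<in> {0..T} \<Longrightarrow> norm (x t) \<le> C"
proof -
  have "bounded (x ` {0..T})"
    by (intro compact_imp_bounded compact_continuous_image assms) auto
  then obtain C where C: "\<And>t. t \<in> {0..T} \<Longrightarrow> norm (x t) \<le> C"
    unfolding bounded_iff by blast
  show thesis by (rule that[of "max 0 C"]) (auto intro!: max.coboundedI2 C)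
qed

lemma continuous_on_Icc_measurable:
  fixes x :: "real \<Rightarrow> 'a::euclidean_space"
  shows "continuous_on {0..T} x \<Longrightarrow> x \<in> borel_measurable (lebesgue_on {0..T})"
  by (rule continuous_imp_measurable_on_sets_lebesgue) auto

lemma borel_measurable_continuous_Pair:
  fixes x :: "real \<Rightarrow> 'a::euclidean_space" and u :: "real \<Rightarrow> 'b::euclidean_space"
  assumes "continuous_on {0..T} x" "u \<in> borel_measurable (lebesgue_on {0..T})"
  shows "(\<lambda>t. (x t, u t)) \<in> borel_measurable (lebesgue_on {0..T})"
  by (rule borel_measurable_Pair[OF continuous_on_Icc_measurable[OF assms(1)] assms(2)])

lemma absolutely_integrable_iff_integrable_lebesgue_on:
  fixes h :: "real \<Rightarrow> 'a::euclidean_space"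
  shows "h absolutely_integrable_on {a..b} \<longleftrightarrow> integrable (lebesgue_on {a..b}) h"
proof
  assume i: "integrable (lebesgue_on {a..b}) h"
  then show "h absolutely_integrable_on {a..b}"
    unfolding absolutely_integrable_on_def by (auto intro: integrable_on_lebesgue_on integrable_norm)
qed (auto intro: absolutely_integrable_imp_integrable)

text \<open>Carries Caratheodory solutions over to the gauge integral, for which the Gronwall and
  fixed point lemmas are stated.\<close>

lemma is_state_iff:
  "is_state T b x0 u x \<longleftrightarrow> (\<lambda>t. b t (x t) (u t)) absolutely_integrable_on {0..T} \<and>
     (\<forall>t\<in>{0..T}. x t = x0 + integral {0..t} (\<lambda>s. b s (x s) (u s)))"
proof -
  have "integral\<^sup>L (lebesgue_on {0..t}) (\<lambda>s. b s (x s) (u s)) = integral {0..t} (\<lambda>s. b s (x s) (u s))"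
    if "(\<lambda>t. b t (x t) (u t)) absolutely_integrable_on {0..T}" "t \<in> {0..T}" for t
  proof -
    have "(\<lambda>t. b t (x t) (u t)) absolutely_integrable_on {0..t}"
      by (rule absolutely_integrable_on_subinterval[OF that(1)]) (use that(2) in auto)
    then show ?thesis
      by (intro lebesgue_integral_eq_integral absolutely_integrable_imp_integrable) auto
  qed
  then show ?thesis
    unfolding is_state_def absolutely_integrable_iff_integrable_lebesgue_on[symmetric] by auto
qed

section \<open>Existence of state, adjoint and their linearisations\<close>

context control_data
begin

definition X :: "(real \<Rightarrow> real^'m) \<Rightarrow> real \<Rightarrow> real^'n" where
  "X u = state T b x0 u"

definition Z :: "(real \<Rightarrow> real^'m) \<Rightarrow> real \<Rightarrow> (real^'n) \<times> (real^'m)" where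
  "Z u t = (X u t, u t)"

text \<open>The first component of \<open>DH\<close> is H_x = b_x^T p + f_x, so this is the adjoint
  equation integrated back from T.\<close>

definition P :: "(real \<Rightarrow> real^'m) \<Rightarrow> real \<Rightarrow> real^'n" where
  "P u = (SOME p. continuous_on {0..T} p \<and>
     (\<forall>t\<in>{0..T}. p t = Dg (X u T) + integral {t..T} (\<lambda>s. fst (DH s (Z u s) (p s)))))"

text \<open>The integrand is b_x y + b_u v, applied as one linear map to the pair; the summand 0 is
  the initial value and fits the pattern of the integral-equation lemmas.\<close>

definition Y :: "(real \<Rightarrow> real^'m) \<Rightarrow> (real \<Rightarrow> real^'m) \<Rightarrow> real \<Rightarrow> real^'n" where
  "Y u v = (SOME y. continuous_on {0..T} y \<and>
     (\<forall>t\<in>{0..T}. y t = 0 + integral {0..t} (\<lambda>s. B1 s (Z u s) (y s, v s))))"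

definition \<Psi> :: "(real \<Rightarrow> real^'m) \<Rightarrow> (real \<Rightarrow> real^'m) \<Rightarrow> real \<Rightarrow> real^'n" where
  "\<Psi> u v = (SOME q. continuous_on {0..T} q \<and>
     (\<forall>t\<in>{0..T}. q t = DDg (X u T) (Y u v T) +
        integral {t..T} (\<lambda>s. fst (DB s (Z u s) (q s) + DDH s (Z u s) (P u s) (Y u v s, v s)))))"

text \<open>\<open>\<psi>' = -fst W\<close> and \<open>J''(u)v = snd W\<close>.\<close>

definition W :: "(real \<Rightarrow> real^'m) \<Rightarrow> (real \<Rightarrow> real^'m) \<Rightarrow> real \<Rightarrow> (real^'n) \<times> (real^'m)" where
  "W u v t = DB t (Z u t) (\<Psi> u v t) + DDH t (Z u t) (P u t) (Y u v t, v t)"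

text \<open>Linear growth of b makes the integrand absolutely integrable along every continuous path
  as soon as u is in L^1, and the Lipschitz bound in x supplies the contraction.\<close>

lemma is_state_X:
  assumes u: "u absolutely_integrable_on {0..T}"
  shows "is_state T b x0 u (X u)"
  unfolding X_def state_def
proof (rule someI_ex[of "is_state T b x0 u"])
  have um: "u \<in> borel_measurable (lebesgue_on {0..T})"
    using u by (rule absolutely_integrable_imp_borel_measurable) simp
  have int: "(\<lambda>t. b t (x t) (u t)) absolutely_integrable_on {0..T}" if x: "continuous_on {0..T} x" for x
  proof -
    obtain C where C: "\<And>t. t \<in> {0..T} \<Longrightarrow> norm (x t) \<le> C" using continuous_on_Icc_bounded[OF x] by blast
    show ?thesis
    proof (rule absolutely_integrable_affine_bound[where u = u and v = u and c = "L * (C + 1)" and d = L and e = 0])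
      show "(\<lambda>t. b t (x t) (u t)) \<in> borel_measurable (lebesgue_on {0..T})"
        using b_measurable[OF borel_measurable_continuous_Pair[OF x um]] by simp
      fix t assume t: "t \<in> {0..T}"
      have "norm (b t (x t) (u t)) \<le> L * (norm (x t) + norm (u t) + 1)" by (rule b_growth[OF t])
      also have "\<dots> \<le> L * (C + norm (u t) + 1)" using C[OF t] L by (intro mult_left_mono) auto
      finally show "norm (b t (x t) (u t)) \<le> L * (C + 1) + L * norm (u t) + 0 * norm (u t)"
        by (simp add: algebra_simps)
    qed (use u in auto)
  qed
  have "norm (b t x (u t) - b t y (u t)) \<le> L * norm (x - y)" if "t \<in> {0..T}" for t x y
    using b_lip[OF that, of x "u t" y "u t"] by simp
  then obtain x where "continuous_on {0..T} x" "\<And>t. t \<in> {0..T} \<Longrightarrow> x t = x0 + integral {0..t} (\<lambda>s. b s (x s) (u s))"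
    using picard_forward[of T L "\<lambda>t x. b t x (u t)" x0, OF less_imp_le[OF T] L _ int] by blast
  then show "\<exists>x. is_state T b x0 u x" unfolding is_state_iff using int by blast
qed

context
  fixes u :: "real \<Rightarrow> real^'m"
  assumes u: "u absolutely_integrable_on {0..T}"
begin

lemma u_measurable: "u \<in> borel_measurable (lebesgue_on {0..T})"
  using u by (rule absolutely_integrable_imp_borel_measurable) simp

lemma X_int: "(\<lambda>t. b t (X u t) (u t)) absolutely_integrable_on {0..T}"
  and X_eq: "t \<in> {0..T} \<Longrightarrow> X u t = x0 + integral {0..t} (\<lambda>s. b s (X u s) (u s))"
  using is_state_X[OF u] unfolding is_state_iff by auto

lemma X_cont: "continuous_on {0..T} (X u)"
  using continuous_on_integral_equation[OF X_eq X_int] .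

lemma Z_measurable: "Z u \<in> borel_measurable (lebesgue_on {0..T})"
  using borel_measurable_continuous_Pair[OF X_cont u_measurable] by (simp add: Z_def[abs_def])

lemma DH_int:
  assumes p: "continuous_on {0..T} p"
  shows "(\<lambda>s. DH s (Z u s) (p s)) absolutely_integrable_on {0..T}"
proof -
  obtain C where C: "\<And>t. t \<in> {0..T} \<Longrightarrow> norm (p t) \<le> C" using continuous_on_Icc_bounded[OF p] by blast
  obtain C' where C': "\<And>t. t \<in> {0..T} \<Longrightarrow> norm (X u t) \<le> C'" using continuous_on_Icc_bounded[OF X_cont] by blast
  show ?thesis
  proof (rule absolutely_integrable_affine_bound[where u = u and v = u and c = "L * C + L * (C' + 1)" and d = L and e = 0])
    show "(\<lambda>s. DH s (Z u s) (p s)) \<in> borel_measurable (lebesgue_on {0..T})"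
      by (rule DH_measurable[OF Z_measurable continuous_on_Icc_measurable[OF p]])
    fix t assume t: "t \<in> {0..T}"
    have "norm (DH t (Z u t) (p t)) \<le> norm (DB t (Z u t) (p t)) + norm (DF t (Z u t))"
      unfolding DH_def by (rule norm_triangle_ineq)
    also have "\<dots> \<le> L * norm (p t) + L * (norm (X u t) + norm (u t) + 1)"
      using norm_DB_le[OF t, of "Z u t" "p t"] norm_DF_le[OF t, of "Z u t"] by (simp add: Z_def)
    also have "\<dots> \<le> L * C + L * (C' + norm (u t) + 1)"
      using C[OF t] C'[OF t] L by (intro add_mono mult_left_mono) auto
    finally show "norm (DH t (Z u t) (p t)) \<le> L * C + L * (C' + 1) + L * norm (u t) + 0 * norm (u t)"
      by (simp add: algebra_simps)
  qed (use u in auto)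
qed

lemma P_cont: "continuous_on {0..T} (P u)"
  and P_eq: "t \<in> {0..T} \<Longrightarrow> P u t = Dg (X u T) + integral {t..T} (\<lambda>s. fst (DH s (Z u s) (P u s)))"
proof -
  have "\<exists>p. continuous_on {0..T} p \<and> (\<forall>t\<in>{0..T}. p t = Dg (X u T) + integral {t..T} (\<lambda>s. fst (DH s (Z u s) (p s))))"
  proof (rule picard_backward[of T L "\<lambda>s p. fst (DH s (Z u s) p)" "Dg (X u T)"])
    fix t p q assume t: "t \<in> {0..T}"
    have "norm (fst (DH t (Z u t) p) - fst (DH t (Z u t) q)) \<le> norm (DB t (Z u t) (p - q))"
      using norm_fst_le_norm[of "DB t (Z u t) (p - q)"] by (simp add: DH_def DB_diff[OF t])
    then show "norm (fst (DH t (Z u t) p) - fst (DH t (Z u t) q)) \<le> L * norm (p - q)"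
      using norm_DB_le[OF t, of "Z u t" "p - q"] by linarith
  next
    fix x :: "real \<Rightarrow> real^'n" assume "continuous_on {0..T} x"
    then show "(\<lambda>t. fst (DH t (Z u t) (x t))) absolutely_integrable_on {0..T}"
      by (intro absolutely_integrable_fst DH_int)
  qed (use T L in auto)
  from someI_ex[OF this] show "continuous_on {0..T} (P u)"
    and "t \<in> {0..T} \<Longrightarrow> P u t = Dg (X u T) + integral {t..T} (\<lambda>s. fst (DH s (Z u s) (P u s)))"
    unfolding P_def by auto
qed

lemma P_int: "(\<lambda>s. fst (DH s (Z u s) (P u s))) absolutely_integrable_on {0..T}"
  by (intro absolutely_integrable_fst DH_int P_cont)

context
  fixes v :: "real \<Rightarrow> real^'m"
  assumes v: "v absolutely_integrable_on {0..T}"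
begin

lemma v_measurable: "v \<in> borel_measurable (lebesgue_on {0..T})"
  using v by (rule absolutely_integrable_imp_borel_measurable) simp

lemma B1_int:
  assumes y: "continuous_on {0..T} y"
  shows "(\<lambda>s. B1 s (Z u s) (y s, v s)) absolutely_integrable_on {0..T}"
proof -
  obtain C where C: "\<And>t. t \<in> {0..T} \<Longrightarrow> norm (y t) \<le> C" using continuous_on_Icc_bounded[OF y] by blast
  show ?thesis
  proof (rule absolutely_integrable_affine_bound[where u = v and v = v and c = "L * C" and d = L and e = 0])
    show "(\<lambda>s. B1 s (Z u s) (y s, v s)) \<in> borel_measurable (lebesgue_on {0..T})"
      by (rule B1_measurable2[OF Z_measurable borel_measurable_continuous_Pair[OF y v_measurable]])
    fix t assume t: "t \<in> {0..T}"
    have "norm (B1 t (Z u t) (y t, v t)) \<le> L * norm (y t, v t)" by (rule B1_bound[OF t])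
    also have "\<dots> \<le> L * (C + norm (v t))"
      using C[OF t] L norm_Pair_le[of "y t" "v t"] by (intro mult_left_mono) auto
    finally show "norm (B1 t (Z u t) (y t, v t)) \<le> L * C + L * norm (v t) + 0 * norm (v t)"
      by (simp add: algebra_simps)
  qed (use v in auto)
qed

lemma Y_cont: "continuous_on {0..T} (Y u v)"
  and Y_eq: "t \<in> {0..T} \<Longrightarrow> Y u v t = 0 + integral {0..t} (\<lambda>s. B1 s (Z u s) (Y u v s, v s))"
proof -
  have "\<exists>y. continuous_on {0..T} y \<and> (\<forall>t\<in>{0..T}. y t = 0 + integral {0..t} (\<lambda>s. B1 s (Z u s) (y s, v s)))"
  proof (rule picard_forward[of T L "\<lambda>s y. B1 s (Z u s) (y, v s)" 0])
    fix t x y assume t: "t \<in> {0..T}"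
    have "B1 t (Z u t) (x, v t) - B1 t (Z u t) (y, v t) = B1 t (Z u t) (x - y, 0)"
      using linear_diff[OF second_derivative.linear_D1[OF second_order.axioms(1)[OF so_b[OF t]]], of "Z u t" "(x, v t)" "(y, v t)"] by simp
    then show "norm (B1 t (Z u t) (x, v t) - B1 t (Z u t) (y, v t)) \<le> L * norm (x - y)"
      using B1_bound[OF t, of "Z u t" "(x - y, 0)"] by simp
  qed (use T L B1_int in auto)
  from someI_ex[OF this] show "continuous_on {0..T} (Y u v)"
    and "t \<in> {0..T} \<Longrightarrow> Y u v t = 0 + integral {0..t} (\<lambda>s. B1 s (Z u s) (Y u v s, v s))"
    unfolding Y_def by auto
qed

lemma Y_int: "(\<lambda>s. B1 s (Z u s) (Y u v s, v s)) absolutely_integrable_on {0..T}"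
  by (intro B1_int Y_cont)

lemma DBDDH_int:
  assumes q: "continuous_on {0..T} q"
  shows "(\<lambda>s. DB s (Z u s) (q s) + DDH s (Z u s) (P u s) (Y u v s, v s)) absolutely_integrable_on {0..T}"
proof -
  obtain C where C: "0 \<le> C" "\<And>t. t \<in> {0..T} \<Longrightarrow> norm (P u t) \<le> C" using continuous_on_Icc_bounded[OF P_cont] by blast
  obtain C' where C': "\<And>t. t \<in> {0..T} \<Longrightarrow> norm (Y u v t) \<le> C'" using continuous_on_Icc_bounded[OF Y_cont] by blast
  obtain C'' where C'': "\<And>t. t \<in> {0..T} \<Longrightarrow> norm (q t) \<le> C''" using continuous_on_Icc_bounded[OF q] by blast
  show ?thesis
  proof (rule absolutely_integrable_affine_bound[where u = v and v = v and c = "L * C'' + L * (1 + C) * C'" and d = "L * (1 + C)" and e = 0])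
    show "(\<lambda>s. DB s (Z u s) (q s) + DDH s (Z u s) (P u s) (Y u v s, v s)) \<in> borel_measurable (lebesgue_on {0..T})"
      by (intro borel_measurable_add DB_measurable DDH_measurable Z_measurable continuous_on_Icc_measurable q P_cont
        borel_measurable_continuous_Pair Y_cont v_measurable)
    fix t assume t: "t \<in> {0..T}"
    have "norm (DDH t (Z u t) (P u t) (Y u v t, v t)) \<le> L * (1 + norm (P u t)) * norm (Y u v t, v t)"
      by (rule norm_DDH_le[OF t])
    also have "\<dots> \<le> L * (1 + C) * (C' + norm (v t))"
      using C C'[OF t] L t norm_Pair_le[of "Y u v t" "v t"] by (intro mult_mono mult_left_mono) auto
    finally have "norm (DDH t (Z u t) (P u t) (Y u v t, v t)) \<le> L * (1 + C) * C' + L * (1 + C) * norm (v t)"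
      by (simp add: algebra_simps)
    moreover have "norm (DB t (Z u t) (q t)) \<le> L * C''"
      using norm_DB_le[OF t, of "Z u t" "q t"] mult_left_mono[OF C''[OF t], of L] L by linarith
    ultimately show "norm (DB t (Z u t) (q t) + DDH t (Z u t) (P u t) (Y u v t, v t)) \<le>
        L * C'' + L * (1 + C) * C' + L * (1 + C) * norm (v t) + 0 * norm (v t)"
      by (intro order_trans[OF norm_triangle_ineq]) linarith
  qed (use v in auto)
qed

lemma \<Psi>_cont: "continuous_on {0..T} (\<Psi> u v)"
  and \<Psi>_eq: "t \<in> {0..T} \<Longrightarrow> \<Psi> u v t = DDg (X u T) (Y u v T) + integral {t..T} (\<lambda>s. fst (W u v s))"
proof -
  have "\<exists>q. continuous_on {0..T} q \<and> (\<forall>t\<in>{0..T}. q t = DDg (X u T) (Y u v T) +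
        integral {t..T} (\<lambda>s. fst (DB s (Z u s) (q s) + DDH s (Z u s) (P u s) (Y u v s, v s))))"
  proof (rule picard_backward[of T L "\<lambda>s q. fst (DB s (Z u s) q + DDH s (Z u s) (P u s) (Y u v s, v s))" "DDg (X u T) (Y u v T)"])
    fix t p q assume t: "t \<in> {0..T}"
    show "norm (fst (DB t (Z u t) p + DDH t (Z u t) (P u t) (Y u v t, v t)) -
        fst (DB t (Z u t) q + DDH t (Z u t) (P u t) (Y u v t, v t))) \<le> L * norm (p - q)"
      using norm_fst_le_norm[of "DB t (Z u t) (p - q)"] norm_DB_le[OF t, of "Z u t" "p - q"] by (simp add: DB_diff[OF t])
  next
    fix x :: "real \<Rightarrow> real^'n" assume "continuous_on {0..T} x"
    then show "(\<lambda>s. fst (DB s (Z u s) (x s) + DDH s (Z u s) (P u s) (Y u v s, v s))) absolutely_integrable_on {0..T}"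
      by (rule absolutely_integrable_fst[OF DBDDH_int])
  qed (use T L in auto)
  from someI_ex[OF this] show "continuous_on {0..T} (\<Psi> u v)"
    and "t \<in> {0..T} \<Longrightarrow> \<Psi> u v t = DDg (X u T) (Y u v T) + integral {t..T} (\<lambda>s. fst (W u v s))"
    unfolding \<Psi>_def W_def by auto
qed

lemma W_int: "W u v absolutely_integrable_on {0..T}"
  using DBDDH_int[OF \<Psi>_cont] by (simp add: W_def[abs_def])

lemma \<Psi>_int: "(\<lambda>s. fst (W u v s)) absolutely_integrable_on {0..T}"
  by (rule absolutely_integrable_fst[OF W_int])

lemma W_measurable: "W u v \<in> borel_measurable (lebesgue_on {0..T})"
  using W_int by (rule absolutely_integrable_imp_borel_measurable) simp

end

end

end

section \<open>Bounds for state, adjoint and their linearisations\<close>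

context control_data
begin

abbreviation Cx where "Cx \<equiv> C_x T L x0"
abbreviation Kp where "Kp \<equiv> K_p T L x0"
abbreviation Cp where "Cp \<equiv> C_p T L x0"
abbreviation C1 where "C1 \<equiv> C_1 T L x0"
abbreviation Cy where "Cy \<equiv> C_y T L x0"
abbreviation K\<psi> where "K\<psi> \<equiv> K_psi T L x0"
abbreviation C\<psi> where "C\<psi> \<equiv> C_psi T L x0"
abbreviation C2 where "C2 \<equiv> C_2 T L x0"

text \<open>Lipschitz constant of the state in the L^1 distance of the controls. It is the second
  entry of C_x and the factor in front of C_y.\<close>

definition Ky where "Ky = L * exp (L * T)"

definition N :: "(real \<Rightarrow> real^'m) \<Rightarrow> real" where
  "N u = integral {0..T} (\<lambda>t. norm (u t))"

lemma Ky_pos: "0 < Ky" using L by (simp add: Ky_def)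
lemma Ky_le_Cx: "Ky \<le> Cx" by (simp add: Ky_def C_x_def)
lemma Cx_pos: "0 < Cx" using Ky_pos Ky_le_Cx by linarith
lemma Cx_le_C1: "Cx \<le> C1" by (simp add: C_1_def)
lemma C1_pos: "0 < C1" using Cx_pos Cx_le_C1 by linarith
lemma Kp_pos: "0 < Kp" using Cx_pos T L by (simp add: K_p_def)
lemma Kp_le_Cp: "Kp \<le> Cp" by (simp add: C_p_def)
lemma Cp_pos: "0 < Cp" using Kp_pos Kp_le_Cp by linarith
lemma CH_le_C1: "C_H T L x0 \<le> C1" by (simp add: C_1_def)

text \<open>The two entries of C_H in the form in which they are used: one multiplies |u - u'| at a
  single time, the other the L^1 distance of the controls.\<close>

lemma L_Cp_le_C1: "L * (1 + Cp) \<le> C1" "L * (Cp + Cx + Cp * Cx) \<le> C1"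
  using CH_le_C1 by (auto simp: C_H_def)

lemma Ky_le_Cy: "Ky \<le> Cy"
proof -
  have "0 \<le> (C1 + L * exp (L * T) + C1 * L * T * exp (L * T)) * T"
    using C1_pos L T by (intro mult_nonneg_nonneg add_nonneg_nonneg) auto
  then have "Ky * 1 \<le> Ky * ((C1 + L * exp (L * T) + C1 * L * T * exp (L * T)) * T + 1)"
    using Ky_pos by (intro mult_left_mono) auto
  then show ?thesis by (simp add: C_y_def Ky_def)
qed
lemma Cy_pos: "0 < Cy" using Ky_pos Ky_le_Cy by linarith
lemma K\<psi>_pos: "0 < K\<psi>" unfolding K_psi_def using Cy_pos C1_pos T L
  by (intro mult_pos_pos add_pos_pos) auto
lemma K\<psi>_le_C\<psi>: "K\<psi> \<le> C\<psi>" by (simp add: C_psi_def)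
lemma Cy_le_C2: "Cy \<le> C2" by (simp add: C_2_def)
lemma C\<psi>_le_C2: "C\<psi> \<le> C2" by (simp add: C_2_def)
lemma C2_pos: "0 < C2" using Cy_pos Cy_le_C2 by linarith

lemma N_nonneg: "u absolutely_integrable_on {0..T} \<Longrightarrow> 0 \<le> N u"
  unfolding N_def by (rule integral_nonneg[OF norm_integrable]) auto

lemma integral_affine_norm:
  fixes h :: "real \<Rightarrow> 'a::euclidean_space"
  assumes "h absolutely_integrable_on {0..T}"
  shows "(\<lambda>t. c + d * norm (h t)) integrable_on {0..T}"
    and "integral {0..T} (\<lambda>t. c + d * norm (h t)) = c * T + d * integral {0..T} (\<lambda>t. norm (h t))"
proof -
  have i: "(\<lambda>t. d * norm (h t)) integrable_on {0..T}"
    by (rule integrable_on_mult_right[OF norm_integrable[OF assms]])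
  have c: "(\<lambda>t. c) integrable_on {0..T}" by (rule integrable_on_const) simp
  show "(\<lambda>t. c + d * norm (h t)) integrable_on {0..T}" by (rule integrable_add[OF c i])
  show "integral {0..T} (\<lambda>t. c + d * norm (h t)) = c * T + d * integral {0..T} (\<lambda>t. norm (h t))"
    using T by (simp add: integral_add[OF c i])
qed

context
  fixes u :: "real \<Rightarrow> real^'m"
  assumes u: "u absolutely_integrable_on {0..T}"
begin

text \<open>Gronwall gives a constant part and a multiple of \<parallel>u\<parallel>_1; the two
  entries of C_x bound these separately.\<close>

lemma norm_X_le:
  assumes t: "t \<in> {0..T}"
  shows "norm (X u t) \<le> Cx * (1 + N u)"
proof -
  have "norm (X u t) \<le> exp (L * T) * (norm x0 + integral {0..T} (\<lambda>s. L + L * norm (u s)))"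
  proof (rule gronwall_forward[OF X_eq[OF u] X_int[OF u] less_imp_le[OF L] _ _ _ order_refl t])
    show "(\<lambda>s. L + L * norm (u s)) integrable_on {0..T}" by (rule integral_affine_norm[OF u])
    show "norm (b s (X u s) (u s)) \<le> L * norm (X u s) + (L + L * norm (u s))" if "s \<in> {0..T}" for s
      using b_growth[OF that, of "X u s" "u s"] by (simp add: algebra_simps)
  qed (use L in auto)
  also have "\<dots> = exp (L * T) * (norm x0 + L * T) + L * exp (L * T) * N u"
    by (simp add: integral_affine_norm[OF u] N_def algebra_simps)
  also have "\<dots> \<le> Cx + Cx * N u"
    using N_nonneg[OF u] by (intro add_mono mult_right_mono) (auto simp: C_x_def)
  finally show ?thesis by (simp add: algebra_simps)
qed

lemma norm_P_le:
  assumes t: "t \<in> {0..T}"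
  shows "norm (P u t) \<le> Kp * (1 + N u)"
proof -
  have N0: "0 \<le> N u" by (rule N_nonneg[OF u])
  \<comment> \<open>A bound for L (|x| + 1) along the state, used twice: for the terminal value g_x
    and for the part of f_x without the control.\<close>
  define q where "q = L * (Cx * (1 + N u) + 1)"
  have q0: "0 \<le> q" unfolding q_def using L Cx_pos N0 by (intro mult_nonneg_nonneg add_nonneg_nonneg) auto
  have "norm (P u t) \<le> exp (L * T) * (q + integral {0..T} (\<lambda>s. q + L * norm (u s)))"
  proof (rule gronwall_backward[OF P_eq[OF u] P_int[OF u] less_imp_le[OF L] _ _ _ _ t])
    show "(\<lambda>s. q + L * norm (u s)) integrable_on {0..T}" by (rule integral_affine_norm[OF u])
    show "norm (fst (DH s (Z u s) (P u s))) \<le> L * norm (P u s) + (q + L * norm (u s))" if s: "s \<in> {0..T}" for s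
    proof -
      have "norm (fst (DH s (Z u s) (P u s))) \<le> norm (DB s (Z u s) (P u s)) + norm (DF s (Z u s))"
        unfolding DH_def by (intro order_trans[OF norm_fst_le_norm] norm_triangle_ineq)
      also have "\<dots> \<le> L * norm (P u s) + L * (norm (X u s) + norm (u s) + 1)"
        using norm_DB_le[OF s, of "Z u s" "P u s"] norm_DF_le[OF s, of "Z u s"] by (simp add: Z_def)
      also have "\<dots> \<le> L * norm (P u s) + L * (Cx * (1 + N u) + norm (u s) + 1)"
        using norm_X_le[OF s] L by (intro add_mono mult_left_mono) auto
      finally show ?thesis by (simp add: q_def algebra_simps)
    qed
    have "norm (Dg (X u T)) \<le> L * (norm (X u T) + 1)" by (rule norm_Dg_le)
    also have "\<dots> \<le> q" unfolding q_def using norm_X_le[of T] T L by (intro mult_left_mono) auto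
    finally show "norm (Dg (X u T)) \<le> q" .
  qed (use L q0 in auto)
  also have "\<dots> = L * exp (L * T) * ((1 + T) * (Cx * (1 + N u) + 1) + N u)"
    unfolding integral_affine_norm(2)[OF u] by (simp add: N_def q_def algebra_simps)
  also have "\<dots> \<le> L * exp (L * T) * ((1 + Cx) * (T + 1) * (1 + N u))"
  proof -
    have "0 \<le> T * N u" using T N0 by simp
    then have "(1 + T) * (Cx * (1 + N u) + 1) + N u \<le> (1 + Cx) * (T + 1) * (1 + N u)"
      by (simp add: algebra_simps)
    then show ?thesis using L by (intro mult_left_mono) auto
  qed
  also have "\<dots> = Kp * (1 + N u)" by (simp add: K_p_def)
  finally show ?thesis .
qed

lemma one_plus_norm_P_le:
  assumes t: "t \<in> {0..T}"
  shows "1 + norm (P u t) \<le> (1 + Kp) * (1 + N u)"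
  using norm_P_le[OF t] N_nonneg[OF u] by (simp add: algebra_simps)

lemma norm_DDH_along_le:
  assumes t: "t \<in> {0..T}"
  shows "norm (DDH t (Z u t) (P u t) h) \<le> C1 * (1 + N u) * norm h"
proof -
  have "norm (DDH t (Z u t) (P u t) h) \<le> L * (1 + norm (P u t)) * norm h" by (rule norm_DDH_le[OF t])
  also have "\<dots> \<le> L * ((1 + Kp) * (1 + N u)) * norm h"
    using L by (intro mult_right_mono mult_left_mono one_plus_norm_P_le t) auto
  also have "\<dots> \<le> C1 * (1 + N u) * norm h"
  proof -
    have "L * (1 + Kp) \<le> L * (1 + Cp)" using L Kp_le_Cp by (intro mult_left_mono) auto
    then have "L * (1 + Kp) * ((1 + N u) * norm h) \<le> C1 * ((1 + N u) * norm h)"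
      using L_Cp_le_C1(1) N_nonneg[OF u] by (intro mult_right_mono) auto
    then show ?thesis by (simp add: mult.assoc)
  qed
  finally show ?thesis .
qed

context
  fixes v :: "real \<Rightarrow> real^'m"
  assumes v: "v absolutely_integrable_on {0..T}"
begin

lemma norm_Y_le:
  assumes t: "t \<in> {0..T}"
  shows "norm (Y u v t) \<le> Ky * N v"
proof -
  have "norm (Y u v t) \<le> exp (L * T) * (0 + integral {0..T} (\<lambda>s. 0 + L * norm (v s)))"
  proof (rule gronwall_forward[OF Y_eq[OF u v] Y_int[OF u v] less_imp_le[OF L] _ _ _ _ t])
    show "(\<lambda>s. 0 + L * norm (v s)) integrable_on {0..T}" by (rule integral_affine_norm[OF v])
    show "norm (B1 s (Z u s) (Y u v s, v s)) \<le> L * norm (Y u v s) + (0 + L * norm (v s))" if s: "s \<in> {0..T}" for s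
    proof -
      have "norm (B1 s (Z u s) (Y u v s, v s)) \<le> L * norm (Y u v s, v s)" by (rule B1_bound[OF s])
      also have "\<dots> \<le> L * (norm (Y u v s) + norm (v s))" using L by (intro mult_left_mono norm_Pair_le) auto
      finally show ?thesis by (simp add: algebra_simps)
    qed
  qed (use L in auto)
  also have "\<dots> = Ky * N v" unfolding integral_affine_norm(2)[OF v] by (simp add: N_def Ky_def)
  finally show ?thesis .
qed

lemma norm_Y_le': "t \<in> {0..T} \<Longrightarrow> norm (Y u v t) \<le> Cy * N v"
  using norm_Y_le[of t] mult_right_mono[OF Ky_le_Cy N_nonneg[OF v]] by linarith

lemma norm_\<Psi>_le:
  assumes t: "t \<in> {0..T}"
  shows "norm (\<Psi> u v t) \<le> K\<psi> * (1 + N u) * N v"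
proof -
  have N0: "0 \<le> N u" "0 \<le> N v" by (rule N_nonneg[OF u] N_nonneg[OF v])+
  define c where "c = C1 * (1 + N u)"
  have c0: "0 \<le> c" using C1_pos N0 by (simp add: c_def)
  have "norm (\<Psi> u v t) \<le> exp (L * T) * (L * (Cy * N v) + integral {0..T} (\<lambda>s. c * (Cy * N v) + c * norm (v s)))"
  proof (rule gronwall_backward[OF \<Psi>_eq[OF u v] \<Psi>_int[OF u v] less_imp_le[OF L] _ _ _ _ t])
    show "(\<lambda>s. c * (Cy * N v) + c * norm (v s)) integrable_on {0..T}" by (rule integral_affine_norm[OF v])
    show "norm (fst (W u v s)) \<le> L * norm (\<Psi> u v s) + (c * (Cy * N v) + c * norm (v s))" if s: "s \<in> {0..T}" for s
    proof -
      have "norm (fst (W u v s)) \<le> norm (DB s (Z u s) (\<Psi> u v s)) + norm (DDH s (Z u s) (P u s) (Y u v s, v s))"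
        unfolding W_def by (intro order_trans[OF norm_fst_le_norm] norm_triangle_ineq)
      also have "\<dots> \<le> L * norm (\<Psi> u v s) + c * norm (Y u v s, v s)"
        unfolding c_def by (intro add_mono norm_DB_le norm_DDH_along_le s)
      also have "\<dots> \<le> L * norm (\<Psi> u v s) + c * (Cy * N v + norm (v s))"
        using c0 norm_Y_le'[OF s] by (intro add_left_mono mult_left_mono order_trans[OF norm_Pair_le]) auto
      finally show ?thesis by (simp add: algebra_simps)
    qed
    have "norm (DDg (X u T) (Y u v T)) \<le> L * norm (Y u v T)" by (rule norm_DDg_le)
    also have "\<dots> \<le> L * (Cy * N v)" using norm_Y_le'[of T] T L by (intro mult_left_mono) auto
    finally show "norm (DDg (X u T) (Y u v T)) \<le> L * (Cy * N v)" .
  qed (use c0 N0 Cy_pos in auto)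
  also have "\<dots> = exp (L * T) * (L * Cy + c * (Cy * T + 1)) * N v"
    unfolding integral_affine_norm(2)[OF v] by (simp add: N_def algebra_simps)
  \<comment> \<open>The terminal datum carries no factor 1 + N u; it is multiplied by it so that
    K_psi can be factored out.\<close>
  also have "\<dots> \<le> exp (L * T) * (L * Cy * (1 + N u) + c * (Cy * T + 1)) * N v"
  proof -
    have "L * Cy * 1 \<le> L * Cy * (1 + N u)" using L Cy_pos N0 by (intro mult_left_mono) auto
    then show ?thesis using N0 by (intro mult_right_mono mult_left_mono add_right_mono) auto
  qed
  also have "\<dots> = K\<psi> * (1 + N u) * N v" by (simp add: K_psi_def c_def algebra_simps)
  finally show ?thesis .
qed

end

end

end

section \<open>Lipschitz dependence on the control\<close>

context control_data
begin

context
  fixes u u' :: "real \<Rightarrow> real^'m"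
  assumes u: "u absolutely_integrable_on {0..T}" and u': "u' absolutely_integrable_on {0..T}"
begin

abbreviation D where "D \<equiv> N (\<lambda>t. u t - u' t)"

lemmas uu' = absolutely_integrable_difference[OF u u']

lemma D_nonneg: "0 \<le> D" by (rule N_nonneg[OF uu'])

lemma norm_X_diff_le_Ky:
  assumes t: "t \<in> {0..T}"
  shows "norm (X u t - X u' t) \<le> Ky * D"
proof -
  have "norm (X u t - X u' t) \<le> exp (L * T) * (0 + integral {0..T} (\<lambda>s. 0 + L * norm (u s - u' s)))"
  proof (rule gronwall_forward[OF _ set_integral_diff(1)[OF X_int[OF u] X_int[OF u']] less_imp_le[OF L] _ _ _ _ t])
    show "X u s - X u' s = 0 + integral {0..s} (\<lambda>s. b s (X u s) (u s) - b s (X u' s) (u' s))" if s: "s \<in> {0..T}" for s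
      using integral_increment_diff(1)[OF X_int[OF u] X_int[OF u'] s] X_eq[OF u s] X_eq[OF u' s] by simp
    show "(\<lambda>s. 0 + L * norm (u s - u' s)) integrable_on {0..T}" by (rule integral_affine_norm[OF uu'])
    show "norm (b s (X u s) (u s) - b s (X u' s) (u' s)) \<le> L * norm (X u s - X u' s) + (0 + L * norm (u s - u' s))"
      if s: "s \<in> {0..T}" for s
      using b_lip[OF s, of "X u s" "u s" "X u' s" "u' s"] by (simp add: algebra_simps)
  qed (use L in auto)
  also have "\<dots> = Ky * D" unfolding integral_affine_norm(2)[OF uu'] by (simp add: N_def Ky_def)
  finally show ?thesis .
qed

lemma norm_X_diff_le:
  assumes t: "t \<in> {0..T}"
  shows "norm (X u t - X u' t) \<le> Cx * D"
  using norm_X_diff_le_Ky[OF t] mult_right_mono[OF Ky_le_Cx D_nonneg] by linarith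

lemma delta_le:
  assumes t: "t \<in> {0..T}"
  shows "norm (fst (Z u t) - fst (Z u' t)) + norm (snd (Z u t) - snd (Z u' t)) \<le> Cx * D + norm (u t - u' t)"
  using norm_X_diff_le[OF t] by (simp add: Z_def)

text \<open>The right-hand sides are compared through the term with the old adjoint
  \<open>P u\<close> at the new point \<open>Z u'\<close>. The first part then involves only the
  size of \<open>P u\<close>, and the second is linear in the difference and absorbed by Gronwall.
  The outcome is the second entry of C_p.\<close>

lemma norm_P_diff_le:
  assumes t: "t \<in> {0..T}"
  shows "norm (P u t - P u' t) \<le> Cp * (1 + N u) * D"
proof -
  have N0: "0 \<le> N u" "0 \<le> D" by (rule N_nonneg[OF u] D_nonneg)+
  define c where "c = L * ((1 + Kp) * (1 + N u))"
  have c0: "0 \<le> c" using L Kp_pos N0 by (simp add: c_def)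
  have "norm (P u t - P u' t) \<le> exp (L * T) * (L * (Cx * D) + integral {0..T} (\<lambda>s. c * (Cx * D) + c * norm (u s - u' s)))"
  proof (rule gronwall_backward[OF _ set_integral_diff(1)[OF P_int[OF u] P_int[OF u']] less_imp_le[OF L] _ _ _ _ t])
    show "P u s - P u' s = (Dg (X u T) - Dg (X u' T)) +
       integral {s..T} (\<lambda>s. fst (DH s (Z u s) (P u s)) - fst (DH s (Z u' s) (P u' s)))" if s: "s \<in> {0..T}" for s
      using integral_increment_diff(2)[OF P_int[OF u] P_int[OF u'] s] P_eq[OF u s] P_eq[OF u' s] by simp
    show "(\<lambda>s. c * (Cx * D) + c * norm (u s - u' s)) integrable_on {0..T}" by (rule integral_affine_norm[OF uu'])
    show "norm (fst (DH s (Z u s) (P u s)) - fst (DH s (Z u' s) (P u' s))) \<le>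
        L * norm (P u s - P u' s) + (c * (Cx * D) + c * norm (u s - u' s))" if s: "s \<in> {0..T}" for s
    proof -
      have "DH s (Z u s) (P u s) - DH s (Z u' s) (P u' s) =
        (DH s (Z u s) (P u s) - DH s (Z u' s) (P u s)) + DB s (Z u' s) (P u s - P u' s)"
        by (simp add: DH_def DB_diff[OF s])
      then have "norm (fst (DH s (Z u s) (P u s)) - fst (DH s (Z u' s) (P u' s))) \<le>
        norm (DH s (Z u s) (P u s) - DH s (Z u' s) (P u s)) + norm (DB s (Z u' s) (P u s - P u' s))"
        unfolding fst_diff[symmetric] by (simp only:) (intro order_trans[OF norm_fst_le_norm] norm_triangle_ineq)
      also have "\<dots> \<le> L * (norm (fst (Z u s) - fst (Z u' s)) + norm (snd (Z u s) - snd (Z u' s))) * (1 + norm (P u s))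
          + L * norm (P u s - P u' s)"
        by (intro add_mono norm_DH_diff_le norm_DB_le s)
      also have "\<dots> \<le> L * (Cx * D + norm (u s - u' s)) * ((1 + Kp) * (1 + N u)) + L * norm (P u s - P u' s)"
        using L Cx_pos N0 by (intro add_right_mono mult_mono mult_left_mono delta_le one_plus_norm_P_le[OF u] s) auto
      finally show ?thesis by (simp add: c_def algebra_simps)
    qed
    have "norm (Dg (X u T) - Dg (X u' T)) \<le> L * norm (X u T - X u' T)" by (rule norm_Dg_diff_le)
    also have "\<dots> \<le> L * (Cx * D)" using norm_X_diff_le[of T] T L by (intro mult_left_mono) auto
    finally show "norm (Dg (X u T) - Dg (X u' T)) \<le> L * (Cx * D)" .
  qed (use c0 N0 Cx_pos in auto)
  also have "\<dots> = exp (L * T) * (L * (Cx * D) + c * ((Cx * T + 1) * D))"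
    unfolding integral_affine_norm(2)[OF uu'] by (simp add: N_def algebra_simps)
  also have "\<dots> \<le> exp (L * T) * (L * (Cx * D) * (1 + N u) + c * ((Cx * T + 1) * D))"
  proof -
    have "L * (Cx * D) * 1 \<le> L * (Cx * D) * (1 + N u)" using L Cx_pos N0 by (intro mult_left_mono) auto
    then show ?thesis by (intro mult_left_mono add_right_mono) auto
  qed
  also have "\<dots> = (L * exp (L * T) * (Cx + (Cx * T + 1) * (1 + Kp))) * (1 + N u) * D"
    by (simp add: c_def algebra_simps)
  also have "\<dots> \<le> Cp * (1 + N u) * D"
    using N0 by (intro mult_right_mono) (auto simp: C_p_def)
  finally show ?thesis .
qed

text \<open>Origin of C_H: the L^1 distance D acts through the state and through the adjoint, which
  gives the first entry, and the control at time t acts directly, which gives the second.\<close>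

lemma norm_DDH_along_diff_le:
  assumes t: "t \<in> {0..T}"
  shows "norm (DDH t (Z u t) (P u t) h - DDH t (Z u' t) (P u' t) h) \<le> C1 * (1 + N u) * (D + norm (u t - u' t)) * norm h"
proof -
  have N0: "0 \<le> N u" "0 \<le> D" by (rule N_nonneg[OF u] D_nonneg)+
  define w where "w = norm (u t - u' t)"
  have w0: "0 \<le> w" by (simp add: w_def)
  have "norm (DDH t (Z u t) (P u t) h - DDH t (Z u' t) (P u' t) h) \<le>
    (L * (norm (fst (Z u t) - fst (Z u' t)) + norm (snd (Z u t) - snd (Z u' t))) * (1 + norm (P u t)) + L * norm (P u t - P u' t)) * norm h"
    by (rule norm_DDH_diff_le[OF t])
  also have "\<dots> \<le> (L * (Cx * D + w) * ((1 + Kp) * (1 + N u)) + L * (Cp * (1 + N u) * D)) * norm h"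
    unfolding w_def using L Cx_pos N0
    by (intro mult_right_mono add_mono mult_mono mult_left_mono delta_le one_plus_norm_P_le[OF u] norm_P_diff_le t) auto
  also have "\<dots> \<le> C1 * (1 + N u) * (D + w) * norm h"
  proof -
    \<comment> \<open>K_p is enlarged to C_p before regrouping by D and w, because C_H is written in
      terms of C_p.\<close>
    have "L * (Cx * D + w) * (1 + Kp) + L * (Cp * D) \<le> L * (Cx * D + w) * (1 + Cp) + L * (Cp * D)"
      using L Cx_pos N0 w0 Kp_le_Cp by (intro add_right_mono mult_left_mono) auto
    also have "\<dots> = L * (Cp + Cx + Cp * Cx) * D + L * (1 + Cp) * w" by (simp add: algebra_simps)
    also have "\<dots> \<le> C1 * D + C1 * w"
      using N0 w0 by (intro add_mono mult_right_mono L_Cp_le_C1) auto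
    finally have "(L * (Cx * D + w) * (1 + Kp) + L * (Cp * D)) * (1 + N u) \<le> (C1 * D + C1 * w) * (1 + N u)"
      using N0 by (intro mult_right_mono) auto
    then show ?thesis by (intro mult_right_mono) (auto simp: algebra_simps)
  qed
  finally show ?thesis by (simp add: w_def)
qed

text \<open>The only estimate that uses the independence assumption of part (ii).\<close>

lemma norm_Huu_diff_le:
  assumes t: "t \<in> {0..T}"
    and indep: "\<And>x w w' h k. B2 t (x, w) (0, h) (0, k) = B2 t (x, w') (0, h) (0, k)"
      "\<And>x w w' h k. F2 t (x, w) (0, h) (0, k) = F2 t (x, w') (0, h) (0, k)"
  shows "norm (snd (DDH t (Z u t) (P u t) (0, c)) - snd (DDH t (Z u' t) (P u' t) (0, c))) \<le> C1 * (1 + N u) * D * norm c"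
proof -
  have N0: "0 \<le> N u" "0 \<le> D" by (rule N_nonneg[OF u] D_nonneg)+
  \<comment> \<open>On pairs of control directions the second derivatives at (x', u') equal those at
    (x', u), so the two points compared differ in the state only and no pointwise |u - u'|
    arises.\<close>
  have "snd (DDH t (Z u' t) (P u' t) (0, c)) = snd (DDH t (X u' t, u t) (P u' t) (0, c))"
  proof (rule eq_of_inner)
    fix k
    have "snd (DDH t z p h) \<bullet> k = DDH t z p h \<bullet> (0, k)" for z p h by (simp add: inner_prod_def)
    then show "snd (DDH t (Z u' t) (P u' t) (0, c)) \<bullet> k = snd (DDH t (X u' t, u t) (P u' t) (0, c)) \<bullet> k"
      by (simp add: DDH_inner[OF t] Z_def indep(1)[of _ "u' t" _ _ "u t"] indep(2)[of _ "u' t" _ _ "u t"])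
  qed
  then have "norm (snd (DDH t (Z u t) (P u t) (0, c)) - snd (DDH t (Z u' t) (P u' t) (0, c))) \<le>
    norm (DDH t (Z u t) (P u t) (0, c) - DDH t (X u' t, u t) (P u' t) (0, c))"
    using norm_snd_le_norm[of "DDH t (Z u t) (P u t) (0, c) - DDH t (X u' t, u t) (P u' t) (0, c)"] by simp
  also have "\<dots> \<le> (L * norm (X u t - X u' t) * (1 + norm (P u t)) + L * norm (P u t - P u' t)) * norm c"
    using norm_DDH_diff_le[OF t, of "Z u t" "P u t" "(0, c)" "(X u' t, u t)" "P u' t"] by (simp add: Z_def)
  also have "\<dots> \<le> (L * (Cx * D) * ((1 + Kp) * (1 + N u)) + L * (Cp * (1 + N u) * D)) * norm c"
    using L Cx_pos N0
    by (intro mult_right_mono add_mono mult_mono mult_left_mono norm_X_diff_le one_plus_norm_P_le[OF u] norm_P_diff_le t) auto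
  also have "\<dots> \<le> C1 * (1 + N u) * D * norm c"
  proof -
    have "L * (Cx * D) * (1 + Kp) + L * (Cp * D) \<le> L * (Cx * D) * (1 + Cp) + L * (Cp * D)"
      using L Cx_pos N0 Kp_le_Cp by (intro add_right_mono mult_left_mono) auto
    also have "\<dots> = L * (Cp + Cx + Cp * Cx) * D" by (simp add: algebra_simps)
    also have "\<dots> \<le> C1 * D"
      using N0 by (intro mult_right_mono L_Cp_le_C1) auto
    finally have "(L * (Cx * D) * (1 + Kp) + L * (Cp * D)) * (1 + N u) \<le> (C1 * D) * (1 + N u)"
      using N0 by (intro mult_right_mono) auto
    then show ?thesis by (intro mult_right_mono) (auto simp: algebra_simps)
  qed
  finally show ?thesis .
qed

section \<open>Differences of the linearised solutions under an abstract bound M\<close>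

context
  fixes v :: "real \<Rightarrow> real^'m" and M :: real
  assumes v: "v absolutely_integrable_on {0..T}"
    and uv: "(\<lambda>t. norm (u t - u' t) * norm (v t)) integrable_on {0..T}"
    and S_le: "integral {0..T} (\<lambda>t. norm (u t - u' t) * norm (v t)) \<le> M"
    and DV_le: "D * N v \<le> T * M"
begin

abbreviation V where "V \<equiv> N v"
abbreviation \<delta>u where "\<delta>u t \<equiv> norm (u t - u' t)"

lemma M_nonneg: "0 \<le> M"
  using order_trans[OF _ S_le, of 0] integral_nonneg[OF uv] by simp

lemma V_nonneg: "0 \<le> V" by (rule N_nonneg[OF v])

lemma mixed_integral:
  shows "(\<lambda>s. (a * D + c * \<delta>u s) * (e + h * norm (v s))) integrable_on {0..T}"
    and "integral {0..T} (\<lambda>s. (a * D + c * \<delta>u s) * (e + h * norm (v s))) =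
      a * D * e * T + a * D * h * V + c * e * D + c * h * integral {0..T} (\<lambda>t. \<delta>u t * norm (v t))"
proof -
  have i1: "(\<lambda>s. a * D * e + (a * D * h) * norm (v s)) integrable_on {0..T}" by (rule integral_affine_norm[OF v])
  have i2: "(\<lambda>s. (c * e) * \<delta>u s) integrable_on {0..T}" by (rule integrable_on_mult_right[OF norm_integrable[OF uu']])
  have i3: "(\<lambda>s. (c * h) * (\<delta>u s * norm (v s))) integrable_on {0..T}" by (rule integrable_on_mult_right[OF uv])
  have eq: "(\<lambda>s. (a * D + c * \<delta>u s) * (e + h * norm (v s))) =
    (\<lambda>s. ((a * D * e + (a * D * h) * norm (v s)) + (c * e) * \<delta>u s) + (c * h) * (\<delta>u s * norm (v s)))"
    by (rule ext) (simp add: algebra_simps)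
  show "(\<lambda>s. (a * D + c * \<delta>u s) * (e + h * norm (v s))) integrable_on {0..T}"
    unfolding eq by (intro integrable_add i1 i2 i3)
  show "integral {0..T} (\<lambda>s. (a * D + c * \<delta>u s) * (e + h * norm (v s))) =
      a * D * e * T + a * D * h * V + c * e * D + c * h * integral {0..T} (\<lambda>t. \<delta>u t * norm (v t))"
    unfolding eq integral_add[OF integrable_add[OF i1 i2] i3] integral_add[OF i1 i2] integral_affine_norm(2)[OF v]
    by (simp add: N_def)
qed

text \<open>The constant e is scaled by V so that each term of the expanded product contains either
  D V, at most T M, or the integral of |u - u'| |v|, at most M. Thus M factors out.\<close>

lemma mixed_integral_le:
  assumes "0 \<le> a" "0 \<le> c" "0 \<le> e" "0 \<le> h"
  shows "integral {0..T} (\<lambda>s. (a * D + c * \<delta>u s) * (e * V + h * norm (v s))) \<le>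
    M * (a * e * T\<^sup>2 + a * h * T + c * e * T + c * h)"
proof -
  have "integral {0..T} (\<lambda>s. (a * D + c * \<delta>u s) * (e * V + h * norm (v s))) =
    a * e * T * (D * V) + a * h * (D * V) + c * e * (D * V) + c * h * integral {0..T} (\<lambda>t. \<delta>u t * norm (v t))"
    unfolding mixed_integral(2) by (simp add: algebra_simps)
  also have "\<dots> \<le> a * e * T * (T * M) + a * h * (T * M) + c * e * (T * M) + c * h * M"
    using assms T by (intro add_mono mult_left_mono DV_le S_le) auto
  also have "\<dots> = M * (a * e * T\<^sup>2 + a * h * T + c * e * T + c * h)"
    by (simp add: power2_eq_square algebra_simps)
  finally show ?thesis .
qed

lemma norm_Y_diff_le:
  assumes t: "t \<in> {0..T}"
  shows "norm (Y u v t - Y u' v t) \<le> Cy * M"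
proof -
  \<comment> \<open>The change of the coefficients acting on (y, v), with the state difference
    bounded by Cx D. For y the finer bound Ky V is inserted, since C_y is built from L
    e^{LT}.\<close>
  define k where "k s = (L * Cx * D + L * \<delta>u s) * (Ky * V + 1 * norm (v s))" for s
  have "norm (Y u v t - Y u' v t) \<le> exp (L * T) * (0 + integral {0..T} k)"
  proof (rule gronwall_forward[OF _ set_integral_diff(1)[OF Y_int[OF u v] Y_int[OF u' v]] less_imp_le[OF L] _ _ _ _ t])
    show "Y u v s - Y u' v s = 0 + integral {0..s} (\<lambda>s. B1 s (Z u s) (Y u v s, v s) - B1 s (Z u' s) (Y u' v s, v s))"
      if s: "s \<in> {0..T}" for s
      using integral_increment_diff(1)[OF Y_int[OF u v] Y_int[OF u' v] s] Y_eq[OF u v s] Y_eq[OF u' v s] by simp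
    show "k integrable_on {0..T}" unfolding k_def by (rule mixed_integral(1))
    show "norm (B1 s (Z u s) (Y u v s, v s) - B1 s (Z u' s) (Y u' v s, v s)) \<le> L * norm (Y u v s - Y u' v s) + k s"
      if s: "s \<in> {0..T}" for s
    proof -
      have e: "B1 s (Z u' s) (Y u v s, v s) - B1 s (Z u' s) (Y u' v s, v s) = B1 s (Z u' s) (Y u v s - Y u' v s, 0)"
        using linear_diff[OF second_derivative.linear_D1[OF second_order.axioms(1)[OF so_b[OF s]]], of "Z u' s" "(Y u v s, v s)" "(Y u' v s, v s)"] by simp
      \<comment> \<open>The coefficients at u' act on y - y', which Gronwall absorbs, and the
        difference of the coefficients acts on the known pair (y, v).\<close>
      have "B1 s (Z u s) (Y u v s, v s) - B1 s (Z u' s) (Y u' v s, v s) =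
        B1 s (Z u' s) (Y u v s - Y u' v s, 0) + (B1 s (Z u s) (Y u v s, v s) - B1 s (Z u' s) (Y u v s, v s))"
        by (simp add: e[symmetric])
      then have "norm (B1 s (Z u s) (Y u v s, v s) - B1 s (Z u' s) (Y u' v s, v s)) \<le>
        norm (B1 s (Z u' s) (Y u v s - Y u' v s, 0)) + norm (B1 s (Z u s) (Y u v s, v s) - B1 s (Z u' s) (Y u v s, v s))"
        by (simp only: norm_triangle_ineq)
      also have "\<dots> \<le> L * norm (Y u v s - Y u' v s) + L * norm (Z u s - Z u' s) * norm (Y u v s, v s)"
        using B1_bound[OF s, of "Z u' s" "(Y u v s - Y u' v s, 0)"] second_order.D1_lip[OF so_b[OF s], of "Z u s" "(Y u v s, v s)" "Z u' s"]
        by simp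
      also have "\<dots> \<le> L * norm (Y u v s - Y u' v s) + L * (Cx * D + \<delta>u s) * (Ky * V + norm (v s))"
        using L Cx_pos D_nonneg norm_Y_le[OF u v s] norm_diff_le_fst_snd[of "Z u s" "Z u' s"] delta_le[OF s] norm_Pair_le[of "Y u v s" "v s"]
        by (intro add_left_mono mult_mono mult_left_mono) auto
      finally show ?thesis by (simp add: k_def algebra_simps)
    qed
    show "0 \<le> k s" for s
      unfolding k_def using L Cx_pos D_nonneg Ky_pos V_nonneg by (intro mult_nonneg_nonneg add_nonneg_nonneg) auto
  qed (use L in auto)
  also have "\<dots> \<le> exp (L * T) * (M * (L * Cx * Ky * T\<^sup>2 + L * Cx * 1 * T + L * Ky * T + L * 1))"
    unfolding k_def using mixed_integral_le[of "L * Cx" L Ky 1] L Cx_pos Ky_pos by (intro mult_left_mono) auto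
  \<comment> \<open>Factoring L e^{LT} out of the four terms already gives the expression for C_y,
    except that C_x still has to be enlarged to C_1.\<close>
  also have "\<dots> = Ky * (Cx * (Ky * T\<^sup>2 + T) + Ky * T + 1) * M"
    by (simp add: Ky_def algebra_simps)
  also have "\<dots> \<le> Ky * (C1 * (Ky * T\<^sup>2 + T) + Ky * T + 1) * M"
    using Ky_pos T M_nonneg Cx_le_C1 by (intro mult_right_mono mult_left_mono add_right_mono) auto
  also have "\<dots> = Cy * M" by (simp add: C_y_def Ky_def power2_eq_square algebra_simps)
  finally show ?thesis .
qed

text \<open>Each summand has one difference and one factor of known size: \<open>\<Psi>\<close> and
  the adjoint are sized at u, and \<open>Y u' v\<close> is harmless because its bound does not
  depend on the control. Splitting (y, v) into (y, 0) and (0, v) isolates the terms in which v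
  occurs pointwise.\<close>

lemma W_diff_eq:
  assumes t: "t \<in> {0..T}"
  shows "W u v t - W u' v t = (DB t (Z u t) (\<Psi> u v t) - DB t (Z u' t) (\<Psi> u v t))
    + DB t (Z u' t) (\<Psi> u v t - \<Psi> u' v t)
    + (DDH t (Z u t) (P u t) (Y u' v t, 0) - DDH t (Z u' t) (P u' t) (Y u' v t, 0))
    + (DDH t (Z u t) (P u t) (0, v t) - DDH t (Z u' t) (P u' t) (0, v t))
    + DDH t (Z u t) (P u t) (Y u v t - Y u' v t, 0)"
proof -
  have s: "DDH t z p (y, c) = DDH t z p (y, 0) + DDH t z p (0, c)" for z p y c
    using DDH_add[OF t, of z p "(y, 0)" "(0, c)"] by simp
  have d: "DDH t z p (y - y', 0) = DDH t z p (y, 0) - DDH t z p (y', 0)" for z p y y'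
    using DDH_diff[OF t, of z p "(y, 0)" "(y', 0)"] by simp
  show ?thesis
    unfolding W_def s[of _ _ "Y u v t" "v t"] s[of _ _ "Y u' v t" "v t"] d DB_diff[OF t] by (simp add: algebra_simps)
qed

text \<open>All terms of the difference of \<open>W\<close> except the one carrying \<open>\<psi> - \<psi>'\<close> and the one carrying \<open>H\<^bsub>\<cdot>u\<^esub>v\<close>.\<close>

definition k0 where "k0 s = (1 + N u) * ((L * (Cx * D + \<delta>u s)) * (K\<psi> * V) + C1 * (D + \<delta>u s) * (Cy * V) + C1 * (Cy * M))"

lemma norm_DB_term_le:
  assumes t: "t \<in> {0..T}"
  shows "norm (DB t (Z u t) (\<Psi> u v t) - DB t (Z u' t) (\<Psi> u v t)) \<le> L * (Cx * D + \<delta>u t) * (K\<psi> * (1 + N u) * V)"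
proof -
  have "norm (DB t (Z u t) (\<Psi> u v t) - DB t (Z u' t) (\<Psi> u v t)) \<le>
    L * (norm (fst (Z u t) - fst (Z u' t)) + norm (snd (Z u t) - snd (Z u' t))) * norm (\<Psi> u v t)"
    by (rule norm_DB_diff_le[OF t])
  also have "\<dots> \<le> L * (Cx * D + \<delta>u t) * (K\<psi> * (1 + N u) * V)"
    using L Cx_pos D_nonneg by (intro mult_mono mult_left_mono delta_le norm_\<Psi>_le[OF u v] t) auto
  finally show ?thesis .
qed

lemma norm_W_partial_diff_le:
  assumes t: "t \<in> {0..T}"
  shows "norm (DB t (Z u t) (\<Psi> u v t) - DB t (Z u' t) (\<Psi> u v t))
    + norm (DDH t (Z u t) (P u t) (Y u' v t, 0) - DDH t (Z u' t) (P u' t) (Y u' v t, 0))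
    + norm (DDH t (Z u t) (P u t) (Y u v t - Y u' v t, 0)) \<le> k0 t"
proof -
  have N0: "0 \<le> N u" by (rule N_nonneg[OF u])
  have a: "norm (DDH t (Z u t) (P u t) (Y u' v t, 0) - DDH t (Z u' t) (P u' t) (Y u' v t, 0)) \<le> C1 * (1 + N u) * (D + \<delta>u t) * (Cy * V)"
  proof -
    have "norm (DDH t (Z u t) (P u t) (Y u' v t, 0) - DDH t (Z u' t) (P u' t) (Y u' v t, 0)) \<le> C1 * (1 + N u) * (D + \<delta>u t) * norm (Y u' v t)"
      using norm_DDH_along_diff_le[OF t, of "(Y u' v t, 0)"] by simp
    also have "\<dots> \<le> C1 * (1 + N u) * (D + \<delta>u t) * (Cy * V)"
      using C1_pos N0 D_nonneg by (intro mult_left_mono norm_Y_le'[OF u' v t]) auto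
    finally show ?thesis .
  qed
  have c: "norm (DDH t (Z u t) (P u t) (Y u v t - Y u' v t, 0)) \<le> C1 * (1 + N u) * (Cy * M)"
  proof -
    have "norm (DDH t (Z u t) (P u t) (Y u v t - Y u' v t, 0)) \<le> C1 * (1 + N u) * norm (Y u v t - Y u' v t)"
      using norm_DDH_along_le[OF u t, of "(Y u v t - Y u' v t, 0)"] by simp
    also have "\<dots> \<le> C1 * (1 + N u) * (Cy * M)"
      using C1_pos N0 by (intro mult_left_mono norm_Y_diff_le t) auto
    finally show ?thesis .
  qed
  show ?thesis using norm_DB_term_le[OF t] a c by (simp add: k0_def algebra_simps)
qed

text \<open>The three groups in the second entry of C_psi come from the terminal condition, from the
  change of b_x acting on \<psi>, and from the second derivatives of the Hamiltonian.\<close>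

lemma norm_\<Psi>_diff_le:
  assumes t: "t \<in> {0..T}"
  shows "norm (\<Psi> u v t - \<Psi> u' v t) \<le> C\<psi> * (1 + N u) * M"
proof -
  have N0: "0 \<le> N u" by (rule N_nonneg[OF u])
  \<comment> \<open>This is \<open>k0\<close> plus the contribution of the pointwise term in v; the
    coefficients 0 and 1 of |v| bring both products into the shape of
    \<open>mixed_integral\<close>.\<close>
  define k where "k s = (1 + N u) * ((L * Cx * D + L * \<delta>u s) * (K\<psi> * V + 0 * norm (v s))
    + (C1 * D + C1 * \<delta>u s) * (Cy * V + 1 * norm (v s)) + C1 * (Cy * M))" for s
  define \<iota>1 where "\<iota>1 = (\<lambda>s. (L * Cx * D + L * \<delta>u s) * (K\<psi> * V + 0 * norm (v s)))"
  define \<iota>2 where "\<iota>2 = (\<lambda>s. (C1 * D + C1 * \<delta>u s) * (Cy * V + 1 * norm (v s)))"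
  have i1: "\<iota>1 integrable_on {0..T}" and i2: "\<iota>2 integrable_on {0..T}" and i3: "(\<lambda>s. C1 * (Cy * M)) integrable_on {0..T}"
    unfolding \<iota>1_def \<iota>2_def by (rule mixed_integral(1) mixed_integral(1) integrable_on_const | simp)+
  have k: "k = (\<lambda>s. (1 + N u) * ((\<iota>1 s + \<iota>2 s) + C1 * (Cy * M)))"
    by (rule ext) (simp add: k_def \<iota>1_def \<iota>2_def)
  have ki: "k integrable_on {0..T}" unfolding k by (intro integrable_on_mult_right integrable_add i1 i2 i3)
  have "norm (\<Psi> u v t - \<Psi> u' v t) \<le> exp (L * T) * ((1 + N u) * (L * Cy * (C1 * T + 1) * M) + integral {0..T} k)"
  proof (rule gronwall_backward[OF _ set_integral_diff(1)[OF \<Psi>_int[OF u v] \<Psi>_int[OF u' v]] less_imp_le[OF L] ki _ _ _ t])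
    show "\<Psi> u v s - \<Psi> u' v s = (DDg (X u T) (Y u v T) - DDg (X u' T) (Y u' v T)) + integral {s..T} (\<lambda>s. fst (W u v s) - fst (W u' v s))"
      if s: "s \<in> {0..T}" for s
      using integral_increment_diff(2)[OF \<Psi>_int[OF u v] \<Psi>_int[OF u' v] s] \<Psi>_eq[OF u v s] \<Psi>_eq[OF u' v s] by simp
    show "norm (fst (W u v s) - fst (W u' v s)) \<le> L * norm (\<Psi> u v s - \<Psi> u' v s) + k s" if s: "s \<in> {0..T}" for s
    proof -
      have "norm (fst (W u v s) - fst (W u' v s)) \<le> norm (W u v s - W u' v s)"
        using norm_fst_le_norm[of "W u v s - W u' v s"] by simp
      also have "\<dots> \<le> norm (DB s (Z u s) (\<Psi> u v s) - DB s (Z u' s) (\<Psi> u v s))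
    + norm (DB s (Z u' s) (\<Psi> u v s - \<Psi> u' v s))
    + norm (DDH s (Z u s) (P u s) (Y u' v s, 0) - DDH s (Z u' s) (P u' s) (Y u' v s, 0))
    + norm (DDH s (Z u s) (P u s) (0, v s) - DDH s (Z u' s) (P u' s) (0, v s))
    + norm (DDH s (Z u s) (P u s) (Y u v s - Y u' v s, 0))"
        unfolding W_diff_eq[OF s] by (intro order_trans[OF norm_triangle_ineq] add_right_mono) simp
      also have "\<dots> \<le> k0 s + L * norm (\<Psi> u v s - \<Psi> u' v s) + C1 * (1 + N u) * (D + \<delta>u s) * norm (v s)"
        using norm_W_partial_diff_le[OF s] norm_DB_le[OF s, of "Z u' s" "\<Psi> u v s - \<Psi> u' v s"] norm_DDH_along_diff_le[OF s, of "(0, v s)"]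
        by simp
      also have "\<dots> = L * norm (\<Psi> u v s - \<Psi> u' v s) + k s"
        by (simp add: k0_def k_def algebra_simps)
      finally show ?thesis .
    qed
    show "0 \<le> k s" for s
      unfolding k_def using L Cx_pos D_nonneg K\<psi>_pos V_nonneg N0 C1_pos Cy_pos M_nonneg
      by (intro mult_nonneg_nonneg add_nonneg_nonneg) auto
    have "DDg (X u T) (Y u v T) - DDg (X u' T) (Y u' v T) =
       (DDg (X u T) (Y u v T) - DDg (X u' T) (Y u v T)) + DDg (X u' T) (Y u v T - Y u' v T)"
      by (simp add: DDg_diff)
    then have "norm (DDg (X u T) (Y u v T) - DDg (X u' T) (Y u' v T)) \<le>
       norm (DDg (X u T) (Y u v T) - DDg (X u' T) (Y u v T)) + norm (DDg (X u' T) (Y u v T - Y u' v T))"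
      by (simp only: norm_triangle_ineq)
    also have "\<dots> \<le> L * norm (X u T - X u' T) * norm (Y u v T) + L * norm (Y u v T - Y u' v T)"
      by (intro add_mono norm_DDg_diff_le norm_DDg_le)
    also have "\<dots> \<le> L * (Cx * D) * (Cy * V) + L * (Cy * M)"
      using L T Cx_pos D_nonneg norm_X_diff_le[of T] norm_Y_le'[OF u v, of T] norm_Y_diff_le[of T]
      by (intro add_mono mult_mono mult_left_mono) auto
    also have "\<dots> = L * Cy * (Cx * (D * V) + M)" by (simp add: algebra_simps)
    also have "\<dots> \<le> L * Cy * (C1 * (T * M) + M)"
      using L Cy_pos Cx_pos C1_pos D_nonneg V_nonneg
      by (intro mult_left_mono add_right_mono mult_mono Cx_le_C1 DV_le) auto
    also have "\<dots> = 1 * (L * Cy * (C1 * T + 1) * M)" by (simp add: algebra_simps)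
    also have "\<dots> \<le> (1 + N u) * (L * Cy * (C1 * T + 1) * M)"
      using N0 L Cy_pos C1_pos T M_nonneg by (intro mult_right_mono mult_nonneg_nonneg add_nonneg_nonneg) auto
    finally show "norm (DDg (X u T) (Y u v T) - DDg (X u' T) (Y u' v T)) \<le> (1 + N u) * (L * Cy * (C1 * T + 1) * M)" .
  qed
  also have "integral {0..T} k = (1 + N u) * (integral {0..T} \<iota>1 + integral {0..T} \<iota>2 + C1 * (Cy * M) * T)"
    unfolding k using T by (simp only: integral_mult_right integral_add[OF integrable_add[OF i1 i2] i3] integral_add[OF i1 i2]) simp
  also have "exp (L * T) * ((1 + N u) * (L * Cy * (C1 * T + 1) * M) + \<dots>) \<le>
     exp (L * T) * ((1 + N u) * (L * Cy * (C1 * T + 1) * M) +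
      (1 + N u) * (M * (L * Cx * K\<psi> * T\<^sup>2 + L * Cx * 0 * T + L * K\<psi> * T + L * 0) + M * (C1 * Cy * T\<^sup>2 + C1 * 1 * T + C1 * Cy * T + C1 * 1) + C1 * (Cy * M) * T))"
    unfolding \<iota>1_def \<iota>2_def
    using L Cx_pos K\<psi>_pos C1_pos Cy_pos N0
    by (intro mult_left_mono add_left_mono add_right_mono add_mono mixed_integral_le) auto
  also have "\<dots> \<le> exp (L * T) * ((1 + N u) * (L * Cy * (C1 * T + 1) * M) +
      (1 + N u) * (M * (L * C1 * K\<psi> * T\<^sup>2 + L * K\<psi> * T) + M * (C1 * Cy * T\<^sup>2 + C1 * 1 * T + C1 * Cy * T + C1 * 1) + C1 * (Cy * M) * T))"
    using N0 L T K\<psi>_pos M_nonneg Cx_le_C1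
    by (intro mult_left_mono add_left_mono add_right_mono) (auto intro!: mult_right_mono)
  \<comment> \<open>The summand 2 C_y T has two sources: the term c e T of the mixed product and the
    constant C_1 C_y M integrated over [0,T].\<close>
  also have "\<dots> = exp (L * T) *
       (L * Cy * (C1 * T + 1) + L * K\<psi> * T * (C1 * T + 1)
        + C1 * (Cy * T\<^sup>2 + 2 * Cy * T + T + 1)) * (1 + N u) * M"
    by (simp add: power2_eq_square algebra_simps)
  also have "\<dots> \<le> C\<psi> * (1 + N u) * M"
    using N0 M_nonneg by (intro mult_right_mono) (auto simp: C_psi_def)
  finally show ?thesis .
qed

text \<open>The summand \<open>H\<^bsub>uu\<^esub>v\<close> is kept separate because it is the only one for which the two parts
  of the theorem use different bounds.\<close>

lemma norm_snd_W_diff_le: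
  assumes t: "t \<in> {0..T}"
  shows "norm (snd (W u v t) - snd (W u' v t)) \<le>
    (1 + N u) * ((L * (Cx * D + \<delta>u t)) * (C2 * V) + C1 * (D + \<delta>u t) * (C2 * V) + C1 * (C2 * M) + L * (C2 * M))
    + norm (snd (DDH t (Z u t) (P u t) (0, v t)) - snd (DDH t (Z u' t) (P u' t) (0, v t)))"
proof -
  have N0: "0 \<le> N u" by (rule N_nonneg[OF u])
  define q where "q = DB t (Z u t) (\<Psi> u v t) - DB t (Z u' t) (\<Psi> u v t)
    + DB t (Z u' t) (\<Psi> u v t - \<Psi> u' v t)
    + (DDH t (Z u t) (P u t) (Y u' v t, 0) - DDH t (Z u' t) (P u' t) (Y u' v t, 0))
    + DDH t (Z u t) (P u t) (Y u v t - Y u' v t, 0)"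
  have "snd (W u v t) - snd (W u' v t) = snd (W u v t - W u' v t)" by simp
  also have "\<dots> = snd q + (snd (DDH t (Z u t) (P u t) (0, v t)) - snd (DDH t (Z u' t) (P u' t) (0, v t)))"
    unfolding W_diff_eq[OF t] q_def by simp
  finally have "norm (snd (W u v t) - snd (W u' v t)) \<le>
    norm (snd q) + norm (snd (DDH t (Z u t) (P u t) (0, v t)) - snd (DDH t (Z u' t) (P u' t) (0, v t)))"
    by (simp only: norm_triangle_ineq)
  moreover have "norm (snd q) \<le> norm q" by (rule norm_snd_le_norm)
  moreover have "norm q \<le> norm (DB t (Z u t) (\<Psi> u v t) - DB t (Z u' t) (\<Psi> u v t))
    + norm (DB t (Z u' t) (\<Psi> u v t - \<Psi> u' v t))
    + norm (DDH t (Z u t) (P u t) (Y u' v t, 0) - DDH t (Z u' t) (P u' t) (Y u' v t, 0))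
    + norm (DDH t (Z u t) (P u t) (Y u v t - Y u' v t, 0))"
    unfolding q_def by (intro order_trans[OF norm_triangle_ineq] add_right_mono) simp
  moreover have "norm (DB t (Z u' t) (\<Psi> u v t - \<Psi> u' v t)) \<le> L * (C2 * (1 + N u) * M)"
  proof -
    have "norm (DB t (Z u' t) (\<Psi> u v t - \<Psi> u' v t)) \<le> L * norm (\<Psi> u v t - \<Psi> u' v t)" by (rule norm_DB_le[OF t])
    also have "\<dots> \<le> L * (C\<psi> * (1 + N u) * M)" using L by (intro mult_left_mono norm_\<Psi>_diff_le t) auto
    also have "\<dots> \<le> L * (C2 * (1 + N u) * M)"
      using L N0 M_nonneg by (intro mult_left_mono mult_right_mono C\<psi>_le_C2) auto
    finally show ?thesis .
  qed
  \<comment> \<open>C_2 dominates C_y, K_psi and C_psi alike, so all remaining terms can share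
    it.\<close>
  moreover have "k0 t \<le> (1 + N u) * ((L * (Cx * D + \<delta>u t)) * (C2 * V) + C1 * (D + \<delta>u t) * (C2 * V) + C1 * (C2 * M))"
    unfolding k0_def using N0 L Cx_pos D_nonneg V_nonneg C1_pos M_nonneg K\<psi>_le_C\<psi> C\<psi>_le_C2
    by (intro mult_left_mono add_mono mult_right_mono Cy_le_C2) auto
  ultimately show ?thesis
    using norm_W_partial_diff_le[OF t] by (simp add: algebra_simps)
qed

end

end

end

section \<open>The gradient of the cost\<close>

lemma lp_norm_mono_AE:
  fixes v :: "real \<Rightarrow> 'e::euclidean_space" and w :: "real \<Rightarrow> 'f::euclidean_space"
  assumes v: "v \<in> borel_measurable (lebesgue_on {0..T})"
    and le: "AE t in lebesgue_on {0..T}. norm (v t) \<le> norm (w t)"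
  shows "lp_norm T \<beta> v \<le> lp_norm T \<beta> w"
proof (cases "w \<in> borel_measurable (lebesgue_on {0..T})")
  case w: True
  show ?thesis
  proof (cases "\<beta> = \<infinity>")
    case True
    have "esssup (lebesgue_on {0..T}) (\<lambda>t. ennreal (norm (v t))) \<le> esssup (lebesgue_on {0..T}) (\<lambda>t. ennreal (norm (w t)))"
    proof (rule esssup_AE_mono)
      show "(\<lambda>t. ennreal (norm (v t))) \<in> borel_measurable (lebesgue_on {0..T})" using v by measurable
      show "AE t in lebesgue_on {0..T}. ennreal (norm (v t)) \<le> ennreal (norm (w t))"
        using le by eventually_elim (rule ennreal_leI)
    qed
    then show ?thesis using v w True by (simp add: lp_norm_def)
  next
    case False
    define r where "r = enn2real \<beta>"
    define I where "I = (\<integral>\<^sup>+t. ennreal (norm (v t) powr r) \<partial>lebesgue_on {0..T})"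
    define J where "J = (\<integral>\<^sup>+t. ennreal (norm (w t) powr r) \<partial>lebesgue_on {0..T})"
    have r0: "0 \<le> r" by (simp add: r_def)
    have IJ: "I \<le> J" unfolding I_def J_def
      by (rule nn_integral_mono_AE, use le in eventually_elim) (use r0 in \<open>auto intro!: ennreal_leI powr_mono2\<close>)
    have "(if I < \<infinity> then ennreal (enn2real I powr (1 / r)) else \<infinity>) \<le> (if J < \<infinity> then ennreal (enn2real J powr (1 / r)) else \<infinity>)"
    proof (cases "J < \<infinity>")
      case True
      then have "I < \<infinity>" using IJ by (rule order_le_less_trans[rotated])
      moreover have "enn2real I \<le> enn2real J" using IJ True by (intro enn2real_mono) auto
      ultimately show ?thesis using True r0 by (auto intro!: ennreal_leI powr_mono2)
    qed auto
    moreover have "lp_norm T \<beta> v = (if I < \<infinity> then ennreal (enn2real I powr (1 / r)) else \<infinity>)"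
      using v False by (simp add: lp_norm_def Let_def I_def r_def)
    moreover have "lp_norm T \<beta> w = (if J < \<infinity> then ennreal (enn2real J powr (1 / r)) else \<infinity>)"
      using w False by (simp add: lp_norm_def Let_def J_def r_def)
    ultimately show ?thesis by simp
  qed
qed (simp add: lp_norm_def)

lemma lp_space_two_affine_bound:
  fixes h :: "real \<Rightarrow> 'a::euclidean_space" and u :: "real \<Rightarrow> 'b::euclidean_space" and v :: "real \<Rightarrow> 'c::euclidean_space"
  assumes T: "0 < T" and h: "h \<in> borel_measurable (lebesgue_on {0..T})"
    and u: "u \<in> lp_space T 2" and v: "v \<in> lp_space T 2" and cd: "0 \<le> c" "0 \<le> d" "0 \<le> e"
    and le: "\<And>t. t \<in> {0..T} \<Longrightarrow> norm (h t) \<le> c + d * norm (u t) + e * norm (v t)"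
  shows "h \<in> lp_space T 2"
proof -
  obtain a b where ab: "0 \<le> a" "lp_norm T 2 u = ennreal a" "0 \<le> b" "lp_norm T 2 v = ennreal b"
    using u v unfolding lp_space_iff by blast
  have "lp_norm T 2 h \<le> ennreal (c * T powr enn2real (1 / 2) + d * a + e * b)"
    by (rule lp_norm_affine_bound[OF _ T h _ _ ab(1,3) cd le]) (use ab in auto)
  then show ?thesis by (auto simp: lp_space_def intro: le_less_trans)
qed

lemma lp_space_two_absolutely_integrable:
  fixes u :: "real \<Rightarrow> 'b::euclidean_space"
  assumes "0 < T" "u \<in> lp_space T 2"
  shows "u absolutely_integrable_on {0..T}"
proof -
  obtain c where "0 \<le> c" "lp_norm T 2 u = ennreal c" using assms(2) unfolding lp_space_iff by blast
  then show ?thesis using lp_norm_one_le(1)[OF order_refl assms(1), of u c] by simp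
qed

lemma lp_space_two_inner:
  fixes u v :: "real \<Rightarrow> 'b::euclidean_space"
  assumes u: "u \<in> lp_space T 2" and v: "v \<in> lp_space T 2"
  shows "(\<lambda>t. u t \<bullet> v t) absolutely_integrable_on {0..T}"
proof (rule measurable_bounded_by_integrable_imp_absolutely_integrable)
  have [measurable]: "u \<in> borel_measurable (lebesgue_on {0..T})" "v \<in> borel_measurable (lebesgue_on {0..T})"
    using u v by (auto simp: lp_space_two_iff)
  show "(\<lambda>t. u t \<bullet> v t) \<in> borel_measurable (lebesgue_on {0..T})" by measurable
  show "(\<lambda>t. (norm (u t))\<^sup>2 + (norm (v t))\<^sup>2) integrable_on {0..T}"
    using u v by (auto simp: lp_space_two_iff intro: integrable_add)
  fix t
  have "norm (u t \<bullet> v t) \<le> norm (u t) * norm (v t)" using Cauchy_Schwarz_ineq2[of "u t" "v t"] by simp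
  also have "\<dots> \<le> (norm (u t))\<^sup>2 + (norm (v t))\<^sup>2"
  proof -
    have "2 * (norm (u t) * norm (v t)) \<le> (norm (u t))\<^sup>2 + (norm (v t))\<^sup>2"
      using sum_squares_bound[of "norm (u t)" "norm (v t)"] by (simp only: mult.assoc)
    moreover have "0 \<le> norm (u t) * norm (v t)" by simp
    ultimately show ?thesis by linarith
  qed
  finally show "norm (u t \<bullet> v t) \<le> (norm (u t))\<^sup>2 + (norm (v t))\<^sup>2" .
qed auto

lemma lp_space_two_linear_combination:
  fixes u v :: "real \<Rightarrow> 'b::euclidean_space"
  assumes T: "0 < T" and u: "u \<in> lp_space T 2" and v: "v \<in> lp_space T 2"
  shows "(\<lambda>t. c *\<^sub>R u t + d *\<^sub>R v t) \<in> lp_space T 2"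
proof (rule lp_space_two_affine_bound[OF T _ u v order_refl abs_ge_zero abs_ge_zero, of _ c d])
  have [measurable]: "u \<in> borel_measurable (lebesgue_on {0..T})" "v \<in> borel_measurable (lebesgue_on {0..T})"
    using u v by (auto simp: lp_space_two_iff)
  show "(\<lambda>t. c *\<^sub>R u t + d *\<^sub>R v t) \<in> borel_measurable (lebesgue_on {0..T})" by measurable
  show "norm (c *\<^sub>R u t + d *\<^sub>R v t) \<le> 0 + \<bar>c\<bar> * norm (u t) + \<bar>d\<bar> * norm (v t)" for t
    using norm_triangle_ineq[of "c *\<^sub>R u t" "d *\<^sub>R v t"] by simp
qed

text \<open>Both limits are tested with the direction G - G', which is admissible because it lies in
  L^2.\<close>

lemma has_gateaux_gradient_unique_AE:
  fixes G G' :: "real \<Rightarrow> 'e::euclidean_space"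
  assumes T: "0 < T" and G: "has_gateaux_gradient T J u G" and G': "has_gateaux_gradient T J u G'"
  shows "AE t in lebesgue_on {0..T}. G t = G' t"
proof -
  have L2: "G \<in> lp_space T 2" "G' \<in> lp_space T 2" using G G' by (auto simp: has_gateaux_gradient_def)
  define v where "v t = G t - G' t" for t
  have v: "v \<in> lp_space T 2"
    using lp_space_two_linear_combination[OF T L2, of 1 "-1"] by (simp add: v_def[abs_def])
  have "(\<integral>t. G t \<bullet> v t \<partial>lebesgue_on {0..T}) = (\<integral>t. G' t \<bullet> v t \<partial>lebesgue_on {0..T})"
  proof (rule tendsto_unique[OF at_neq_bot])
    show "((\<lambda>\<epsilon>. (J (\<lambda>t. u t + \<epsilon> *\<^sub>R v t) - J u) / \<epsilon>) \<longlongrightarrow> (\<integral>t. G t \<bullet> v t \<partial>lebesgue_on {0..T})) (at (0::real))"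
      using G v unfolding has_gateaux_gradient_def by blast
    show "((\<lambda>\<epsilon>. (J (\<lambda>t. u t + \<epsilon> *\<^sub>R v t) - J u) / \<epsilon>) \<longlongrightarrow> (\<integral>t. G' t \<bullet> v t \<partial>lebesgue_on {0..T})) (at (0::real))"
      using G' v unfolding has_gateaux_gradient_def by blast
  qed
  moreover have i: "integrable (lebesgue_on {0..T}) (\<lambda>t. G t \<bullet> v t)" "integrable (lebesgue_on {0..T}) (\<lambda>t. G' t \<bullet> v t)"
    using lp_space_two_inner[OF L2(1) v] lp_space_two_inner[OF L2(2) v]
    by (auto simp: absolutely_integrable_iff_integrable_lebesgue_on)
  ultimately have "(\<integral>t. G t \<bullet> v t - G' t \<bullet> v t \<partial>lebesgue_on {0..T}) = 0"
    by (simp add: Bochner_Integration.integral_diff[OF i])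
  then have "(\<integral>t. v t \<bullet> v t \<partial>lebesgue_on {0..T}) = 0" by (simp add: v_def inner_diff_left)
  moreover have vi: "integrable (lebesgue_on {0..T}) (\<lambda>t. v t \<bullet> v t)"
    using lp_space_two_inner[OF v v] by (simp add: absolutely_integrable_iff_integrable_lebesgue_on)
  ultimately have "AE t in lebesgue_on {0..T}. v t \<bullet> v t = 0"
    using integral_nonneg_eq_0_iff_AE[OF vi] by simp
  then show ?thesis by eventually_elim (simp add: v_def)
qed

context control_data
begin

text \<open>H_u along the trajectory; the other component of the same vector drives the adjoint
  equation.\<close>

definition G :: "(real \<Rightarrow> real^'m) \<Rightarrow> real \<Rightarrow> real^'m" where
  "G u t = snd (DH t (Z u t) (P u t))"

context
  fixes u :: "real \<Rightarrow> real^'m"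
  assumes u2: "u \<in> lp_space T 2"
begin

lemmas u1 = lp_space_two_absolutely_integrable[OF T u2]

lemma f_int: "(\<lambda>t. f t (X u t) (u t)) absolutely_integrable_on {0..T}"
proof -
  have um: "u \<in> borel_measurable (lebesgue_on {0..T})" and ui: "(\<lambda>t. (norm (u t))\<^sup>2) integrable_on {0..T}"
    using u2 by (auto simp: lp_space_two_iff)
  obtain C where C: "0 \<le> C" "\<And>t. t \<in> {0..T} \<Longrightarrow> norm (X u t) \<le> C"
    using continuous_on_Icc_bounded[OF X_cont[OF u1]] by blast
  show ?thesis
  proof (rule measurable_bounded_by_integrable_imp_absolutely_integrable)
    show "(\<lambda>t. f t (X u t) (u t)) \<in> borel_measurable (lebesgue_on {0..T})"
      using f_measurable[OF borel_measurable_continuous_Pair[OF X_cont[OF u1] um]] by simp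
    show "(\<lambda>t. L * (C\<^sup>2 + 1) + L * (norm (u t))\<^sup>2) integrable_on {0..T}"
      by (intro integrable_add integrable_on_const integrable_on_mult_right ui) auto
    fix t assume t: "t \<in> {0..T}"
    have "norm (f t (X u t) (u t)) \<le> L * ((norm (X u t))\<^sup>2 + (norm (u t))\<^sup>2 + 1)" using f_growth[OF t] by simp
    also have "\<dots> \<le> L * (C\<^sup>2 + (norm (u t))\<^sup>2 + 1)"
      using L C t by (intro mult_left_mono add_right_mono power_mono) auto
    finally show "norm (f t (X u t) (u t)) \<le> L * (C\<^sup>2 + 1) + L * (norm (u t))\<^sup>2" by (simp add: algebra_simps)
  qed auto
qed

lemma cost_eq: "cost T b f g x0 u = integral {0..T} (\<lambda>t. f t (X u t) (u t)) + g (X u T)"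
  unfolding cost_def X_def[symmetric]
  using lebesgue_integral_eq_integral[of "{0..T}" "\<lambda>t. f t (X u t) (u t)"] f_int
  by (simp add: absolutely_integrable_iff_integrable_lebesgue_on)

lemma G_L2: "G u \<in> lp_space T 2"
proof (rule lp_space_two_affine_bound[OF T _ u2 u2, where d = L and e = 0])
  obtain C where C: "0 \<le> C" "\<And>t. t \<in> {0..T} \<Longrightarrow> norm (X u t) \<le> C"
    using continuous_on_Icc_bounded[OF X_cont[OF u1]] by blast
  obtain C' where C': "0 \<le> C'" "\<And>t. t \<in> {0..T} \<Longrightarrow> norm (P u t) \<le> C'"
    using continuous_on_Icc_bounded[OF P_cont[OF u1]] by blast
  have "(\<lambda>t. DH t (Z u t) (P u t)) \<in> borel_measurable (lebesgue_on {0..T})"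
    by (intro DH_measurable Z_measurable[OF u1] continuous_on_Icc_measurable P_cont[OF u1])
  then show "G u \<in> borel_measurable (lebesgue_on {0..T})"
    unfolding G_def[abs_def]
    by (rule measurable_compose) (intro borel_measurable_continuous_onI continuous_on_snd continuous_on_id)
  have N0: "0 \<le> N u" by (rule N_nonneg[OF u1])
  show "0 \<le> L * (Kp * (1 + N u)) + L * (Cx * (1 + N u) + 1)"
    using L Kp_pos Cx_pos N0 by (intro add_nonneg_nonneg mult_nonneg_nonneg) auto
  fix t assume t: "t \<in> {0..T}"
  have "norm (G u t) \<le> norm (DB t (Z u t) (P u t)) + norm (DF t (Z u t))"
    unfolding G_def DH_def by (intro order_trans[OF norm_snd_le_norm] norm_triangle_ineq)
  also have "\<dots> \<le> L * norm (P u t) + L * (norm (X u t) + norm (u t) + 1)"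
    using norm_DB_le[OF t, of "Z u t" "P u t"] norm_DF_le[OF t, of "Z u t"] by (simp add: Z_def)
  also have "\<dots> \<le> L * (Kp * (1 + N u)) + L * (Cx * (1 + N u) + norm (u t) + 1)"
    using L norm_P_le[OF u1 t] norm_X_le[OF u1 t] by (intro add_mono mult_left_mono) auto
  finally show "norm (G u t) \<le> (L * (Kp * (1 + N u)) + L * (Cx * (1 + N u) + 1)) + L * norm (u t) + 0 * norm (u t)"
    by (simp add: algebra_simps)
qed (use L in auto)

text \<open>Integration by parts is stated for two functions integrated from time 0, so the adjoint
  is rewritten with its initial value.\<close>

lemma P_eq_forward:
  assumes t: "t \<in> {0..T}"
  shows "P u t = P u 0 + integral {0..t} (\<lambda>s. - fst (DH s (Z u s) (P u s)))"
proof -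
  have i: "(\<lambda>s. fst (DH s (Z u s) (P u s))) integrable_on {0..T}"
    using P_int[OF u1] by (simp add: absolutely_integrable_on_def)
  have "integral {0..t} (\<lambda>s. fst (DH s (Z u s) (P u s))) + integral {t..T} (\<lambda>s. fst (DH s (Z u s) (P u s)))
     = integral {0..T} (\<lambda>s. fst (DH s (Z u s) (P u s)))"
    by (rule Henstock_Kurzweil_Integration.integral_combine[OF _ _ i]) (use t in auto)
  then show ?thesis using P_eq[OF u1 t] P_eq[OF u1, of 0] T by (simp add: algebra_simps)
qed

end

text \<open>Testing the equation of \<open>x' - x\<close> with the adjoint \<open>p\<close> removes the first order terms in
  \<open>x' - x\<close>, so that no linearised state is needed for the gradient.\<close>

lemma first_order_remainder:
  fixes u u' :: "real \<Rightarrow> real^'m"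
  assumes u2: "u \<in> lp_space T 2" and u2': "u' \<in> lp_space T 2"
    and w: "\<And>t. t \<in> {0..T} \<Longrightarrow> norm (Z u' t - Z u t) \<le> w t" and wi: "(\<lambda>t. (w t)\<^sup>2) integrable_on {0..T}"
  shows "\<bar>cost T b f g x0 u' - cost T b f g x0 u - integral {0..T} (\<lambda>t. G u t \<bullet> (u' t - u t))\<bar> \<le>
    L * ((1 + Kp) * (1 + N u)) * integral {0..T} (\<lambda>t. (w t)\<^sup>2) + L * (norm (X u' T - X u T))\<^sup>2"
proof -
  note u1 = u1[OF u2] and u1' = u1[OF u2']
  define p where "p = P u"
  define \<Delta>x where "\<Delta>x t = X u' t - X u t" for t
  define bd where "bd t = b t (X u' t) (u' t) - b t (X u t) (u t)" for t
  define h where "h t = - fst (DH t (Z u t) (P u t))" for t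
  have bdi: "bd absolutely_integrable_on {0..T}"
    unfolding bd_def using set_integral_diff(1)[OF X_int[OF u1'] X_int[OF u1]] .
  have hi: "h absolutely_integrable_on {0..T}"
    unfolding h_def using absolutely_integrable_scaleR_left[OF P_int[OF u1], of "-1"] by simp
  have xeq: "\<Delta>x t = 0 + integral {0..t} bd" if "t \<in> {0..T}" for t
    using integral_increment_diff(1)[OF X_int[OF u1'] X_int[OF u1] that] X_eq[OF u1 that] X_eq[OF u1' that]
    by (simp add: \<Delta>x_def bd_def[abs_def])
  have xc: "continuous_on {0..T} \<Delta>x" using continuous_on_integral_equation[OF xeq bdi] .
  have peq: "P u t = P u 0 + integral {0..t} h" if "t \<in> {0..T}" for t
    unfolding h_def[abs_def] by (rule P_eq_forward[OF u2 that])
  have parts: "p T \<bullet> \<Delta>x T - p 0 \<bullet> \<Delta>x 0 = integral {0..T} (\<lambda>t. p t \<bullet> bd t + h t \<bullet> \<Delta>x t)"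
    unfolding p_def
    using integral_by_parts_absolutely_continuous[where x = "P u" and y = \<Delta>x, OF less_imp_le[OF T] hi bdi peq xeq] .
  have pT: "p T = Dg (X u T)" using P_eq[OF u1, of T] T by (simp add: p_def)
  have x0: "\<Delta>x 0 = 0" using xeq[of 0] T by simp
  have i1: "(\<lambda>t. p t \<bullet> bd t) absolutely_integrable_on {0..T}"
    unfolding p_def by (rule absolutely_integrable_inner_continuous[OF P_cont[OF u1] bdi])
  have i2: "(\<lambda>t. h t \<bullet> \<Delta>x t) absolutely_integrable_on {0..T}"
    using absolutely_integrable_inner_continuous[OF xc hi] by (simp add: inner_commute)
  define fd where "fd t = f t (X u' t) (u' t) - f t (X u t) (u t)" for t
  have i3: "fd absolutely_integrable_on {0..T}"
    unfolding fd_def using set_integral_diff(1)[OF f_int[OF u2'] f_int[OF u2]] .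
  have ud: "(\<lambda>t. u' t - u t) \<in> lp_space T 2"
    using lp_space_two_linear_combination[OF T u2' u2, of 1 "-1"] by simp
  have i4: "(\<lambda>t. G u t \<bullet> (u' t - u t)) absolutely_integrable_on {0..T}"
    by (rule lp_space_two_inner[OF G_L2[OF u2] ud])
  define \<rho> where "\<rho> t = fd t + (p t \<bullet> bd t + h t \<bullet> \<Delta>x t) - G u t \<bullet> (u' t - u t)" for t
  have i1': "(\<lambda>t. p t \<bullet> bd t) integrable_on {0..T}" and i2': "(\<lambda>t. h t \<bullet> \<Delta>x t) integrable_on {0..T}"
    and i3': "fd integrable_on {0..T}" and i4': "(\<lambda>t. G u t \<bullet> (u' t - u t)) integrable_on {0..T}"
    using i1 i2 i3 i4 by (auto simp: absolutely_integrable_on_def)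
  have \<rho>i: "\<rho> integrable_on {0..T}" unfolding \<rho>_def by (intro integrable_diff integrable_add i1' i2' i3' i4')
  have \<rho>_le: "norm (\<rho> t) \<le> L * ((1 + Kp) * (1 + N u)) * (w t)\<^sup>2" if t: "t \<in> {0..T}" for t
  proof -
    define z d where "z = Z u t" and "d = Z u' t - Z u t"
    have d: "d = (\<Delta>x t, u' t - u t)" by (simp add: d_def Z_def \<Delta>x_def)
    \<comment> \<open>Pairing the gradient of the Hamiltonian with d yields exactly the linear terms
      of \<rho>, so that only the Taylor remainders of f and of b, the latter paired with p, are
      left.\<close>
    have "DH t z (p t) \<bullet> d = - h t \<bullet> \<Delta>x t + G u t \<bullet> (u' t - u t)"
      by (simp add: d h_def G_def z_def p_def inner_prod_def)
    moreover have "DH t z (p t) \<bullet> d = B1 t z d \<bullet> p t + F1 t z d"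
      by (simp add: DH_def inner_add_left DB_inner[OF t] DF_inner[OF t])
    moreover have "(bd t - B1 t z d) \<bullet> p t = p t \<bullet> bd t - B1 t z d \<bullet> p t"
      by (simp only: inner_diff_left inner_commute[of "p t"])
    ultimately have "\<rho> t = (fd t - F1 t z d) + (bd t - B1 t z d) \<bullet> p t"
      unfolding \<rho>_def inner_minus_left by linarith
    moreover have "\<bar>fd t - F1 t z d\<bar> \<le> L * (norm d)\<^sup>2"
      using f_taylor[OF t, of "Z u' t" "Z u t"] by (simp add: fd_def d_def z_def Z_def)
    moreover have "norm (bd t - B1 t z d) \<le> L * (norm d)\<^sup>2"
      using b_taylor[OF t, of "Z u' t" "Z u t"] by (simp add: bd_def d_def z_def Z_def)
    then have "\<bar>(bd t - B1 t z d) \<bullet> p t\<bar> \<le> L * (norm d)\<^sup>2 * norm (p t)"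
      by (rule order_trans[OF Cauchy_Schwarz_ineq2 mult_right_mono]) simp
    ultimately have "norm (\<rho> t) \<le> L * (norm d)\<^sup>2 + L * (norm d)\<^sup>2 * norm (p t)"
      unfolding real_norm_def by linarith
    also have "\<dots> = L * (norm d)\<^sup>2 * (1 + norm (p t))" by (simp add: algebra_simps)
    finally have "norm (\<rho> t) \<le> L * (norm d)\<^sup>2 * (1 + norm (p t))" .
    also have "\<dots> \<le> L * (w t)\<^sup>2 * ((1 + Kp) * (1 + N u))"
      using L w[OF t] one_plus_norm_P_le[OF u1 t]
      by (intro mult_mono mult_left_mono power_mono) (auto simp: d_def p_def)
    finally show ?thesis by (simp only: mult.assoc mult.commute[of "(w t)\<^sup>2"])
  qed
  have "cost T b f g x0 u' - cost T b f g x0 u - integral {0..T} (\<lambda>t. G u t \<bullet> (u' t - u t))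
    = integral {0..T} fd + (g (X u' T) - g (X u T)) - integral {0..T} (\<lambda>t. G u t \<bullet> (u' t - u t))"
    using f_int[OF u2] f_int[OF u2'] unfolding cost_eq[OF u2] cost_eq[OF u2'] fd_def
    by (simp add: integral_diff absolutely_integrable_on_def)
  \<comment> \<open>The boundary terms reduce to g_x \<bullet> \<Delta>x(T), since \<Delta>x
    vanishes at 0. Adding the integral and subtracting these terms leaves the first order remainder
    of g.\<close>
  also have "\<dots> = integral {0..T} fd + integral {0..T} (\<lambda>t. p t \<bullet> bd t + h t \<bullet> \<Delta>x t) - integral {0..T} (\<lambda>t. G u t \<bullet> (u' t - u t))
     + (g (X u' T) - g (X u T) - Dg (X u T) \<bullet> \<Delta>x T)"
    unfolding parts[symmetric] pT x0 by simp
  also have "integral {0..T} fd + integral {0..T} (\<lambda>t. p t \<bullet> bd t + h t \<bullet> \<Delta>x t) - integral {0..T} (\<lambda>t. G u t \<bullet> (u' t - u t))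
     = integral {0..T} \<rho>"
    unfolding \<rho>_def
    by (simp add: integral_diff[OF integrable_add[OF i3' integrable_add[OF i1' i2']] i4'] integral_add[OF i3' integrable_add[OF i1' i2']])
  finally have eq: "cost T b f g x0 u' - cost T b f g x0 u - integral {0..T} (\<lambda>t. G u t \<bullet> (u' t - u t)) =
    integral {0..T} \<rho> + (g (X u' T) - g (X u T) - Dg (X u T) \<bullet> \<Delta>x T)" .
  have "\<bar>integral {0..T} \<rho>\<bar> \<le> integral {0..T} (\<lambda>t. L * ((1 + Kp) * (1 + N u)) * (w t)\<^sup>2)"
    using integral_norm_bound_integral[OF \<rho>i integrable_on_mult_right[OF wi] \<rho>_le] by simp
  then have "\<bar>integral {0..T} \<rho>\<bar> \<le> L * ((1 + Kp) * (1 + N u)) * integral {0..T} (\<lambda>t. (w t)\<^sup>2)" by simp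
  moreover have "\<bar>g (X u' T) - g (X u T) - Dg (X u T) \<bullet> \<Delta>x T\<bar> \<le> L * (norm (X u' T - X u T))\<^sup>2"
    using g_taylor[of "X u' T" "X u T"] by (simp only: \<Delta>x_def)
  ultimately show ?thesis unfolding eq by linarith
qed

end

section \<open>Linearity and boundedness of the solution operator of the linearised system\<close>

context control_data
begin

context
  fixes u v1 v2 :: "real \<Rightarrow> real^'m" and c d :: real
  assumes u: "u absolutely_integrable_on {0..T}"
    and v1: "v1 absolutely_integrable_on {0..T}" and v2: "v2 absolutely_integrable_on {0..T}"
begin

abbreviation v12 where "v12 \<equiv> \<lambda>t. c *\<^sub>R v1 t + d *\<^sub>R v2 t"

lemmas v12 = absolutely_integrable_linear_combination[OF v1 v2, of c d]

text \<open>Linearity in \<open>v\<close> is uniqueness for the linear equations, i.e. Gronwall with zero data.\<close>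

lemma Y_linear:
  assumes t: "t \<in> {0..T}"
  shows "Y u v12 t = c *\<^sub>R Y u v1 t + d *\<^sub>R Y u v2 t"
proof -
  define h where "h s = B1 s (Z u s) (Y u v12 s, v12 s) - (c *\<^sub>R B1 s (Z u s) (Y u v1 s, v1 s) + d *\<^sub>R B1 s (Z u s) (Y u v2 s, v2 s))" for s
  have i12: "(\<lambda>s. c *\<^sub>R B1 s (Z u s) (Y u v1 s, v1 s) + d *\<^sub>R B1 s (Z u s) (Y u v2 s, v2 s)) absolutely_integrable_on {0..T}"
    by (rule set_integral_add(1)[OF absolutely_integrable_scaleR_left[OF Y_int[OF u v1]] absolutely_integrable_scaleR_left[OF Y_int[OF u v2]]])
  have hi: "h absolutely_integrable_on {0..T}"
    unfolding h_def by (rule set_integral_diff(1)[OF Y_int[OF u v12] i12])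
  have "norm (Y u v12 t - (c *\<^sub>R Y u v1 t + d *\<^sub>R Y u v2 t)) \<le> exp (L * T) * (0 + integral {0..T} (\<lambda>s. 0))"
  proof (rule gronwall_forward[where x = "\<lambda>t. Y u v12 t - (c *\<^sub>R Y u v1 t + d *\<^sub>R Y u v2 t)" and a = 0, OF _ hi less_imp_le[OF L] _ _ _ _ t])
    fix s assume s: "s \<in> {0..T}"
    have sub: "{0..s} \<subseteq> {0..T}" using s by auto
    have "integral {0..s} h = integral {0..s} (\<lambda>s. B1 s (Z u s) (Y u v12 s, v12 s)) -
       integral {0..s} (\<lambda>s. c *\<^sub>R B1 s (Z u s) (Y u v1 s, v1 s) + d *\<^sub>R B1 s (Z u s) (Y u v2 s, v2 s))"
      unfolding h_def by (rule integral_diff[OF integrable_restrict[OF Y_int[OF u v12] sub] integrable_restrict[OF i12 sub]])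
    also have "integral {0..s} (\<lambda>s. c *\<^sub>R B1 s (Z u s) (Y u v1 s, v1 s) + d *\<^sub>R B1 s (Z u s) (Y u v2 s, v2 s)) = c *\<^sub>R Y u v1 s + d *\<^sub>R Y u v2 s"
      unfolding integral_linear_combination[OF integrable_restrict[OF Y_int[OF u v1] sub] integrable_restrict[OF Y_int[OF u v2] sub]]
      using Y_eq[OF u v1 s] Y_eq[OF u v2 s] by simp
    finally show "Y u v12 s - (c *\<^sub>R Y u v1 s + d *\<^sub>R Y u v2 s) = 0 + integral {0..s} h"
      using Y_eq[OF u v12 s] by simp
    have lin: "linear (B1 s (Z u s))" by (rule second_derivative.linear_D1[OF second_order.axioms(1)[OF so_b[OF s]]])
    have "h s = B1 s (Z u s) ((Y u v12 s, v12 s) - (c *\<^sub>R (Y u v1 s, v1 s) + d *\<^sub>R (Y u v2 s, v2 s)))"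
      by (simp only: h_def linear_diff[OF lin] linear_add[OF lin] linear_scale[OF lin])
    also have "(Y u v12 s, v12 s) - (c *\<^sub>R (Y u v1 s, v1 s) + d *\<^sub>R (Y u v2 s, v2 s)) = (Y u v12 s - (c *\<^sub>R Y u v1 s + d *\<^sub>R Y u v2 s), 0)"
      by simp
    finally show "norm (h s) \<le> L * norm (Y u v12 s - (c *\<^sub>R Y u v1 s + d *\<^sub>R Y u v2 s)) + 0"
      using B1_bound[OF s, of "Z u s" "(Y u v12 s - (c *\<^sub>R Y u v1 s + d *\<^sub>R Y u v2 s), 0)"] by simp
  qed auto
  then show ?thesis by simp
qed

lemma \<Psi>_linear:
  assumes t: "t \<in> {0..T}"
  shows "\<Psi> u v12 t = c *\<^sub>R \<Psi> u v1 t + d *\<^sub>R \<Psi> u v2 t"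
proof -
  define h where "h s = fst (W u v12 s) - (c *\<^sub>R fst (W u v1 s) + d *\<^sub>R fst (W u v2 s))" for s
  have i12: "(\<lambda>s. c *\<^sub>R fst (W u v1 s) + d *\<^sub>R fst (W u v2 s)) absolutely_integrable_on {0..T}"
    by (rule set_integral_add(1)[OF absolutely_integrable_scaleR_left[OF \<Psi>_int[OF u v1]] absolutely_integrable_scaleR_left[OF \<Psi>_int[OF u v2]]])
  have hi: "h absolutely_integrable_on {0..T}"
    unfolding h_def by (rule set_integral_diff(1)[OF \<Psi>_int[OF u v12] i12])
  have TT: "T \<in> {0..T}" using T by simp
  have "norm (\<Psi> u v12 t - (c *\<^sub>R \<Psi> u v1 t + d *\<^sub>R \<Psi> u v2 t)) \<le> exp (L * T) * (0 + integral {0..T} (\<lambda>s. 0))"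
  proof (rule gronwall_backward[where x = "\<lambda>t. \<Psi> u v12 t - (c *\<^sub>R \<Psi> u v1 t + d *\<^sub>R \<Psi> u v2 t)" and a = 0, OF _ hi less_imp_le[OF L] _ _ _ _ t])
    fix s assume s: "s \<in> {0..T}"
    have sub: "{s..T} \<subseteq> {0..T}" using s by auto
    have "integral {s..T} h = integral {s..T} (\<lambda>s. fst (W u v12 s)) -
       integral {s..T} (\<lambda>s. c *\<^sub>R fst (W u v1 s) + d *\<^sub>R fst (W u v2 s))"
      unfolding h_def by (rule integral_diff[OF integrable_restrict[OF \<Psi>_int[OF u v12] sub] integrable_restrict[OF i12 sub]])
    also have "integral {s..T} (\<lambda>s. c *\<^sub>R fst (W u v1 s) + d *\<^sub>R fst (W u v2 s)) =
        c *\<^sub>R (\<Psi> u v1 s - DDg (X u T) (Y u v1 T)) + d *\<^sub>R (\<Psi> u v2 s - DDg (X u T) (Y u v2 T))"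
      unfolding integral_linear_combination[OF integrable_restrict[OF \<Psi>_int[OF u v1] sub] integrable_restrict[OF \<Psi>_int[OF u v2] sub]]
      using \<Psi>_eq[OF u v1 s] \<Psi>_eq[OF u v2 s] by simp
    finally have e1: "integral {s..T} h = integral {s..T} (\<lambda>s. fst (W u v12 s)) -
        (c *\<^sub>R (\<Psi> u v1 s - DDg (X u T) (Y u v1 T)) + d *\<^sub>R (\<Psi> u v2 s - DDg (X u T) (Y u v2 T)))" .
    have e2: "\<Psi> u v12 s = (c *\<^sub>R DDg (X u T) (Y u v1 T) + d *\<^sub>R DDg (X u T) (Y u v2 T)) + integral {s..T} (\<lambda>s. fst (W u v12 s))"
      using \<Psi>_eq[OF u v12 s] unfolding Y_linear[OF TT] DDg_add DDg_scaleR .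
    show "\<Psi> u v12 s - (c *\<^sub>R \<Psi> u v1 s + d *\<^sub>R \<Psi> u v2 s) = 0 + integral {s..T} h"
      unfolding e1 e2 by (simp add: scaleR_diff_right)
    have e: "W u v12 s - (c *\<^sub>R W u v1 s + d *\<^sub>R W u v2 s) = DB s (Z u s) (\<Psi> u v12 s - (c *\<^sub>R \<Psi> u v1 s + d *\<^sub>R \<Psi> u v2 s))
       + DDH s (Z u s) (P u s) ((Y u v12 s, v12 s) - (c *\<^sub>R (Y u v1 s, v1 s) + d *\<^sub>R (Y u v2 s, v2 s)))"
      by (simp only: W_def DB_diff[OF s] DB_add[OF s] DB_scaleR[OF s] DDH_diff[OF s] DDH_add[OF s] DDH_scaleR[OF s])
        (simp add: algebra_simps)
    \<comment> \<open>By linearity of y the arguments of the second derivative cancel, so the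
      difference solves the homogeneous adjoint equation with zero terminal value.\<close>
    have z: "(Y u v12 s, v12 s) - (c *\<^sub>R (Y u v1 s, v1 s) + d *\<^sub>R (Y u v2 s, v2 s)) = 0"
      by (simp add: Y_linear[OF s] zero_prod_def)
    have "h s = fst (W u v12 s - (c *\<^sub>R W u v1 s + d *\<^sub>R W u v2 s))" by (simp add: h_def)
    also have "\<dots> = fst (DB s (Z u s) (\<Psi> u v12 s - (c *\<^sub>R \<Psi> u v1 s + d *\<^sub>R \<Psi> u v2 s)))"
      unfolding e z using DDH_scaleR[OF s, of "Z u s" "P u s" 0 0] by simp
    finally have "h s = fst (DB s (Z u s) (\<Psi> u v12 s - (c *\<^sub>R \<Psi> u v1 s + d *\<^sub>R \<Psi> u v2 s)))" .
    then show "norm (h s) \<le> L * norm (\<Psi> u v12 s - (c *\<^sub>R \<Psi> u v1 s + d *\<^sub>R \<Psi> u v2 s)) + 0"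
      by (simp only: add_0_right) (rule order_trans[OF norm_fst_le_norm norm_DB_le[OF s]])
  qed auto
  then show ?thesis by simp
qed

lemma W_linear:
  assumes t: "t \<in> {0..T}"
  shows "W u v12 t = c *\<^sub>R W u v1 t + d *\<^sub>R W u v2 t"
proof -
  have "(Y u v12 t, v12 t) = c *\<^sub>R (Y u v1 t, v1 t) + d *\<^sub>R (Y u v2 t, v2 t)" by (simp add: Y_linear[OF t])
  then have "DDH t (Z u t) (P u t) (Y u v12 t, v12 t) =
    c *\<^sub>R DDH t (Z u t) (P u t) (Y u v1 t, v1 t) + d *\<^sub>R DDH t (Z u t) (P u t) (Y u v2 t, v2 t)"
    by (simp only: DDH_add[OF t] DDH_scaleR[OF t])
  moreover have "DB t (Z u t) (\<Psi> u v12 t) = c *\<^sub>R DB t (Z u t) (\<Psi> u v1 t) + d *\<^sub>R DB t (Z u t) (\<Psi> u v2 t)"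
    by (simp only: \<Psi>_linear[OF t] DB_add[OF t] DB_scaleR[OF t])
  ultimately show ?thesis by (simp add: W_def algebra_simps)
qed

end

lemma norm_W_le:
  assumes u: "u absolutely_integrable_on {0..T}" and v: "v absolutely_integrable_on {0..T}" and t: "t \<in> {0..T}"
  shows "norm (W u v t) \<le> (L * (K\<psi> * (1 + N u)) + C1 * (1 + N u) * Cy) * N v + C1 * (1 + N u) * norm (v t)"
proof -
  have N0: "0 \<le> N u" "0 \<le> N v" by (rule N_nonneg[OF u] N_nonneg[OF v])+
  have "norm (W u v t) \<le> norm (DB t (Z u t) (\<Psi> u v t)) + norm (DDH t (Z u t) (P u t) (Y u v t, v t))"
    unfolding W_def by (rule norm_triangle_ineq)
  also have "\<dots> \<le> L * norm (\<Psi> u v t) + C1 * (1 + N u) * norm (Y u v t, v t)"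
    by (intro add_mono norm_DB_le norm_DDH_along_le u t)
  also have "\<dots> \<le> L * (K\<psi> * (1 + N u) * N v) + C1 * (1 + N u) * (Cy * N v + norm (v t))"
    using L C1_pos N0 norm_\<Psi>_le[OF u v t] norm_Y_le'[OF u v t]
    by (intro add_mono mult_left_mono order_trans[OF norm_Pair_le] add_right_mono) auto
  finally show ?thesis by (simp add: algebra_simps)
qed

lemma snd_W_measurable:
  assumes u: "u absolutely_integrable_on {0..T}" and v: "v absolutely_integrable_on {0..T}"
  shows "(\<lambda>t. snd (W u v t)) \<in> borel_measurable (lebesgue_on {0..T})"
  by (rule measurable_compose[OF W_measurable[OF u v]])
    (intro borel_measurable_continuous_onI continuous_on_snd continuous_on_id)

lemma lp_bounded_linear_W:
  assumes u2: "u \<in> lp_space T 2"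
  shows "lp_bounded_linear T 2 (\<lambda>v t. snd (W u v t))"
proof -
  note u = u1[OF u2]
  have N0: "0 \<le> N u" by (rule N_nonneg[OF u])
  define c0 where "c0 = L * (K\<psi> * (1 + N u)) + C1 * (1 + N u) * Cy"
  define c1 where "c1 = C1 * (1 + N u)"
  have c: "0 \<le> c0" "0 \<le> c1"
    unfolding c0_def c1_def using L K\<psi>_pos C1_pos Cy_pos N0 by (auto intro!: add_nonneg_nonneg mult_nonneg_nonneg)
  define e where "e = enn2real (1 / 2)"
  \<comment> \<open>\<open>N v\<close> is at most T^{1-e} times the L^2 norm of v, and a constant
    has L^2 norm T^e times its value.\<close>
  define K where "K = c0 * T powr (1 - e) * T powr e + c1"
  have bd: "lp_norm T 2 (\<lambda>t. snd (W u v t)) \<le> ennreal (K * a)" if a: "0 \<le> a" "lp_norm T 2 v = ennreal a" for v a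
  proof -
    have v2: "v \<in> lp_space T 2" using a by (auto simp: lp_space_def)
    note v = u1[OF v2]
    have Nv: "N v \<le> a * T powr (1 - e)"
      unfolding N_def e_def by (rule lp_norm_one_le(2)[OF order_refl T _ a(1)]) (simp add: a)
    have "lp_norm T 2 (\<lambda>t. snd (W u v t)) \<le> ennreal (c0 * (a * T powr (1 - e)) * T powr enn2real (1 / 2) + c1 * a + 0 * a)"
    proof (rule lp_norm_affine_bound[where h = v and k = v, OF _ T snd_W_measurable[OF u v] _ _ a(1) a(1)])
      fix t assume t: "t \<in> {0..T}"
      have "norm (snd (W u v t)) \<le> c0 * N v + c1 * norm (v t)"
        unfolding c0_def c1_def by (rule order_trans[OF norm_snd_le_norm norm_W_le[OF u v t]])
      also have "\<dots> \<le> c0 * (a * T powr (1 - e)) + c1 * norm (v t)"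
        using c Nv by (intro add_right_mono mult_left_mono)
      finally show "norm (snd (W u v t)) \<le> c0 * (a * T powr (1 - e)) + c1 * norm (v t) + 0 * norm (v t)" by simp
    qed (use a c in auto)
    also have "c0 * (a * T powr (1 - e)) * T powr enn2real (1 / 2) + c1 * a + 0 * a = K * a"
      by (simp add: K_def e_def algebra_simps)
    finally show ?thesis .
  qed
  have K0: "0 \<le> K" unfolding K_def using c by (intro add_nonneg_nonneg mult_nonneg_nonneg) auto
  show ?thesis
    unfolding lp_bounded_linear_def
  proof (intro conjI ballI allI exI[of _ K])
    fix v :: "real \<Rightarrow> real^'m" assume v2: "v \<in> lp_space T 2"
    then obtain a where a: "0 \<le> a" "lp_norm T 2 v = ennreal a" unfolding lp_space_iff by blast
    show "lp_norm T 2 (\<lambda>t. snd (W u v t)) \<le> ennreal K * lp_norm T 2 v"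
      using bd[OF a] a K0 by (simp add: ennreal_mult)
    show "(\<lambda>t. snd (W u v t)) \<in> lp_space T 2"
      unfolding lp_space_def using le_less_trans[OF bd[OF a] ennreal_less_top] by simp
    show "AE t in lebesgue_on {0..T}. snd (W u (\<lambda>s. c *\<^sub>R v s) t) = c *\<^sub>R snd (W u v t)" for c
      using W_linear[OF u u1[OF v2] u1[OF v2], of _ c 0] by (intro AE_I2) (simp add: space_restrict_space)
    fix w :: "real \<Rightarrow> real^'m" assume w2: "w \<in> lp_space T 2"
    show "AE t in lebesgue_on {0..T}. snd (W u (\<lambda>s. v s + w s) t) = snd (W u v t) + snd (W u w t)"
      using W_linear[OF u u1[OF v2] u1[OF w2], of _ 1 1] by (intro AE_I2) (simp add: space_restrict_space)
  qed
qed

end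

section \<open>The second derivative of the cost\<close>

context control_data
begin

abbreviation J where "J \<equiv> cost T b f g x0"

context
  fixes u v :: "real \<Rightarrow> real^'m"
  assumes u2: "u \<in> lp_space T 2" and v2: "v \<in> lp_space T 2"
begin

abbreviation u\<epsilon> where "u\<epsilon> \<epsilon> \<equiv> \<lambda>t. u t + \<epsilon> *\<^sub>R v t"

text \<open>Up to the summand 1 this bounds the difference quotient of the trajectory. The summand
  forces w \<ge> 1, so that remainders of order \<epsilon>^2 and \<epsilon>^2 w are absorbed by
  \<epsilon>^2 w^2.\<close>

definition w where "w t = Cx * N v + 1 + norm (v t)"

lemma u\<epsilon>_L2: "u\<epsilon> \<epsilon> \<in> lp_space T 2"
  using lp_space_two_linear_combination[OF T u2 v2, of 1 \<epsilon>] by simp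

lemmas pu = u1[OF u2] and pv = u1[OF v2] and pu\<epsilon> = u1[OF u\<epsilon>_L2]

lemma Nv_nonneg: "0 \<le> N v" and Nu_nonneg: "0 \<le> N u" by (rule N_nonneg[OF pv] N_nonneg[OF pu])+

lemma D_u\<epsilon>: "N (\<lambda>t. - (\<epsilon> *\<^sub>R v t)) = \<bar>\<epsilon>\<bar> * N v"
  by (simp add: N_def)

lemma w_ge_1: "1 \<le> w t" unfolding w_def using Cx_pos Nv_nonneg by simp

lemma w_measurable: "w \<in> borel_measurable (lebesgue_on {0..T})"
proof -
  have [measurable]: "v \<in> borel_measurable (lebesgue_on {0..T})" using v2 by (simp add: lp_space_two_iff)
  show ?thesis unfolding w_def[abs_def] by measurable
qed

lemma w_square_integrable: "(\<lambda>t. (w t)\<^sup>2) integrable_on {0..T}"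
proof -
  have "w \<in> lp_space T 2"
  proof (rule lp_space_two_affine_bound[OF T w_measurable v2 v2, of "Cx * N v + 1" 1 0])
    show "norm (w t) \<le> Cx * N v + 1 + 1 * norm (v t) + 0 * norm (v t)" for t
      using w_ge_1[of t] by (simp add: w_def)
  qed (use Cx_pos Nv_nonneg in auto)
  then show ?thesis by (simp add: lp_space_two_iff)
qed

lemma X_pert:
  assumes t: "t \<in> {0..T}"
  shows "norm (X (u\<epsilon> \<epsilon>) t - X u t) \<le> \<bar>\<epsilon>\<bar> * (Cx * N v)"
  using norm_X_diff_le[OF pu pu\<epsilon> t, of \<epsilon>] by (simp add: D_u\<epsilon> norm_minus_commute algebra_simps)

lemma Z_pert:
  assumes t: "t \<in> {0..T}"
  shows "norm (fst (Z (u\<epsilon> \<epsilon>) t) - fst (Z u t)) + norm (snd (Z (u\<epsilon> \<epsilon>) t) - snd (Z u t)) \<le> \<bar>\<epsilon>\<bar> * w t"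
proof -
  have "norm (fst (Z (u\<epsilon> \<epsilon>) t) - fst (Z u t)) + norm (snd (Z (u\<epsilon> \<epsilon>) t) - snd (Z u t)) \<le> \<bar>\<epsilon>\<bar> * (Cx * N v) + \<bar>\<epsilon>\<bar> * norm (v t)"
    using X_pert[OF t, of \<epsilon>] by (simp add: Z_def)
  also have "\<dots> \<le> \<bar>\<epsilon>\<bar> * (Cx * N v) + \<bar>\<epsilon>\<bar> * norm (v t) + \<bar>\<epsilon>\<bar>" by simp
  also have "\<dots> = \<bar>\<epsilon>\<bar> * w t" by (simp add: w_def algebra_simps)
  finally show ?thesis .
qed

lemma norm_Z_pert: "t \<in> {0..T} \<Longrightarrow> norm (Z (u\<epsilon> \<epsilon>) t - Z u t) \<le> \<bar>\<epsilon>\<bar> * w t"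
  using norm_diff_le_fst_snd[of "Z (u\<epsilon> \<epsilon>) t" "Z u t"] Z_pert[of t \<epsilon>] by linarith

lemma gateaux_limit:
  "((\<lambda>\<epsilon>. (J (u\<epsilon> \<epsilon>) - J u) / \<epsilon>) \<longlongrightarrow> (\<integral>t. G u t \<bullet> v t \<partial>lebesgue_on {0..T})) (at 0)"
proof -
  define I where "I = integral {0..T} (\<lambda>t. G u t \<bullet> v t)"
  have Gi: "(\<lambda>t. G u t \<bullet> v t) absolutely_integrable_on {0..T}" by (rule lp_space_two_inner[OF G_L2[OF u2] v2])
  have I: "(\<integral>t. G u t \<bullet> v t \<partial>lebesgue_on {0..T}) = I"
    using Gi unfolding I_def absolutely_integrable_iff_integrable_lebesgue_on by (intro lebesgue_integral_eq_integral) auto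
  define K where "K = L * ((1 + Kp) * (1 + N u)) * integral {0..T} (\<lambda>t. (w t)\<^sup>2) + L * (Cx * N v)\<^sup>2"
  have bd: "\<bar>J (u\<epsilon> \<epsilon>) - J u - \<epsilon> * I\<bar> \<le> K * \<epsilon>\<^sup>2" for \<epsilon>
  proof -
    have i: "(\<lambda>t. (\<bar>\<epsilon>\<bar> * w t)\<^sup>2) integrable_on {0..T}"
      using integrable_on_mult_right[OF w_square_integrable, of "\<epsilon>\<^sup>2"] by (simp add: power_mult_distrib)
    have "\<bar>J (u\<epsilon> \<epsilon>) - J u - integral {0..T} (\<lambda>t. G u t \<bullet> (u\<epsilon> \<epsilon> t - u t))\<bar> \<le>
      L * ((1 + Kp) * (1 + N u)) * integral {0..T} (\<lambda>t. (\<bar>\<epsilon>\<bar> * w t)\<^sup>2) + L * (norm (X (u\<epsilon> \<epsilon>) T - X u T))\<^sup>2"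
      by (rule first_order_remainder[OF u2 u\<epsilon>_L2 norm_Z_pert i])
    also have "integral {0..T} (\<lambda>t. G u t \<bullet> (u\<epsilon> \<epsilon> t - u t)) = \<epsilon> * I" by (simp add: I_def)
    also have "integral {0..T} (\<lambda>t. (\<bar>\<epsilon>\<bar> * w t)\<^sup>2) = \<epsilon>\<^sup>2 * integral {0..T} (\<lambda>t. (w t)\<^sup>2)"
      by (simp add: power_mult_distrib)
    also have "L * ((1 + Kp) * (1 + N u)) * (\<epsilon>\<^sup>2 * integral {0..T} (\<lambda>t. (w t)\<^sup>2)) + L * (norm (X (u\<epsilon> \<epsilon>) T - X u T))\<^sup>2
       \<le> L * ((1 + Kp) * (1 + N u)) * (\<epsilon>\<^sup>2 * integral {0..T} (\<lambda>t. (w t)\<^sup>2)) + L * (\<bar>\<epsilon>\<bar> * (Cx * N v))\<^sup>2"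
      using L T by (intro add_left_mono mult_left_mono power_mono X_pert) auto
    also have "\<dots> = K * \<epsilon>\<^sup>2" by (simp add: K_def power_mult_distrib algebra_simps)
    finally show ?thesis .
  qed
  have "((\<lambda>\<epsilon>. (J (u\<epsilon> \<epsilon>) - J u) / \<epsilon>) \<longlongrightarrow> I) (at 0)"
  proof (rule Lim_null[THEN iffD2], rule Lim_null_comparison)
    show "\<forall>\<^sub>F \<epsilon> in at 0. norm ((J (u\<epsilon> \<epsilon>) - J u) / \<epsilon> - I) \<le> K * \<bar>\<epsilon>\<bar>"
    proof (rule eventually_at_filter[THEN iffD2], rule always_eventually, intro allI impI)
      fix \<epsilon> :: real assume e: "\<epsilon> \<noteq> 0"
      have "(J (u\<epsilon> \<epsilon>) - J u) / \<epsilon> - I = (J (u\<epsilon> \<epsilon>) - J u - \<epsilon> * I) / \<epsilon>" using e by (simp add: diff_divide_distrib)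
      then have "norm ((J (u\<epsilon> \<epsilon>) - J u) / \<epsilon> - I) = \<bar>J (u\<epsilon> \<epsilon>) - J u - \<epsilon> * I\<bar> / \<bar>\<epsilon>\<bar>" by simp
      also have "\<dots> \<le> K * \<epsilon>\<^sup>2 / \<bar>\<epsilon>\<bar>" by (rule divide_right_mono[OF bd]) simp
      also have "\<dots> = K * \<bar>\<epsilon>\<bar>" using e by (simp add: power2_eq_square abs_if)
      finally show "norm ((J (u\<epsilon> \<epsilon>) - J u) / \<epsilon> - I) \<le> K * \<bar>\<epsilon>\<bar>" .
    qed
    have "((\<lambda>\<epsilon>. K * \<bar>\<epsilon>\<bar>) \<longlongrightarrow> K * \<bar>0\<bar>) (at (0::real))" by (intro tendsto_intros)
    then show "((\<lambda>\<epsilon>. K * \<bar>\<epsilon>\<bar>) \<longlongrightarrow> 0) (at (0::real))" by simp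
  qed
  then show ?thesis unfolding I .
qed

text \<open>Both remainders are controlled through \<open>|Z(u + \<epsilon> v) - Z(u)| \<le> |\<epsilon>| w\<close> with \<open>w \<in> L\<^sup>2\<close>.\<close>

definition R1 where "R1 = exp (L * T) * (L * integral {0..T} (\<lambda>t. (w t)\<^sup>2))"

lemma R1_nonneg: "0 \<le> R1"
  unfolding R1_def using L by (intro mult_nonneg_nonneg integral_nonneg w_square_integrable) auto

lemma state_remainder:
  assumes t: "t \<in> {0..T}"
  shows "norm (X (u\<epsilon> \<epsilon>) t - X u t - \<epsilon> *\<^sub>R Y u v t) \<le> R1 * \<epsilon>\<^sup>2"
proof -
  define h where "h s = (b s (X (u\<epsilon> \<epsilon>) s) (u\<epsilon> \<epsilon> s) - b s (X u s) (u s)) - \<epsilon> *\<^sub>R B1 s (Z u s) (Y u v s, v s)" for s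
  have bi: "(\<lambda>s. b s (X (u\<epsilon> \<epsilon>) s) (u\<epsilon> \<epsilon> s) - b s (X u s) (u s)) absolutely_integrable_on {0..T}"
    by (rule set_integral_diff(1)[OF X_int[OF pu\<epsilon>] X_int[OF pu]])
  have yi: "(\<lambda>s. \<epsilon> *\<^sub>R B1 s (Z u s) (Y u v s, v s)) absolutely_integrable_on {0..T}"
    by (rule absolutely_integrable_scaleR_left[OF Y_int[OF pu pv]])
  have hi: "h absolutely_integrable_on {0..T}" unfolding h_def by (rule set_integral_diff(1)[OF bi yi])
  have "norm (X (u\<epsilon> \<epsilon>) t - X u t - \<epsilon> *\<^sub>R Y u v t) \<le> exp (L * T) * (0 + integral {0..T} (\<lambda>s. L * \<epsilon>\<^sup>2 * (w s)\<^sup>2))"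
  proof (rule gronwall_forward[where x = "\<lambda>t. X (u\<epsilon> \<epsilon>) t - X u t - \<epsilon> *\<^sub>R Y u v t" and a = 0, OF _ hi less_imp_le[OF L] _ _ _ _ t])
    show "(\<lambda>s. L * \<epsilon>\<^sup>2 * (w s)\<^sup>2) integrable_on {0..T}" by (rule integrable_on_mult_right[OF w_square_integrable])
    fix s assume s: "s \<in> {0..T}"
    have e1: "X (u\<epsilon> \<epsilon>) s - X u s = integral {0..s} (\<lambda>s. b s (X (u\<epsilon> \<epsilon>) s) (u\<epsilon> \<epsilon> s) - b s (X u s) (u s))"
      using integral_increment_diff(1)[OF X_int[OF pu\<epsilon>] X_int[OF pu] s] X_eq[OF pu s] X_eq[OF pu\<epsilon> s] by simp
    have e2: "\<epsilon> *\<^sub>R Y u v s = integral {0..s} (\<lambda>s. \<epsilon> *\<^sub>R B1 s (Z u s) (Y u v s, v s))"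
      using Y_eq[OF pu pv s] by simp
    show "X (u\<epsilon> \<epsilon>) s - X u s - \<epsilon> *\<^sub>R Y u v s = 0 + integral {0..s} h"
      unfolding e1 e2 h_def[abs_def] integral_increment_diff(1)[OF bi yi s, symmetric] by simp
    define d where "d = Z (u\<epsilon> \<epsilon>) s - Z u s"
    have lin: "linear (B1 s (Z u s))" by (rule second_derivative.linear_D1[OF second_order.axioms(1)[OF so_b[OF s]]])
    have "(X (u\<epsilon> \<epsilon>) s - X u s - \<epsilon> *\<^sub>R Y u v s, 0) = d - \<epsilon> *\<^sub>R (Y u v s, v s)" by (simp add: d_def Z_def)
    then have "h s = (b s (fst (Z (u\<epsilon> \<epsilon>) s)) (snd (Z (u\<epsilon> \<epsilon>) s)) - b s (fst (Z u s)) (snd (Z u s)) - B1 s (Z u s) d)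
       + B1 s (Z u s) (X (u\<epsilon> \<epsilon>) s - X u s - \<epsilon> *\<^sub>R Y u v s, 0)"
      by (simp only: linear_diff[OF lin] linear_scale[OF lin] h_def) (simp add: Z_def)
    then have "norm (h s) \<le> norm (b s (fst (Z (u\<epsilon> \<epsilon>) s)) (snd (Z (u\<epsilon> \<epsilon>) s)) - b s (fst (Z u s)) (snd (Z u s)) - B1 s (Z u s) d)
       + norm (B1 s (Z u s) (X (u\<epsilon> \<epsilon>) s - X u s - \<epsilon> *\<^sub>R Y u v s, 0))"
      by (simp only: norm_triangle_ineq)
    also have "\<dots> \<le> L * (norm d)\<^sup>2 + L * norm (X (u\<epsilon> \<epsilon>) s - X u s - \<epsilon> *\<^sub>R Y u v s)"
      using b_taylor[OF s, of "Z (u\<epsilon> \<epsilon>) s" "Z u s"] B1_bound[OF s, of "Z u s" "(X (u\<epsilon> \<epsilon>) s - X u s - \<epsilon> *\<^sub>R Y u v s, 0)"]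
      unfolding d_def by (intro add_mono) auto
    also have "L * (norm d)\<^sup>2 \<le> L * (\<bar>\<epsilon>\<bar> * w s)\<^sup>2"
      unfolding d_def using L by (intro mult_left_mono power_mono norm_Z_pert s) auto
    also have "L * (\<bar>\<epsilon>\<bar> * w s)\<^sup>2 = L * \<epsilon>\<^sup>2 * (w s)\<^sup>2" by (simp add: power_mult_distrib)
    finally show "norm (h s) \<le> L * norm (X (u\<epsilon> \<epsilon>) s - X u s - \<epsilon> *\<^sub>R Y u v s) + L * \<epsilon>\<^sup>2 * (w s)\<^sup>2" by simp
  qed (use L in auto)
  also have "\<dots> = R1 * \<epsilon>\<^sup>2" by (simp add: R1_def algebra_simps)
  finally show ?thesis .
qed

text \<open>\<open>a2\<close> bounds the difference quotient of the adjoint; \<pi>, defined next,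
  bounds 1 + |p|, the factor with which p enters the derivatives of the Hamiltonian.\<close>

definition a2 where "a2 = Cp * (1 + N u) * N v"
definition \<pi> where "\<pi> = (1 + Kp) * (1 + N u)"

lemma a2_nonneg: "0 \<le> a2" unfolding a2_def using Cp_pos Nu_nonneg Nv_nonneg by simp
lemma \<pi>_nonneg: "0 \<le> \<pi>" unfolding \<pi>_def using Kp_pos Nu_nonneg by simp

lemma P_pert:
  assumes t: "t \<in> {0..T}"
  shows "norm (P (u\<epsilon> \<epsilon>) t - P u t) \<le> \<bar>\<epsilon>\<bar> * a2"
  using norm_P_diff_le[OF pu pu\<epsilon> t, of \<epsilon>] by (simp add: D_u\<epsilon> norm_minus_commute a2_def algebra_simps)

text \<open>The error of linearising the joint gradient of the Hamiltonian. Its first component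
  drives the equation for the adjoint remainder, its second is the remainder of the cost
  gradient.\<close>

definition E where "E \<epsilon> s = DH s (Z (u\<epsilon> \<epsilon>) s) (P (u\<epsilon> \<epsilon>) s) - DH s (Z u s) (P u s) - \<epsilon> *\<^sub>R W u v s"

text \<open>The Taylor remainder is estimated quadratically, by Lipschitz continuity of the second
  derivatives, and linearly, by their boundedness. The minimum keeps both: the adjoint needs the
  quadratic rate in L^1, the gradient a majorant in L^2.\<close>

lemma norm_E_le:
  assumes t: "t \<in> {0..T}"
  shows "norm (E \<epsilon> t) \<le> L * norm (P (u\<epsilon> \<epsilon>) t - P u t - \<epsilon> *\<^sub>R \<Psi> u v t) + L * a2 * \<epsilon>\<^sup>2 * w t
     + 2 * L * \<pi> * (\<bar>\<epsilon>\<bar> * w t * min 1 (\<bar>\<epsilon>\<bar> * w t)) + L * \<pi> * (R1 * \<epsilon>\<^sup>2)"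
proof -
  define z z' p p' d where "z = Z u t" and "z' = Z (u\<epsilon> \<epsilon>) t" and "p = P u t" and "p' = P (u\<epsilon> \<epsilon>) t"
    and "d = Z (u\<epsilon> \<epsilon>) t - Z u t"
  have d: "d = \<epsilon> *\<^sub>R (Y u v t, v t) + (X (u\<epsilon> \<epsilon>) t - X u t - \<epsilon> *\<^sub>R Y u v t, 0)" by (simp add: d_def Z_def)
  have dn: "norm d \<le> \<bar>\<epsilon>\<bar> * w t" unfolding d_def by (rule norm_Z_pert[OF t])
  have w0: "0 \<le> \<bar>\<epsilon>\<bar> * w t" using w_ge_1[of t] by simp
  have pb: "1 + norm p \<le> \<pi>" unfolding p_def \<pi>_def by (rule one_plus_norm_P_le[OF pu t])
  have "DDH t z p d = \<epsilon> *\<^sub>R DDH t z p (Y u v t, v t) + DDH t z p (X (u\<epsilon> \<epsilon>) t - X u t - \<epsilon> *\<^sub>R Y u v t, 0)"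
    unfolding d by (simp only: DDH_add[OF t] DDH_scaleR[OF t])
  \<comment> \<open>Four errors: the adjoint remainder, the change of point acting on p' - p, the
    Taylor remainder at fixed p, and the state remainder.\<close>
  then have "E \<epsilon> t = DB t z (p' - p - \<epsilon> *\<^sub>R \<Psi> u v t) + (DB t z' (p' - p) - DB t z (p' - p))
      + (DH t z' p - DH t z p - DDH t z p d) + DDH t z p (X (u\<epsilon> \<epsilon>) t - X u t - \<epsilon> *\<^sub>R Y u v t, 0)"
    unfolding E_def W_def DH_def z_def z'_def p_def p'_def DB_diff[OF t] DB_scaleR[OF t]
    by (simp add: scaleR_add_right)
  then have "norm (E \<epsilon> t) \<le> norm (DB t z (p' - p - \<epsilon> *\<^sub>R \<Psi> u v t)) + norm (DB t z' (p' - p) - DB t z (p' - p))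
      + norm (DH t z' p - DH t z p - DDH t z p d) + norm (DDH t z p (X (u\<epsilon> \<epsilon>) t - X u t - \<epsilon> *\<^sub>R Y u v t, 0))"
    by (simp only:) (intro order_trans[OF norm_triangle_ineq] add_right_mono order_refl)
  moreover have "norm (DB t z (p' - p - \<epsilon> *\<^sub>R \<Psi> u v t)) \<le> L * norm (p' - p - \<epsilon> *\<^sub>R \<Psi> u v t)"
    by (rule norm_DB_le[OF t])
  moreover have "norm (DB t z' (p' - p) - DB t z (p' - p)) \<le> L * a2 * \<epsilon>\<^sup>2 * w t"
  proof -
    have "norm (DB t z' (p' - p) - DB t z (p' - p)) \<le> L * (norm (fst z' - fst z) + norm (snd z' - snd z)) * norm (p' - p)"
      by (rule norm_DB_diff_le[OF t])
    also have "\<dots> \<le> L * (\<bar>\<epsilon>\<bar> * w t) * (\<bar>\<epsilon>\<bar> * a2)"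
      unfolding z_def z'_def p_def p'_def using L w0
      by (intro mult_mono mult_left_mono Z_pert P_pert t) auto
    also have "\<dots> = L * a2 * \<epsilon>\<^sup>2 * w t" by (simp add: power2_eq_square algebra_simps)
    finally show ?thesis .
  qed
  moreover have "norm (DH t z' p - DH t z p - DDH t z p d) \<le> 2 * L * \<pi> * (\<bar>\<epsilon>\<bar> * w t * min 1 (\<bar>\<epsilon>\<bar> * w t))"
  proof -
    define q where "q = DH t z' p - DH t z p - DDH t z p d"
    have "norm q \<le> 2 * L * (1 + norm p) * (norm d)\<^sup>2"
      unfolding q_def d_def z'_def z_def by (rule norm_DH_taylor_le[OF t])
    also have "\<dots> \<le> 2 * L * \<pi> * (\<bar>\<epsilon>\<bar> * w t)\<^sup>2"
      using L pb dn \<pi>_nonneg by (intro mult_mono mult_left_mono power_mono) auto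
    finally have 1: "norm q \<le> 2 * L * \<pi> * (\<bar>\<epsilon>\<bar> * w t) * (\<bar>\<epsilon>\<bar> * w t)" by (simp add: power2_eq_square)
    have "norm q \<le> norm (DH t z' p - DH t z p) + norm (DDH t z p d)"
      unfolding q_def by (rule norm_triangle_ineq4)
    also have "\<dots> \<le> L * (norm (fst z' - fst z) + norm (snd z' - snd z)) * (1 + norm p) + L * (1 + norm p) * norm d"
      by (intro add_mono norm_DH_diff_le norm_DDH_le t)
    also have "\<dots> \<le> L * (\<bar>\<epsilon>\<bar> * w t) * \<pi> + L * \<pi> * (\<bar>\<epsilon>\<bar> * w t)"
      unfolding z_def z'_def using L pb dn w0 \<pi>_nonneg
      by (intro add_mono mult_mono mult_left_mono Z_pert t) auto
    finally have 2: "norm q \<le> 2 * L * \<pi> * (\<bar>\<epsilon>\<bar> * w t) * 1" by (simp add: algebra_simps)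
    have "norm q \<le> 2 * L * \<pi> * (\<bar>\<epsilon>\<bar> * w t) * min 1 (\<bar>\<epsilon>\<bar> * w t)" using 1 2 by (simp add: min_def)
    then show ?thesis by (simp add: q_def mult.assoc)
  qed
  moreover have "norm (DDH t z p (X (u\<epsilon> \<epsilon>) t - X u t - \<epsilon> *\<^sub>R Y u v t, 0)) \<le> L * \<pi> * (R1 * \<epsilon>\<^sup>2)"
  proof -
    have "norm (DDH t z p (X (u\<epsilon> \<epsilon>) t - X u t - \<epsilon> *\<^sub>R Y u v t, 0)) \<le> L * (1 + norm p) * norm (X (u\<epsilon> \<epsilon>) t - X u t - \<epsilon> *\<^sub>R Y u v t)"
      using norm_DDH_le[OF t, of z p "(X (u\<epsilon> \<epsilon>) t - X u t - \<epsilon> *\<^sub>R Y u v t, 0)"] by simp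
    also have "\<dots> \<le> L * \<pi> * (R1 * \<epsilon>\<^sup>2)"
      using L pb \<pi>_nonneg by (intro mult_mono mult_left_mono state_remainder t) auto
    finally show ?thesis .
  qed
  ultimately show ?thesis unfolding p_def p'_def by linarith
qed

definition \<kappa> where "\<kappa> = L * a2 + 2 * L * \<pi> + L * \<pi> * R1"
definition Q where "Q = exp (L * T) * (L * (Cx * N v)\<^sup>2 + L * R1 + \<kappa> * integral {0..T} (\<lambda>t. (w t)\<^sup>2))"

lemma \<kappa>_nonneg: "0 \<le> \<kappa>"
  unfolding \<kappa>_def using L a2_nonneg \<pi>_nonneg R1_nonneg by (intro add_nonneg_nonneg mult_nonneg_nonneg) auto

lemma Q_nonneg: "0 \<le> Q"
  unfolding Q_def using L \<kappa>_nonneg R1_nonneg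
  by (intro mult_nonneg_nonneg add_nonneg_nonneg integral_nonneg w_square_integrable) auto

text \<open>Only an integral of the error is involved here, so the minimum is replaced by its
  quadratic branch and integrability of w^2 suffices. The first term of the error bound is absorbed
  by Gronwall.\<close>

lemma adjoint_remainder:
  assumes t: "t \<in> {0..T}"
  shows "norm (P (u\<epsilon> \<epsilon>) t - P u t - \<epsilon> *\<^sub>R \<Psi> u v t) \<le> Q * \<epsilon>\<^sup>2"
proof -
  define h where "h s = (fst (DH s (Z (u\<epsilon> \<epsilon>) s) (P (u\<epsilon> \<epsilon>) s)) - fst (DH s (Z u s) (P u s))) - \<epsilon> *\<^sub>R fst (W u v s)" for s
  have bi: "(\<lambda>s. fst (DH s (Z (u\<epsilon> \<epsilon>) s) (P (u\<epsilon> \<epsilon>) s)) - fst (DH s (Z u s) (P u s))) absolutely_integrable_on {0..T}"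
    by (rule set_integral_diff(1)[OF P_int[OF pu\<epsilon>] P_int[OF pu]])
  have yi: "(\<lambda>s. \<epsilon> *\<^sub>R fst (W u v s)) absolutely_integrable_on {0..T}"
    by (rule absolutely_integrable_scaleR_left[OF \<Psi>_int[OF pu pv]])
  have hi: "h absolutely_integrable_on {0..T}" unfolding h_def by (rule set_integral_diff(1)[OF bi yi])
  have TT: "T \<in> {0..T}" using T by simp
  define a where "a = Dg (X (u\<epsilon> \<epsilon>) T) - Dg (X u T) - \<epsilon> *\<^sub>R DDg (X u T) (Y u v T)"
  have "norm (P (u\<epsilon> \<epsilon>) t - P u t - \<epsilon> *\<^sub>R \<Psi> u v t) \<le>
    exp (L * T) * ((L * (Cx * N v)\<^sup>2 + L * R1) * \<epsilon>\<^sup>2 + integral {0..T} (\<lambda>s. \<kappa> * \<epsilon>\<^sup>2 * (w s)\<^sup>2))"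
  proof (rule gronwall_backward[where x = "\<lambda>t. P (u\<epsilon> \<epsilon>) t - P u t - \<epsilon> *\<^sub>R \<Psi> u v t" and a = a, OF _ hi less_imp_le[OF L] _ _ _ _ t])
    show "(\<lambda>s. \<kappa> * \<epsilon>\<^sup>2 * (w s)\<^sup>2) integrable_on {0..T}" by (rule integrable_on_mult_right[OF w_square_integrable])
    show "0 \<le> \<kappa> * \<epsilon>\<^sup>2 * (w s)\<^sup>2" for s using \<kappa>_nonneg by simp
    define \<Delta> where "\<Delta> = X (u\<epsilon> \<epsilon>) T - X u T"
    have "a = (Dg (X (u\<epsilon> \<epsilon>) T) - Dg (X u T) - DDg (X u T) \<Delta>) + DDg (X u T) (\<Delta> - \<epsilon> *\<^sub>R Y u v T)"
      by (simp add: a_def DDg_diff DDg_scaleR)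
    then have "norm a \<le> norm (Dg (X (u\<epsilon> \<epsilon>) T) - Dg (X u T) - DDg (X u T) \<Delta>) + norm (DDg (X u T) (\<Delta> - \<epsilon> *\<^sub>R Y u v T))"
      by (simp only: norm_triangle_ineq)
    also have "\<dots> \<le> L * (norm \<Delta>)\<^sup>2 + L * norm (\<Delta> - \<epsilon> *\<^sub>R Y u v T)"
      unfolding \<Delta>_def by (intro add_mono norm_Dg_taylor_le norm_DDg_le)
    also have "\<dots> \<le> L * (\<bar>\<epsilon>\<bar> * (Cx * N v))\<^sup>2 + L * (R1 * \<epsilon>\<^sup>2)"
      unfolding \<Delta>_def using L by (intro add_mono mult_left_mono power_mono X_pert state_remainder TT) auto
    also have "\<dots> = (L * (Cx * N v)\<^sup>2 + L * R1) * \<epsilon>\<^sup>2" by (simp add: power_mult_distrib algebra_simps)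
    finally show "norm a \<le> (L * (Cx * N v)\<^sup>2 + L * R1) * \<epsilon>\<^sup>2" .
    fix s assume s: "s \<in> {0..T}"
    have e1: "P (u\<epsilon> \<epsilon>) s - P u s = (Dg (X (u\<epsilon> \<epsilon>) T) - Dg (X u T)) +
       integral {s..T} (\<lambda>s. fst (DH s (Z (u\<epsilon> \<epsilon>) s) (P (u\<epsilon> \<epsilon>) s)) - fst (DH s (Z u s) (P u s)))"
      using integral_increment_diff(2)[OF P_int[OF pu\<epsilon>] P_int[OF pu] s] P_eq[OF pu s] P_eq[OF pu\<epsilon> s] by simp
    have e2: "\<epsilon> *\<^sub>R \<Psi> u v s = \<epsilon> *\<^sub>R DDg (X u T) (Y u v T) + integral {s..T} (\<lambda>s. \<epsilon> *\<^sub>R fst (W u v s))"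
      using \<Psi>_eq[OF pu pv s] by (simp add: scaleR_add_right)
    show "P (u\<epsilon> \<epsilon>) s - P u s - \<epsilon> *\<^sub>R \<Psi> u v s = a + integral {s..T} h"
      unfolding e1 e2 a_def h_def[abs_def] integral_increment_diff(2)[OF bi yi s, symmetric] by simp
    have hE: "h s = fst (E \<epsilon> s)" by (simp add: h_def E_def)
    have w1: "1 \<le> w s" by (rule w_ge_1)
    have ww: "w s \<le> (w s)\<^sup>2" "1 \<le> (w s)\<^sup>2" using w1 by (auto simp: power2_eq_square intro: order_trans[OF w1])
    have "norm (h s) \<le> norm (E \<epsilon> s)" unfolding hE by (rule norm_fst_le_norm)
    also have "\<dots> \<le> L * norm (P (u\<epsilon> \<epsilon>) s - P u s - \<epsilon> *\<^sub>R \<Psi> u v s) + L * a2 * \<epsilon>\<^sup>2 * w s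
     + 2 * L * \<pi> * (\<bar>\<epsilon>\<bar> * w s * min 1 (\<bar>\<epsilon>\<bar> * w s)) + L * \<pi> * (R1 * \<epsilon>\<^sup>2)"
      by (rule norm_E_le[OF s])
    also have "\<dots> \<le> L * norm (P (u\<epsilon> \<epsilon>) s - P u s - \<epsilon> *\<^sub>R \<Psi> u v s) + L * a2 * \<epsilon>\<^sup>2 * (w s)\<^sup>2
     + 2 * L * \<pi> * (\<bar>\<epsilon>\<bar> * w s * (\<bar>\<epsilon>\<bar> * w s)) + L * \<pi> * (R1 * \<epsilon>\<^sup>2) * (w s)\<^sup>2"
    proof (intro add_mono order_refl)
      show "L * a2 * \<epsilon>\<^sup>2 * w s \<le> L * a2 * \<epsilon>\<^sup>2 * (w s)\<^sup>2"
        using L a2_nonneg by (intro mult_left_mono ww) auto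
      show "2 * L * \<pi> * (\<bar>\<epsilon>\<bar> * w s * min 1 (\<bar>\<epsilon>\<bar> * w s)) \<le> 2 * L * \<pi> * (\<bar>\<epsilon>\<bar> * w s * (\<bar>\<epsilon>\<bar> * w s))"
        using L \<pi>_nonneg w1 by (intro mult_left_mono) auto
      have "L * \<pi> * (R1 * \<epsilon>\<^sup>2) * 1 \<le> L * \<pi> * (R1 * \<epsilon>\<^sup>2) * (w s)\<^sup>2"
        using L \<pi>_nonneg R1_nonneg by (intro mult_left_mono ww) auto
      then show "L * \<pi> * (R1 * \<epsilon>\<^sup>2) \<le> L * \<pi> * (R1 * \<epsilon>\<^sup>2) * (w s)\<^sup>2" by simp
    qed
    also have "\<dots> = L * norm (P (u\<epsilon> \<epsilon>) s - P u s - \<epsilon> *\<^sub>R \<Psi> u v s) + \<kappa> * \<epsilon>\<^sup>2 * (w s)\<^sup>2"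
    proof -
      have "\<bar>\<epsilon>\<bar> * w s * (\<bar>\<epsilon>\<bar> * w s) = \<epsilon>\<^sup>2 * (w s)\<^sup>2"
        by (simp add: power2_eq_square)
      then show ?thesis by (simp add: \<kappa>_def algebra_simps)
    qed
    finally show "norm (h s) \<le> L * norm (P (u\<epsilon> \<epsilon>) s - P u s - \<epsilon> *\<^sub>R \<Psi> u v s) + \<kappa> * \<epsilon>\<^sup>2 * (w s)\<^sup>2" .
  qed
  also have "\<dots> = Q * \<epsilon>\<^sup>2" by (simp add: Q_def algebra_simps)
  finally show ?thesis .
qed

definition \<Lambda> where "\<Lambda> = L * Q + L * a2 + 2 * L * \<pi> + L * \<pi> * R1"

text \<open>All terms fit under the truncated one, since |\<epsilon>| \<le> |\<epsilon>| w \<le> w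
  min(1, |\<epsilon>| w) follows from w \<ge> 1 and |\<epsilon>| \<le> 1.\<close>

lemma difference_quotient_le:
  assumes t: "t \<in> {0..T}" and e: "\<epsilon> \<noteq> 0" "\<bar>\<epsilon>\<bar> \<le> 1"
  shows "norm ((1 / \<epsilon>) *\<^sub>R (G (u\<epsilon> \<epsilon>) t - G u t) - snd (W u v t)) \<le> \<Lambda> * (w t * min 1 (\<bar>\<epsilon>\<bar> * w t))"
proof -
  define m where "m = w t * min 1 (\<bar>\<epsilon>\<bar> * w t)"
  have w1: "1 \<le> w t" by (rule w_ge_1)
  have "\<bar>\<epsilon>\<bar> * 1 \<le> \<bar>\<epsilon>\<bar> * w t" using w1 by (intro mult_left_mono) auto
  then have em: "\<bar>\<epsilon>\<bar> \<le> min 1 (\<bar>\<epsilon>\<bar> * w t)" using e by simp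
  have ewm: "\<bar>\<epsilon>\<bar> * w t \<le> m" unfolding m_def using mult_left_mono[OF em, of "w t"] w1 by (simp add: mult.commute)
  have em': "\<bar>\<epsilon>\<bar> \<le> m" using ewm \<open>\<bar>\<epsilon>\<bar> * 1 \<le> \<bar>\<epsilon>\<bar> * w t\<close> by simp
  have "norm (snd (E \<epsilon> t)) \<le> norm (E \<epsilon> t)" by (rule norm_snd_le_norm)
  also have "\<dots> \<le> L * norm (P (u\<epsilon> \<epsilon>) t - P u t - \<epsilon> *\<^sub>R \<Psi> u v t) + L * a2 * \<epsilon>\<^sup>2 * w t
     + 2 * L * \<pi> * (\<bar>\<epsilon>\<bar> * w t * min 1 (\<bar>\<epsilon>\<bar> * w t)) + L * \<pi> * (R1 * \<epsilon>\<^sup>2)"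
    by (rule norm_E_le[OF t])
  also have "\<dots> \<le> L * (Q * \<epsilon>\<^sup>2) + L * a2 * \<epsilon>\<^sup>2 * w t + 2 * L * \<pi> * (\<bar>\<epsilon>\<bar> * m) + L * \<pi> * (R1 * \<epsilon>\<^sup>2)"
    using L a2_nonneg \<pi>_nonneg R1_nonneg adjoint_remainder[OF t, of \<epsilon>] by (intro add_mono mult_left_mono order_refl) (auto simp: m_def)
  also have "\<dots> = \<bar>\<epsilon>\<bar> * (L * Q * \<bar>\<epsilon>\<bar> + L * a2 * (\<bar>\<epsilon>\<bar> * w t) + 2 * L * \<pi> * m + L * \<pi> * R1 * \<bar>\<epsilon>\<bar>)"
  proof -
    have "\<epsilon>\<^sup>2 = \<bar>\<epsilon>\<bar> * \<bar>\<epsilon>\<bar>" by (simp add: power2_eq_square)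
    then show ?thesis by (simp add: algebra_simps)
  qed
  also have "\<dots> \<le> \<bar>\<epsilon>\<bar> * (L * Q * m + L * a2 * m + 2 * L * \<pi> * m + L * \<pi> * R1 * m)"
    using L Q_nonneg a2_nonneg \<pi>_nonneg R1_nonneg ewm em'
    by (intro mult_left_mono add_mono order_refl) auto
  also have "\<dots> = \<bar>\<epsilon>\<bar> * (\<Lambda> * m)" by (simp add: \<Lambda>_def algebra_simps)
  finally have bd: "norm (snd (E \<epsilon> t)) \<le> \<bar>\<epsilon>\<bar> * (\<Lambda> * m)" .
  have "(1 / \<epsilon>) *\<^sub>R (G (u\<epsilon> \<epsilon>) t - G u t) - snd (W u v t) = (1 / \<epsilon>) *\<^sub>R snd (E \<epsilon> t)"
    using e by (simp add: G_def E_def scaleR_diff_right)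
  then have "norm ((1 / \<epsilon>) *\<^sub>R (G (u\<epsilon> \<epsilon>) t - G u t) - snd (W u v t)) = norm (snd (E \<epsilon> t)) / \<bar>\<epsilon>\<bar>" by simp
  also have "\<dots> \<le> \<Lambda> * m" using bd e by (simp add: pos_divide_le_eq mult.commute)
  finally show ?thesis by (simp add: m_def)
qed

lemma \<Lambda>_nonneg: "0 \<le> \<Lambda>"
  unfolding \<Lambda>_def using L Q_nonneg a2_nonneg \<pi>_nonneg R1_nonneg by (intro add_nonneg_nonneg mult_nonneg_nonneg) auto

text \<open>The truncation keeps the square below w^2, which is integrable, while at each t it tends
  to 0.\<close>

lemma truncated_square_tendsto_0:
  assumes s: "s \<longlonglongrightarrow> (0::real)"
  shows "(\<lambda>t. (w t * min 1 (\<bar>s n\<bar> * w t))\<^sup>2) integrable_on {0..T}"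
    and "(\<lambda>n. integral {0..T} (\<lambda>t. (w t * min 1 (\<bar>s n\<bar> * w t))\<^sup>2)) \<longlonglongrightarrow> 0"
proof -
  have le: "norm ((w t * min 1 (\<bar>s n\<bar> * w t))\<^sup>2) \<le> (w t)\<^sup>2" for t n
  proof -
    have "w t * min 1 (\<bar>s n\<bar> * w t) \<le> w t * 1" "0 \<le> w t * min 1 (\<bar>s n\<bar> * w t)"
      using w_ge_1[of t] by (auto intro!: mult_left_mono)
    then show ?thesis by (simp add: power_mono)
  qed
  have i: "(\<lambda>t. (w t * min 1 (\<bar>s n\<bar> * w t))\<^sup>2) integrable_on {0..T}" for n
  proof (rule measurable_bounded_by_integrable_imp_integrable[OF _ w_square_integrable le])
    have [measurable]: "w \<in> borel_measurable (lebesgue_on {0..T})" by (rule w_measurable)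
    show "(\<lambda>t. (w t * min 1 (\<bar>s n\<bar> * w t))\<^sup>2) \<in> borel_measurable (lebesgue_on {0..T})" by measurable
  qed auto
  then show "(\<lambda>t. (w t * min 1 (\<bar>s n\<bar> * w t))\<^sup>2) integrable_on {0..T}" .
  have "(\<lambda>n. integral {0..T} (\<lambda>t. (w t * min 1 (\<bar>s n\<bar> * w t))\<^sup>2)) \<longlonglongrightarrow> integral {0..T} (\<lambda>t. 0)"
  proof (rule dominated_convergence(2)[OF i w_square_integrable le])
    fix t
    have "(\<lambda>n. (w t * min 1 (\<bar>s n\<bar> * w t))\<^sup>2) \<longlonglongrightarrow> (w t * min 1 (\<bar>0\<bar> * w t))\<^sup>2"
      by (intro tendsto_intros s)
    then show "(\<lambda>n. (w t * min 1 (\<bar>s n\<bar> * w t))\<^sup>2) \<longlonglongrightarrow> 0" by simp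
  qed
  then show "(\<lambda>n. integral {0..T} (\<lambda>t. (w t * min 1 (\<bar>s n\<bar> * w t))\<^sup>2)) \<longlonglongrightarrow> 0" by simp
qed

end

section \<open>The selected derivatives agree with the explicit ones almost everywhere\<close>

lemma has_gateaux_gradient_G: "u \<in> lp_space T 2 \<Longrightarrow> has_gateaux_gradient T J u (G u)"
  unfolding has_gateaux_gradient_def using G_L2 gateaux_limit by blast

lemma gateaux_gradient_AE:
  assumes "u \<in> lp_space T 2"
  shows "AE t in lebesgue_on {0..T}. gateaux_gradient T J u t = G u t"
    and "gateaux_gradient T J u \<in> lp_space T 2"
proof -
  have g: "has_gateaux_gradient T J u (gateaux_gradient T J u)"
    unfolding gateaux_gradient_def by (rule someI[of "has_gateaux_gradient T J u", OF has_gateaux_gradient_G[OF assms]])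
  show "AE t in lebesgue_on {0..T}. gateaux_gradient T J u t = G u t"
    by (rule has_gateaux_gradient_unique_AE[OF T g has_gateaux_gradient_G[OF assms]])
  show "gateaux_gradient T J u \<in> lp_space T 2" using g by (simp add: has_gateaux_gradient_def)
qed

text \<open>Dominated convergence concerns sequences, so the limit is tested along arbitrary null
  sequences avoiding 0; the selected gradients are replaced by G off a null set for each member
  separately.\<close>

lemma second_gateaux_limit:
  assumes u2: "u \<in> lp_space T 2" and v2: "v \<in> lp_space T 2"
  shows "((\<lambda>\<epsilon>. lp_norm T 2 (\<lambda>t. (1 / \<epsilon>) *\<^sub>R (gateaux_gradient T J (\<lambda>s. u s + \<epsilon> *\<^sub>R v s) t
            - gateaux_gradient T J u t) - snd (W u v t))) \<longlongrightarrow> 0) (at 0)"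
  unfolding tendsto_at_iff_sequentially
proof (intro allI impI)
  fix s :: "nat \<Rightarrow> real" assume s: "\<forall>i. s i \<in> UNIV - {0}" "s \<longlonglongrightarrow> 0"
  define q where "q n = (\<lambda>t. (1 / s n) *\<^sub>R (gateaux_gradient T J (\<lambda>r. u r + s n *\<^sub>R v r) t
            - gateaux_gradient T J u t) - snd (W u v t))" for n
  define I where "I n = integral {0..T} (\<lambda>t. (w v t * min 1 (\<bar>s n\<bar> * w v t))\<^sup>2)" for n
  have uL: "(\<lambda>r. u r + s n *\<^sub>R v r) \<in> lp_space T 2" for n by (rule u\<epsilon>_L2[OF u2 v2])
  have bd: "lp_norm T 2 (q n) \<le> ennreal (\<Lambda> u v * sqrt (I n))" if n: "\<bar>s n\<bar> \<le> 1" for n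
  proof -
    have [measurable]: "gateaux_gradient T J (\<lambda>r. u r + s n *\<^sub>R v r) \<in> borel_measurable (lebesgue_on {0..T})"
      "gateaux_gradient T J u \<in> borel_measurable (lebesgue_on {0..T})"
      "(\<lambda>t. snd (W u v t)) \<in> borel_measurable (lebesgue_on {0..T})"
      "w v \<in> borel_measurable (lebesgue_on {0..T})"
      using gateaux_gradient_AE(2)[OF uL[of n]] gateaux_gradient_AE(2)[OF u2] snd_W_measurable[OF u1[OF u2] u1[OF v2]] w_measurable[OF u2 v2]
      by (auto simp: lp_space_two_iff)
    have qm: "q n \<in> borel_measurable (lebesgue_on {0..T})" unfolding q_def by measurable
    have "lp_norm T 2 (q n) \<le> lp_norm T 2 (\<lambda>t. \<Lambda> u v * norm (w v t * min 1 (\<bar>s n\<bar> * w v t)))"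
    proof (rule lp_norm_mono_AE[OF qm])
      show "AE t in lebesgue_on {0..T}. norm (q n t) \<le> norm (\<Lambda> u v * norm (w v t * min 1 (\<bar>s n\<bar> * w v t)))"
        using gateaux_gradient_AE(1)[OF uL[of n]] gateaux_gradient_AE(1)[OF u2] AE_space[of "lebesgue_on {0..T}"]
      proof eventually_elim
        case (elim t)
        then have t: "t \<in> {0..T}" by (simp add: space_restrict_space)
        have "norm (q n t) \<le> \<Lambda> u v * (w v t * min 1 (\<bar>s n\<bar> * w v t))"
          using difference_quotient_le[OF u2 v2 t, of "s n"] s(1) n elim by (simp add: q_def)
        also have "\<dots> = norm (\<Lambda> u v * norm (w v t * min 1 (\<bar>s n\<bar> * w v t)))"
          using \<Lambda>_nonneg[OF u2 v2] w_ge_1[OF u2 v2, of t] by (simp add: abs_mult)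
        finally show ?case .
      qed
    qed
    also have "\<dots> \<le> ennreal (\<Lambda> u v * sqrt (I n))"
    proof (rule lp_norm_scaled)
      have "0 \<le> I n" unfolding I_def by (rule integral_nonneg[OF truncated_square_tendsto_0(1)[OF u2 v2 s(2)]]) simp
      moreover have "(\<lambda>t. w v t * min 1 (\<bar>s n\<bar> * w v t)) \<in> borel_measurable (lebesgue_on {0..T})" by measurable
      ultimately show "lp_norm T 2 (\<lambda>t. w v t * min 1 (\<bar>s n\<bar> * w v t)) \<le> ennreal (sqrt (I n))" "0 \<le> sqrt (I n)"
        using truncated_square_tendsto_0(1)[OF u2 v2 s(2), of n] by (auto simp: lp_norm_two_le_iff I_def)
    qed (use \<Lambda>_nonneg[OF u2 v2] in auto)
    finally show ?thesis .
  qed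
  have "(\<lambda>n. \<Lambda> u v * sqrt (I n)) \<longlonglongrightarrow> \<Lambda> u v * sqrt 0"
    unfolding I_def by (intro tendsto_intros truncated_square_tendsto_0(2)[OF u2 v2 s(2)])
  then have lim: "(\<lambda>n. ennreal (\<Lambda> u v * sqrt (I n))) \<longlonglongrightarrow> 0"
    using tendsto_ennrealI by fastforce
  have ev: "\<forall>\<^sub>F n in sequentially. \<bar>s n\<bar> \<le> 1"
  proof -
    have "\<forall>\<^sub>F n in sequentially. dist (s n) 0 < 1" using s(2) by (rule tendstoD) simp
    then show ?thesis by eventually_elim simp
  qed
  have "(\<lambda>n. lp_norm T 2 (q n)) \<longlonglongrightarrow> 0"
    by (rule tendsto_sandwich[OF _ _ tendsto_const lim]) (use ev bd in \<open>auto elim: eventually_mono\<close>)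
  then show "((\<lambda>\<epsilon>. lp_norm T 2 (\<lambda>t. (1 / \<epsilon>) *\<^sub>R (gateaux_gradient T J (\<lambda>s. u s + \<epsilon> *\<^sub>R v s) t
            - gateaux_gradient T J u t) - snd (W u v t))) \<circ> s) \<longlonglongrightarrow> 0"
    by (simp add: o_def q_def)
qed

lemma has_second_gateaux_W:
  assumes "u \<in> lp_space T 2"
  shows "has_second_gateaux T J u (\<lambda>v t. snd (W u v t))"
  unfolding has_second_gateaux_def
  using has_gateaux_gradient_G lp_bounded_linear_W[OF assms] second_gateaux_limit[OF assms] by blast

text \<open>Whatever operator is selected, its value at v and the explicit one are L^2 limits of the
  same difference quotients; by the triangle inequality their distance is below every positive
  number.\<close>

lemma second_gateaux_AE:
  assumes u2: "u \<in> lp_space T 2" and v2: "v \<in> lp_space T 2"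
  shows "AE t in lebesgue_on {0..T}. second_gateaux T J u v t = snd (W u v t)"
    and "second_gateaux T J u v \<in> lp_space T 2"
proof -
  define A where "A = second_gateaux T J u"
  have A: "has_second_gateaux T J u A"
    unfolding A_def second_gateaux_def by (rule someI[of "has_second_gateaux T J u", OF has_second_gateaux_W[OF u2]])
  show Av: "second_gateaux T J u v \<in> lp_space T 2"
    using A v2 unfolding has_second_gateaux_def lp_bounded_linear_def A_def by blast
  have Wv: "(\<lambda>t. snd (W u v t)) \<in> lp_space T 2"
    using lp_bounded_linear_W[OF u2] v2 unfolding lp_bounded_linear_def by blast
  define q where "q \<epsilon> = (\<lambda>t. (1 / \<epsilon>) *\<^sub>R (gateaux_gradient T J (\<lambda>s. u s + \<epsilon> *\<^sub>R v s) t - gateaux_gradient T J u t))" for \<epsilon>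
  define d where "d t = A v t - snd (W u v t)" for t
  have dL: "d \<in> lp_space T 2"
    using lp_space_two_linear_combination[OF T Av Wv, of 1 "-1"] by (simp add: d_def[abs_def] A_def)
  then have dm: "d \<in> borel_measurable (lebesgue_on {0..T})" by (simp add: lp_space_two_iff)
  have l1: "((\<lambda>\<epsilon>. lp_norm T 2 (\<lambda>t. q \<epsilon> t - A v t)) \<longlongrightarrow> 0) (at 0)"
    using A v2 unfolding has_second_gateaux_def q_def by blast
  have l2: "((\<lambda>\<epsilon>. lp_norm T 2 (\<lambda>t. q \<epsilon> t - snd (W u v t))) \<longlongrightarrow> 0) (at 0)"
    using second_gateaux_limit[OF u2 v2] unfolding q_def .
  have "lp_norm T 2 d \<le> ennreal 0"
  proof (rule ennreal_le_of_greater)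
    fix c :: real assume c: "0 < c"
    have "\<forall>\<^sub>F \<epsilon> in at 0. lp_norm T 2 (\<lambda>t. q \<epsilon> t - A v t) < ennreal (c / 2)"
      "\<forall>\<^sub>F \<epsilon> in at 0. lp_norm T 2 (\<lambda>t. q \<epsilon> t - snd (W u v t)) < ennreal (c / 2)"
      using c by (intro order_tendstoD(2)[OF l1] order_tendstoD(2)[OF l2]; simp)+
    then have "\<forall>\<^sub>F \<epsilon> in at (0::real). lp_norm T 2 d \<le> ennreal c"
    proof eventually_elim
      case (elim \<epsilon>)
      have "lp_norm T 2 d \<le> ennreal (c / 2 + c / 2)"
      proof (rule lp_norm_triangle_dominated[OF _ dm less_imp_le[OF elim(1)] less_imp_le[OF elim(2)]])
        show "norm (d t) \<le> norm (q \<epsilon> t - A v t) + norm (q \<epsilon> t - snd (W u v t))" for t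
          using norm_triangle_ineq4[of "q \<epsilon> t - snd (W u v t)" "q \<epsilon> t - A v t"] by (simp add: d_def add.commute)
      qed (use c in auto)
      then show ?case by simp
    qed
    then show "lp_norm T 2 d \<le> ennreal c" by (auto dest: eventually_happens)
  qed
  then have "(\<lambda>t. (norm (d t))\<^sup>2) integrable_on {0..T} \<and> integral {0..T} (\<lambda>t. (norm (d t))\<^sup>2) \<le> 0"
    using lp_norm_two_le_iff[of 0 T d] by simp
  then have "(\<integral>\<^sup>+t. ennreal ((norm (d t))\<^sup>2) \<partial>lebesgue_on {0..T}) \<le> ennreal 0"
    using dm by (subst nn_integral_lebesgue_on_le_iff) auto
  then have "AE t in lebesgue_on {0..T}. ennreal ((norm (d t))\<^sup>2) = 0"
    using dm by (subst (asm) ennreal_0, subst (asm) le_zero_eq, subst (asm) nn_integral_0_iff_AE) auto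
  then show "AE t in lebesgue_on {0..T}. second_gateaux T J u v t = snd (W u v t)"
    by eventually_elim (simp add: d_def A_def)
qed

end

section \<open>The Lipschitz estimates\<close>

lemma integral_le_AE:
  fixes h k :: "real \<Rightarrow> real"
  assumes "h absolutely_integrable_on {0..T}" "k absolutely_integrable_on {0..T}"
    and "AE t in lebesgue_on {0..T}. h t \<le> k t"
  shows "integral {0..T} h \<le> integral {0..T} k"
  using integral_mono_AE[of "lebesgue_on {0..T}" h k] assms
  by (simp add: absolutely_integrable_iff_integrable_lebesgue_on lebesgue_integral_eq_integral)

lemma lp_op_norm_leI:
  assumes "\<And>v. v \<in> lp_space T \<beta> \<Longrightarrow> lp_norm T \<beta> v \<le> ennreal 1 \<Longrightarrow> lp_norm T \<beta> (A v) \<le> K"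
  shows "lp_op_norm T \<beta> A \<le> K"
  unfolding lp_op_norm_def by (rule SUP_least) (use assms in auto)

context control_data
begin

abbreviation C3 where "C3 \<equiv> C_3 T L x0"
abbreviation C4 where "C4 \<equiv> C_4 T L x0"

text \<open>The bracket common to C_3 and C_4.\<close>

abbreviation \<Gamma> where "\<Gamma> \<equiv> C2 * (L * (C1 * T + 2) + C1 * (T + 2))"

lemma \<Gamma>_nonneg: "0 \<le> \<Gamma>"
  using C2_pos L C1_pos T by (intro mult_nonneg_nonneg add_nonneg_nonneg) auto

lemma C3_pos: "0 < C3"
proof -
  have "0 \<le> T * \<Gamma>" using T \<Gamma>_nonneg by simp
  moreover have "0 < C1 * (T + 1)" using C1_pos T by simp
  ultimately show ?thesis by (simp add: C_3_def mult.assoc)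
qed

lemma C4_pos: "0 < C4 \<beta>"
  unfolding C_4_def using T \<Gamma>_nonneg C1_pos by (intro mult_pos_pos) auto

text \<open>Knowledge almost everywhere is enough for every L^\<beta> norm, so the estimate is
  reduced to a pointwise one for the explicit formula.\<close>

lemma lp_norm_second_gateaux_diff_le:
  assumes u: "u \<in> lp_space T 2" and u': "u' \<in> lp_space T 2" and v: "v \<in> lp_space T 2"
    and le: "AE t in lebesgue_on {0..T}. norm (snd (W u v t) - snd (W u' v t)) \<le> norm (h t)"
  shows "lp_norm T \<beta> (\<lambda>t. second_gateaux T J u v t - second_gateaux T J u' v t) \<le> lp_norm T \<beta> h"
proof (rule lp_norm_mono_AE)
  have [measurable]: "second_gateaux T J u v \<in> borel_measurable (lebesgue_on {0..T})"
    "second_gateaux T J u' v \<in> borel_measurable (lebesgue_on {0..T})"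
    using second_gateaux_AE(2)[OF u v] second_gateaux_AE(2)[OF u' v] by (auto simp: lp_space_two_iff)
  show "(\<lambda>t. second_gateaux T J u v t - second_gateaux T J u' v t) \<in> borel_measurable (lebesgue_on {0..T})" by measurable
  show "AE t in lebesgue_on {0..T}. norm (second_gateaux T J u v t - second_gateaux T J u' v t) \<le> norm (h t)"
    using second_gateaux_AE(1)[OF u v] second_gateaux_AE(1)[OF u' v] le by eventually_elim simp
qed

lemma one_plus_lp_norm_one:
  assumes "u absolutely_integrable_on {0..T}"
  shows "1 + lp_norm T 1 u = ennreal (1 + N u)"
  using lp_norm_one_eq[OF assms] N_nonneg[OF assms] by (simp add: N_def ennreal_plus)

lemma ennreal_bound_eq:
  assumes "u absolutely_integrable_on {0..T}" "0 \<le> c" "0 \<le> \<Delta>"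
  shows "ennreal c * (1 + lp_norm T 1 u) * ennreal \<Delta> = ennreal (c * (1 + N u) * \<Delta>)"
  unfolding one_plus_lp_norm_one[OF assms(1)] using assms N_nonneg[OF assms(1)] by (simp add: ennreal_mult)

text \<open>An infinite distance of the controls makes the right-hand side infinite, because the
  factor in front is positive; afterwards the distance is a real number.\<close>

lemma ennreal_bound_top:
  assumes "0 < c" shows "ennreal c * (1 + lp_norm T 1 u) * top = top"
proof -
  have "ennreal c * (1 + lp_norm T 1 u) \<noteq> 0" using assms by (simp add: not_le add_eq_0_iff_both_eq_0)
  then show ?thesis by (simp add: ennreal_mult_top)
qed

lemma second_gateaux_lipschitz_infinity:
  assumes \<beta>: "2 \<le> \<beta>" and u: "u \<in> lp_space T \<infinity>" and u': "u' \<in> lp_space T \<infinity>"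
  shows "lp_op_norm T \<beta> (\<lambda>v t. second_gateaux T J u v t - second_gateaux T J u' v t)
     \<le> ennreal C3 * (1 + lp_norm T 1 u) * lp_norm T \<infinity> (\<lambda>t. u t - u' t)"
proof (cases "lp_norm T \<infinity> (\<lambda>t. u t - u' t)")
  case top
  then show ?thesis using ennreal_bound_top[OF C3_pos, of u] by simp
next
  case (real \<Delta>)
  have \<Delta>: "0 \<le> \<Delta>" "lp_norm T top (\<lambda>t. u t - u' t) \<le> ennreal \<Delta>" using real by auto
  have u2: "u \<in> lp_space T 2" and u2': "u' \<in> lp_space T 2"
    using lp_space_subset_two[OF _ T u] lp_space_subset_two[OF _ T u'] by auto
  note u1 = u1[OF u2] and u1' = u1[OF u2']
  define \<delta> where "\<delta> = (\<lambda>t. norm (u t - u' t))"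
  have ae: "AE t in lebesgue_on {0..T}. \<delta> t \<le> \<Delta>"
    using \<Delta> unfolding lp_norm_infinity_le_iff[OF \<Delta>(1)] \<delta>_def by blast
  have D: "D u u' \<le> T * \<Delta>"
    using lp_norm_one_le(2)[OF _ T \<Delta>(2,1)] T by (simp add: N_def mult.commute)
  show ?thesis
    unfolding real(2) ennreal_bound_eq[OF u1 less_imp_le[OF C3_pos] \<Delta>(1)]
  proof (rule lp_op_norm_leI)
    fix v :: "real \<Rightarrow> real^'m"
    assume v: "v \<in> lp_space T \<beta>" and v_le: "lp_norm T \<beta> v \<le> ennreal 1"
    have v2: "v \<in> lp_space T 2" by (rule lp_space_subset_two[OF \<beta> T v])
    note v1 = control_data_axioms[THEN control_data.u1, OF v2]
    define M where "M = \<Delta> * N v"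
    have V0: "0 \<le> N v" by (rule N_nonneg[OF v1])
    have uv: "(\<lambda>t. norm (u t - u' t) * norm (v t)) integrable_on {0..T}"
    proof -
      have "lp_norm T 2 (\<lambda>t. u t - u' t) \<le> ennreal (\<Delta> * sqrt T)" by (rule lp_norm_two_of_infinity[OF T \<Delta>(2,1)])
      moreover obtain c where c: "0 \<le> c" "lp_norm T 2 v = ennreal c" using v2 unfolding lp_space_iff by blast
      ultimately show ?thesis
        by (intro holder_product_bound(1)[OF order_refl T, of v c _ "\<Delta> * sqrt T"]) (use \<Delta> T in auto)
    qed
    have S: "integral {0..T} (\<lambda>t. norm (u t - u' t) * norm (v t)) \<le> M"
    proof -
      have "integral {0..T} (\<lambda>t. norm (u t - u' t) * norm (v t)) \<le> integral {0..T} (\<lambda>t. \<Delta> * norm (v t))"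
      proof (rule integral_le_AE)
        show "(\<lambda>t. norm (u t - u' t) * norm (v t)) absolutely_integrable_on {0..T}"
          by (rule nonnegative_absolutely_integrable_1[OF uv]) simp
        show "(\<lambda>t. \<Delta> * norm (v t)) absolutely_integrable_on {0..T}"
          by (rule nonnegative_absolutely_integrable_1[OF integrable_on_mult_right[OF norm_integrable[OF v1]]]) (use \<Delta> in simp)
        show "AE t in lebesgue_on {0..T}. norm (u t - u' t) * norm (v t) \<le> \<Delta> * norm (v t)"
          using ae by eventually_elim (simp add: \<delta>_def mult_right_mono)
      qed
      then show ?thesis by (simp add: M_def N_def)
    qed
    have DV: "D u u' * N v \<le> T * M" using mult_right_mono[OF D V0] by (simp add: M_def mult.assoc)
    \<comment> \<open>With D \<le> T \<Delta> and |u - u'| \<le> \<Delta> inserted, the pointwise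
      bound is a constant plus a multiple of |v|. The terms with M complete C_1 T + 1 and T + 1 to
      the sums in \<Gamma>, and C_1 (T + 1) comes from H_uu v.\<close>
    define c0 where "c0 = (1 + N u) * \<Delta> * (\<Gamma> * N v)"
    define c2 where "c2 = (1 + N u) * \<Delta> * (C1 * (T + 1))"
    have N0: "0 \<le> N u" by (rule N_nonneg[OF u1])
    have c: "0 \<le> c0" "0 \<le> c2" unfolding c0_def c2_def using N0 \<Delta> \<Gamma>_nonneg V0 C1_pos T by auto
    have "lp_norm T \<beta> (\<lambda>t. second_gateaux T J u v t - second_gateaux T J u' v t) \<le> lp_norm T \<beta> (\<lambda>t. c0 + c2 * norm (v t))"
    proof (rule lp_norm_second_gateaux_diff_le[OF u2 u2' v2])
      show "AE t in lebesgue_on {0..T}. norm (snd (W u v t) - snd (W u' v t)) \<le> norm (c0 + c2 * norm (v t))"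
        using ae AE_space[of "lebesgue_on {0..T}"]
      proof eventually_elim
        case (elim t)
        then have t: "t \<in> {0..T}" by (simp add: space_restrict_space)
        have d: "norm (u t - u' t) \<le> \<Delta>" using elim by (simp add: \<delta>_def)
        have "norm (snd (DDH t (Z u t) (P u t) (0, v t)) - snd (DDH t (Z u' t) (P u' t) (0, v t))) \<le>
            norm (DDH t (Z u t) (P u t) (0, v t) - DDH t (Z u' t) (P u' t) (0, v t))"
          using norm_snd_le_norm[of "DDH t (Z u t) (P u t) (0, v t) - DDH t (Z u' t) (P u' t) (0, v t)"] by simp
        also have "\<dots> \<le> C1 * (1 + N u) * (D u u' + norm (u t - u' t)) * norm (v t)"
          using norm_DDH_along_diff_le[OF u1 u1' t, of "(0, v t)"] by simp
        finally have h: "norm (snd (DDH t (Z u t) (P u t) (0, v t)) - snd (DDH t (Z u' t) (P u' t) (0, v t))) \<le>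
            C1 * (1 + N u) * (D u u' + norm (u t - u' t)) * norm (v t)" .
        have "norm (snd (W u v t) - snd (W u' v t)) \<le>
          (1 + N u) * ((L * (Cx * D u u' + norm (u t - u' t))) * (C2 * N v) + C1 * (D u u' + norm (u t - u' t)) * (C2 * N v) + C1 * (C2 * M) + L * (C2 * M))
          + C1 * (1 + N u) * (D u u' + norm (u t - u' t)) * norm (v t)"
          using norm_snd_W_diff_le[OF u1 u1' v1 uv S DV t] h by linarith
        also have "\<dots> \<le> (1 + N u) * ((L * (C1 * (T * \<Delta>) + \<Delta>)) * (C2 * N v) + C1 * (T * \<Delta> + \<Delta>) * (C2 * N v) + C1 * (C2 * M) + L * (C2 * M))
          + C1 * (1 + N u) * (T * \<Delta> + \<Delta>) * norm (v t)"
          using N0 L C1_pos C2_pos V0 T \<Delta>(1) Cx_le_C1 Cx_pos D d D_nonneg[OF u1 u1']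
          by (intro add_mono mult_left_mono mult_right_mono mult_mono order_refl) auto
        also have "\<dots> = c0 + c2 * norm (v t)" by (simp add: c0_def c2_def M_def algebra_simps)
        finally show ?case using c by simp
      qed
    qed
    also have "\<dots> \<le> ennreal (c0 * T powr enn2real (1 / \<beta>) + c2 * 1 + 0 * 1)"
    proof (rule lp_norm_affine_bound[where h = v and k = v, OF _ T _ v_le v_le])
      show "1 \<le> \<beta>" using \<beta> by (rule order_trans[rotated]) simp
      have [measurable]: "v \<in> borel_measurable (lebesgue_on {0..T})" using v_le by (rule lp_norm_le_measurable)
      show "(\<lambda>t. c0 + c2 * norm (v t)) \<in> borel_measurable (lebesgue_on {0..T})" by measurable
    qed (use c in auto)
    also have "c0 * T powr enn2real (1 / \<beta>) + c2 * 1 + 0 * 1 \<le> C3 * (1 + N u) * \<Delta>"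
    proof -
      \<comment> \<open>The embedding in L^1 costs T^{1-1/\<beta>} and the norm of a constant
        T^{1/\<beta>}; together they give the factor T of C_3 for every \<beta>.\<close>
      have "N v \<le> T powr (1 - enn2real (1 / \<beta>))"
        using lp_norm_one_le(2)[OF \<beta> T v_le] by (simp add: N_def)
      then have "N v * T powr enn2real (1 / \<beta>) \<le> T powr (1 - enn2real (1 / \<beta>)) * T powr enn2real (1 / \<beta>)"
        by (intro mult_right_mono) auto
      also have "\<dots> = T" using T by (simp add: powr_add[symmetric])
      finally have "(1 + N u) * \<Delta> * \<Gamma> * (N v * T powr enn2real (1 / \<beta>)) \<le> (1 + N u) * \<Delta> * \<Gamma> * T"
        by (rule mult_left_mono[OF _ mult_nonneg_nonneg[OF mult_nonneg_nonneg[OF _ \<Delta>(1)] \<Gamma>_nonneg]]) (use N0 in auto)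
      then have "c0 * T powr enn2real (1 / \<beta>) \<le> (1 + N u) * \<Delta> * (\<Gamma> * T)"
        by (simp add: c0_def mult.assoc)
      then show ?thesis by (simp add: c2_def C_3_def algebra_simps)
    qed
    finally show "lp_norm T \<beta> (\<lambda>t. second_gateaux T J u v t - second_gateaux T J u' v t) \<le> ennreal (C3 * (1 + N u) * \<Delta>)"
      by (simp add: ennreal_leI)
  qed
qed

lemma second_gateaux_lipschitz_beta:
  assumes \<beta>: "2 \<le> \<beta>" and u: "u \<in> lp_space T \<beta>" and u': "u' \<in> lp_space T \<beta>"
    and indep: "\<And>t x w w' h k. t \<in> {0..T} \<Longrightarrow> B2 t (x, w) (0, h) (0, k) = B2 t (x, w') (0, h) (0, k)"
      "\<And>t x w w' h k. t \<in> {0..T} \<Longrightarrow> F2 t (x, w) (0, h) (0, k) = F2 t (x, w') (0, h) (0, k)"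
  shows "lp_op_norm T \<beta> (\<lambda>v t. second_gateaux T J u v t - second_gateaux T J u' v t)
     \<le> ennreal (C4 \<beta>) * (1 + lp_norm T 1 u) * lp_norm T \<beta> (\<lambda>t. u t - u' t)"
proof (cases "lp_norm T \<beta> (\<lambda>t. u t - u' t)")
  case top
  then show ?thesis using ennreal_bound_top[OF C4_pos, of \<beta> u] by simp
next
  case (real \<Delta>)
  have \<Delta>: "0 \<le> \<Delta>" "lp_norm T \<beta> (\<lambda>t. u t - u' t) \<le> ennreal \<Delta>" using real by auto
  have u2: "u \<in> lp_space T 2" and u2': "u' \<in> lp_space T 2"
    using lp_space_subset_two[OF \<beta> T u] lp_space_subset_two[OF \<beta> T u'] by auto
  note u1 = u1[OF u2] and u1' = u1[OF u2']
  define s where "s = enn2real (1 / \<beta>)"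
  define \<tau> where "\<tau> = T powr (1 - s)"
  have \<tau>: "0 < \<tau>" using T by (simp add: \<tau>_def)
  have D: "D u u' \<le> \<Delta> * \<tau>"
    using lp_norm_one_le(2)[OF \<beta> T \<Delta>(2,1)] by (simp add: N_def s_def \<tau>_def)
  show ?thesis
    unfolding real(2) ennreal_bound_eq[OF u1 less_imp_le[OF C4_pos] \<Delta>(1)]
  proof (rule lp_op_norm_leI)
    fix v :: "real \<Rightarrow> real^'m"
    assume v: "v \<in> lp_space T \<beta>" and v_le: "lp_norm T \<beta> v \<le> ennreal 1"
    have v2: "v \<in> lp_space T 2" by (rule lp_space_subset_two[OF \<beta> T v])
    note v1 = control_data_axioms[THEN control_data.u1, OF v2]
    \<comment> \<open>Hoelder's bound for the integral of |u - u'| |v|. Its exponent also fits the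
      product of the two L^1 norms, because 2 (1 - s) = 1 + (1 - 2 s).\<close>
    define M where "M = \<Delta> * T powr (1 - 2 * s)"
    have V0: "0 \<le> N v" by (rule N_nonneg[OF v1])
    have V: "N v \<le> \<tau>" using lp_norm_one_le(2)[OF \<beta> T v_le] by (simp add: N_def s_def \<tau>_def)
    note hp = holder_product_bound[OF \<beta> T v_le \<Delta>(2) zero_le_one \<Delta>(1)]
    have S: "integral {0..T} (\<lambda>t. norm (u t - u' t) * norm (v t)) \<le> M"
      using hp(2) by (simp add: M_def s_def)
    have \<tau>\<tau>: "\<tau> * \<tau> = T * T powr (1 - 2 * s)"
    proof -
      have "\<tau> * \<tau> = T powr ((1 - s) + (1 - s))" unfolding \<tau>_def powr_add ..
      also have "(1 - s) + (1 - s) = 1 + (1 - 2 * s)" by simp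
      also have "T powr (1 + (1 - 2 * s)) = T powr 1 * T powr (1 - 2 * s)" by (rule powr_add)
      finally show ?thesis using T by simp
    qed
    have DV: "D u u' * N v \<le> T * M"
    proof -
      have "D u u' * N v \<le> (\<Delta> * \<tau>) * \<tau>" using D V V0 \<Delta>(1) \<tau> by (intro mult_mono) auto
      also have "\<dots> = \<Delta> * (\<tau> * \<tau>)" by simp
      also have "\<dots> = T * M" unfolding \<tau>\<tau> M_def by simp
      finally show ?thesis .
    qed
    have N0: "0 \<le> N u" by (rule N_nonneg[OF u1])
    have D0: "0 \<le> D u u'" by (rule D_nonneg[OF u1 u1'])
    have M0: "0 \<le> M" using \<Delta>(1) by (simp add: M_def)
    \<comment> \<open>Here |u - u'| has no pointwise bound. It occurs on its own, with coefficient
      c1, and is measured in L^\<beta>; the product with |v| has been removed by independence of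
      u.\<close>
    define c0 where "c0 = (1 + N u) * ((L * (C1 * (\<Delta> * \<tau>))) * (C2 * \<tau>) + C1 * (\<Delta> * \<tau>) * (C2 * \<tau>) + C1 * (C2 * M) + L * (C2 * M))"
    define c1 where "c1 = (1 + N u) * ((L + C1) * (C2 * \<tau>))"
    define c2 where "c2 = C1 * (1 + N u) * (\<Delta> * \<tau>)"
    have c: "0 \<le> c0" "0 \<le> c1" "0 \<le> c2"
      unfolding c0_def c1_def c2_def using N0 L \<Delta>(1) \<tau> C1_pos C2_pos M0
      by (auto intro!: mult_nonneg_nonneg add_nonneg_nonneg)
    have "lp_norm T \<beta> (\<lambda>t. second_gateaux T J u v t - second_gateaux T J u' v t) \<le>
        lp_norm T \<beta> (\<lambda>t. c0 + c1 * norm (u t - u' t) + c2 * norm (v t))"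
    proof (rule lp_norm_second_gateaux_diff_le[OF u2 u2' v2], rule AE_I2)
      fix t assume "t \<in> space (lebesgue_on {0..T})"
      then have t: "t \<in> {0..T}" by (simp add: space_restrict_space)
      define d where "d = norm (u t - u' t)"
      have h: "norm (snd (DDH t (Z u t) (P u t) (0, v t)) - snd (DDH t (Z u' t) (P u' t) (0, v t))) \<le>
            C1 * (1 + N u) * D u u' * norm (v t)"
        by (rule norm_Huu_diff_le[OF u1 u1' t]) (use indep t in auto)
      have "norm (snd (W u v t) - snd (W u' v t)) \<le>
          (1 + N u) * ((L * (Cx * D u u' + d)) * (C2 * N v) + C1 * (D u u' + d) * (C2 * N v) + C1 * (C2 * M) + L * (C2 * M))
          + C1 * (1 + N u) * D u u' * norm (v t)"
        using norm_snd_W_diff_le[OF u1 u1' v1 hp(1) S DV t] h unfolding d_def by linarith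
      also have "\<dots> \<le> (1 + N u) * ((L * (C1 * (\<Delta> * \<tau>) + d)) * (C2 * \<tau>) + C1 * (\<Delta> * \<tau> + d) * (C2 * \<tau>) + C1 * (C2 * M) + L * (C2 * M))
          + C1 * (1 + N u) * (\<Delta> * \<tau>) * norm (v t)"
      proof -
        have "0 \<le> d" by (simp add: d_def)
        then show ?thesis
          using N0 L C1_pos C2_pos V0 V \<tau> T \<Delta>(1) Cx_le_C1 Cx_pos D D0
          by (intro add_mono mult_left_mono mult_right_mono mult_mono order_refl mult_nonneg_nonneg add_nonneg_nonneg) auto
      qed
      also have "\<dots> = c0 + c1 * d + c2 * norm (v t)" by (simp add: c0_def c1_def c2_def algebra_simps)
      finally show "norm (snd (W u v t) - snd (W u' v t)) \<le> norm (c0 + c1 * norm (u t - u' t) + c2 * norm (v t))"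
        unfolding d_def by simp
    qed
    also have "\<dots> \<le> ennreal (c0 * T powr enn2real (1 / \<beta>) + c1 * \<Delta> + c2 * 1)"
    proof (rule lp_norm_affine_bound[OF _ T _ \<Delta>(2) v_le])
      show "1 \<le> \<beta>" using \<beta> by (rule order_trans[rotated]) simp
      have [measurable]: "v \<in> borel_measurable (lebesgue_on {0..T})" using v_le by (rule lp_norm_le_measurable)
      have [measurable]: "(\<lambda>t. u t - u' t) \<in> borel_measurable (lebesgue_on {0..T})" using \<Delta>(2) by (rule lp_norm_le_measurable)
      show "(\<lambda>t. c0 + c1 * norm (u t - u' t) + c2 * norm (v t)) \<in> borel_measurable (lebesgue_on {0..T})" by measurable
      show "norm (c0 + c1 * norm (u t - u' t) + c2 * norm (v t)) \<le> c0 + c1 * norm (u t - u' t) + c2 * norm (v t)" for t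
        using c by simp
    qed (use c \<Delta> in auto)
    also have "c0 * T powr enn2real (1 / \<beta>) + c1 * \<Delta> + c2 * 1 = C4 \<beta> * (1 + N u) * \<Delta>"
    proof -
      \<comment> \<open>After multiplication by the norm of a constant, both powers of T contain
        \<tau> = T^{1-1/\<beta>}, the prefactor of C_4; the terms with c1 and c2 carry it
        already.\<close>
      have t1: "\<tau> * \<tau> * T powr s = T * \<tau>"
      proof -
        have "\<tau> * \<tau> * T powr s = \<tau> * (T powr (1 - s) * T powr s)" by (simp add: \<tau>_def)
        also have "T powr (1 - s) * T powr s = T" using T by (simp add: powr_add[symmetric])
        finally show ?thesis by simp
      qed
      have t2: "T powr (1 - 2 * s) * T powr s = \<tau>" by (simp add: powr_add[symmetric] \<tau>_def)
      have "c0 * T powr s = (1 + N u) * \<Delta> * ((L * C1 * C2 + C1 * C2) * (\<tau> * \<tau> * T powr s) + (C1 + L) * C2 * (T powr (1 - 2 * s) * T powr s))"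
        by (simp add: c0_def M_def algebra_simps)
      also have "\<dots> = (1 + N u) * \<Delta> * ((L * C1 * C2 + C1 * C2) * (T * \<tau>) + (C1 + L) * C2 * \<tau>)"
        unfolding t1 t2 ..
      finally show ?thesis
        unfolding s_def[symmetric] C_4_def \<tau>_def[symmetric] by (simp add: c1_def c2_def algebra_simps)
    qed
    finally show "lp_norm T \<beta> (\<lambda>t. second_gateaux T J u v t - second_gateaux T J u' v t) \<le> ennreal (C4 \<beta> * (1 + N u) * \<Delta>)" .
  qed
qed

end

section \<open>From the standing assumptions to the derivative arrays\<close>

text \<open>Differentiability is assumed for the operator-valued derivative; evaluation at a fixed k
  is bounded and linear and passes it on to each directional derivative.\<close>

lemma second_derivative_of_twice_differentiable:
  fixes \<phi> :: "'a::euclidean_space \<Rightarrow> 'b::euclidean_space"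
  assumes \<phi>: "twice_differentiable \<phi>"
  shows "second_derivative \<phi> (\<lambda>z. frechet_derivative \<phi> (at z))
    (\<lambda>z h k. frechet_derivative (\<lambda>z. frechet_derivative \<phi> (at z) k) (at z) h)"
proof
  have d: "\<phi> differentiable (at z)" for z using \<phi> by (simp add: twice_differentiable_def)
  then show "(\<phi> has_derivative frechet_derivative \<phi> (at z)) (at z)" for z
    by (simp add: frechet_derivative_works[symmetric])
  fix z k
  have ap: "blinfun_apply (Blinfun (frechet_derivative \<phi> (at w))) k = frechet_derivative \<phi> (at w) k" for w
    using d[of w] by (simp add: bounded_linear_Blinfun_apply linear_frechet_derivative linear_conv_bounded_linear[symmetric])
  have "(\<lambda>w. Blinfun (frechet_derivative \<phi> (at w))) differentiable (at z)"
    using \<phi> by (simp add: twice_differentiable_def)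
  then obtain D where "((\<lambda>w. Blinfun (frechet_derivative \<phi> (at w))) has_derivative D) (at z)"
    by (auto simp: differentiable_def)
  from bounded_linear.has_derivative[OF blinfun.bounded_linear_left this, of k]
  have "(\<lambda>w. frechet_derivative \<phi> (at w) k) differentiable (at z)"
    unfolding ap by (auto simp: differentiable_def)
  then show "((\<lambda>z. frechet_derivative \<phi> (at z) k) has_derivative
      (\<lambda>h. frechet_derivative (\<lambda>z. frechet_derivative \<phi> (at z) k) (at z) h)) (at z)"
    by (simp add: frechet_derivative_works[symmetric])
qed

section \<open>Euclidean norms of arrays and joint coordinates\<close>

lemma norm_sum_scaleR_vec_le:
  fixes c :: "real^'k" and s :: "'b::real_normed_vector^'k"
  shows "norm (\<Sum>j\<in>UNIV. (c $ j) *\<^sub>R (s $ j)) \<le> norm c * norm s"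
proof -
  have "norm (\<Sum>j\<in>UNIV. (c $ j) *\<^sub>R (s $ j)) \<le> (\<Sum>j\<in>UNIV. \<bar>norm (c $ j)\<bar> * \<bar>norm (s $ j)\<bar>)"
    by (rule order_trans[OF norm_sum]) simp
  also have "\<dots> \<le> L2_set (\<lambda>j. norm (c $ j)) UNIV * L2_set (\<lambda>j. norm (s $ j)) UNIV"
    by (rule L2_set_mult_ineq)
  finally show ?thesis by (simp add: norm_vec_def)
qed

lemma norm_matrix_vector_mult_le:
  fixes A :: "real^'n^'m" and x :: "real^'n"
  shows "norm (A *v x) \<le> norm A * norm x"
proof -
  have "norm (A *v x) \<le> L2_set (\<lambda>i. norm (A $ i) * norm x) UNIV"
    unfolding norm_vec_def[of "A *v x"]
    by (rule L2_set_mono) (auto simp: matrix_vector_mul_component Cauchy_Schwarz_ineq2)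
  also have "\<dots> = norm A * norm x" by (simp add: norm_vec_def[of A] L2_set_left_distrib)
  finally show ?thesis .
qed

lemma matrix_works_linear:
  fixes l :: "real^'n \<Rightarrow> real^'m"
  shows "linear l \<Longrightarrow> matrix l *v x = l x"
  by (rule matrix_works) (simp add: linear_matrix_vector_mul_eq)

text \<open>The isometry of the product with R^{n+m} that matches \<open>joint_axis\<close>; it
  relates the Euclidean norm of an array to the product norm.\<close>

definition joint_coord :: "(real^'n) \<times> (real^'m) \<Rightarrow> real^('n + 'm)" where
  "joint_coord z = (\<chi> j. case j of Inl i \<Rightarrow> fst z $ i | Inr i \<Rightarrow> snd z $ i)"

lemma sum_UNIV_Plus:
  fixes f :: "'n::finite + 'm::finite \<Rightarrow> 'b::comm_monoid_add"
  shows "(\<Sum>j\<in>UNIV. f j) = (\<Sum>i\<in>UNIV. f (Inl i)) + (\<Sum>i\<in>UNIV. f (Inr i))"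
  unfolding UNIV_Plus_UNIV[symmetric] by (subst sum.Plus) auto

lemma vec_axis_expansion:
  fixes x :: "real^'n"
  shows "(\<Sum>i\<in>UNIV. (x $ i) *\<^sub>R axis i 1) = x"
  using basis_expansion[of x] by (simp add: scalar_mult_eq_scaleR)

lemma joint_axis_expansion: "(\<Sum>j\<in>UNIV. (joint_coord z $ j) *\<^sub>R joint_axis j) = z"
  by (simp add: sum_UNIV_Plus joint_coord_def joint_axis_def prod_eq_iff fst_sum snd_sum vec_axis_expansion)

lemma norm_joint_coord: "norm (joint_coord z) = norm z"
proof -
  have "(norm (joint_coord z))\<^sup>2 = (norm z)\<^sup>2"
    unfolding norm_vec_def[of "joint_coord z"] norm_prod_def norm_vec_def[of "fst z"] norm_vec_def[of "snd z"]
    by (simp add: L2_set_def sum_nonneg sum_UNIV_Plus joint_coord_def)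
  then show ?thesis by simp
qed

text \<open>Cauchy-Schwarz once for each argument: the Euclidean norm of the entries dominates the
  norm of the bilinear map.\<close>

lemma norm_bilinear_le_array:
  fixes \<beta> :: "(real^'n) \<times> (real^'m) \<Rightarrow> (real^'n) \<times> (real^'m) \<Rightarrow> 'b::real_normed_vector"
  assumes l: "\<And>k. linear (\<lambda>h. \<beta> h k)" and r: "\<And>h. linear (\<beta> h)"
  shows "norm (\<beta> h k) \<le> norm ((\<chi> i j. \<beta> (joint_axis i) (joint_axis j)) :: 'b^('n + 'm)^('n + 'm)) * norm h * norm k"
proof -
  define S :: "'b^('n + 'm)^('n + 'm)" where "S = (\<chi> i j. \<beta> (joint_axis i) (joint_axis j))"
  define q :: "'b^('n + 'm)" where "q = (\<Sum>i\<in>UNIV. (joint_coord h $ i) *\<^sub>R (S $ i))"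
  have "\<beta> h k = \<beta> (\<Sum>i\<in>UNIV. (joint_coord h $ i) *\<^sub>R joint_axis i) (\<Sum>j\<in>UNIV. (joint_coord k $ j) *\<^sub>R joint_axis j)"
    by (simp add: joint_axis_expansion)
  also have "\<dots> = (\<Sum>j\<in>UNIV. (joint_coord k $ j) *\<^sub>R (\<Sum>i\<in>UNIV. (joint_coord h $ i) *\<^sub>R \<beta> (joint_axis i) (joint_axis j)))"
    by (simp add: linear_sum[OF r] linear_scale[OF r] linear_sum[OF l] linear_scale[OF l])
  also have "\<dots> = (\<Sum>j\<in>UNIV. (joint_coord k $ j) *\<^sub>R (q $ j))"
    by (simp add: q_def S_def sum_component)
  finally have "norm (\<beta> h k) \<le> norm (joint_coord k) * norm q" using norm_sum_scaleR_vec_le by simp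
  also have "\<dots> \<le> norm (joint_coord k) * (norm (joint_coord h) * norm S)"
    unfolding q_def by (intro mult_left_mono norm_sum_scaleR_vec_le) auto
  finally show ?thesis by (simp add: norm_joint_coord S_def mult.commute mult.left_commute)
qed

lemma grad_inner:
  fixes \<phi> :: "real^'k \<Rightarrow> real"
  assumes "(\<phi> has_derivative D) (at z)"
  shows "grad \<phi> z \<bullet> h = D h"
proof -
  have D: "frechet_derivative \<phi> (at z) = D" using frechet_derivative_at[OF assms] by simp
  have "D h = D (\<Sum>i\<in>UNIV. (h $ i) *\<^sub>R axis i 1)" by (simp add: vec_axis_expansion)
  also have "\<dots> = (\<Sum>i\<in>UNIV. (h $ i) * D (axis i 1))"
    by (simp add: linear_sum[OF has_derivative_linear[OF assms]] linear_scale[OF has_derivative_linear[OF assms]])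
  finally show ?thesis by (simp add: grad_def D inner_vec_def mult.commute)
qed

text \<open>Identifies the Jacobian of the gradient field with the bilinear form \<open>D2\<close>;
  it serves g_xx as well as the blocks f_uu and b_uu.\<close>

lemma jacobian_grad_inner:
  fixes \<phi> :: "real^'k \<Rightarrow> real"
  assumes "second_derivative \<phi> D1 D2"
  shows "(jacobian (grad \<phi>) (at z) *v h) \<bullet> k = D2 z h k"
proof -
  interpret second_derivative \<phi> D1 D2 by (rule assms)
  have fd: "frechet_derivative \<phi> (at z) = D1 z" for z
    by (rule frechet_derivative_at[OF der, symmetric])
  have g: "grad \<phi> = (\<lambda>z. \<chi> i. D1 z (axis i 1))"
    unfolding grad_def[abs_def] fd ..
  have d: "(grad \<phi> has_derivative (\<lambda>h. \<chi> i. D2 z h (axis i 1))) (at z)"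
    unfolding g
  proof (rule has_derivative_componentwise_within[THEN iffD2], rule ballI)
    fix e :: "real^'k" assume "e \<in> Basis"
    then obtain i where e: "e = axis i 1" by (auto simp: Basis_vec_def)
    show "((\<lambda>x. (\<chi> i. D1 x (axis i 1)) \<bullet> e) has_derivative (\<lambda>x. (\<chi> i. D2 z x (axis i 1)) \<bullet> e)) (at z)"
      using der2[of "axis i 1" z] by (simp add: e inner_axis)
  qed
  have "jacobian (grad \<phi>) (at z) *v h = (\<chi> i. D2 z h (axis i 1))"
    unfolding jacobian_def frechet_derivative_at[OF d, symmetric] by (rule matrix_works_linear[OF has_derivative_linear[OF d]])
  then have "(jacobian (grad \<phi>) (at z) *v h) \<bullet> k = (\<Sum>i\<in>UNIV. (k $ i) * D2 z h (axis i 1))"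
    by (simp add: inner_vec_def mult.commute)
  also have "\<dots> = D2 z h (\<Sum>i\<in>UNIV. (k $ i) *\<^sub>R axis i 1)"
    by (simp add: linear_sum[OF linear_D2_right] linear_scale[OF linear_D2_right])
  finally show ?thesis by (simp add: vec_axis_expansion)
qed

lemma has_derivative_Pair_left:
  fixes \<phi> :: "'a::real_normed_vector \<times> 'b::real_normed_vector \<Rightarrow> 'c::real_normed_vector"
  assumes "(\<phi> has_derivative D) (at (x, u))"
  shows "((\<lambda>x. \<phi> (x, u)) has_derivative (\<lambda>h. D (h, 0))) (at x)"
proof -
  have "((\<lambda>x. (x, u)) has_derivative (\<lambda>h. (h, 0))) (at x)" by (auto intro!: derivative_eq_intros)
  from has_derivative_compose[OF this assms] show ?thesis .
qed

lemma has_derivative_Pair_right: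
  fixes \<phi> :: "'a::real_normed_vector \<times> 'b::real_normed_vector \<Rightarrow> 'c::real_normed_vector"
  assumes "(\<phi> has_derivative D) (at (x, u))"
  shows "((\<lambda>u. \<phi> (x, u)) has_derivative (\<lambda>h. D (0, h))) (at u)"
proof -
  have "((\<lambda>u. (x, u)) has_derivative (\<lambda>h. (0, h))) (at u)" by (auto intro!: derivative_eq_intros)
  from has_derivative_compose[OF this assms] show ?thesis .
qed

lemma second_order_of_array_bounds:
  fixes \<phi> :: "real^'n \<Rightarrow> real^'m \<Rightarrow> 'b::euclidean_space"
  assumes \<phi>: "twice_differentiable (\<lambda>(x, u). \<phi> x u)" and L: "0 \<le> L"
    and bd: "\<And>x u. norm (second_deriv \<phi> x u) \<le> L"
    and lip: "\<And>x u x' u'. norm (second_deriv \<phi> x u - second_deriv \<phi> x' u') \<le> L * (norm (x - x') + norm (u - u'))"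
  defines "D1 \<equiv> \<lambda>z. frechet_derivative (\<lambda>(x, u). \<phi> x u) (at z)"
  defines "D2 \<equiv> \<lambda>z h k. frechet_derivative (\<lambda>z. D1 z k) (at z) h"
  shows "second_derivative (\<lambda>z. \<phi> (fst z) (snd z)) D1 D2"
    and "\<And>z h k. norm (D2 z h k) \<le> L * norm h * norm k"
    and "\<And>z z' h k. norm (D2 z h k - D2 z' h k) \<le> L * (norm (fst z - fst z') + norm (snd z - snd z')) * norm h * norm k"
    and "second_order (\<lambda>z. \<phi> (fst z) (snd z)) D1 D2 L (2 * L)"
proof -
  show sd: "second_derivative (\<lambda>z. \<phi> (fst z) (snd z)) D1 D2"
    using second_derivative_of_twice_differentiable[OF \<phi>] unfolding D1_def D2_def by (simp add: case_prod_unfold)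
  interpret second_derivative "\<lambda>z. \<phi> (fst z) (snd z)" D1 D2 by (rule sd)
  have arr: "second_deriv \<phi> x u = (\<chi> i j. D2 (x, u) (joint_axis i) (joint_axis j))" for x u
    by (simp add: second_deriv_def D1_def D2_def)
  show b: "norm (D2 z h k) \<le> L * norm h * norm k" for z h k
  proof -
    have "norm (D2 z h k) \<le> norm (second_deriv \<phi> (fst z) (snd z)) * norm h * norm k"
      unfolding arr prod.collapse by (rule norm_bilinear_le_array[OF linear_D2_left linear_D2_right])
    also have "\<dots> \<le> L * norm h * norm k" by (intro mult_right_mono bd) auto
    finally show ?thesis .
  qed
  show l: "norm (D2 z h k - D2 z' h k) \<le> L * (norm (fst z - fst z') + norm (snd z - snd z')) * norm h * norm k" for z z' h k
  proof -
    have "(\<chi> i j. D2 z (joint_axis i) (joint_axis j) - D2 z' (joint_axis i) (joint_axis j)) =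
       second_deriv \<phi> (fst z) (snd z) - second_deriv \<phi> (fst z') (snd z')"
      unfolding arr by (simp add: vec_eq_iff)
    moreover have "norm (D2 z h k - D2 z' h k) \<le>
       norm ((\<chi> i j. D2 z (joint_axis i) (joint_axis j) - D2 z' (joint_axis i) (joint_axis j)) :: 'b^('n + 'm)^('n + 'm)) * norm h * norm k"
      by (rule norm_bilinear_le_array) (intro linear_compose_sub linear_D2_left linear_D2_right)+
    ultimately have "norm (D2 z h k - D2 z' h k) \<le>
       norm (second_deriv \<phi> (fst z) (snd z) - second_deriv \<phi> (fst z') (snd z')) * norm h * norm k" by simp
    also have "\<dots> \<le> L * (norm (fst z - fst z') + norm (snd z - snd z')) * norm h * norm k"
      by (intro mult_right_mono lip) auto
    finally show ?thesis .
  qed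
  show "second_order (\<lambda>z. \<phi> (fst z) (snd z)) D1 D2 L (2 * L)"
  proof (intro_locales, unfold_locales)
    show "norm (D2 z h k) \<le> L * norm h * norm k" for z h k by (rule b)
    show "norm (D2 z h k - D2 z' h k) \<le> 2 * L * norm (z - z') * norm h * norm k" for z z' h k
    proof -
      have "norm (fst z - fst z') \<le> norm (z - z')" "norm (snd z - snd z') \<le> norm (z - z')"
        using norm_fst_le_norm[of "z - z'"] norm_snd_le_norm[of "z - z'"] by auto
      \<comment> \<open>Each component norm is at most the product norm, which is the source of 2
        L.\<close>
      then have "L * (norm (fst z - fst z') + norm (snd z - snd z')) * norm h * norm k \<le> L * (2 * norm (z - z')) * norm h * norm k"
        using L by (intro mult_right_mono mult_left_mono) auto
      then show ?thesis using l[of z h k z'] by (simp add: mult.commute mult.left_commute)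
    qed
  qed (use L in auto)
qed

text \<open>Fixing x and restricting both directions to controls yields the uu block; l selects a
  component of b and is the identity for f.\<close>

lemma second_derivative_partial_right:
  fixes \<phi> :: "(real^'n) \<times> (real^'m) \<Rightarrow> 'b::euclidean_space" and l :: "'b \<Rightarrow> real"
  assumes "second_derivative \<phi> D1 D2" and l: "bounded_linear l"
  shows "second_derivative (\<lambda>u. l (\<phi> (x, u))) (\<lambda>u k. l (D1 (x, u) (0, k))) (\<lambda>u h k. l (D2 (x, u) (0, h) (0, k)))"
proof -
  interpret second_derivative \<phi> D1 D2 by (rule assms)
  show ?thesis
    by unfold_locales (auto intro!: bounded_linear.has_derivative[OF l] has_derivative_Pair_right der der2)
qed

lemma control_data_of_standing_assumptions:
  fixes b :: "real \<Rightarrow> real^'n \<Rightarrow> real^'m \<Rightarrow> real^'n"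
  assumes T: "0 < T" and sa: "standing_assumptions T L b f g"
  defines "B1 \<equiv> \<lambda>t z. frechet_derivative (\<lambda>(x, u). b t x u) (at z)"
  defines "B2 \<equiv> \<lambda>t z h k. frechet_derivative (\<lambda>z. B1 t z k) (at z) h"
  defines "F1 \<equiv> \<lambda>t z. frechet_derivative (\<lambda>(x, u). f t x u) (at z)"
  defines "F2 \<equiv> \<lambda>t z h k. frechet_derivative (\<lambda>z. F1 t z k) (at z) h"
  defines "g1 \<equiv> \<lambda>x. frechet_derivative g (at x)"
  defines "g2 \<equiv> \<lambda>x h k. frechet_derivative (\<lambda>x. g1 x k) (at x) h"
  shows "control_data T L b f g B1 B2 F1 F2 g1 g2"
    and "(\<forall>t\<in>{0..T}. \<forall>x u u'. vec_uu b t x u = vec_uu b t x u' \<and> scal_uu f t x u = scal_uu f t x u') \<Longrightarrow>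
      t \<in> {0..T} \<Longrightarrow> B2 t (x, w) (0, h) (0, k) = B2 t (x, w') (0, h) (0, k) \<and> F2 t (x, w) (0, h) (0, k) = F2 t (x, w') (0, h) (0, k)"
proof -
  have L: "0 < L" and bm: "(\<lambda>(t, x, u). b t x u) \<in> borel_measurable (lebesgue_on ({0..T} \<times> UNIV))"
    and fm: "(\<lambda>(t, x, u). f t x u) \<in> borel_measurable (lebesgue_on ({0..T} \<times> UNIV))"
    and td: "\<And>t. t \<in> {0..T} \<Longrightarrow> twice_differentiable (\<lambda>(x, u). b t x u)"
      "\<And>t. t \<in> {0..T} \<Longrightarrow> twice_differentiable (\<lambda>(x, u). f t x u)"
    and tdg: "twice_differentiable g"
    using sa unfolding standing_assumptions_def by blast+
  have bds: "norm (b t x u) \<le> L * (norm x + norm u + 1)"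
      "norm (jacobian (\<lambda>x. b t x u) (at x)) + norm (jacobian (\<lambda>u. b t x u) (at u)) \<le> L"
      "norm (second_deriv (b t) x u) \<le> L"
      "norm (second_deriv (b t) x u - second_deriv (b t) x' u') \<le> L * (norm (x - x') + norm (u - u'))"
      "\<bar>f t x u\<bar> \<le> L * ((norm x)\<^sup>2 + (norm u)\<^sup>2 + 1)"
      "norm (grad (\<lambda>x. f t x u) x) + norm (grad (\<lambda>u. f t x u) u) \<le> L * (norm x + norm u + 1)"
      "norm (second_deriv (f t) x u) \<le> L"
      "norm (second_deriv (f t) x u - second_deriv (f t) x' u') \<le> L * (norm (x - x') + norm (u - u'))"
    if "t \<in> {0..T}" for t x u x' u'
    using sa that unfolding standing_assumptions_def by blast+
  have gbds: "norm (grad g x) \<le> L * (norm x + 1)" "norm (jacobian (grad g) (at x)) \<le> L"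
      "norm (jacobian (grad g) (at x) - jacobian (grad g) (at x')) \<le> L * norm (x - x')" for x x'
    using sa unfolding standing_assumptions_def by blast+
  have Bsd: "second_derivative (\<lambda>z. b t (fst z) (snd z)) (B1 t) (B2 t)" if t: "t \<in> {0..T}" for t
    unfolding B1_def B2_def by (rule second_order_of_array_bounds(1)[OF td(1)[OF t] less_imp_le[OF L] bds(3)[OF t] bds(4)[OF t]])
  have Blip: "norm (B2 t z h k - B2 t z' h k) \<le> L * (norm (fst z - fst z') + norm (snd z - snd z')) * norm h * norm k" if t: "t \<in> {0..T}" for t z z' h k
    unfolding B1_def B2_def by (rule second_order_of_array_bounds(3)[OF td(1)[OF t] less_imp_le[OF L] bds(3)[OF t] bds(4)[OF t]])
  have Bso: "second_order (\<lambda>z. b t (fst z) (snd z)) (B1 t) (B2 t) L (2 * L)" if t: "t \<in> {0..T}" for t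
    unfolding B1_def B2_def by (rule second_order_of_array_bounds(4)[OF td(1)[OF t] less_imp_le[OF L] bds(3)[OF t] bds(4)[OF t]])
  have Fsd: "second_derivative (\<lambda>z. f t (fst z) (snd z)) (F1 t) (F2 t)" if t: "t \<in> {0..T}" for t
    unfolding F1_def F2_def by (rule second_order_of_array_bounds(1)[OF td(2)[OF t] less_imp_le[OF L] bds(7)[OF t] bds(8)[OF t]])
  have Flip: "norm (F2 t z h k - F2 t z' h k) \<le> L * (norm (fst z - fst z') + norm (snd z - snd z')) * norm h * norm k" if t: "t \<in> {0..T}" for t z z' h k
    unfolding F1_def F2_def by (rule second_order_of_array_bounds(3)[OF td(2)[OF t] less_imp_le[OF L] bds(7)[OF t] bds(8)[OF t]])
  have Fso: "second_order (\<lambda>z. f t (fst z) (snd z)) (F1 t) (F2 t) L (2 * L)" if t: "t \<in> {0..T}" for t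
    unfolding F1_def F2_def by (rule second_order_of_array_bounds(4)[OF td(2)[OF t] less_imp_le[OF L] bds(7)[OF t] bds(8)[OF t]])
  have G: "second_derivative g g1 g2"
    using second_derivative_of_twice_differentiable[OF tdg] unfolding g1_def g2_def .
  have g2J: "g2 x h k = (jacobian (grad g) (at x) *v h) \<bullet> k" for x h k
    using jacobian_grad_inner[OF G] by simp
  have split: "l k = l (fst k, 0) + l (0, snd k)" if "linear l" for l :: "(real^'n) \<times> (real^'m) \<Rightarrow> 'c::real_vector" and k
    using linear_add[OF that, of "(fst k, 0)" "(0, snd k)"] by simp
  have nk: "norm (fst k) \<le> norm k" "norm (snd k) \<le> norm k" for k :: "(real^'n) \<times> (real^'m)"
    by (rule norm_fst_le_norm norm_snd_le_norm)+
  show "control_data T L b f g B1 B2 F1 F2 g1 g2"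
  proof (rule control_data.intro)
    show "0 < T" "0 < L" by (rule T L)+
    show "second_order g g1 g2 L L"
    proof (rule second_order.intro)
      show "second_derivative g g1 g2" by (rule G)
      show "second_order_axioms g2 L L"
      proof (rule second_order_axioms.intro)
        show "norm (g2 x h k) \<le> L * norm h * norm k" for x h k
        proof -
          have "norm (g2 x h k) \<le> norm (jacobian (grad g) (at x) *v h) * norm k"
            unfolding g2J real_norm_def by (rule Cauchy_Schwarz_ineq2)
          also have "\<dots> \<le> (L * norm h) * norm k"
            using gbds(2)[of x] by (intro mult_right_mono order_trans[OF norm_matrix_vector_mult_le]) auto
          finally show ?thesis .
        qed
        show "norm (g2 x h k - g2 x' h k) \<le> L * norm (x - x') * norm h * norm k" for x x' h k
        proof -
          have "g2 x h k - g2 x' h k = ((jacobian (grad g) (at x) - jacobian (grad g) (at x')) *v h) \<bullet> k"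
            by (simp add: g2J matrix_vector_mult_diff_rdistrib inner_diff_left)
          then have "norm (g2 x h k - g2 x' h k) \<le> norm ((jacobian (grad g) (at x) - jacobian (grad g) (at x')) *v h) * norm k"
            by (simp add: Cauchy_Schwarz_ineq2)
          also have "\<dots> \<le> (L * norm (x - x') * norm h) * norm k"
            using gbds(3)[of x x'] by (intro mult_right_mono order_trans[OF norm_matrix_vector_mult_le]) auto
          finally show ?thesis .
        qed
      qed (use L in simp)
    qed
    show "\<bar>g1 x k\<bar> \<le> L * (norm x + 1) * norm k" for x k
    proof -
      have "g1 x k = grad g x \<bullet> k" using grad_inner[OF second_derivative.der[OF G]] by simp
      then have "\<bar>g1 x k\<bar> \<le> norm (grad g x) * norm k" by (simp add: Cauchy_Schwarz_ineq2)
      also have "\<dots> \<le> L * (norm x + 1) * norm k" by (intro mult_right_mono gbds) auto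
      finally show ?thesis .
    qed
    fix t assume t: "t \<in> {0..T}"
    show "second_order (\<lambda>z. b t (fst z) (snd z)) (B1 t) (B2 t) L (2 * L)" by (rule Bso[OF t])
    show "second_order (\<lambda>z. f t (fst z) (snd z)) (F1 t) (F2 t) L (2 * L)" by (rule Fso[OF t])
    show "norm (b t x u) \<le> L * (norm x + norm u + 1)" for x u by (rule bds[OF t])
    show "\<bar>f t x u\<bar> \<le> L * ((norm x)\<^sup>2 + (norm u)\<^sup>2 + 1)" for x u by (rule bds[OF t])
    show "norm (B2 t z h k - B2 t z' h k) \<le> L * (norm (fst z - fst z') + norm (snd z - snd z')) * norm h * norm k" for z z' h k
      by (rule Blip[OF t])
    show "\<bar>F2 t z h k - F2 t z' h k\<bar> \<le> L * (norm (fst z - fst z') + norm (snd z - snd z')) * norm h * norm k" for z z' h k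
      using Flip[OF t, of z h k z'] by simp
    show "norm (B1 t z k) \<le> L * norm k" for z k
    proof -
      \<comment> \<open>The assumption bounds the two partial Jacobians together, so the joint
        derivative is split along the state and the control part of k.\<close>
      obtain x u where z: "z = (x, u)" by (cases z)
      note d = second_derivative.der[OF Bsd[OF t], of z]
      have dx: "((\<lambda>x. b t x u) has_derivative (\<lambda>h. B1 t z (h, 0))) (at x)"
        using has_derivative_Pair_left[OF d[unfolded z]] by (simp add: z)
      have du: "((\<lambda>u. b t x u) has_derivative (\<lambda>h. B1 t z (0, h))) (at u)"
        using has_derivative_Pair_right[OF d[unfolded z]] by (simp add: z)
      have jx: "B1 t z (h, 0) = jacobian (\<lambda>x. b t x u) (at x) *v h" for h
        unfolding jacobian_def frechet_derivative_at[OF dx, symmetric] by (rule matrix_works_linear[OF has_derivative_linear[OF dx], symmetric])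
      have ju: "B1 t z (0, h) = jacobian (\<lambda>u. b t x u) (at u) *v h" for h
        unfolding jacobian_def frechet_derivative_at[OF du, symmetric] by (rule matrix_works_linear[OF has_derivative_linear[OF du], symmetric])
      have "norm (B1 t z k) \<le> norm (B1 t z (fst k, 0)) + norm (B1 t z (0, snd k))"
        unfolding split[OF has_derivative_linear[OF d], of k] by (rule norm_triangle_ineq)
      also have "\<dots> \<le> norm (jacobian (\<lambda>x. b t x u) (at x)) * norm k + norm (jacobian (\<lambda>u. b t x u) (at u)) * norm k"
        unfolding jx ju by (intro add_mono order_trans[OF norm_matrix_vector_mult_le] mult_left_mono nk) auto
      also have "\<dots> \<le> L * norm k"
        unfolding distrib_right[symmetric] by (intro mult_right_mono bds(2)[OF t]) auto
      finally show ?thesis .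
    qed
    show "\<bar>F1 t z k\<bar> \<le> L * (norm (fst z) + norm (snd z) + 1) * norm k" for z k
    proof -
      obtain x u where z: "z = (x, u)" by (cases z)
      note d = second_derivative.der[OF Fsd[OF t], of z]
      have dx: "((\<lambda>x. f t x u) has_derivative (\<lambda>h. F1 t z (h, 0))) (at x)"
        using has_derivative_Pair_left[OF d[unfolded z]] by (simp add: z)
      have du: "((\<lambda>u. f t x u) has_derivative (\<lambda>h. F1 t z (0, h))) (at u)"
        using has_derivative_Pair_right[OF d[unfolded z]] by (simp add: z)
      have "F1 t z k = grad (\<lambda>x. f t x u) x \<bullet> fst k + grad (\<lambda>u. f t x u) u \<bullet> snd k"
        unfolding split[OF has_derivative_linear[OF d], of k] grad_inner[OF dx] grad_inner[OF du] ..
      then have "\<bar>F1 t z k\<bar> \<le> norm (grad (\<lambda>x. f t x u) x) * norm (fst k) + norm (grad (\<lambda>u. f t x u) u) * norm (snd k)"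
        by (simp only:) (intro order_trans[OF abs_triangle_ineq] add_mono Cauchy_Schwarz_ineq2)
      also have "\<dots> \<le> norm (grad (\<lambda>x. f t x u) x) * norm k + norm (grad (\<lambda>u. f t x u) u) * norm k"
        by (intro add_mono mult_left_mono nk) auto
      also have "\<dots> \<le> L * (norm x + norm u + 1) * norm k"
        unfolding distrib_right[symmetric] by (intro mult_right_mono bds(6)[OF t]) auto
      finally show ?thesis by (simp add: z)
    qed
  next
    fix z :: "(real^'n) \<times> (real^'m)"
    have cb: "continuous_on UNIV (\<lambda>z. b t (fst z) (snd z))" if "t \<in> {0..T}" for t
      using second_derivative.der[OF Bsd[OF that]]
      by (auto simp: continuous_on_eq_continuous_at intro: has_derivative_continuous)
    have cf: "continuous_on UNIV (\<lambda>z. f t (fst z) (snd z))" if "t \<in> {0..T}" for t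
      using second_derivative.der[OF Fsd[OF that]]
      by (auto simp: continuous_on_eq_continuous_at intro: has_derivative_continuous)
    show "(\<lambda>t. b t (fst z) (snd z)) \<in> borel_measurable (lebesgue_on {0..T})"
      using borel_measurable_section[of "\<lambda>t z. b t (fst z) (snd z)" "{0..T}" z] bm cb by (simp add: case_prod_unfold)
    show "(\<lambda>t. f t (fst z) (snd z)) \<in> borel_measurable (lebesgue_on {0..T})"
      using borel_measurable_section[of "\<lambda>t z. f t (fst z) (snd z)" "{0..T}" z] fm cf by (simp add: case_prod_unfold)
  qed
  assume indep: "\<forall>t\<in>{0..T}. \<forall>x u u'. vec_uu b t x u = vec_uu b t x u' \<and> scal_uu f t x u = scal_uu f t x u'"
    and t: "t \<in> {0..T}"
  \<comment> \<open>Independence of u is assumed for matrices; these identities turn it into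
    independence of the bilinear forms on pairs of control directions.\<close>
  have Fuu: "F2 t (x, w) (0, h) (0, k) = (scal_uu f t x w *v h) \<bullet> k" for w
    using jacobian_grad_inner[OF second_derivative_partial_right[OF Fsd[OF t] bounded_linear_ident, of x], of w h k]
    by (simp add: scal_uu_def)
  have Buu: "B2 t (x, w) (0, h) (0, k) $ i = (vec_uu b t x w $ i *v h) \<bullet> k" for w i
    using jacobian_grad_inner[OF second_derivative_partial_right[OF Bsd[OF t] bounded_linear_vec_nth[of i], of x], of w h k]
    by (simp add: vec_uu_def)
  have e: "vec_uu b t x w = vec_uu b t x w'" "scal_uu f t x w = scal_uu f t x w'" using indep t by blast+
  have "B2 t (x, w) (0, h) (0, k) = B2 t (x, w') (0, h) (0, k)"
    by (rule vec_eq_iff[THEN iffD2]) (simp add: Buu e)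
  moreover have "F2 t (x, w) (0, h) (0, k) = F2 t (x, w') (0, h) (0, k)" by (simp add: Fuu e)
  ultimately show "B2 t (x, w) (0, h) (0, k) = B2 t (x, w') (0, h) (0, k) \<and> F2 t (x, w) (0, h) (0, k) = F2 t (x, w') (0, h) (0, k)" ..
qed

theorem theorem3p9:
  fixes T L :: real
    and x0 :: "real^'n"
    and b :: "real \<Rightarrow> real^'n \<Rightarrow> real^'m \<Rightarrow> real^'n"
    and f :: "real \<Rightarrow> real^'n \<Rightarrow> real^'m \<Rightarrow> real"
    and g :: "real^'n \<Rightarrow> real"
    and \<beta> :: ennreal
  assumes "0 < T"
    and "standing_assumptions T L b f g"
    and "2 \<le> \<beta>"
  shows
    "(0 < C_3 T L x0 \<and>
      (\<forall>u \<in> lp_space T \<infinity>. \<forall>u' \<in> lp_space T \<infinity>.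
         lp_op_norm T \<beta> (\<lambda>v t. second_gateaux T (cost T b f g x0) u v t
                               - second_gateaux T (cost T b f g x0) u' v t)
           \<le> ennreal (C_3 T L x0) * (1 + lp_norm T 1 u) * lp_norm T \<infinity> (\<lambda>t. u t - u' t)))
     \<and>
     ((\<forall>t\<in>{0..T}. \<forall>x u u'. vec_uu b t x u = vec_uu b t x u' \<and> scal_uu f t x u = scal_uu f t x u')
      \<longrightarrow>
      0 < C_4 T L x0 \<beta> \<and>
      (\<forall>u \<in> lp_space T \<beta>. \<forall>u' \<in> lp_space T \<beta>.
         lp_op_norm T \<beta> (\<lambda>v t. second_gateaux T (cost T b f g x0) u v t
                               - second_gateaux T (cost T b f g x0) u' v t)
           \<le> ennreal (C_4 T L x0 \<beta>) * (1 + lp_norm T 1 u) * lp_norm T \<beta> (\<lambda>t. u t - u' t)))"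
proof -
  note cd = control_data_of_standing_assumptions[OF assms(1,2)]
  interpret control_data T L x0 b f g
    "\<lambda>t z. frechet_derivative (\<lambda>(x, u). b t x u) (at z)"
    "\<lambda>t z h k. frechet_derivative (\<lambda>z. frechet_derivative (\<lambda>(x, u). b t x u) (at z) k) (at z) h"
    "\<lambda>t z. frechet_derivative (\<lambda>(x, u). f t x u) (at z)"
    "\<lambda>t z h k. frechet_derivative (\<lambda>z. frechet_derivative (\<lambda>(x, u). f t x u) (at z) k) (at z) h"
    "\<lambda>x. frechet_derivative g (at x)"
    "\<lambda>x h k. frechet_derivative (\<lambda>x. frechet_derivative g (at x) k) (at x) h"
    by (rule cd(1))
  show ?thesis
  proof (intro conjI ballI impI)
    show "0 < C_3 T L x0" by (rule C3_pos)
    show "0 < C_4 T L x0 \<beta>" by (rule C4_pos)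
    show "lp_op_norm T \<beta> (\<lambda>v t. second_gateaux T (cost T b f g x0) u v t - second_gateaux T (cost T b f g x0) u' v t)
           \<le> ennreal (C_3 T L x0) * (1 + lp_norm T 1 u) * lp_norm T \<infinity> (\<lambda>t. u t - u' t)"
      if "u \<in> lp_space T \<infinity>" "u' \<in> lp_space T \<infinity>" for u u'
      by (rule second_gateaux_lipschitz_infinity[OF assms(3) that])
    show "lp_op_norm T \<beta> (\<lambda>v t. second_gateaux T (cost T b f g x0) u v t - second_gateaux T (cost T b f g x0) u' v t)
           \<le> ennreal (C_4 T L x0 \<beta>) * (1 + lp_norm T 1 u) * lp_norm T \<beta> (\<lambda>t. u t - u' t)"
      if "\<forall>t\<in>{0..T}. \<forall>x u u'. vec_uu b t x u = vec_uu b t x u' \<and> scal_uu f t x u = scal_uu f t x u'"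
        "u \<in> lp_space T \<beta>" "u' \<in> lp_space T \<beta>" for u u'
      by (rule second_gateaux_lipschitz_beta[OF assms(3) that(2,3)]) (use cd(2)[OF that(1)] in blast)+
  qed
qed

end
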